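(* The dimension $\dim$ of virtual idempotents (pairs of idempotents), defined in the context, has the following properties, where $\mathbf p,\mathbf p_1,\mathbf p_2$ are pairs of idempotents (over the same ring in (a), (c), and over possibly different rings in (e)): (a) $\mathbf p_1\simeq_{\mathrm{alg}}\mathbf p_2$ implies $\dim\mathbf p_1=\dim\mathbf p_2$. (b) $\dim\mathbf p=0$ holds if and only if $\mathbf p\simeq_{\mathrm{alg}}\mathbf 0$. (c) $\dim(\mathbf p_1\oplus\mathbf p_2)\le\dim\mathbf p_1+\dim\mathbf p_2$. (d) $\dim\mathbf p^{\mathrm{inv}}=\dim\mathbf p$. (e) $\dim(\mathbf p_1\otimes\mathbf p_2)\le\dim\mathbf p_1\cdot\dim\mathbf p_2$, where $\otimes$ is either of $\overleftarrow\otimes,\overrightarrow\otimes$. (f) $\dim\mathbf 1=1$, where $\mathbf 1=\langle1,0\rangle$ is taken over the base ring $\mathbb Z$ or the base field $\mathbb K$.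
   Context: **Sets of polynomial growth (spg).** $\mathcal S^{-\infty}_{\mathbb N}$ is the set of real functions on $\mathbb N$ of at most polynomial growth. An infinite spg is a set $\Omega$ with a set of real functions $\mathcal S^{-\infty}_\Omega$ such that $\mathcal S^{-\infty}_\Omega=q^*\mathcal S^{-\infty}_{\mathbb N}$ for some bijection $q:\Omega\to\mathbb N$. A finite spg is a finite (possibly empty) set with all real functions. $\Omega_1\dot\cup\Omega_2$ carries the functions whose restrictions lie in $\mathcal S^{-\infty}_{\Omega_i}$; $\Omega_1\times\Omega_2$ carries the functions bounded in absolute value by some $f_1(n)f_2(m)$, $f_i\in\mathcal S^{-\infty}_{\Omega_i}$. All index sets are spg's. **Polymetric rings.** A topological ring $\mathfrak A$ is polymetric if its topology is induced by a family of "seminorms" $p:\mathfrak A\to[0,\infty)$ with $p(0)=0$, $p(-X)=p(X)$, $p(X+Y)\le p(X)+p(Y)$, such that for each $p$ there is a seminorm $\tilde p$ of the family with $p(XY)\le\tilde p(X)\tilde p(Y)$. $\mathfrak A$ is always separated and sequentially complete. $\mathfrak A^+$ is the unital extension $\mathbb Z\oplus\mathfrak A$ (or $\mathbb K\oplus\mathfrak A$ for a locally convex algebra over $\mathbb K$). **Matrices.** $\mathcal K_{\Omega',\Omega}(\mathfrak A)$ is the set of rapidly decreasing $\Omega'\times\Omega$ matrices: $\sup_{n,m}|f(n)h(m)|\,p(a_{n,m})<\infty$ for all seminorms $p$ and all $f\in\mathcal S^{-\infty}_{\Omega'}$, $h\in\mathcal S^{-\infty}_{\Omega}$. $\Psi_{\Omega',\Omega}(\mathfrak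 A)$ is the set of matrices of pseudodifferential size: for every $p$ and all $f\in\mathcal S^{-\infty}_{\Omega'}$, $h\in\mathcal S^{-\infty}_\Omega$ there are $g\in\mathcal S^{-\infty}_\Omega$, $k\in\mathcal S^{-\infty}_{\Omega'}$ with $|f(n)|p(a_{n,m})\le g(m)$ and $|h(m)|p(a_{n,m})\le k(n)$ for all $n,m$. (If $\mathfrak A$ is discrete, $\mathcal K$ consists of the matrices with finitely many nonzero entries and $\Psi$ of those whose rows and columns each have finitely many nonzero entries.) $\mathcal K_\Omega=\mathcal K_{\Omega,\Omega}$, $\Psi_\Omega=\Psi_{\Omega,\Omega}$. $1_\Omega,0_\Omega$ are the unit and zero matrices; $\bar a=1_\Omega-a$. $\Psi^{(2)}_{\Omega',\Omega}(\mathfrak A^+)$ is the set of pairs $\langle B,A\rangle$ with $A,B\in\Psi_{\Omega',\Omega}(\mathfrak A^+)$, $B-A\in\mathcal K_{\Omega',\Omega}(\mathfrak A)$, with componentwise operations. **Pairs of idempotents.** $\mathcal G^{(2)}_\Omega(\mathfrak A)$ is the set of pairs $\langle b,a\rangle$ of idempotents $a,b\in\Psi_\Omega(\mathfrak A^+)$ with $b-a\in\mathcal K_\Omega(\mathfrak A)$. $\langle b,a\rangle\oplus\langle d,c\rangle=\langle b\oplus d,a\oplus c\rangle$ (over $\Omega\dot\cup\Xi$); $\langle b,a\rangle^{\mathrm{inv}}=\langle\bar b,\bar a\rangle$; $\mathbf 0$ is the pair of empty matrices; $\mathbf 1=\langle1,0\rangle$ is a pair of $1\times1$ matrices. For $\langle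 b,a\rangle\in\mathcal G^{(2)}_\Omega(\mathfrak A)$, $\langle d,c\rangle\in\mathcal G^{(2)}_\Xi(\mathfrak B)$, over $\Omega\times\Xi$ and $\mathfrak A\otimes\mathfrak B$: $\langle b,a\rangle\overleftarrow\otimes\langle d,c\rangle=\langle b\otimes d+\bar b\otimes c,\,a\otimes d+\bar a\otimes c\rangle$ and $\langle b,a\rangle\overrightarrow\otimes\langle d,c\rangle=\langle b\otimes d+a\otimes\bar d,\,b\otimes c+a\otimes\bar c\rangle$. Here $\otimes$ is the (completed) projective tensor product of polymetric rings or, if $\mathfrak A=\mathfrak B$ is commutative, $\mathfrak A$ itself with $x\otimes y=xy$; on matrices it is the Kronecker product. The unital extension used for $\mathfrak A\otimes\mathfrak B$ is $\mathfrak A^+\otimes\mathfrak B^+$ (in the commutative case $\mathfrak A^+$). **Algebraic homotopy.** $\mathbf 0_\Xi=\langle0_\Xi,0_\Xi\rangle$, $\mathbf 0'_\Xi=\langle1_\Xi,1_\Xi\rangle$. For $\mathbf p_i\in\mathcal G^{(2)}_{\Omega_i}(\mathfrak A)$, $\mathbf p_1\simeq_{\mathrm{alg}}\mathbf p_2$ means that there are index sets $\Omega_{10},\Omega_{11},\Omega_{20},\Omega_{21}$ and an invertible $g\in\Psi^{(2)}_{\Omega_2\dot\cup\Omega_{20}\dot\cup\Omega_{21},\,\Omega_1\dot\cup\Omega_{10}\dot\cup\Omega_{11}}(\mathfrak A^+)$ with $g(\mathbf p_1\oplus\mathbf 0_{\Omega_{10}}\oplus\mathbf 0'_{\Omega_{11}})g^{-1}=\mathbf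 p_2\oplus\mathbf 0_{\Omega_{20}}\oplus\mathbf 0'_{\Omega_{21}}$ (componentwise). **Regular idempotents and dimension.** For an index set $\Xi$, consider $\{0,1\}\times\Xi$ block matrices $$U=\begin{bmatrix}h_{00} & h_{01} \\ {h_{10}} & 1_\Xi+h_{11}\end{bmatrix},\qquad h_{ij}\in\mathcal K_\Xi(\mathfrak A).$$ $U$ is a regular idempotent if $U^2=U$ and, in addition, $h_{00}h_{10}=h_{01}h_{00}=0$, $h_{00}h_{11}=h_{01}h_{01}=0$, $h_{10}h_{10}=h_{11}h_{00}=0$, $h_{10}h_{11}=h_{11}h_{01}=0$. For a pair of idempotents $\langle b,a\rangle$ over $\mathfrak A$, $\dim\langle b,a\rangle$ is the infimum of the cardinalities of those index sets $\Xi$ for which $\langle b,a\rangle\simeq_{\mathrm{alg}}\langle U,\,0_\Xi\oplus1_\Xi\rangle$ for some regular idempotent $U$ over $\{0,1\}\times\Xi$. *)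

theory Defs
  imports Complex_Main "HOL-Library.Product_Plus" "HOL-Library.Extended_Nat"
    "HOL-Library.Poly_Mapping"
begin

section \<open>Sets of polynomial growth\<close>

text \<open>The functions of an spg live on the whole type; only their values on \<open>pts\<close> are
  relevant, and \<open>growth\<close> is closed under arbitrary changes outside \<open>pts\<close>.\<close>

record 'i spg =
  pts :: "'i set"
  growth :: "('i \<Rightarrow> real) set"

definition poly_growth :: "(nat \<Rightarrow> real) set" where
  "poly_growth = {f. \<exists>C k. \<forall>n. \<bar>f n\<bar> \<le> C * (1 + real n) ^ k}"

definition is_spg :: "'i spg \<Rightarrow> bool" where
  "is_spg \<Omega> \<longleftrightarrow>
     (finite (pts \<Omega>) \<and> growth \<Omega> = UNIV) \<or>
     (\<exists>q. bij_betw q (pts \<Omega>) (UNIV :: nat set) \<and>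
          growth \<Omega> = {f. \<exists>g\<in>poly_growth. \<forall>x\<in>pts \<Omega>. f x = g (q x)})"

definition spg_sum :: "'i spg \<Rightarrow> 'j spg \<Rightarrow> ('i + 'j) spg" where
  "spg_sum \<Omega>1 \<Omega>2 = \<lparr>pts = pts \<Omega>1 <+> pts \<Omega>2,
     growth = {f. f \<circ> Inl \<in> growth \<Omega>1 \<and> f \<circ> Inr \<in> growth \<Omega>2}\<rparr>"

definition spg_prod :: "'i spg \<Rightarrow> 'j spg \<Rightarrow> ('i \<times> 'j) spg" where
  "spg_prod \<Omega>1 \<Omega>2 = \<lparr>pts = pts \<Omega>1 \<times> pts \<Omega>2,
     growth = {f. \<exists>f1\<in>growth \<Omega>1. \<exists>f2\<in>growth \<Omega>2.
       \<forall>n\<in>pts \<Omega>1. \<forall>m\<in>pts \<Omega>2. \<bar>f (n, m)\<bar> \<le> f1 n * f2 m}\<rparr>"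

definition spg_card :: "'i spg \<Rightarrow> enat" where
  "spg_card \<Omega> = (if finite (pts \<Omega>) then enat (card (pts \<Omega>)) else \<infinity>)"

section \<open>Polymetric rings and locally convex algebras\<close>

text \<open>The base is the ring of integers, the real field or the complex field, with its usual
  absolute value \<open>av\<close>.\<close>

definition base_ring :: "('k::comm_ring_1 \<Rightarrow> real) \<Rightarrow> bool" where
  "base_ring av \<longleftrightarrow>
     (\<exists>\<phi> :: 'k \<Rightarrow> int. bij \<phi> \<and> (\<forall>x y. \<phi> (x + y) = \<phi> x + \<phi> y \<and> \<phi> (x * y) = \<phi> x * \<phi> y) \<and>
        (\<forall>x. av x = real_of_int \<bar>\<phi> x\<bar>)) \<or>
     (\<exists>\<phi> :: 'k \<Rightarrow> real. bij \<phi> \<and> (\<forall>x y. \<phi> (x + y) = \<phi> x + \<phi> y \<and> \<phi> (x * y) = \<phi> x * \<phi> y) \<and>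
        (\<forall>x. av x = \<bar>\<phi> x\<bar>)) \<or>
     (\<exists>\<phi> :: 'k \<Rightarrow> complex. bij \<phi> \<and> (\<forall>x y. \<phi> (x + y) = \<phi> x + \<phi> y \<and> \<phi> (x * y) = \<phi> x * \<phi> y) \<and>
        (\<forall>x. av x = cmod (\<phi> x)))"

record ('k, 'a) palg =
  mult :: "'a \<Rightarrow> 'a \<Rightarrow> 'a"
  scale :: "'k \<Rightarrow> 'a \<Rightarrow> 'a"
  sn :: "('a \<Rightarrow> real) set"

text \<open>A separated, sequentially complete polymetric ring over the base. Over the integers,
  \<open>scale\<close> is forced to be the action of the integers on the additive group and the last
  inequality for seminorms follows from subadditivity; over a field that inequality is
  homogeneity. Continuity of the ring operations follows from the seminorm inequalities.\<close>

definition polymetric ::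
    "('k::comm_ring_1 \<Rightarrow> real) \<Rightarrow> ('k, 'a::ab_group_add, 'z) palg_scheme \<Rightarrow> bool" where
  "polymetric av A \<longleftrightarrow>
     (\<forall>x y z. mult A (mult A x y) z = mult A x (mult A y z)) \<and>
     (\<forall>x y z. mult A (x + y) z = mult A x z + mult A y z) \<and>
     (\<forall>x y z. mult A x (y + z) = mult A x y + mult A x z) \<and>
     module (scale A) \<and>
     (\<forall>c x y. scale A c (mult A x y) = mult A (scale A c x) y \<and>
              scale A c (mult A x y) = mult A x (scale A c y)) \<and>
     (\<forall>p\<in>sn A. p 0 = 0 \<and> (\<forall>x. 0 \<le> p x) \<and> (\<forall>x. p (- x) = p x) \<and>
               (\<forall>x y. p (x + y) \<le> p x + p y) \<and> (\<forall>c x. p (scale A c x) \<le> av c * p x)) \<and>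
     (\<forall>p\<in>sn A. \<exists>p'\<in>sn A. \<forall>x y. p (mult A x y) \<le> p' x * p' y) \<and>
     (\<forall>x. (\<forall>p\<in>sn A. p x = 0) \<longrightarrow> x = 0) \<and>
     (\<forall>X :: nat \<Rightarrow> 'a.
        (\<forall>p\<in>sn A. \<forall>e>0. \<exists>N. \<forall>m\<ge>N. \<forall>n\<ge>N. p (X m - X n) < e) \<longrightarrow>
        (\<exists>l. \<forall>p\<in>sn A. (\<lambda>n. p (X n - l)) \<longlonglongrightarrow> 0))"

definition discrete_top :: "('k, 'a::ab_group_add, 'z) palg_scheme \<Rightarrow> bool" where
  "discrete_top A \<longleftrightarrow>
     (\<exists>F e. finite F \<and> F \<subseteq> sn A \<and> 0 < e \<and> (\<forall>x. x \<noteq> 0 \<longrightarrow> (\<exists>p\<in>F. e \<le> p x)))"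

definition commutative :: "('k, 'a, 'z) palg_scheme \<Rightarrow> bool" where
  "commutative A \<longleftrightarrow> (\<forall>x y. mult A x y = mult A y x)"

definition base_alg :: "('k::comm_ring_1 \<Rightarrow> real) \<Rightarrow> ('k, 'k) palg" where
  "base_alg av = \<lparr>mult = (*), scale = (*), sn = {av}\<rparr>"

text \<open>The families of seminorms are not assumed to be directed. The directed family
  generated by \<open>P\<close> gives the same topology and the same spaces of matrices.\<close>

definition sn_span :: "('a \<Rightarrow> real) set \<Rightarrow> ('a \<Rightarrow> real) set" where
  "sn_span P = {\<lambda>x. C * (\<Sum>p\<in>F. p x) | C F. 0 \<le> C \<and> finite F \<and> F \<subseteq> P}"

text \<open>A ring together with the unital extension used for it: \<open>'r\<close> is the type of the unital
  extension, and the ring itself is the ideal \<open>ideal\<close>.\<close>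

record ('k, 'r) uext = "('k, 'r) palg" +
  unit :: 'r
  ideal :: "'r set"

definition unitization ::
    "('k::comm_ring_1 \<Rightarrow> real) \<Rightarrow> ('k, 'a::ab_group_add) palg \<Rightarrow> ('k, 'k \<times> 'a) uext" where
  "unitization av A =
     \<lparr>mult = (\<lambda>(k, x) (l, y). (k * l, scale A k y + scale A l x + mult A x y)),
      scale = (\<lambda>c (k, x). (c * k, scale A c x)),
      sn = {\<lambda>(k, x). C * av k + s x | C s. 0 \<le> C \<and> s \<in> sn_span (sn A)},
      unit = (1, 0),
      ideal = {0} \<times> UNIV\<rparr>"

section \<open>Completed projective tensor products\<close>

text \<open>The algebraic tensor product over the base is the free abelian group on pairs modulo the
  subgroup \<open>tensor_rel\<close>. Since integer multiples can be absorbed, each of its elements is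
  represented by a list of pairs, standing for a finite sum of elementary tensors.\<close>

inductive_set tensor_rel ::
    "('k, 'r::ab_group_add, 'y) palg_scheme \<Rightarrow> ('k, 's::ab_group_add, 'z) palg_scheme \<Rightarrow>
     ('r \<times> 's \<Rightarrow>\<^sub>0 int) set"
  for R S where
  "Poly_Mapping.single (x + x', y) 1 - Poly_Mapping.single (x, y) 1
     - Poly_Mapping.single (x', y) 1 \<in> tensor_rel R S"
| "Poly_Mapping.single (x, y + y') 1 - Poly_Mapping.single (x, y) 1
     - Poly_Mapping.single (x, y') 1 \<in> tensor_rel R S"
| "Poly_Mapping.single (scale R c x, y) 1 - Poly_Mapping.single (x, scale S c y) 1
     \<in> tensor_rel R S"
| "0 \<in> tensor_rel R S"
| "u \<in> tensor_rel R S \<Longrightarrow> v \<in> tensor_rel R S \<Longrightarrow> u - v \<in> tensor_rel R S"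

definition formal_sum :: "('r \<times> 's) list \<Rightarrow> ('r \<times> 's \<Rightarrow>\<^sub>0 int)" where
  "formal_sum zs = (\<Sum>z\<leftarrow>zs. Poly_Mapping.single z 1)"

definition proj_sn ::
    "('k, 'r::ab_group_add, 'y) palg_scheme \<Rightarrow> ('k, 's::ab_group_add, 'z) palg_scheme \<Rightarrow>
     ('r \<Rightarrow> real) \<Rightarrow> ('s \<Rightarrow> real) \<Rightarrow> ('r \<times> 's) list \<Rightarrow> real" where
  "proj_sn R S p q zs =
     Inf {\<Sum>(x, y)\<leftarrow>ws. p x * q y | ws. formal_sum ws - formal_sum zs \<in> tensor_rel R S}"

definition tensor_eval :: "('r \<Rightarrow> 's \<Rightarrow> 't::ab_group_add) \<Rightarrow> ('r \<times> 's) list \<Rightarrow> 't" where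
  "tensor_eval t zs = (\<Sum>(x, y)\<leftarrow>zs. t x y)"

text \<open>\<open>T\<close> with the bilinear map \<open>t\<close> is the completed projective tensor product of the unital
  extensions \<open>R\<close> and \<open>S\<close>: separated, sequentially complete, with the projective seminorms on
  the dense image of the algebraic tensor product. Its ideal is the closure of the span of
  the elementary tensors of the two ideals; as the ideals are complemented in \<open>R\<close> and \<open>S\<close>
  when these are unitizations, this is the completed projective tensor product of the two
  original rings.\<close>

definition completed_tensor ::
    "('k::comm_ring_1 \<Rightarrow> real) \<Rightarrow> ('k, 'r::ab_group_add) uext \<Rightarrow> ('k, 's::ab_group_add) uext \<Rightarrow>
     ('k, 't::ab_group_add) uext \<Rightarrow> ('r \<Rightarrow> 's \<Rightarrow> 't) \<Rightarrow> bool" where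
  "completed_tensor av R S T t \<longleftrightarrow>
     polymetric av T \<and>
     (\<forall>x x' y. t (x + x') y = t x y + t x' y) \<and>
     (\<forall>x y y'. t x (y + y') = t x y + t x y') \<and>
     (\<forall>c x y. t (scale R c x) y = scale T c (t x y) \<and> t x (scale S c y) = scale T c (t x y)) \<and>
     (\<forall>x y x' y'. mult T (t x y) (t x' y') = t (mult R x x') (mult S y y')) \<and>
     unit T = t (unit R) (unit S) \<and>
     (\<forall>p\<in>sn_span (sn R). \<forall>q\<in>sn_span (sn S). \<exists>r\<in>sn T.
        \<forall>zs. r (tensor_eval t zs) = proj_sn R S p q zs) \<and>
     (\<forall>r\<in>sn T. \<exists>p\<in>sn_span (sn R). \<exists>q\<in>sn_span (sn S).
        \<forall>zs. r (tensor_eval t zs) = proj_sn R S p q zs) \<and>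
     (\<forall>w F e. finite F \<and> F \<subseteq> sn T \<and> 0 < e \<longrightarrow>
        (\<exists>zs. \<forall>r\<in>F. r (w - tensor_eval t zs) < e)) \<and>
     ideal T = {w. \<forall>F e. finite F \<and> F \<subseteq> sn T \<and> 0 < e \<longrightarrow>
        (\<exists>zs. set zs \<subseteq> ideal R \<times> ideal S \<and> (\<forall>r\<in>F. r (w - tensor_eval t zs) < e))}"

section \<open>Matrices\<close>

text \<open>A matrix over index sets \<open>\<Omega>'\<close>, \<open>\<Omega>\<close> is a function on the whole types, vanishing outside
  \<open>pts \<Omega>' \<times> pts \<Omega>\<close>.

  The flag \<open>d\<close> distinguishes the two conventions for matrix spaces: if it is false, the
  definitions by seminorms and growth functions apply (to every ring); if it is true, the rings
  are discrete and the finiteness conditions on the entries apply. The two conventions agree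
  for \<open>Kmat\<close> over a discrete ring, but the finiteness condition for \<open>Psi\<close> does not bound the
  position of the nonzero entries polynomially.\<close>

definition matrix_on :: "'i spg \<Rightarrow> 'j spg \<Rightarrow> ('i \<Rightarrow> 'j \<Rightarrow> 'r::zero) \<Rightarrow> bool" where
  "matrix_on \<Omega>' \<Omega> a \<longleftrightarrow> (\<forall>n m. n \<notin> pts \<Omega>' \<or> m \<notin> pts \<Omega> \<longrightarrow> a n m = 0)"

definition Kmat ::
    "bool \<Rightarrow> ('k, 'r::ab_group_add) uext \<Rightarrow> 'i spg \<Rightarrow> 'j spg \<Rightarrow> ('i \<Rightarrow> 'j \<Rightarrow> 'r) set" where
  "Kmat d R \<Omega>' \<Omega> = {a. matrix_on \<Omega>' \<Omega> a \<and> (\<forall>n m. a n m \<in> ideal R) \<and>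
     (if d then finite {(n, m). a n m \<noteq> 0}
      else \<forall>p\<in>sn R. \<forall>f\<in>growth \<Omega>'. \<forall>h\<in>growth \<Omega>.
        bdd_above {\<bar>f n * h m\<bar> * p (a n m) | n m. n \<in> pts \<Omega>' \<and> m \<in> pts \<Omega>})}"

definition Psi ::
    "bool \<Rightarrow> ('k, 'r::ab_group_add) uext \<Rightarrow> 'i spg \<Rightarrow> 'j spg \<Rightarrow> ('i \<Rightarrow> 'j \<Rightarrow> 'r) set" where
  "Psi d R \<Omega>' \<Omega> = {a. matrix_on \<Omega>' \<Omega> a \<and>
     (if d then (\<forall>n. finite {m. a n m \<noteq> 0}) \<and> (\<forall>m. finite {n. a n m \<noteq> 0})
      else \<forall>p\<in>sn R. \<forall>f\<in>growth \<Omega>'. \<forall>h\<in>growth \<Omega>. \<exists>g\<in>growth \<Omega>. \<exists>k\<in>growth \<Omega>'.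
        \<forall>n\<in>pts \<Omega>'. \<forall>m\<in>pts \<Omega>. \<bar>f n\<bar> * p (a n m) \<le> g m \<and> \<bar>h m\<bar> * p (a n m) \<le> k n)}"

text \<open>Unconditional sum of a family with respect to the seminorms; for the entries of products
  of matrices in \<open>Psi\<close> it exists.\<close>

definition ring_sum :: "('k, 'r::ab_group_add) uext \<Rightarrow> ('i \<Rightarrow> 'r) \<Rightarrow> 'r" where
  "ring_sum R x =
     (THE s. \<forall>p\<in>sn R. ((\<lambda>F. p (sum x F - s)) \<longlongrightarrow> 0) (finite_subsets_at_top UNIV))"

definition mmult ::
    "('k, 'r::ab_group_add) uext \<Rightarrow> ('h \<Rightarrow> 'i \<Rightarrow> 'r) \<Rightarrow> ('i \<Rightarrow> 'j \<Rightarrow> 'r) \<Rightarrow> 'h \<Rightarrow> 'j \<Rightarrow> 'r" where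
  "mmult R a b = (\<lambda>n l. ring_sum R (\<lambda>m. mult R (a n m) (b m l)))"

definition madd :: "('i \<Rightarrow> 'j \<Rightarrow> 'r::ab_group_add) \<Rightarrow> ('i \<Rightarrow> 'j \<Rightarrow> 'r) \<Rightarrow> 'i \<Rightarrow> 'j \<Rightarrow> 'r" where
  "madd a b = (\<lambda>n m. a n m + b n m)"

definition mminus :: "('i \<Rightarrow> 'j \<Rightarrow> 'r::ab_group_add) \<Rightarrow> ('i \<Rightarrow> 'j \<Rightarrow> 'r) \<Rightarrow> 'i \<Rightarrow> 'j \<Rightarrow> 'r" where
  "mminus a b = (\<lambda>n m. a n m - b n m)"

definition mzero :: "'i \<Rightarrow> 'j \<Rightarrow> 'r::zero" where
  "mzero = (\<lambda>n m. 0)"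

definition mone :: "('k, 'r::ab_group_add) uext \<Rightarrow> 'i spg \<Rightarrow> 'i \<Rightarrow> 'i \<Rightarrow> 'r" where
  "mone R \<Omega> = (\<lambda>n m. if n = m \<and> n \<in> pts \<Omega> then unit R else 0)"

definition mcompl ::
    "('k, 'r::ab_group_add) uext \<Rightarrow> 'i spg \<Rightarrow> ('i \<Rightarrow> 'i \<Rightarrow> 'r) \<Rightarrow> 'i \<Rightarrow> 'i \<Rightarrow> 'r" where
  "mcompl R \<Omega> a = mminus (mone R \<Omega>) a"

definition block ::
    "('i \<Rightarrow> 'i' \<Rightarrow> 'r) \<Rightarrow> ('i \<Rightarrow> 'j' \<Rightarrow> 'r) \<Rightarrow> ('j \<Rightarrow> 'i' \<Rightarrow> 'r) \<Rightarrow> ('j \<Rightarrow> 'j' \<Rightarrow> 'r) \<Rightarrow>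
     'i + 'j \<Rightarrow> 'i' + 'j' \<Rightarrow> 'r" where
  "block a00 a01 a10 a11 = (\<lambda>u v. case u of
      Inl n \<Rightarrow> (case v of Inl m \<Rightarrow> a00 n m | Inr m \<Rightarrow> a01 n m)
    | Inr n \<Rightarrow> (case v of Inl m \<Rightarrow> a10 n m | Inr m \<Rightarrow> a11 n m))"

definition dsum ::
    "('i \<Rightarrow> 'i \<Rightarrow> 'r::zero) \<Rightarrow> ('j \<Rightarrow> 'j \<Rightarrow> 'r) \<Rightarrow> 'i + 'j \<Rightarrow> 'i + 'j \<Rightarrow> 'r" where
  "dsum a c = block a mzero mzero c"

definition kron ::
    "('r \<Rightarrow> 's \<Rightarrow> 't) \<Rightarrow> ('i \<Rightarrow> 'i \<Rightarrow> 'r) \<Rightarrow> ('j \<Rightarrow> 'j \<Rightarrow> 's) \<Rightarrow> 'i \<times> 'j \<Rightarrow> 'i \<times> 'j \<Rightarrow> 't" where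
  "kron t a d = (\<lambda>(n, m) (n', m'). t (a n n') (d m m'))"

text \<open>Pairs with components \<open>(B, A)\<close>.\<close>

definition Psi2 ::
    "bool \<Rightarrow> ('k, 'r::ab_group_add) uext \<Rightarrow> 'i spg \<Rightarrow> 'j spg \<Rightarrow>
     (('i \<Rightarrow> 'j \<Rightarrow> 'r) \<times> ('i \<Rightarrow> 'j \<Rightarrow> 'r)) set" where
  "Psi2 d R \<Omega>' \<Omega> =
     {(B, A). B \<in> Psi d R \<Omega>' \<Omega> \<and> A \<in> Psi d R \<Omega>' \<Omega> \<and> mminus B A \<in> Kmat d R \<Omega>' \<Omega>}"

section \<open>Pairs of idempotents\<close>

text \<open>The pair with first component \<open>fstm\<close> and second component \<open>sndm\<close>, over the index
  set \<open>idx\<close>.\<close>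

record ('i, 'r) mpair =
  idx :: "'i spg"
  fstm :: "'i \<Rightarrow> 'i \<Rightarrow> 'r"
  sndm :: "'i \<Rightarrow> 'i \<Rightarrow> 'r"

definition G2 :: "bool \<Rightarrow> ('k, 'r::ab_group_add) uext \<Rightarrow> ('i, 'r) mpair set" where
  "G2 d R = {p. is_spg (idx p) \<and>
     fstm p \<in> Psi d R (idx p) (idx p) \<and> sndm p \<in> Psi d R (idx p) (idx p) \<and>
     mmult R (fstm p) (fstm p) = fstm p \<and> mmult R (sndm p) (sndm p) = sndm p \<and>
     mminus (fstm p) (sndm p) \<in> Kmat d R (idx p) (idx p)}"

definition psum :: "('i, 'r::zero) mpair \<Rightarrow> ('j, 'r) mpair \<Rightarrow> ('i + 'j, 'r) mpair" where
  "psum p q = \<lparr>idx = spg_sum (idx p) (idx q),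
     fstm = dsum (fstm p) (fstm q), sndm = dsum (sndm p) (sndm q)\<rparr>"

definition pinv :: "('k, 'r::ab_group_add) uext \<Rightarrow> ('i, 'r) mpair \<Rightarrow> ('i, 'r) mpair" where
  "pinv R p = \<lparr>idx = idx p,
     fstm = mcompl R (idx p) (fstm p), sndm = mcompl R (idx p) (sndm p)\<rparr>"

definition pempty :: "(nat, 'r::zero) mpair" where
  "pempty = \<lparr>idx = \<lparr>pts = {}, growth = UNIV\<rparr>, fstm = mzero, sndm = mzero\<rparr>"

definition pzero :: "'i spg \<Rightarrow> ('i, 'r::zero) mpair" where
  "pzero \<Xi> = \<lparr>idx = \<Xi>, fstm = mzero, sndm = mzero\<rparr>"

definition pzero' :: "('k, 'r::ab_group_add) uext \<Rightarrow> 'i spg \<Rightarrow> ('i, 'r) mpair" where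
  "pzero' R \<Xi> = \<lparr>idx = \<Xi>, fstm = mone R \<Xi>, sndm = mone R \<Xi>\<rparr>"

text \<open>The pair of one by one matrices with entries 1 and 0 over the base. Here 1 is the unit
  of the base viewed as the ideal of its own unitization, i.e. \<open>(0, 1)\<close>; with the unit
  \<open>(1, 0)\<close> of the unitization the difference would not be in the ideal.\<close>

definition punit :: "(unit, 'k::comm_ring_1 \<times> 'k) mpair" where
  "punit = \<lparr>idx = \<lparr>pts = UNIV, growth = UNIV\<rparr>, fstm = (\<lambda>_ _. (0, 1)), sndm = mzero\<rparr>"

definition left_tensor ::
    "('k, 'r::ab_group_add) uext \<Rightarrow> ('r \<Rightarrow> 's \<Rightarrow> 't::ab_group_add) \<Rightarrow>
     ('i, 'r) mpair \<Rightarrow> ('j, 's) mpair \<Rightarrow> ('i \<times> 'j, 't) mpair" where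
  "left_tensor R t p q = \<lparr>idx = spg_prod (idx p) (idx q),
     fstm = madd (kron t (fstm p) (fstm q)) (kron t (mcompl R (idx p) (fstm p)) (sndm q)),
     sndm = madd (kron t (sndm p) (fstm q)) (kron t (mcompl R (idx p) (sndm p)) (sndm q))\<rparr>"

definition right_tensor ::
    "('k, 's::ab_group_add) uext \<Rightarrow> ('r \<Rightarrow> 's \<Rightarrow> 't::ab_group_add) \<Rightarrow>
     ('i, 'r) mpair \<Rightarrow> ('j, 's) mpair \<Rightarrow> ('i \<times> 'j, 't) mpair" where
  "right_tensor S t p q = \<lparr>idx = spg_prod (idx p) (idx q),
     fstm = madd (kron t (fstm p) (fstm q)) (kron t (sndm p) (mcompl S (idx q) (fstm q))),
     sndm = madd (kron t (fstm p) (sndm q)) (kron t (sndm p) (mcompl S (idx q) (sndm q)))\<rparr>"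

text \<open>The existentially quantified index sets have carriers in \<open>nat\<close>; every spg is isomorphic
  to one of this kind.\<close>

definition alg_homotopic ::
    "bool \<Rightarrow> ('k, 'r::ab_group_add) uext \<Rightarrow> ('i, 'r) mpair \<Rightarrow> ('j, 'r) mpair \<Rightarrow> bool" where
  "alg_homotopic d R p1 p2 \<longleftrightarrow>
     (\<exists>(\<Omega>10 :: nat spg) (\<Omega>11 :: nat spg) (\<Omega>20 :: nat spg) (\<Omega>21 :: nat spg).
        is_spg \<Omega>10 \<and> is_spg \<Omega>11 \<and> is_spg \<Omega>20 \<and> is_spg \<Omega>21 \<and>
        (let q1 = psum (psum p1 (pzero \<Omega>10)) (pzero' R \<Omega>11);
             q2 = psum (psum p2 (pzero \<Omega>20)) (pzero' R \<Omega>21)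
         in \<exists>B A B' A'.
              (B, A) \<in> Psi2 d R (idx q2) (idx q1) \<and> (B', A') \<in> Psi2 d R (idx q1) (idx q2) \<and>
              mmult R B B' = mone R (idx q2) \<and> mmult R B' B = mone R (idx q1) \<and>
              mmult R A A' = mone R (idx q2) \<and> mmult R A' A = mone R (idx q1) \<and>
              mmult R (mmult R B (fstm q1)) B' = fstm q2 \<and>
              mmult R (mmult R A (sndm q1)) A' = sndm q2))"

section \<open>Regular idempotents and dimension\<close>

text \<open>The index set \<open>{0,1} \<times> \<Xi>\<close> is written as \<open>spg_sum \<Xi> \<Xi>\<close>.\<close>

definition regular_idem ::
    "bool \<Rightarrow> ('k, 'r::ab_group_add) uext \<Rightarrow> 'i spg \<Rightarrow> ('i + 'i \<Rightarrow> 'i + 'i \<Rightarrow> 'r) \<Rightarrow> bool" where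
  "regular_idem d R \<Xi> U \<longleftrightarrow>
     (\<exists>h00\<in>Kmat d R \<Xi> \<Xi>. \<exists>h01\<in>Kmat d R \<Xi> \<Xi>. \<exists>h10\<in>Kmat d R \<Xi> \<Xi>. \<exists>h11\<in>Kmat d R \<Xi> \<Xi>.
        U = block h00 h01 h10 (madd (mone R \<Xi>) h11) \<and>
        mmult R U U = U \<and>
        mmult R h00 h10 = mzero \<and> mmult R h01 h00 = mzero \<and>
        mmult R h00 h11 = mzero \<and> mmult R h01 h01 = mzero \<and>
        mmult R h10 h10 = mzero \<and> mmult R h11 h00 = mzero \<and>
        mmult R h10 h11 = mzero \<and> mmult R h11 h01 = mzero)"

definition vdim :: "bool \<Rightarrow> ('k, 'r::ab_group_add) uext \<Rightarrow> ('i, 'r) mpair \<Rightarrow> enat" where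
  "vdim d R p = Inf {spg_card \<Xi> | \<Xi> :: nat spg. is_spg \<Xi> \<and>
     (\<exists>U. regular_idem d R \<Xi> U \<and>
        alg_homotopic d R p
          \<lparr>idx = spg_sum \<Xi> \<Xi>, fstm = U, sndm = dsum mzero (mone R \<Xi>)\<rparr>)}"

end

theory Submission
  imports "HOL-Analysis.Complex_Analysis_Basics" "HOL-Library.Nat_Bijection" Defs
begin

text \<open>
  Every index set embeds into the natural numbers with polynomial control, and two disjoint copies
  of the natural numbers inside the natural numbers give isometries \<open>s0\<close>, \<open>s1\<close>
  (with left inverses \<open>t0\<close>, \<open>t1\<close>) among the matrices. So all pairs of idempotents live in one ring,
  in which direct sums are \<open>s0 p t0 + s1 q t1\<close>. There algebraic homotopy becomes the relation
  \<open>p \<oplus> 1 = x y, q \<oplus> 1 = y x\<close>: infinite repetition (an Eilenberg swindle) makes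
  every constant pair \<open>\<langle>a, a\<rangle>\<close> trivial, hence conjugation can be replaced by this relation.

  With \<open>s = b - a\<close>, the pair \<open>\<langle>b, a\<rangle>\<close> is equivalent to the regular idempotent
  with the blocks \<open>a\<^sub>i s a\<^sub>j\<close>, where \<open>a\<^sub>0 = 1 - a\<close> and \<open>a\<^sub>1 = a\<close>. Part (c) is the
  direct sum of regular idempotents. Part (d) exchanges the two blocks of \<open>1 - U\<close>. In part (e), the
  product of two regular idempotents \<open>P + H\<close> and \<open>P + H'\<close> carries four blocks, and the regularity
  relations allow their indices to be summed up two by two, which leaves a regular idempotent
  over the product of the index sets. In part (f), the trace of \<open>b - a\<close> is an invariant for a
  commutative ring, and it does not vanish on \<open>\<langle>1, 0\<rangle>\<close>.
\<close>

text \<open>The eight regularity relations are one statement: \<open>h_ij h_kl = 0\<close> whenever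
  \<open>j \<noteq> k\<close>. For blocks \<open>a_i s a_j\<close> this is
  \<open>a_j a_k = 0\<close>. The statement is symmetric in the two indices, survives direct sums,
  and implies that inserting the all-ones two by two matrix between two factors changes nothing,
  which is what the product needs. The tensor product treats its arguments differently. With the
  second idempotent fixed it is multiplicative in the first, but in the second it is only affine, so
  it does not transport an equivalence \<open>x y = q\<close>, \<open>y x = q'\<close>. Instead
  \<open>q\<close> is joined to \<open>q'\<close> by idempotents whose consecutive differences
  square to zero; the affine dependence preserves such steps, and they also drive the reduction of
  the blocks. An index set fills only a corner of the universal ring. Formulas with the full unit
  and with the unit of the corner differ by a constant orthogonal idempotent, which stable
  equivalence ignores.\<close>

text \<open>The model is the ring of pairs of matrices over the natural numbers: \<open>G\<close> are the pairs with
  difference in \<open>Kmat\<close>, \<open>\<pi> \<langle>b, a\<rangle> = \<langle>a, a\<rangle>\<close>, and \<open>\<sigma> x\<close> repeats \<open>x\<close>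
  infinitely often along the diagonal.\<close>

locale stable =
  fixes G :: "'x::{ring,monoid_mult} set" and \<pi> :: "'x \<Rightarrow> 'x" and s0 s1 t0 t1 :: 'x
    and \<sigma> :: "'x \<Rightarrow> 'x"
  assumes G_add: "x \<in> G \<Longrightarrow> y \<in> G \<Longrightarrow> x + y \<in> G"
    and G_uminus: "x \<in> G \<Longrightarrow> - x \<in> G"
    and G_mult: "x \<in> G \<Longrightarrow> y \<in> G \<Longrightarrow> x * y \<in> G"
    and pi_add: "\<pi> (x + y) = \<pi> x + \<pi> y"
    and pi_mult: "\<pi> (x * y) = \<pi> x * \<pi> y"
    and pi_pi: "\<pi> (\<pi> x) = \<pi> x"
    and pi_one: "\<pi> 1 = 1"
    and pi_G: "\<pi> x \<in> G"
    and pi_s0: "\<pi> s0 = s0" and pi_s1: "\<pi> s1 = s1" and pi_t0: "\<pi> t0 = t0" and pi_t1: "\<pi> t1 = t1"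
    and t0s0: "t0 * s0 = 1" and t1s1: "t1 * s1 = 1" and t0s1: "t0 * s1 = 0" and t1s0: "t1 * s0 = 0"
    and st: "s0 * t0 + s1 * t1 = 1"
    and sigma_mult: "\<sigma> (x * y) = \<sigma> x * \<sigma> y"
    and sigma_pi: "\<pi> (\<sigma> x) = \<sigma> (\<pi> x)"
    and sigma_eq: "\<sigma> x = s0 * x * t0 + s1 * \<sigma> x * t1"
begin

lemma pi_uminus: "\<pi> (- x) = - \<pi> x"
  by (metis add_cancel_left_left minus_unique pi_add add.right_inverse)

lemma pi_zero: "\<pi> 0 = 0"
  using pi_add[of 0 0] by simp

lemma pi_diff: "\<pi> (x - y) = \<pi> x - \<pi> y"
  using pi_add[of x "- y"] by (simp add: pi_uminus)

lemmas pi_simps = pi_add pi_mult pi_pi pi_one pi_zero pi_uminus pi_diff pi_s0 pi_s1 pi_t0 pi_t1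

lemma G_C: "\<pi> x = x \<Longrightarrow> x \<in> G"
  using pi_G[of x] by simp

lemma G_one: "1 \<in> G" by (rule G_C[OF pi_one])
lemma G_zero: "0 \<in> G" by (rule G_C[OF pi_zero])
lemma G_diff: "x \<in> G \<Longrightarrow> y \<in> G \<Longrightarrow> x - y \<in> G"
  using G_add[of x "- y"] G_uminus by simp

lemmas G_intros = G_add G_uminus G_diff G_mult G_one G_zero pi_G
  G_C[OF pi_s0] G_C[OF pi_s1] G_C[OF pi_t0] G_C[OF pi_t1]

section \<open>Two by two block matrices inside the ring\<close>

lemma ts_simps:
  "t0 * (s0 * x) = x" "t1 * (s1 * x) = x" "t0 * (s1 * x) = 0" "t1 * (s0 * x) = 0"
  by (simp_all add: mult.assoc[symmetric] t0s0 t1s1 t0s1 t1s0)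

lemmas cuntz = t0s0 t1s1 t0s1 t1s0 ts_simps

text \<open>The Cuntz relations make this an isomorphism from the two by two matrices over the ring
  onto the ring itself, so block arguments stay within one type.\<close>

definition blk :: "'x \<Rightarrow> 'x \<Rightarrow> 'x \<Rightarrow> 'x \<Rightarrow> 'x" where
  "blk a b c d = s0 * a * t0 + s0 * b * t1 + s1 * c * t0 + s1 * d * t1"

lemma blk_mult:
  "blk a b c d * blk a' b' c' d' =
     blk (a * a' + b * c') (a * b' + b * d') (c * a' + d * c') (c * b' + d * d')"
  by (simp add: blk_def distrib_left distrib_right mult.assoc cuntz add_ac)

lemma blk_add: "blk a b c d + blk a' b' c' d' = blk (a + a') (b + b') (c + c') (d + d')"
  by (simp add: blk_def distrib_left distrib_right add_ac)

lemma blk_diff: "blk a b c d - blk a' b' c' d' = blk (a - a') (b - b') (c - c') (d - d')"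
  by (simp add: blk_def left_diff_distrib right_diff_distrib)

lemma blk_one: "blk 1 0 0 1 = 1"
  using st by (simp add: blk_def)

lemma blk_zero: "blk 0 0 0 0 = 0"
  by (simp add: blk_def)

lemma blk_G: "a \<in> G \<Longrightarrow> b \<in> G \<Longrightarrow> c \<in> G \<Longrightarrow> d \<in> G \<Longrightarrow> blk a b c d \<in> G"
  unfolding blk_def by (intro G_intros)

lemma pi_blk: "\<pi> (blk a b c d) = blk (\<pi> a) (\<pi> b) (\<pi> c) (\<pi> d)"
  by (simp add: blk_def pi_simps)

definition dsm :: "'x \<Rightarrow> 'x \<Rightarrow> 'x" where
  "dsm p q = blk p 0 0 q"

lemma dsm_mult: "dsm p q * dsm p' q' = dsm (p * p') (q * q')"
  by (simp add: dsm_def blk_mult)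

lemma dsm_G: "p \<in> G \<Longrightarrow> q \<in> G \<Longrightarrow> dsm p q \<in> G"
  by (simp add: dsm_def blk_G G_zero)

lemma pi_dsm: "\<pi> (dsm p q) = dsm (\<pi> p) (\<pi> q)"
  by (simp add: dsm_def pi_blk pi_zero)

section \<open>Idempotents and Murray-von Neumann equivalence\<close>

definition idem :: "'x \<Rightarrow> bool" where
  "idem p \<longleftrightarrow> p \<in> G \<and> p * p = p"

lemma idem_dsm: "idem p \<Longrightarrow> idem q \<Longrightarrow> idem (dsm p q)"
  by (simp add: idem_def dsm_mult dsm_G)

lemma idem_one: "idem 1" by (simp add: idem_def G_one)
lemma idem_zero: "idem 0" by (simp add: idem_def G_zero)

lemma idem_compl: "idem p \<Longrightarrow> idem (1 - p)"
  by (simp add: idem_def G_intros algebra_simps)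

lemma idem_pi: "idem p \<Longrightarrow> idem (\<pi> p)"
  by (simp add: idem_def pi_G pi_mult[symmetric])

lemma pi_one_minus: "\<pi> c = c \<Longrightarrow> \<pi> (1 - c) = 1 - c"
  by (simp add: pi_simps)

text \<open>Murray-von Neumann equivalence in unnormalised form: \<open>x\<close> and
  \<open>y\<close> may stick out of the corners of \<open>p\<close> and \<open>q\<close>. For
  idempotents \<open>mvn_corner\<close> restores the normalisation.\<close>

definition mvn :: "'x \<Rightarrow> 'x \<Rightarrow> bool" where
  "mvn p q \<longleftrightarrow> (\<exists>x\<in>G. \<exists>y\<in>G. x * y = p \<and> y * x = q)"

lemma mvnI: "x \<in> G \<Longrightarrow> y \<in> G \<Longrightarrow> x * y = p \<Longrightarrow> y * x = q \<Longrightarrow> mvn p q"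
  unfolding mvn_def by blast

lemma mvn_refl: "idem p \<Longrightarrow> mvn p p"
  unfolding mvn_def idem_def by blast

lemma mvn_sym: "mvn p q \<Longrightarrow> mvn q p"
  unfolding mvn_def by blast

lemma mvn_trans:
  assumes "idem p" "idem r" "mvn p q" "mvn q r"
  shows "mvn p r"
proof -
  obtain x y where xy: "x \<in> G" "y \<in> G" "x * y = p" "y * x = q"
    using assms(3) by (auto simp: mvn_def)
  obtain x' y' where xy': "x' \<in> G" "y' \<in> G" "x' * y' = q" "y' * x' = r"
    using assms(4) by (auto simp: mvn_def)
  show ?thesis
  proof (rule mvnI[of "x * x'" "y' * y"])
    have "x * x' * (y' * y) = x * (x' * y') * y" by (simp add: mult.assoc)
    also have "\<dots> = (x * y) * (x * y)" unfolding xy'(3) xy(4)[symmetric] by (simp add: mult.assoc)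
    finally show "x * x' * (y' * y) = p" using assms(1) xy(3) by (simp add: idem_def)
    have "y' * y * (x * x') = y' * (y * x) * x'" by (simp add: mult.assoc)
    also have "\<dots> = (y' * x') * (y' * x')" unfolding xy(4) xy'(3)[symmetric] by (simp add: mult.assoc)
    finally show "y' * y * (x * x') = r" using assms(2) xy'(4) by (simp add: idem_def)
  qed (use xy xy' in \<open>auto intro: G_mult\<close>)
qed

text \<open>Since \<open>q * y = y * p\<close> and \<open>x * q = p * x\<close>, cutting
  \<open>x\<close> and \<open>y\<close> down to the corners leaves both products as they
  were.\<close>

lemma mvn_corner:
  assumes "idem p" "idem q" "mvn p q"
  obtains x y where "x \<in> G" "y \<in> G" "x * y = p" "y * x = q"
    "p * x = x" "x * q = x" "q * y = y" "y * p = y"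
proof -
  obtain x y where xy: "x \<in> G" "y \<in> G" "x * y = p" "y * x = q"
    using assms(3) by (auto simp: mvn_def)
  have pp: "p * p = p" "q * q = q" "p \<in> G" "q \<in> G" using assms by (auto simp: idem_def)
  have qy: "q * y = y * p" and xq: "x * q = p * x"
    unfolding xy(3,4)[symmetric] by (simp_all add: mult.assoc)
  show thesis
  proof (rule that[of "p * x * q" "q * y * p"])
    have 1: "p * x * q = p * x" using xq pp by (metis mult.assoc)
    have 2: "q * y * p = q * y" using qy pp by (metis mult.assoc)
    have 3: "p * x * (q * y) = p" "q * y * (p * x) = q"
      using xy(3,4) pp by (metis mult.assoc xq qy)+
    show "p * x * q * (q * y * p) = p" "q * y * p * (p * x * q) = q"
      unfolding 1 2 by (rule 3)+
    show "p * x * q \<in> G" "q * y * p \<in> G" using xy pp by (auto intro: G_mult)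
    show "p * (p * x * q) = p * x * q" "q * (q * y * p) = q * y * p"
      by (simp_all add: mult.assoc[symmetric] pp)
    show "p * x * q * q = p * x * q" "q * y * p * p = q * y * p"
      by (simp_all add: mult.assoc pp)
  qed
qed

text \<open>The elements \<open>p * g'\<close> and \<open>g * p\<close> work because
  \<open>g' * g = 1\<close>; so \<open>g\<close> may be a proper isometry.\<close>

lemma mvn_conj:
  assumes "idem p" "g \<in> G" "g' \<in> G" "g' * g = 1"
  shows "mvn p (g * p * g')"
proof (rule mvnI[of "p * g'" "g * p"])
  have "p * g' * (g * p) = p * (g' * g) * p" by (simp add: mult.assoc)
  then show "p * g' * (g * p) = p" using assms(1,4) by (simp add: idem_def)
  have "g * p * (p * g') = g * (p * p) * g'" by (simp add: mult.assoc)
  then show "g * p * (p * g') = g * p * g'" using assms(1) by (simp add: idem_def)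
qed (use assms in \<open>auto simp: idem_def intro: G_mult\<close>)

lemma idem_conj:
  assumes "idem p" "g \<in> G" "g' \<in> G" "g' * g = 1"
  shows "idem (g * p * g')"
proof -
  have "g * p * g' * (g * p * g') = g * (p * (g' * g) * p) * g'" by (simp add: mult.assoc)
  then show ?thesis using assms by (auto simp: idem_def intro!: G_mult)
qed

text \<open>Idempotence of \<open>a + z\<close> together with \<open>z * z = 0\<close> gives
  \<open>a * z + z * a = z\<close>, and multiplying this by \<open>a\<close> or by \<open>z\<close>
  gives \<open>a * z * a = 0\<close> and \<open>z * a * z = 0\<close>. Hence compressing either of
  the two idempotents by the other returns the latter.\<close>

lemma mvn_square_zero:
  assumes "idem a" "idem (a + z)" "z * z = 0"
  shows "mvn a (a + z)"
proof (rule mvnI[of "a * (a + z)" "(a + z) * a"])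
  have aa: "a * a = a" and az: "a * z + z * a = z"
    using assms by (simp_all add: idem_def algebra_simps)
  have zz: "z * z = 0" "\<And>x. z * (z * x) = 0"
    using assms(3) by (simp_all add: mult.assoc[symmetric])
  have aza: "a * (z * a) = 0"
  proof -
    have "a * (a * z + z * a) = a * z" by (simp only: az)
    then have "a * a * z + a * (z * a) = a * z" by (simp add: algebra_simps)
    then show ?thesis by (simp add: aa)
  qed
  have zaz: "z * (a * z) = 0"
  proof -
    have "z * (a * z + z * a) = z * z" by (simp only: az)
    then show ?thesis using zz by (simp add: distrib_left)
  qed
  have aa': "\<And>x. a * (a * x) = a * x" by (simp add: mult.assoc[symmetric] aa)
  show "a * (a + z) * ((a + z) * a) = a"
    by (simp add: algebra_simps aa aa' aza zz)
  have "(a + z) * a * (a * (a + z)) = (a + z) * a * (a + z)"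
    by (simp add: algebra_simps aa aa')
  also have "\<dots> = a + (a * z + z * a)"
    by (simp add: algebra_simps aa aa' aza zaz zz)
  finally show "(a + z) * a * (a * (a + z)) = a + z" by (simp add: az)
qed (use assms in \<open>auto simp: idem_def intro: G_mult\<close>)

lemma mvn_dsm_cong:
  assumes "mvn p p'" "mvn q q'" shows "mvn (dsm p q) (dsm p' q')"
proof -
  obtain x y u v where "x \<in> G" "y \<in> G" "x * y = p" "y * x = p'"
      "u \<in> G" "v \<in> G" "u * v = q" "v * u = q'"
    using assms unfolding mvn_def by blast
  then show ?thesis
    by (intro mvnI[of "dsm x u" "dsm y v"]) (auto simp: dsm_mult dsm_G)
qed

text \<open>A row and a column with entries \<open>p\<close> and \<open>q\<close> implement the
  equivalence; orthogonality kills the off-diagonal products.\<close>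

lemma mvn_orth:
  assumes "idem p" "idem q" "p * q = 0" "q * p = 0"
  shows "mvn (p + q) (dsm p q)"
proof (rule mvnI[of "p * t0 + q * t1" "s0 * p + s1 * q"])
  have p: "p * p = p" "q * q = q" "\<And>x. p * (p * x) = p * x" "\<And>x. q * (q * x) = q * x"
     "\<And>x. p * (q * x) = 0" "\<And>x. q * (p * x) = 0"
    using assms by (auto simp: idem_def mult.assoc[symmetric])
  show "(p * t0 + q * t1) * (s0 * p + s1 * q) = p + q"
    by (simp add: algebra_simps cuntz p)
  show "(s0 * p + s1 * q) * (p * t0 + q * t1) = dsm p q"
    using assms by (simp add: algebra_simps p dsm_def blk_def)
qed (use assms in \<open>auto simp: idem_def intro!: G_intros\<close>)

lemma mvn_comm:
  assumes "idem p" "idem q" shows "mvn (dsm p q) (dsm q p)"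
  by (rule mvnI[of "blk 0 p q 0" "blk 0 q p 0"])
    (use assms in \<open>auto simp: idem_def dsm_def blk_mult intro!: blk_G G_zero\<close>)

text \<open>The witnesses move \<open>p\<close>, \<open>q\<close>, \<open>r\<close> between the
  nested slots \<open>s0 s0\<close>, \<open>s0 s1\<close>, \<open>s1\<close> and the slots
  \<open>s0\<close>, \<open>s1 s0\<close>, \<open>s1 s1\<close>.\<close>

lemma mvn_assoc:
  assumes "idem p" "idem q" "idem r" shows "mvn (dsm (dsm p q) r) (dsm p (dsm q r))"
proof (rule mvnI)
  let ?x = "s0 * s0 * p * t0 + s0 * s1 * q * t0 * t1 + s1 * r * t1 * t1"
  let ?y = "s0 * p * t0 * t0 + s1 * s0 * q * t1 * t0 + s1 * s1 * r * t1"
  have i: "p * p = p" "q * q = q" "r * r = r"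
    "\<And>x. p * (p * x) = p * x" "\<And>x. q * (q * x) = q * x" "\<And>x. r * (r * x) = r * x"
    using assms by (auto simp: idem_def mult.assoc[symmetric])
  show "?x \<in> G" "?y \<in> G" using assms by (auto simp: idem_def intro!: G_intros)
  show "?x * ?y = dsm (dsm p q) r" by (simp add: dsm_def blk_def algebra_simps cuntz i)
  show "?y * ?x = dsm p (dsm q r)" by (simp add: dsm_def blk_def algebra_simps cuntz i)
qed

lemma mvn_zero_right:
  assumes "idem p" shows "mvn (dsm p 0) p"
  using mvn_orth[OF assms idem_zero] by (simp add: mvn_sym)

subsection \<open>Stable equivalence\<close>

text \<open>\<open>\<sigma> c\<close> absorbs one further copy of \<open>c\<close>, and
  \<open>1\<close> splits into \<open>\<sigma> c\<close> and its complement, so \<open>1\<close>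
  absorbs \<open>c\<close>. Constancy of \<open>c\<close> is what puts \<open>\<sigma> c\<close>
  into \<open>G\<close>: in the model, repeating a nonzero difference infinitely often destroys its
  rapid decrease.\<close>

lemma swindle:
  assumes "idem c" "\<pi> c = c" shows "mvn (dsm c 1) 1"
proof -
  let ?e = "\<sigma> 1" and ?c' = "1 - c"
  have cc: "c * c = c" using assms by (simp add: idem_def)
  have C: "\<pi> (\<sigma> x) = \<sigma> x" if "\<pi> x = x" for x using that by (simp add: sigma_pi)
  have sc: "\<sigma> c * \<sigma> c = \<sigma> c" using cc by (simp add: sigma_mult[symmetric])
  have ec: "idem (\<sigma> c)" using sc C[OF assms(2)] by (simp add: idem_def G_C)
  have absorb: "dsm c (\<sigma> c) = \<sigma> c" using sigma_eq[of c] by (simp add: dsm_def blk_def)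
  have ec': "idem (1 - \<sigma> c)" using ec by (rule idem_compl)
  have orth: "mvn 1 (dsm (\<sigma> c) (1 - \<sigma> c))"
    using mvn_orth[OF ec ec'] sc by (simp add: algebra_simps)
  have "mvn (dsm c 1) (dsm c (dsm (\<sigma> c) (1 - \<sigma> c)))"
    by (rule mvn_dsm_cong[OF mvn_refl[OF assms(1)] orth])
  moreover have "mvn (dsm c (dsm (\<sigma> c) (1 - \<sigma> c))) (dsm (dsm c (\<sigma> c)) (1 - \<sigma> c))"
    by (rule mvn_sym[OF mvn_assoc[OF assms(1) ec ec']])
  moreover have "mvn (dsm (dsm c (\<sigma> c)) (1 - \<sigma> c)) 1"
    unfolding absorb by (rule mvn_sym[OF orth])
  ultimately show ?thesis
    using assms(1) ec ec' by (meson idem_dsm idem_one mvn_trans)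
qed

text \<open>One summand \<open>1\<close> is all the stabilisation there is to do, because by
  \<open>swindle\<close> it absorbs every constant idempotent.\<close>

definition seq :: "'x \<Rightarrow> 'x \<Rightarrow> bool" where
  "seq p q \<longleftrightarrow> mvn (dsm p 1) (dsm q 1)"

lemma seq_sym: "seq p q \<Longrightarrow> seq q p"
  by (simp add: seq_def mvn_sym)

lemma seq_trans: "idem p \<Longrightarrow> idem r \<Longrightarrow> seq p q \<Longrightarrow> seq q r \<Longrightarrow> seq p r"
  unfolding seq_def by (rule mvn_trans) (auto intro: idem_dsm idem_one)

lemma mvn_seq: "mvn p q \<Longrightarrow> seq p q"
  unfolding seq_def by (rule mvn_dsm_cong[OF _ mvn_refl[OF idem_one]])

lemma seq_refl: "idem p \<Longrightarrow> seq p p"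
  by (simp add: mvn_refl mvn_seq)

lemma seq_dsm_right:
  assumes "idem p" "idem q" "idem r" "seq p q" shows "seq (dsm r p) (dsm r q)"
proof -
  have "mvn (dsm (dsm r p) 1) (dsm r (dsm p 1))" using assms by (intro mvn_assoc idem_one)
  moreover have "mvn (dsm r (dsm p 1)) (dsm r (dsm q 1))"
    using assms by (intro mvn_dsm_cong[OF mvn_refl]) (auto simp: seq_def)
  moreover have "mvn (dsm r (dsm q 1)) (dsm (dsm r q) 1)"
    using assms by (intro mvn_sym[OF mvn_assoc] idem_one)
  ultimately show ?thesis unfolding seq_def
    using assms by (meson idem_dsm idem_one mvn_trans)
qed

lemma seq_comm: "idem p \<Longrightarrow> idem q \<Longrightarrow> seq (dsm p q) (dsm q p)"
  by (simp add: mvn_seq mvn_comm)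

lemma seq_dsm_cong:
  assumes "idem p" "idem q" "idem p'" "idem q'" "seq p p'" "seq q q'"
  shows "seq (dsm p q) (dsm p' q')"
proof -
  have "seq (dsm p q) (dsm p q')" using assms by (intro seq_dsm_right)
  moreover have "seq (dsm p q') (dsm q' p)" using assms by (intro seq_comm)
  moreover have "seq (dsm q' p) (dsm q' p')" using assms by (intro seq_dsm_right)
  moreover have "seq (dsm q' p') (dsm p' q')" using assms by (intro seq_comm)
  ultimately show ?thesis using assms by (meson idem_dsm seq_trans)
qed

lemma seq_trivial:
  assumes "idem p" "idem c" "\<pi> c = c" shows "seq (dsm p c) p"
proof -
  have "mvn (dsm (dsm p c) 1) (dsm p (dsm c 1))" using assms by (intro mvn_assoc idem_one)
  moreover have "mvn (dsm p (dsm c 1)) (dsm p 1)"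
    using assms by (intro mvn_dsm_cong mvn_refl swindle)
  ultimately show ?thesis unfolding seq_def using assms by (meson idem_dsm idem_one mvn_trans)
qed

lemma seq_orth_trivial:
  assumes "idem p" "idem c" "\<pi> c = c" "p * c = 0" "c * p = 0" shows "seq (p + c) p"
proof -
  have "idem (p + c)" using assms by (simp add: idem_def G_add algebra_simps)
  then show ?thesis
    using mvn_seq[OF mvn_orth[OF assms(1,2,4,5)]] seq_trivial[OF assms(1-3)] assms
    by (meson seq_trans)
qed

lemma seq_C_zero:
  assumes "idem c" "\<pi> c = c" shows "seq c 0"
  using seq_orth_trivial[OF idem_zero assms] by simp

text \<open>Adding \<open>1 - r\<close> on both sides completes \<open>r\<close> to the constant
  \<open>1\<close>, which is stably invisible.\<close>

lemma seq_cancel: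
  assumes "idem p" "idem q" "idem r" "seq (dsm p r) (dsm q r)" shows "seq p q"
proof -
  note i = assms(1-3) idem_compl[OF assms(3)] idem_one
  have c: "seq (dsm (dsm p r) (1 - r)) p" if "idem p" for p
  proof -
    have "mvn 1 (dsm r (1 - r))" using mvn_orth[of r "1 - r"] i by (simp add: idem_def algebra_simps)
    then have "seq (dsm p (dsm r (1 - r))) (dsm p 1)"
      using that i by (intro seq_dsm_right idem_dsm seq_sym[OF mvn_seq])
    moreover have "seq (dsm p 1) p" using that i by (intro seq_trivial pi_one)
    moreover have "seq (dsm (dsm p r) (1 - r)) (dsm p (dsm r (1 - r)))"
      using that i by (intro mvn_seq mvn_assoc)
    ultimately show ?thesis using that i by (meson idem_dsm seq_trans)
  qed
  have "seq (dsm (dsm p r) (1 - r)) (dsm (dsm q r) (1 - r))"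
    by (rule seq_dsm_cong[OF _ _ _ _ assms(4) seq_refl]) (intro idem_dsm i)+
  then have "seq p (dsm (dsm q r) (1 - r))"
    by (rule seq_trans[rotated 2, OF seq_sym[OF c[OF assms(1)]]]) (intro idem_dsm i)+
  then show ?thesis by (rule seq_trans[rotated 2, OF _ c[OF assms(2)]]) (intro i)+
qed

text \<open>The summand \<open>p\<close> is cancelled: \<open>1 - p\<close> and \<open>p\<close> add
  up to \<open>1\<close>, and so do \<open>1 - q\<close> and \<open>q\<close>, where
  \<open>q\<close> may be exchanged for \<open>p\<close>.\<close>

lemma seq_compl:
  assumes "idem p" "idem q" "seq p q" shows "seq (1 - p) (1 - q)"
proof (rule seq_cancel[of _ _ p])
  note i = assms(1,2) assms(1,2)[THEN idem_compl] idem_one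
  show "idem (1 - p)" "idem (1 - q)" "idem p" using i by auto
  have o: "seq (dsm (1 - p) p) 1" if "idem p" for p
    using mvn_seq[OF mvn_orth[of "1 - p" p], THEN seq_sym] that idem_compl[OF that]
    by (simp add: idem_def algebra_simps)
  have "seq (dsm (1 - q) q) (dsm (1 - q) p)"
    using i assms(3) by (intro seq_dsm_right seq_sym[of p q])
  then show "seq (dsm (1 - p) p) (dsm (1 - q) p)"
    using o[OF assms(1)] o[OF assms(2)] i by (meson idem_dsm seq_sym seq_trans)
qed

text \<open>The complement within the corner of \<open>e\<close> and the full complement differ by
  the constant \<open>1 - e\<close>. This is the form in which complements over an index set appear
  in the universal ring.\<close>

lemma seq_compl_corner:
  assumes "idem p" "idem e" "\<pi> e = e" "e * p = p" "p * e = p"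
  shows "idem (e - p)" "seq (e - p) (1 - p)"
proof -
  have ee: "e * e = e" "p * p = p" using assms by (auto simp: idem_def)
  show i: "idem (e - p)" using assms ee by (simp add: idem_def G_diff algebra_simps)
  have "seq ((e - p) + (1 - e)) (e - p)"
    using assms ee by (intro seq_orth_trivial i idem_compl pi_one_minus)
       (auto simp: algebra_simps)
  then show "seq (e - p) (1 - p)" by (simp add: seq_sym)
qed

section \<open>Stable equivalence versus conjugacy\<close>

lemma seq_mvn_trans: "idem p \<Longrightarrow> idem r \<Longrightarrow> seq p q \<Longrightarrow> mvn q r \<Longrightarrow> seq p r"
  by (blast intro: seq_trans mvn_seq)

text \<open>Two idempotents are conjugate when both they and their complements are equivalent: the
  two partial isomorphisms add up to an invertible element. Of the two extra slots, the one where
  the idempotent is \<open>1\<close> stabilises \<open>p\<close>, and the one where it is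
  \<open>0\<close> stabilises the complement.\<close>

lemma idem_pair_iso:
  assumes p: "idem p" "\<pi> e = e" "idem e" "e * p = p" "p * e = p"
    and q: "idem q" "\<pi> f = f" "idem f" "f * q = q" "q * f = q"
    and eq: "seq p q"
  defines "E \<equiv> dsm (dsm e 1) 1" and "F \<equiv> dsm (dsm f 1) 1"
  obtains g g' where "g \<in> G" "g' \<in> G" "F * g = g" "g * E = g" "E * g' = g'" "g' * F = g'"
    "g * g' = F" "g' * g = E" "g * dsm (dsm p 0) 1 * g' = dsm (dsm q 0) 1"
proof -
  define P where "P = dsm (dsm p 0) 1"
  define P' where "P' = dsm (dsm (e - p) 1) 0"
  define Q where "Q = dsm (dsm q 0) 1"
  define Q' where "Q' = dsm (dsm (f - q) 1) 0"
  note ep = seq_compl_corner[OF p(1,3,2,4,5)] and fq = seq_compl_corner[OF q(1,3,2,4,5)]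
  note i = p(1,3) q(1,3) ep(1) fq(1) idem_one idem_zero idem_compl[OF p(1)] idem_compl[OF q(1)]
  have idems: "idem P" "idem P'" "idem Q" "idem Q'"
    unfolding P_def P'_def Q_def Q'_def by (intro idem_dsm i)+
  have z: "mvn (dsm (dsm r 0) 1) (dsm r 1)" if "idem r" for r
    using that by (intro mvn_dsm_cong mvn_zero_right mvn_refl i)
  have "mvn P (dsm q 1)"
    using z[OF p(1)] eq idems i by (metis P_def idem_dsm mvn_trans seq_def)
  then have "mvn P Q"
    using z[OF q(1)] idems i by (metis Q_def mvn_sym mvn_trans)
  then obtain x y where xy: "x \<in> G" "y \<in> G" "x * y = P" "y * x = Q"
      "P * x = x" "x * Q = x" "Q * y = y" "y * P = y"
    using idems mvn_corner by metis
  have "seq (e - p) (1 - q)"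
    using ep(2) seq_compl[OF p(1) q(1) eq] i by (meson seq_trans)
  then have "seq (e - p) (f - q)"
    using fq(2) i by (meson seq_trans seq_sym)
  then have "mvn (dsm (e - p) 1) (dsm (f - q) 1)" by (simp add: seq_def)
  then have "mvn P' Q'"
    unfolding P'_def Q'_def by (intro mvn_dsm_cong[OF _ mvn_refl[OF idem_zero]])
  then obtain x' y' where xy': "x' \<in> G" "y' \<in> G" "x' * y' = P'" "y' * x' = Q'"
      "P' * x' = x'" "x' * Q' = x'" "Q' * y' = y'" "y' * P' = y'"
    using idems mvn_corner by metis
  have sq: "p * p = p" "q * q = q" "e * e = e" "f * f = f" using i by (auto simp: idem_def)
  have o: "P * P' = 0" "P' * P = 0" "Q * Q' = 0" "Q' * Q = 0"
    unfolding P_def P'_def Q_def Q'_def using p q sq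
    by (simp_all add: dsm_def blk_mult blk_zero algebra_simps)
  have sum: "P + P' = E" "Q + Q' = F"
    unfolding P_def P'_def Q_def Q'_def E_def F_def by (simp_all add: dsm_def blk_add blk_zero)
  have EP: "P * P = P" "P' * P' = P'" "Q * Q = Q" "Q' * Q' = Q'" using idems by (auto simp: idem_def)
  have o2: "y * x' = 0" "y' * x = 0" "x * y' = 0" "x' * y = 0" 
       "P * x' = 0" "P' * x = 0" "Q * y' = 0" "Q' * y = 0"
       "y * P' = 0" "y' * P = 0" "x * Q' = 0" "x' * Q = 0"
    using xy xy' o by (metis mult.assoc mult_zero_left mult_zero_right)+
  show thesis
  proof (rule that[of "y + y'" "x + x'"])
    show "(y + y') * (x + x') = F" "(x + x') * (y + y') = E"
      using sum by (simp_all add: algebra_simps o2 xy xy')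
    show "F * (y + y') = y + y'" "(y + y') * E = y + y'" "E * (x + x') = x + x'" "(x + x') * F = x + x'"
      unfolding sum[symmetric] by (simp_all add: algebra_simps o2 xy xy')
    have "(y + y') * P * (x + x') = y * P * x + y * P * x' + y' * P * x + y' * P * x'"
      by (simp add: algebra_simps)
    then show "(y + y') * dsm (dsm p 0) 1 * (x + x') = dsm (dsm q 0) 1"
      unfolding P_def[symmetric] Q_def[symmetric] by (simp add: xy xy' o2)
  qed (use xy xy' in \<open>auto intro: G_add\<close>)
qed

text \<open>Converse of \<open>idem_pair_iso\<close>. The product \<open>g' * g\<close> is only the
  unit \<open>E\<close> of an index set, but \<open>E\<close> fixes the conjugated idempotent, and
  the constant summands are dropped afterwards.\<close>

lemma seq_if_conj:
  assumes p: "idem p" and q: "idem q"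
    and c: "idem c" "\<pi> c = c" and d: "idem d" "\<pi> d = d"
    and g: "g \<in> G" "g' \<in> G" "g' * g = E" "E * dsm (dsm p 0) c = dsm (dsm p 0) c"
    and eq: "g * dsm (dsm p 0) c * g' = dsm (dsm q 0) d"
  shows "seq p q"
proof -
  let ?P = "dsm (dsm p 0) c" and ?Q = "dsm (dsm q 0) d"
  note i = p q c d idem_zero
  have idP: "idem ?P" and idQ: "idem ?Q" by (intro idem_dsm i)+
  have "mvn ?P ?Q"
  proof (rule mvnI)
    have "?P * g' * (g * ?P) = ?P * ((g' * g) * ?P)" by (simp add: mult.assoc)
    then show "?P * g' * (g * ?P) = ?P" using idP by (simp add: g idem_def)
    have "(g * ?P) * (?P * g') = g * (?P * ?P) * g'" by (simp add: mult.assoc)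
    then show "(g * ?P) * (?P * g') = ?Q" using idP by (simp add: eq idem_def)
    show "?P * g' \<in> G" "g * ?P \<in> G" using g idP by (auto simp: idem_def intro: G_mult)
  qed
  have z: "seq (dsm (dsm r 0) k) r" if "idem r" "idem k" "\<pi> k = k" for r k
  proof -
    have "seq (dsm (dsm r 0) k) (dsm r 0)" using that by (intro seq_trivial idem_dsm idem_zero)
    then show ?thesis using mvn_zero_right[OF that(1)] that by (meson idem_dsm idem_zero seq_mvn_trans)
  qed
  have "seq p ?P" using z[OF p c] by (rule seq_sym)
  then have "seq p ?Q" by (rule seq_mvn_trans[OF p idQ _ \<open>mvn ?P ?Q\<close>])
  then show ?thesis using z[OF q d] p q by (meson seq_trans)
qed

subsection \<open>Regular idempotents\<close>

text \<open>Here \<open>e\<close> is the projection onto the index set. The entries \<open>h\<close>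
  lie in its corner and, by \<open>\<pi> h = 0\<close>, have zero second component, so that
  \<open>U\<close> is paired with \<open>0 \<oplus> 1\<close>. The diagonal carries the full
  \<open>1\<close> in place of \<open>e\<close>, which keeps formulas free of \<open>e\<close>;
  \<open>regular_cut\<close> makes up for it.\<close>

definition regular :: "'x \<Rightarrow> 'x \<Rightarrow> bool" where
  "regular e U \<longleftrightarrow> idem U \<and> (\<exists>h00\<in>G. \<exists>h01\<in>G. \<exists>h10\<in>G. \<exists>h11\<in>G.
     U = blk h00 h01 h10 (1 + h11) \<and>
     \<pi> h00 = 0 \<and> \<pi> h01 = 0 \<and> \<pi> h10 = 0 \<and> \<pi> h11 = 0 \<and>
     e * h00 * e = h00 \<and> e * h01 * e = h01 \<and> e * h10 * e = h10 \<and> e * h11 * e = h11 \<and>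
     h00 * h10 = 0 \<and> h01 * h00 = 0 \<and> h00 * h11 = 0 \<and> h01 * h01 = 0 \<and>
     h10 * h10 = 0 \<and> h11 * h00 = 0 \<and> h10 * h11 = 0 \<and> h11 * h01 = 0)"

definition model :: "'x \<Rightarrow> 'x" where
  "model p = (let a = \<pi> p; s = p - a in
     blk ((1 - a) * s * (1 - a)) ((1 - a) * s * a) (a * s * (1 - a)) (1 + a * s * a))"

text \<open>The involution \<open>W\<close> conjugates the constant
  \<open>a \<oplus> (1 - a)\<close> to \<open>0 \<oplus> 1\<close>, so with \<open>p = a + s\<close>
  it conjugates \<open>p \<oplus> (1 - a)\<close> to \<open>0 \<oplus> 1\<close> plus the four
  blocks of \<open>s\<close>.\<close>

lemma model_seq:
  assumes "idem p" shows "idem (model p)" "seq p (model p)"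
proof -
  define a where "a = \<pi> p"
  define W where "W = blk (1 - a) a a (1 - a)"
  have aa: "a * a = a" "\<pi> a = a" "idem a" "a \<in> G"
    using idem_pi[OF assms] by (auto simp: a_def idem_def pi_pi)
  have aa': "\<And>x. a * (a * x) = a * x" by (simp add: mult.assoc[symmetric] aa)
  have ia: "idem (1 - a)" using aa by (simp add: idem_compl)
  have WW: "W * W = 1" by (simp add: W_def blk_mult algebra_simps aa blk_one)
  have WG: "W \<in> G" using aa by (simp add: W_def blk_G G_intros)
  have m: "model p = W * dsm p (1 - a) * W"
    unfolding model_def Let_def a_def[symmetric] W_def dsm_def blk_mult
    by (simp add: algebra_simps aa aa')
  have ip: "idem (dsm p (1 - a))" by (intro idem_dsm assms ia)
  show im: "idem (model p)" unfolding m by (rule idem_conj[OF ip WG WG WW])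
  have "seq p (dsm p (1 - a))" using seq_trivial[OF assms ia] aa pi_one_minus by (simp add: seq_sym)
  moreover have "mvn (dsm p (1 - a)) (model p)" unfolding m by (rule mvn_conj[OF ip WG WG WW])
  ultimately show "seq p (model p)" using im assms by (meson seq_mvn_trans)
qed

text \<open>In each relation the projections \<open>a\<close> and \<open>1 - a\<close> become
  adjacent. As a consequence the dimension never exceeds the size of the index set of the
  pair.\<close>

lemma regular_model:
  assumes p: "idem p" and e: "e * e = e" "\<pi> e = e" "e * p = p" "p * e = p"
  shows "regular e (model p)"
proof -
  define a where "a = \<pi> p"
  define s where "s = p - a"
  have aa: "a * a = a" "a \<in> G" and ps: "p * p = p" "p \<in> G"
    using idem_pi[OF p] p by (auto simp: a_def idem_def)
  have aa': "\<And>x. a * (a * x) = a * x" by (simp add: mult.assoc[symmetric] aa)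
  have pis: "\<pi> s = 0" "\<pi> a = a" by (simp_all add: s_def a_def pi_simps)
  have ea: "e * a = a" "a * e = a" unfolding a_def by (metis e(2,3,4) pi_mult)+
  then have es: "e * s = s" "s * e = s" by (simp_all add: s_def algebra_simps e)
  have e': "\<And>x. e * (a * x) = a * x" "\<And>x. e * (s * x) = s * x"
    by (simp_all add: mult.assoc[symmetric] ea es)
  show ?thesis
    unfolding regular_def
  proof (intro conjI model_seq(1) p, intro bexI conjI)
    show "model p = blk ((1 - a) * s * (1 - a)) ((1 - a) * s * a) (a * s * (1 - a)) (1 + a * s * a)"
      by (simp add: model_def Let_def a_def s_def)
    show "\<pi> ((1 - a) * s * (1 - a)) = 0" "\<pi> ((1 - a) * s * a) = 0" "\<pi> (a * s * (1 - a)) = 0"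
      "\<pi> (a * s * a) = 0" by (simp_all add: pi_simps pis)
    show "(1 - a) * s * (1 - a) \<in> G" "(1 - a) * s * a \<in> G" "a * s * (1 - a) \<in> G" "a * s * a \<in> G"
      using aa ps by (auto simp: s_def intro!: G_intros)
  qed (simp_all add: algebra_simps ea es e' aa aa')
qed

lemma regular_compl:
  assumes "regular e U" obtains V where "regular e V" "seq (1 - U) V"
proof -
  from assms obtain h00 h01 h10 h11 where h: "h00 \<in> G" "h01 \<in> G" "h10 \<in> G" "h11 \<in> G"
     "idem U" "U = blk h00 h01 h10 (1 + h11)"
     "\<pi> h00 = 0" "\<pi> h01 = 0" "\<pi> h10 = 0" "\<pi> h11 = 0"
     "e * h00 * e = h00" "e * h01 * e = h01" "e * h10 * e = h10" "e * h11 * e = h11"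
     "h00 * h10 = 0" "h01 * h00 = 0" "h00 * h11 = 0" "h01 * h01 = 0"
     "h10 * h10 = 0" "h11 * h00 = 0" "h10 * h11 = 0" "h11 * h01 = 0"
    unfolding regular_def by auto
  define V where "V = blk (- h11) (- h10) (- h01) (1 + (- h00))"
  define W where "W = blk 0 1 1 0"
  have WW: "W * W = 1" by (simp add: W_def blk_mult blk_one)
  have WG: "W \<in> G" by (simp add: W_def blk_G G_intros)
  have "1 - U = blk (1 - h00) (- h01) (- h10) (- h11)"
    by (subst blk_one[symmetric]) (simp add: h(6) blk_diff)
  \<comment> \<open>\<open>W\<close> is the flip of the two blocks. It moves the \<open>1\<close>
    left over in the upper corner of \<open>1 - U\<close> to the lower one, and the list of
    relations is invariant under exchanging the indices.\<close>
  then have V: "V = W * (1 - U) * W" by (simp add: V_def W_def blk_mult)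
  note iU = idem_compl[OF h(5)]
  have "idem V" unfolding V by (rule idem_conj[OF iU WG WG WW])
  moreover have "mvn (1 - U) V" unfolding V by (rule mvn_conj[OF iU WG WG WW])
  moreover have "regular e V"
    unfolding regular_def
  proof (intro conjI \<open>idem V\<close>, intro bexI conjI)
    show "V = blk (- h11) (- h10) (- h01) (1 + (- h00))" by (rule V_def)
  qed (simp_all add: h pi_simps G_intros)
  ultimately show thesis using that mvn_seq by blast
qed

lemma regular_dsm:
  assumes "regular e U" "regular f V" obtains X where "regular (dsm e f) X" "seq (dsm U V) X"
proof -
  from assms(1) obtain h00 h01 h10 h11 where h: "h00 \<in> G" "h01 \<in> G" "h10 \<in> G" "h11 \<in> G"
     "idem U" "U = blk h00 h01 h10 (1 + h11)"
     "\<pi> h00 = 0" "\<pi> h01 = 0" "\<pi> h10 = 0" "\<pi> h11 = 0"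
     "e * h00 * e = h00" "e * h01 * e = h01" "e * h10 * e = h10" "e * h11 * e = h11"
     "h00 * h10 = 0" "h01 * h00 = 0" "h00 * h11 = 0" "h01 * h01 = 0"
     "h10 * h10 = 0" "h11 * h00 = 0" "h10 * h11 = 0" "h11 * h01 = 0"
    unfolding regular_def by auto
  from assms(2) obtain k00 k01 k10 k11 where k: "k00 \<in> G" "k01 \<in> G" "k10 \<in> G" "k11 \<in> G"
     "idem V" "V = blk k00 k01 k10 (1 + k11)"
     "\<pi> k00 = 0" "\<pi> k01 = 0" "\<pi> k10 = 0" "\<pi> k11 = 0"
     "f * k00 * f = k00" "f * k01 * f = k01" "f * k10 * f = k10" "f * k11 * f = k11"
     "k00 * k10 = 0" "k01 * k00 = 0" "k00 * k11 = 0" "k01 * k01 = 0"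
     "k10 * k10 = 0" "k11 * k00 = 0" "k10 * k11 = 0" "k11 * k01 = 0"
    unfolding regular_def by auto
  define X where "X = blk (dsm h00 k00) (dsm h01 k01) (dsm h10 k10) (1 + dsm h11 k11)"
  \<comment> \<open>The involution exchanging the two middle ones of four slots: it turns a sum of
    two-block matrices into a two-block matrix of sums.\<close>
  define W where "W = blk (s0 * t0) (s1 * t0) (s0 * t1) (s1 * t1)"
  have one: "dsm 1 1 = 1" by (simp add: dsm_def blk_one)
  have z: "dsm 0 0 = 0" by (simp add: dsm_def blk_zero)
  have WW: "W * W = 1"
    using st by (simp add: W_def blk_mult mult.assoc cuntz add.commute[of "s1 * t1"] blk_one)
  have WG: "W \<in> G" by (simp add: W_def blk_G G_intros)
  have one': "1 + dsm h11 k11 = dsm (1 + h11) (1 + k11)"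
    by (subst one[symmetric]) (simp add: dsm_def blk_add)
  have X: "X = W * dsm U V * W"
    unfolding X_def W_def one' unfolding dsm_def h(6) k(6)
    by (simp add: blk_def distrib_left distrib_right mult.assoc cuntz add_ac)
  note iU = idem_dsm[OF h(5) k(5)]
  have "idem X" unfolding X by (rule idem_conj[OF iU WG WG WW])
  moreover have "mvn (dsm U V) X" unfolding X by (rule mvn_conj[OF iU WG WG WW])
  moreover have "regular (dsm e f) X"
    unfolding regular_def
  proof (intro conjI \<open>idem X\<close>, intro bexI conjI)
    show "X = blk (dsm h00 k00) (dsm h01 k01) (dsm h10 k10) (1 + dsm h11 k11)" by (rule X_def)
  qed (simp_all add: h k pi_dsm dsm_G dsm_mult z)
  ultimately show thesis using that mvn_seq by blast
qed

text \<open>After conjugating \<open>(P + h) \<oplus> P\<close> suitably, \<open>P + N h M\<close>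
  stands in the lower corner. The equation \<open>h M N h = h h\<close> makes the surrounding
  entries removable in two steps of square zero, and the remaining summand \<open>P\<close> is
  constant.\<close>

lemma reduction:
  assumes P: "idem P" "\<pi> P = P" and M: "\<pi> M = M" "P * M = M * P" and N: "\<pi> N = N" "P * N = N * P"
    and h: "idem (P + h)" and hh: "h * M * N * h = h * h"
  shows "idem (P + N * h * M)" "seq (P + h) (P + N * h * M)"
proof -
  \<comment> \<open>By the hypothesis on \<open>M\<close> and \<open>N\<close> one has
    \<open>h * k = 0\<close>; hence the left column \<open>(k, N * h)\<close> of \<open>C\<close>
    has square zero.\<close>
  define k where "k = h - M * N * h"
  define A where "A = dsm P (P + N * h * M)"
  define B where "B = blk P (k * M) 0 (P + N * h * M)"
  define C where "C = blk (P + k) (k * M) (N * h) (P + N * h * M)"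
  define g where "g = blk (1 - M * N) (- M) N 1"
  define g' where "g' = blk 1 M (- N) (1 - N * M)"
  have PP: "P * P = P" "P \<in> G" using P by (auto simp: idem_def)
  have hG: "h \<in> G" using G_diff[of "P + h" P] h PP by (auto simp: idem_def)
  have MG: "M \<in> G" "N \<in> G" using M N by (auto intro: G_C)
  have PP': "P * (P * x) = P * x" "P * (M * x) = M * (P * x)" "P * (N * x) = N * (P * x)" for x
    using PP M N by (simp_all add: mult.assoc[symmetric])
  have hh1: "h * (M * (N * h)) = h * h" using hh by (simp add: mult.assoc)
  have hh2: "h * (M * (N * (h * x))) = h * (h * x)" for x
    using hh1 by (simp add: mult.assoc[symmetric])
  \<comment> \<open>Idempotence of \<open>P + h\<close> solved for the square, which turns it into a
    rewrite rule.\<close>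
  have ph: "h * h = h - P * h - h * P"
    using h PP by (simp add: idem_def algebra_simps)
  have ph': "h * (h * x) = h * x - P * (h * x) - h * (P * x)" for x
    unfolding mult.assoc[symmetric] ph by (simp add: algebra_simps)
  note r = PP PP' M(2) N(2) hh1 hh2 ph ph'
  have kG: "k \<in> G" using hG MG by (simp add: k_def G_intros)
  have iV: "idem (P + N * h * M)"
    using PP hG MG by (simp add: idem_def G_intros algebra_simps r)
  have iA: "idem A" unfolding A_def by (intro idem_dsm P iV)
  have iB: "idem B"
    using PP hG MG kG by (simp add: idem_def B_def blk_mult blk_G G_intros)
       (simp add: k_def algebra_simps r)
  have C: "C = g * dsm (P + h) P * g'"
    unfolding C_def g_def g'_def dsm_def blk_mult by (simp add: k_def algebra_simps r)
  have gg: "g' * g = 1" by (simp add: g_def g'_def blk_mult algebra_simps blk_one)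
  have gG: "g \<in> G" "g' \<in> G" unfolding g_def g'_def using MG by (auto intro!: blk_G G_intros)
  note iD = idem_dsm[OF h P(1)]
  have iC: "idem C" unfolding C by (rule idem_conj[OF iD gG gg])
  have 1: "mvn (dsm (P + h) P) C" unfolding C by (rule mvn_conj[OF iD gG gg])
  have CB: "C = B + blk k 0 (N * h) 0"
    by (simp add: C_def B_def blk_add)
  have "mvn B (B + blk k 0 (N * h) 0)"
    by (rule mvn_square_zero[OF iB iC[unfolded CB]])
       (simp add: blk_mult k_def algebra_simps r blk_zero)
  then have 2: "mvn C B" unfolding CB by (rule mvn_sym)
  have BA: "B = A + blk 0 (k * M) 0 0"
    by (simp add: A_def B_def dsm_def blk_add)
  have "mvn A (A + blk 0 (k * M) 0 0)"
    by (rule mvn_square_zero[OF iA iB[unfolded BA]]) (simp add: blk_mult blk_zero)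
  then have 3: "mvn B A" unfolding BA by (rule mvn_sym)
  have 4: "seq A (P + N * h * M)"
    unfolding A_def
    by (rule seq_trans[OF _ _ seq_comm seq_trivial]) (intro idem_dsm iV P)+
  show "idem (P + N * h * M)" by (rule iV)
  have "seq (P + h) (dsm (P + h) P)" by (rule seq_sym[OF seq_trivial[OF h P]])
  then have "seq (P + h) C" by (rule seq_mvn_trans[OF h iC _ 1])
  then have "seq (P + h) B" by (rule seq_mvn_trans[OF h iB _ 2])
  then have "seq (P + h) A" by (rule seq_mvn_trans[OF h iA _ 3])
  then show "seq (P + h) (P + N * h * M)" by (rule seq_trans[OF h iV _ 4])
qed

text \<open>Direct sums along foreign isometries such as \<open>kr s0 1\<close>. These are isometric
  only relative to \<open>a\<close> and \<open>b\<close>, because \<open>kr 1 1\<close> need not be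
  the unit.\<close>

lemma mvn_isometries:
  assumes "idem a" "idem b" and G: "S0 \<in> G" "S1 \<in> G" "T0 \<in> G" "T1 \<in> G"
    and "T0 * S1 = 0" "T1 * S0 = 0" "T0 * S0 * a = a" "T1 * S1 * b = b"
  shows "mvn (S0 * a * T0 + S1 * b * T1) (dsm a b)"
proof (rule mvnI[of "S0 * a * t0 + S1 * b * t1" "s0 * a * T0 + s1 * b * T1"])
  have i: "a * a = a" "b * b = b" "\<And>x. a * (a * x) = a * x" "\<And>x. b * (b * x) = b * x"
    using assms by (auto simp: idem_def mult.assoc[symmetric])
  have T: "\<And>x. T0 * (S0 * (a * x)) = a * x" "\<And>x. T1 * (S1 * (b * x)) = b * x"
    "\<And>x. T0 * (S1 * x) = 0" "\<And>x. T1 * (S0 * x) = 0"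
    using assms by (simp_all add: mult.assoc[symmetric])
  show "(S0 * a * t0 + S1 * b * t1) * (s0 * a * T0 + s1 * b * T1) = S0 * a * T0 + S1 * b * T1"
    by (simp add: algebra_simps cuntz i)
  show "(s0 * a * T0 + s1 * b * T1) * (S0 * a * t0 + S1 * b * t1) = dsm a b"
    by (simp add: algebra_simps T i dsm_def blk_def)
qed (use assms in \<open>auto simp: idem_def intro!: G_intros\<close>)

end

subsection \<open>Tensor products and stable equivalence\<close>

text \<open>The product \<open>kr\<close> does not preserve \<open>G\<close>: for pairs
  \<open>\<langle>b, a\<rangle>\<close> and \<open>\<langle>d, c\<rangle>\<close> the difference
  \<open>b \<otimes> d - a \<otimes> c\<close> has no decay. It does so once the first factor is
  replaced by the constant pair of \<open>b - a\<close>, for then the difference is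
  \<open>(b - a) \<otimes> (d - c)\<close>; this is \<open>kr_G\<close>. Unitality of
  \<open>kr\<close> is not among the axioms: in the model \<open>kr\<close> vanishes in all
  components but one.\<close>

locale tensor =
  X: stable GX piX s0X s1X t0X t1X sigmaX +
  Y: stable GY piY s0Y s1Y t0Y t1Y sigmaY +
  Z: stable GZ piZ s0Z s1Z t0Z t1Z sigmaZ
  for GX :: "'x::{ring,monoid_mult} set" and piX s0X s1X t0X t1X sigmaX
    and GY :: "'y::{ring,monoid_mult} set" and piY s0Y s1Y t0Y t1Y sigmaY
    and GZ :: "'z::{ring,monoid_mult} set" and piZ s0Z s1Z t0Z t1Z sigmaZ +
  fixes rho :: "'x \<Rightarrow> 'x" and kr :: "'x \<Rightarrow> 'y \<Rightarrow> 'z"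
  assumes rho_add: "rho (x + y) = rho x + rho y"
    and rho_mult: "rho (x * y) = rho x * rho y"
    and rho_pi: "rho (piX x) = piX x" and pi_rho: "piX (rho x) = rho x"
    and kr_add_left: "kr (x + x') v = kr x v + kr x' v"
    and kr_add_right: "kr x (v + v') = kr x v + kr x v'"
    and kr_mult: "kr x v * kr x' v' = kr (x * x') (v * v')"
    and pi_kr: "piZ (kr x v) = kr (piX x) (piY v)"
    and kr_G: "x \<in> GX \<Longrightarrow> v \<in> GY \<Longrightarrow> kr (rho x - piX x) v \<in> GZ"
begin

lemma kr_zero_left: "kr 0 y = 0" using kr_add_left[of 0 0 y] by simp
lemma kr_zero_right: "kr x 0 = 0" using kr_add_right[of x 0 0] by simp
lemma kr_diff_left: "kr (x - x') y = kr x y - kr x' y"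
  using kr_add_left[of "x - x'" x' y] by simp
lemma kr_diff_right: "kr x (y - y') = kr x y - kr x y'"
  using kr_add_right[of x "y - y'" y'] by simp

lemma kr_mult': "kr x y * (kr x' y' * z) = kr (x * x') (y * y') * z"
  by (simp add: mult.assoc[symmetric] kr_mult)

lemmas kr_simps = kr_add_left kr_add_right kr_diff_left kr_diff_right kr_zero_left kr_zero_right
  kr_mult kr_mult'

lemma kr_C: "piX x = x \<Longrightarrow> piY y = y \<Longrightarrow> piZ (kr x y) = kr x y"
  by (simp add: pi_kr)

lemma rho_zero: "rho 0 = 0" using rho_add[of 0 0] by simp
lemma rho_diff: "rho (x - y) = rho x - rho y" using rho_add[of "x - y" y] by simp
lemma rho_C: "piX x = x \<Longrightarrow> rho x = x" by (metis rho_pi)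

text \<open>In the model, \<open>rho \<langle>b, a\<rangle> = \<langle>b, b\<rangle>\<close>. On components, \<open>Theta \<langle>b,a\<rangle> \<langle>d,c\<rangle>\<close> is the pair of \<open>a \<otimes> 1 + (b - a) \<otimes> d\<close> and
  \<open>a \<otimes> 1 + (b - a) \<otimes> c\<close>, that is, the right tensor product.\<close>

definition Theta :: "'x \<Rightarrow> 'y \<Rightarrow> 'z" where
  "Theta x q = kr (piX x) 1 + kr (rho x - piX x) q"

lemma Theta_G: "x \<in> GX \<Longrightarrow> q \<in> GY \<Longrightarrow> Theta x q \<in> GZ"
  unfolding Theta_def
  by (intro Z.G_add kr_G Z.G_C kr_C) (simp_all add: X.pi_simps Y.pi_simps)

text \<open>For idempotent \<open>q\<close>, \<open>Theta x q\<close> acts as \<open>piX x\<close>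
  over \<open>1 - q\<close> and as \<open>rho x\<close> over \<open>q\<close>, and both maps are
  multiplicative.\<close>

lemma Theta_mult: "q * q = q \<Longrightarrow> Theta x q * Theta y q = Theta (x * y) q"
  by (simp add: Theta_def algebra_simps kr_simps rho_mult X.pi_mult)

lemma Theta_idem: "X.idem p \<Longrightarrow> Y.idem q \<Longrightarrow> Z.idem (Theta p q)"
  by (simp add: X.idem_def Y.idem_def Z.idem_def Theta_G Theta_mult)

lemma Theta_C: "piY q = q \<Longrightarrow> piZ (Theta p q) = Theta p q"
  by (simp add: Theta_def Z.pi_simps pi_kr X.pi_simps Y.pi_simps pi_rho)

lemma Theta_C_left: "piX c = c \<Longrightarrow> piZ (Theta c q) = Theta c q"
  by (simp add: Theta_def rho_C kr_simps kr_C Y.pi_simps)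

lemma Theta_mvn_left:
  assumes "Y.idem q" "X.mvn p p'" shows "Z.mvn (Theta p q) (Theta p' q)"
proof -
  obtain x y where "x \<in> GX" "y \<in> GX" "x * y = p" "y * x = p'"
    using assms(2) by (auto simp: X.mvn_def)
  then show ?thesis using assms(1)
    by (intro Z.mvnI[of "Theta x q" "Theta y q"]) (auto simp: Theta_G Theta_mult Y.idem_def)
qed

lemma Theta_dsm_left:
  assumes "X.idem p" "X.idem p'" "Y.idem q"
  shows "Z.mvn (Theta (X.dsm p p') q) (Z.dsm (Theta p q) (Theta p' q))"
proof -
  have "Theta (X.dsm p p') q =
      kr s0X 1 * Theta p q * kr t0X 1 + kr s1X 1 * Theta p' q * kr t1X 1"
    by (simp add: Theta_def X.dsm_def X.blk_def algebra_simps kr_simps X.pi_simps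
        rho_add rho_diff rho_mult rho_C)
  moreover have "Z.mvn \<dots> (Z.dsm (Theta p q) (Theta p' q))"
  proof (rule Z.mvn_isometries)
    show "Z.idem (Theta p q)" "Z.idem (Theta p' q)" by (intro Theta_idem assms)+
    show "kr s0X 1 \<in> GZ" "kr s1X 1 \<in> GZ" "kr t0X 1 \<in> GZ" "kr t1X 1 \<in> GZ"
      by (rule Z.G_C; simp add: pi_kr X.pi_simps Y.pi_simps)+
  qed (simp_all add: kr_simps X.cuntz Theta_def algebra_simps)
  ultimately show ?thesis by simp
qed

lemma Theta_dsm_right:
  assumes "X.idem p" "Y.idem q" "Y.idem q'"
  shows "Z.mvn (Theta p (Y.dsm q q')) (Z.dsm (Theta p q) (Theta p q'))"
proof -
  have "Theta p (Y.dsm q q') =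
      kr 1 s0Y * Theta p q * kr 1 t0Y + kr 1 s1Y * Theta p q' * kr 1 t1Y"
    \<comment> \<open>The \<open>1\<close> in the constant term has to be split over the two slots
      as well.\<close>
    by (subst Theta_def, subst Y.st[symmetric])
      (simp add: Theta_def Y.dsm_def Y.blk_def algebra_simps kr_simps)
  moreover have "Z.mvn \<dots> (Z.dsm (Theta p q) (Theta p q'))"
  proof (rule Z.mvn_isometries)
    show "Z.idem (Theta p q)" "Z.idem (Theta p q')" by (intro Theta_idem assms)+
    show "kr 1 s0Y \<in> GZ" "kr 1 s1Y \<in> GZ" "kr 1 t0Y \<in> GZ" "kr 1 t1Y \<in> GZ"
      by (rule Z.G_C; simp add: pi_kr X.pi_simps Y.pi_simps)+
  qed (simp_all add: kr_simps Y.cuntz Theta_def algebra_simps)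
  ultimately show ?thesis by simp
qed

text \<open>The stabilising summand \<open>1\<close> is sent to the constant
  \<open>Theta 1 q\<close> and can therefore be dropped.\<close>

lemma Theta_seq_left:
  assumes "X.idem p" "X.idem p'" "Y.idem q" "X.seq p p'"
  shows "Z.seq (Theta p q) (Theta p' q)"
proof -
  have 1: "Z.seq (Theta r q) (Theta (X.dsm r 1) q)" if "X.idem r" for r
  proof -
    have "Z.seq (Z.dsm (Theta r q) (Theta 1 q)) (Theta r q)"
      by (intro Z.seq_trivial Theta_idem that assms X.idem_one Theta_C_left X.pi_one)
    moreover have "Z.seq (Theta (X.dsm r 1) q) (Z.dsm (Theta r q) (Theta 1 q))"
      by (intro Z.mvn_seq Theta_dsm_left that assms X.idem_one)
    ultimately have "Z.seq (Theta (X.dsm r 1) q) (Theta r q)"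
      using that assms by (meson Theta_idem X.idem_dsm X.idem_one Z.seq_trans)
    then show ?thesis by (rule Z.seq_sym)
  qed
  have "Z.seq (Theta (X.dsm p 1) q) (Theta (X.dsm p' 1) q)"
    using assms by (intro Z.mvn_seq Theta_mvn_left) (auto simp: X.seq_def)
  then show ?thesis using 1[OF assms(1)] 1[OF assms(2)] assms
    by (meson Theta_idem X.idem_dsm X.idem_one Z.seq_trans Z.seq_sym)
qed

text \<open>\<open>Theta p\<close> is affine in its second argument, with coefficient
  \<open>s = rho p - piX p\<close>. The difference of the two values squares to
  \<open>kr (s * s) ((q' - q) * (q' - q))\<close>, which vanishes.\<close>

lemma Theta_square_zero:
  assumes "X.idem p" "Y.idem q" "Y.idem q'" "(q' - q) * (q' - q) = 0"
  shows "Z.mvn (Theta p q) (Theta p q')"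
proof -
  have eq: "Theta p q' = Theta p q + kr (rho p - piX p) (q' - q)"
    by (simp add: Theta_def kr_simps)
  show ?thesis
    unfolding eq
    by (rule Z.mvn_square_zero)
      (use assms in \<open>auto simp: eq[symmetric] Theta_idem kr_mult kr_zero_right\<close>)
qed

lemma Theta_seq_right_zero:
  assumes "X.idem p" "Y.idem q" "Y.idem c" "piY c = c"
  shows "Z.seq (Theta p (Y.dsm q c)) (Theta p q)"
proof -
  have "Z.seq (Z.dsm (Theta p q) (Theta p c)) (Theta p q)"
    by (intro Z.seq_trivial Theta_idem assms Theta_C)
  moreover have "Z.seq (Theta p (Y.dsm q c)) (Z.dsm (Theta p q) (Theta p c))"
    by (intro Z.mvn_seq Theta_dsm_right assms)
  ultimately show ?thesis
    using assms by (meson Theta_idem Y.idem_dsm Z.seq_trans)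
qed

text \<open>As \<open>Theta\<close> is not multiplicative in \<open>q\<close>, the equivalence is
  replaced by the path \<open>q1\<close>, \<open>q2\<close>, \<open>q3\<close>, \<open>q4\<close>
  from \<open>q \<oplus> 0\<close> to \<open>0 \<oplus> q'\<close>. Consecutive members differ by an
  element of square zero; for the middle step this uses the corner equations of \<open>x\<close> and
  \<open>y\<close>.\<close>

lemma Theta_mvn_right:
  assumes "X.idem p" "Y.idem q" "Y.idem q'" "Y.mvn q q'"
  shows "Z.seq (Theta p q) (Theta p q')"
proof -
  obtain x y where xy: "x \<in> GY" "y \<in> GY" "x * y = q" "y * x = q'"
      "q * x = x" "x * q' = x" "q' * y = y" "y * q = y"
    using Y.mvn_corner[OF assms(2-4)] by metis
  have qq: "q * q = q" "q' * q' = q'" "q \<in> GY" "q' \<in> GY" using assms by (auto simp: Y.idem_def)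
  define q1 where "q1 = Y.blk q 0 0 0"
  define q2 where "q2 = Y.blk q 0 y 0"
  define q3 where "q3 = Y.blk 0 x 0 q'"
  define q4 where "q4 = Y.blk 0 0 0 q'"
  note d = q1_def q2_def q3_def q4_def
  have i: "Y.idem q1" "Y.idem q2" "Y.idem q3" "Y.idem q4"
    using xy qq by (auto simp: d Y.idem_def Y.blk_mult intro!: Y.blk_G Y.G_zero)
  have "Z.mvn (Theta p q1) (Theta p q2)"
    by (rule Theta_square_zero[OF assms(1) i(1,2)]) (simp add: d Y.blk_diff Y.blk_mult Y.blk_zero)
  moreover have "Z.mvn (Theta p q2) (Theta p q3)"
    by (rule Theta_square_zero[OF assms(1) i(2,3)])
      (simp add: d Y.blk_diff Y.blk_mult Y.blk_zero xy qq)
  moreover have "Z.mvn (Theta p q3) (Theta p q4)"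
    by (rule Theta_square_zero[OF assms(1) i(3,4)]) (simp add: d Y.blk_diff Y.blk_mult Y.blk_zero)
  ultimately have "Z.mvn (Theta p q1) (Theta p q4)"
    using assms i by (meson Theta_idem Z.mvn_trans)
  then have 14: "Z.seq (Theta p q1) (Theta p q4)" by (rule Z.mvn_seq)
  have 1: "Z.seq (Theta p q1) (Theta p q)"
    using Theta_seq_right_zero[OF assms(1,2) Y.idem_zero Y.pi_zero] by (simp add: q1_def Y.dsm_def)
  have "Z.mvn (Theta p q4) (Z.dsm (Theta p 0) (Theta p q'))"
    using Theta_dsm_right[OF assms(1) Y.idem_zero assms(3)] by (simp add: q4_def Y.dsm_def)
  moreover have "Z.mvn (Z.dsm (Theta p 0) (Theta p q')) (Z.dsm (Theta p q') (Theta p 0))"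
    by (intro Z.mvn_comm Theta_idem assms Y.idem_zero)
  moreover have "Z.seq (Z.dsm (Theta p q') (Theta p 0)) (Theta p q')"
    by (intro Z.seq_trivial Theta_idem assms Y.idem_zero Theta_C Y.pi_zero)
  ultimately have 4: "Z.seq (Theta p q4) (Theta p q')"
    using assms i by (meson Theta_idem Z.idem_dsm Y.idem_zero Z.seq_trans Z.mvn_seq)
  show ?thesis using 1 14 4 assms i by (meson Theta_idem Z.seq_trans Z.seq_sym)
qed

lemma Theta_seq_right:
  assumes "X.idem p" "Y.idem q" "Y.idem q'" "Y.seq q q'"
  shows "Z.seq (Theta p q) (Theta p q')"
proof -
  note z = Theta_seq_right_zero[OF assms(1) _ Y.idem_one Y.pi_one]
  have i: "Y.idem (Y.dsm q 1)" "Y.idem (Y.dsm q' 1)" by (intro Y.idem_dsm Y.idem_one assms)+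
  have "Z.seq (Theta p (Y.dsm q 1)) (Theta p (Y.dsm q' 1))"
    using Theta_mvn_right[OF assms(1) i] assms(4) by (simp add: Y.seq_def)
  then show ?thesis using z[OF assms(2)] z[OF assms(3)] assms i
    by (meson Theta_idem Z.seq_trans Z.seq_sym)
qed

lemma Theta_zero_left: "Y.idem q \<Longrightarrow> X.idem p \<Longrightarrow> X.seq p 0 \<Longrightarrow> Z.seq (Theta p q) 0"
  using Theta_seq_left[of p 0 q] by (simp add: X.idem_zero Theta_def rho_zero X.pi_zero kr_simps)

lemma Theta_zero_right:
  assumes "X.idem p" "Y.idem q" "Y.seq q 0" shows "Z.seq (Theta p q) 0"
proof -
  have "Z.seq (Theta p q) (Theta p 0)" by (intro Theta_seq_right assms Y.idem_zero)
  moreover have "Z.seq (Theta p 0) 0"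
    by (intro Z.seq_C_zero Theta_idem assms Y.idem_zero Theta_C Y.pi_zero)
  ultimately show ?thesis using assms
    by (meson Theta_idem Z.idem_zero Y.idem_zero Z.seq_trans)
qed

end

context stable
begin

text \<open>The row \<open>t0 + t1\<close> collapses two by two blocks to the sum of their entries.  Regularity says
  that this is multiplicative on the blocks of a regular idempotent.\<close>

lemma regular_collapse:
  assumes "regular e U" "e * e = e"
  defines "P \<equiv> blk 0 0 0 1" and "J \<equiv> (s0 + s1) * (t0 + t1)"
  obtains H where "H \<in> G" "U = P + H" "\<pi> H = 0" "dsm e e * H = H" "H * dsm e e = H"
    "H * (J * H) = H * H" "H * (P * (J * H)) = H * (P * H)"
    "H * (J * (P * H)) = H * (P * H)" "H * (P * (J * (P * H))) = H * (P * H)"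
proof -
  from assms(1) obtain h00 h01 h10 h11 where h: "h00 \<in> G" "h01 \<in> G" "h10 \<in> G" "h11 \<in> G"
     "idem U" "U = blk h00 h01 h10 (1 + h11)"
     "\<pi> h00 = 0" "\<pi> h01 = 0" "\<pi> h10 = 0" "\<pi> h11 = 0"
     "e * h00 * e = h00" "e * h01 * e = h01" "e * h10 * e = h10" "e * h11 * e = h11"
     "h00 * h10 = 0" "h01 * h00 = 0" "h00 * h11 = 0" "h01 * h01 = 0"
     "h10 * h10 = 0" "h11 * h00 = 0" "h10 * h11 = 0" "h11 * h01 = 0"
    unfolding regular_def by auto
  have eh: "e * h00 = h00" "h00 * e = h00" "e * h01 = h01" "h01 * e = h01"
      "e * h10 = h10" "h10 * e = h10" "e * h11 = h11" "h11 * e = h11"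
    using h(11-14) assms(2) by (metis mult.assoc)+
  have J: "J = blk 1 1 1 1" by (simp add: J_def blk_def distrib_left distrib_right add_ac)
  show thesis
    by (rule that[of "blk h00 h01 h10 h11"])
      (use h in \<open>simp_all add: J P_def dsm_def blk_mult blk_add pi_blk blk_zero blk_G distrib_left add.commute eh\<close>)
qed

lemma collapse_P: "P = blk 0 0 0 1 \<Longrightarrow> \<pi> P = P" "P = blk 0 0 0 1 \<Longrightarrow> P * P = P"
  by (simp_all add: pi_blk pi_simps blk_mult)

end

context tensor
begin

text \<open>\<open>Theta U V\<close> lives over four copies of the product index set. Regularity of
  both factors makes it harmless to insert the all-ones matrix \<open>kr J L\<close> between
  factors, so \<open>reduction\<close>, applied to the \<open>model\<close> of
  \<open>Theta U V\<close>, merges the four copies into one. This is what gives the product of the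
  cardinalities without a factor four.\<close>

lemma tensor_regular:
  assumes "X.regular e U" "piX e = e" "e * e = e" "Y.regular f V" "piY f = f" "f * f = f"
  obtains W where "Z.regular (kr e f) W" "Z.seq (Theta U V) W"
proof -
  define P where "P = X.blk 0 0 0 1"
  define Q where "Q = Y.blk 0 0 0 1"
  define J where "J = (s0X + s1X) * (t0X + t1X)"
  define L where "L = (s0Y + s1Y) * (t0Y + t1Y)"
  obtain H where H: "H \<in> GX" "U = P + H" "piX H = 0" "X.dsm e e * H = H" "H * X.dsm e e = H"
    "H * (J * H) = H * H" "H * (P * (J * H)) = H * (P * H)"
    "H * (J * (P * H)) = H * (P * H)" "H * (P * (J * (P * H))) = H * (P * H)"
    using X.regular_collapse[OF assms(1,3)] unfolding P_def J_def by metis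
  obtain H' where H': "H' \<in> GY" "V = Q + H'" "piY H' = 0" "Y.dsm f f * H' = H'" "H' * Y.dsm f f = H'"
    "H' * (L * H') = H' * H'" "H' * (Q * (L * H')) = H' * (Q * H')"
    "H' * (L * (Q * H')) = H' * (Q * H')" "H' * (Q * (L * (Q * H'))) = H' * (Q * H')"
    using Y.regular_collapse[OF assms(4,6)] unfolding Q_def L_def by metis
  note PQ = X.collapse_P[OF P_def] Y.collapse_P[OF Q_def]
  have PQ': "P * (P * x) = P * x" "Q * (Q * y) = Q * y" for x y
    by (simp_all add: mult.assoc[symmetric] PQ)
  have piJ: "piX J = J" "piY L = L" by (simp_all add: J_def L_def X.pi_simps Y.pi_simps)
  \<comment> \<open>Since \<open>piX H = 0\<close>, the coefficient \<open>rho U - piX U\<close> in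
    \<open>Theta\<close> is \<open>K\<close>.\<close>
  define K where "K = rho H"
  have K: "piX K = K" "X.dsm e e * K = K" "K * X.dsm e e = K"
    "K * (J * K) = K * K" "K * (P * (J * K)) = K * (P * K)"
    "K * (J * (P * K)) = K * (P * K)" "K * (P * (J * (P * K))) = K * (P * K)"
    unfolding K_def
    using H(4-9)[THEN arg_cong[where f = rho]] rho_C[OF PQ(1)] rho_C[OF piJ(1)]
      rho_C[of "X.dsm e e"] by (simp_all add: rho_mult pi_rho X.pi_dsm assms)
  have K': "K * (J * (K * x)) = K * (K * x)" "K * (P * (J * (K * x))) = K * (P * (K * x))"
    "K * (J * (P * (K * x))) = K * (P * (K * x))"
    "K * (P * (J * (P * (K * x)))) = K * (P * (K * x))" for x
    using K(4-7) by (metis mult.assoc)+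
  define M where "M = kr (s0X + s1X) (s0Y + s1Y)"
  define N where "N = kr (t0X + t1X) (t0Y + t1Y)"
  have MN: "M * N = kr J L" by (simp add: M_def N_def kr_mult J_def L_def)
  have piMN: "piZ M = M" "piZ N = N"
    by (simp_all add: M_def N_def pi_kr X.pi_simps Y.pi_simps)
  define A where "A = kr P 1 + kr K Q"
  define S where "S = kr K H'"
  have T: "Theta U V = A + S"
    by (simp add: Theta_def A_def S_def H H' X.pi_simps rho_add rho_C PQ K_def kr_simps)
  have iU: "X.idem U" and iV: "Y.idem V"
    using assms by (auto simp: X.regular_def Y.regular_def)
  have iT: "Z.idem (A + S)" using Theta_idem[OF iU iV] T by simp
  have piA: "piZ (A + S) = A"
    by (simp add: A_def S_def Z.pi_simps pi_kr K PQ H' kr_simps Y.pi_simps)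
  have AA: "A * A = A" and iA: "Z.idem A"
    using Z.idem_pi[OF iT] by (auto simp: piA Z.idem_def)
  \<comment> \<open>The four rules by which \<open>kr J L\<close> disappears between two occurrences
    of \<open>S\<close>, with or without \<open>A\<close> on either side. In the last one
    \<open>A * A\<close> stays unreduced so that both sides expand to the same Kronecker products;
    \<open>AA\<close> is applied afterwards.\<close>
  have S0: "S * (kr J L * S) = S * S" "S * (A * (kr J L * S)) = S * (A * S)"
      "S * (kr J L * (A * S)) = S * (A * S)" "S * (A * (kr J L * (A * S))) = S * ((A * A) * S)"
    by (simp_all add: A_def S_def algebra_simps kr_simps K K' H' PQ PQ')
  note S0 = S0[unfolded AA]
  then have S1: "S * (kr J L * (S * x)) = S * (S * x)" "S * (A * (kr J L * (S * x))) = S * (A * (S * x))"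
      "S * (kr J L * (A * (S * x))) = S * (A * (S * x))"
      "S * (A * (kr J L * (A * (S * x)))) = S * (A * (S * x))" for x
    by (metis mult.assoc)+
  have MN': "M * (N * x) = kr J L * x" for x by (simp add: MN[symmetric] mult.assoc)
  have AA': "A * (A * x) = A * x" for x by (simp add: AA mult.assoc[symmetric])
  note r = AA AA' MN' S0 S1
  let ?B = "1 - A"
  let ?P = "Z.blk 0 0 0 1"
  define h where "h = Z.blk (?B * S * ?B) (?B * S * A) (A * S * ?B) (A * S * A)"
  have m: "Z.model (A + S) = ?P + h"
    by (simp add: Z.model_def Let_def piA h_def Z.blk_add)
  note PZ = Z.collapse_P[OF refl]
  have red: "Z.idem (?P + Z.dsm N N * h * Z.dsm M M)"
    "Z.seq (?P + h) (?P + Z.dsm N N * h * Z.dsm M M)"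
  proof -
    have "Z.idem ?P" using PZ by (simp add: Z.idem_def Z.G_C)
    moreover have "piZ (Z.dsm M M) = Z.dsm M M" "piZ (Z.dsm N N) = Z.dsm N N"
      by (simp_all add: Z.pi_dsm piMN)
    moreover have "?P * Z.dsm M M = Z.dsm M M * ?P" "?P * Z.dsm N N = Z.dsm N N * ?P"
      by (simp_all add: Z.dsm_def Z.blk_mult)
    moreover have "Z.idem (?P + h)" using Z.model_seq(1)[OF iT] by (simp add: m)
    moreover have "h * Z.dsm M M * Z.dsm N N * h = h * h"
      by (simp add: h_def Z.dsm_def Z.blk_mult) (simp add: algebra_simps r)
    ultimately show "Z.idem (?P + Z.dsm N N * h * Z.dsm M M)"
      "Z.seq (?P + h) (?P + Z.dsm N N * h * Z.dsm M M)"
      using Z.reduction[OF _ PZ(1)] by blast+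
  qed
  define W where "W = ?P + Z.dsm N N * h * Z.dsm M M"
  define v00 where "v00 = N * (?B * S * ?B) * M"
  define v01 where "v01 = N * (?B * S * A) * M"
  define v10 where "v10 = N * (A * S * ?B) * M"
  define v11 where "v11 = N * (A * S * A) * M"
  note v = v00_def v01_def v10_def v11_def
  have W: "W = Z.blk v00 v01 v10 (1 + v11)"
    by (simp add: W_def h_def Z.dsm_def Z.blk_mult Z.blk_add v)
  have ASG: "A \<in> GZ" "S \<in> GZ" "M \<in> GZ" "N \<in> GZ"
    using iA iT Z.G_diff[of "A + S" A] Z.G_C piMN by (auto simp: Z.idem_def)
  have piS: "piZ S = 0" "piZ A = A"
    using piA Z.pi_diff[of "A + S" A] Z.pi_pi[of "A + S"] by simp_all
  \<comment> \<open>\<open>E\<close> consists of four copies of \<open>kr e f\<close>; the maps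
    \<open>M\<close> and \<open>N\<close> intertwine the two, so the merged blocks lie in the corner
    of \<open>kr e f\<close>.\<close>
  define E where "E = kr (X.dsm e e) (Y.dsm f f)"
  have eP: "X.dsm e e * P = P * X.dsm e e" "Y.dsm f f * Q = Q * Y.dsm f f"
    by (simp_all add: P_def Q_def X.dsm_def X.blk_mult Y.dsm_def Y.blk_mult)
  have ee: "X.dsm e e * X.dsm e e = X.dsm e e" "Y.dsm f f * Y.dsm f f = Y.dsm f f"
    by (simp_all add: X.dsm_mult Y.dsm_mult assms)
  have ES: "E * S = S" "S * E = S" by (simp_all add: E_def S_def kr_simps K H')
  have EA: "E * A = A * E"
    by (simp add: E_def A_def algebra_simps kr_simps K eP)
  have EN: "kr e f * N = N * E" "M * kr e f = E * M"
    by (simp_all add: N_def M_def E_def kr_simps X.dsm_def Y.dsm_def X.blk_def Y.blk_def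
        distrib_left distrib_right X.cuntz Y.cuntz mult.assoc)
  have ES': "E * (S * x) = S * x" "E * (A * x) = A * (E * x)" for x
    by (simp_all add: mult.assoc[symmetric] ES EA)
  have EN': "kr e f * (N * x) = N * (E * x)" for x by (simp add: mult.assoc[symmetric] EN)
  note r' = ES EA EN ES' EN'
  have corner: "kr e f * (N * ((x * S * y) * M)) * kr e f = N * ((x * S * y) * M)"
    if "E * x = x * E" "E * y = y * E" for x y
  proof -
    have "E * (x * z) = x * (E * z)" "E * (y * z) = y * (E * z)" for z
      using that by (simp_all add: mult.assoc[symmetric])
    then show ?thesis by (simp add: mult.assoc r')
      (metis ES(2) that(2) mult.assoc)
  qed
  have EB: "E * ?B = ?B * E" by (simp add: algebra_simps EA)
  have reg: "Z.regular (kr e f) W"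
    unfolding Z.regular_def
  proof (intro conjI, goal_cases)
    case 1
    show ?case unfolding W_def by (rule red)
  next
    case 2
    show ?case
    proof (intro bexI conjI)
      show "W = Z.blk v00 v01 v10 (1 + v11)" by (rule W)
      show "piZ v00 = 0" "piZ v01 = 0" "piZ v10 = 0" "piZ v11 = 0"
        by (simp_all add: v Z.pi_simps piS)
      show "kr e f * v00 * kr e f = v00" "kr e f * v01 * kr e f = v01"
        "kr e f * v10 * kr e f = v10" "kr e f * v11 * kr e f = v11"
        unfolding v using corner EA EB by (simp_all add: mult.assoc)
      show "v00 * v10 = 0" "v01 * v00 = 0" "v00 * v11 = 0" "v01 * v01 = 0"
        "v10 * v10 = 0" "v11 * v00 = 0" "v10 * v11 = 0" "v11 * v01 = 0"
        by (simp_all add: v algebra_simps r)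
      show "v00 \<in> GZ" "v01 \<in> GZ" "v10 \<in> GZ" "v11 \<in> GZ"
        unfolding v using ASG by (auto intro!: Z.G_intros)
    qed
  qed
  have "Z.seq (A + S) W"
    unfolding W_def
    using Z.seq_trans[OF iT red(1) Z.model_seq(2)[OF iT, unfolded m] red(2)] .
  then show thesis using that reg T by metis
qed

lemma Theta_regular:
  assumes "X.regular e U" "piX e = e" "e * e = e" "Y.regular f V" "piY f = f" "f * f = f"
    and p: "X.idem p" "X.seq p U" and q: "Y.idem q" "Y.seq q V"
  obtains W where "Z.regular (kr e f) W" "Z.seq (Theta p q) W"
proof -
  obtain W where W: "Z.regular (kr e f) W" "Z.seq (Theta U V) W"
    using tensor_regular[OF assms(1-6)] by blast
  have i: "X.idem U" "Y.idem V" "Z.idem W"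
    using assms(1,4) W(1) by (auto simp: X.regular_def Y.regular_def Z.regular_def)
  have "Z.seq (Theta p q) (Theta U q)" by (intro Theta_seq_left p q i)
  moreover have "Z.seq (Theta U q) (Theta U V)" by (intro Theta_seq_right p q i)
  ultimately have "Z.seq (Theta p q) W"
    using W(2) i p q by (meson Theta_idem Z.seq_trans)
  then show thesis using that W(1) by blast
qed

end

subsection \<open>Unconditional sums in polymetric rings\<close>

definition rsums :: "('k, 'r::ab_group_add) uext \<Rightarrow> ('i \<Rightarrow> 'r) \<Rightarrow> 'r \<Rightarrow> bool" where
  "rsums R x s \<longleftrightarrow> (\<forall>p\<in>sn R. \<forall>e>0. \<exists>F0. finite F0 \<and>
     (\<forall>F. finite F \<and> F0 \<subseteq> F \<longrightarrow> p (sum x F - s) < e))"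

text \<open>Absolute summability with respect to each single seminorm, expressed by bounded finite
  sums.\<close>

definition asum :: "('k, 'r::ab_group_add) uext \<Rightarrow> ('i \<Rightarrow> 'r) \<Rightarrow> bool" where
  "asum R x \<longleftrightarrow> (\<forall>p\<in>sn R. \<exists>C. \<forall>F. finite F \<longrightarrow> (\<Sum>i\<in>F. p (x i)) \<le> C)"

lemma sum_reindex_support:
  fixes x :: "'i \<Rightarrow> 'r::ab_group_add"
  assumes "inj_on j P" "\<And>u. u \<notin> j ` P \<Longrightarrow> x' u = 0" "\<And>m. m \<in> P \<Longrightarrow> x' (j m) = x m"
    "\<And>m. m \<notin> P \<Longrightarrow> x m = 0" "finite F" "finite F'" "j ` (F \<inter> P) = F' \<inter> j ` P"
  shows "sum x F = sum x' F'"
proof -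
  have "sum x F = sum x (F \<inter> P)"
    using assms by (intro sum.mono_neutral_right) auto
  also have "\<dots> = sum x' (j ` (F \<inter> P))"
    using assms by (subst sum.reindex) (auto intro: inj_on_subset intro!: sum.cong)
  also have "\<dots> = sum x' F'"
    using assms by (intro sum.mono_neutral_left) auto
  finally show ?thesis .
qed

text \<open>Finite sets of indices on the two sides are matched through \<open>j\<close>, up to
  indices where the families vanish. In this way sums over any index set become sums over the
  natural numbers.\<close>

lemma rsums_reindex:
  assumes j: "inj_on j P" "\<And>u. u \<notin> j ` P \<Longrightarrow> x' u = 0" "\<And>m. m \<in> P \<Longrightarrow> x' (j m) = x m"
    "\<And>m. m \<notin> P \<Longrightarrow> x m = 0"
  shows "rsums R x s \<longleftrightarrow> rsums R x' s"
proof -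
  note eq = sum_reindex_support[of j P x' x, OF j]
  show ?thesis
    unfolding rsums_def
  proof (intro iffI ballI allI impI)
    fix p and e :: real assume p: "p \<in> sn R" "0 < e"
    assume "\<forall>p\<in>sn R. \<forall>e>0. \<exists>F0. finite F0 \<and> (\<forall>F. finite F \<and> F0 \<subseteq> F \<longrightarrow> p (sum x F - s) < e)"
    then obtain F0 where F0: "finite F0" "\<And>F. finite F \<Longrightarrow> F0 \<subseteq> F \<Longrightarrow> p (sum x F - s) < e"
      using p by meson
    show "\<exists>F0. finite F0 \<and> (\<forall>F. finite F \<and> F0 \<subseteq> F \<longrightarrow> p (sum x' F - s) < e)"
    proof (intro exI[of _ "j ` (F0 \<inter> P)"] conjI allI impI)
      fix F' assume F': "finite F' \<and> j ` (F0 \<inter> P) \<subseteq> F'"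
      define F where "F = {m \<in> P. j m \<in> F'} \<union> F0"
      have fin: "finite F"
        using F' F0(1) finite_vimage_IntI[OF _ j(1), of F'] by (auto simp: F_def vimage_def Int_def conj_commute)
      have "j ` (F \<inter> P) = F' \<inter> j ` P" using F' by (auto simp: F_def)
      then have "sum x F = sum x' F'" using eq fin F' by blast
      then show "p (sum x' F' - s) < e" using F0(2)[OF fin] by (simp add: F_def)
    qed (use F0 in auto)
  next
    fix p and e :: real assume p: "p \<in> sn R" "0 < e"
    assume "\<forall>p\<in>sn R. \<forall>e>0. \<exists>F0. finite F0 \<and> (\<forall>F. finite F \<and> F0 \<subseteq> F \<longrightarrow> p (sum x' F - s) < e)"
    then obtain F0 where F0: "finite F0" "\<And>F. finite F \<Longrightarrow> F0 \<subseteq> F \<Longrightarrow> p (sum x' F - s) < e"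
      using p by meson
    have fin0: "finite {m \<in> P. j m \<in> F0}"
      using F0(1) finite_vimage_IntI[OF _ j(1), of F0] by (auto simp: vimage_def Int_def conj_commute)
    show "\<exists>F0. finite F0 \<and> (\<forall>F. finite F \<and> F0 \<subseteq> F \<longrightarrow> p (sum x F - s) < e)"
    proof (intro exI[of _ "{m \<in> P. j m \<in> F0}"] conjI allI impI fin0)
      fix F assume F: "finite F \<and> {m \<in> P. j m \<in> F0} \<subseteq> F"
      define F' where "F' = j ` (F \<inter> P) \<union> F0"
      have fin: "finite F'" using F F0(1) by (auto simp: F'_def)
      have "j ` (F \<inter> P) = F' \<inter> j ` P" using F by (auto simp: F'_def)
      then have "sum x F = sum x' F'" using eq fin F by blast
      then show "p (sum x F - s) < e" using F0(2)[OF fin] by (simp add: F'_def)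
    qed
  qed
qed

text \<open>Collects what matrix calculus requires of a unital extension, so that unitizations and
  completed tensor products can be treated alike. The seminorms are not directed, hence closedness
  of the ideal speaks of finite sets of them.\<close>

locale pm_ring =
  fixes R :: "('k, 'r::ab_group_add) uext"
  assumes mult_assoc: "mult R (mult R x y) z = mult R x (mult R y z)"
    and mult_add_left: "mult R (x + y) z = mult R x z + mult R y z"
    and mult_add_right: "mult R x (y + z) = mult R x y + mult R x z"
    and unit_left: "mult R (unit R) x = x" and unit_right: "mult R x (unit R) = x"
    and sn_zero: "p \<in> sn R \<Longrightarrow> p 0 = 0" and sn_nonneg: "p \<in> sn R \<Longrightarrow> 0 \<le> p x"
    and sn_uminus: "p \<in> sn R \<Longrightarrow> p (- x) = p x"
    and sn_add: "p \<in> sn R \<Longrightarrow> p (x + y) \<le> p x + p y"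
    and sn_mult: "p \<in> sn R \<Longrightarrow> \<exists>p'\<in>sn R. \<forall>x y. p (mult R x y) \<le> p' x * p' y"
    and sn_separated: "(\<And>p. p \<in> sn R \<Longrightarrow> p x = 0) \<Longrightarrow> x = 0"
    and sn_complete: "(\<And>p e. p \<in> sn R \<Longrightarrow> 0 < e \<Longrightarrow> \<exists>N. \<forall>m\<ge>N. \<forall>n\<ge>N. p (X m - X n) < e) \<Longrightarrow>
        \<exists>l. \<forall>p\<in>sn R. (\<lambda>n. p (X n - l)) \<longlonglongrightarrow> 0"
    and ideal_zero: "0 \<in> ideal R"
    and ideal_add: "x \<in> ideal R \<Longrightarrow> y \<in> ideal R \<Longrightarrow> x + y \<in> ideal R"
    and ideal_uminus: "x \<in> ideal R \<Longrightarrow> - x \<in> ideal R"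
    and ideal_mult_right: "x \<in> ideal R \<Longrightarrow> mult R x y \<in> ideal R"
    and ideal_mult_left: "x \<in> ideal R \<Longrightarrow> mult R y x \<in> ideal R"
    and ideal_closed: "(\<And>F e. finite F \<Longrightarrow> F \<subseteq> sn R \<Longrightarrow> 0 < e \<Longrightarrow> \<exists>y\<in>ideal R. \<forall>p\<in>F. p (x - y) < e)
        \<Longrightarrow> x \<in> ideal R"
begin

lemma mult_zero_left: "mult R 0 x = 0" using mult_add_left[of 0 0 x] by simp
lemma mult_zero_right: "mult R x 0 = 0" using mult_add_right[of x 0 0] by simp
lemma ideal_sum: "(\<And>i. i \<in> A \<Longrightarrow> f i \<in> ideal R) \<Longrightarrow> sum f A \<in> ideal R"
  by (induction A rule: infinite_finite_induct) (simp_all add: ideal_zero ideal_add)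

lemma sn_diff: "p \<in> sn R \<Longrightarrow> p (x - y) \<le> p x + p y"
  using sn_add[of p x "- y"] by (simp add: sn_uminus)
lemma sn_sum: "p \<in> sn R \<Longrightarrow> p (sum f A) \<le> (\<Sum>i\<in>A. p (f i))"
proof (induction A rule: infinite_finite_induct)
  case (insert x F)
  then show ?case using sn_add[of p "f x" "sum f F"] by simp
qed (simp_all add: sn_zero)
lemma sn_commute: "p \<in> sn R \<Longrightarrow> p (x - y) = p (y - x)"
  using sn_uminus[of p "x - y"] by simp

lemma sn_mult_obtain:
  assumes "p \<in> sn R"
  obtains p' where "p' \<in> sn R" "\<And>x y. p (mult R x y) \<le> p' x * p' y"
  using sn_mult[OF assms] by blast

lemma rsums_unique: assumes "rsums R x s" "rsums R x s'" shows "s = s'"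
proof -
  have "p (s - s') = 0" if p: "p \<in> sn R" for p
  proof (rule ccontr)
    assume "p (s - s') \<noteq> 0"
    then have e: "p (s - s') / 2 > 0" using sn_nonneg[OF p, of "s - s'"] by linarith
    obtain F1 where F1: "finite F1" "\<And>F. finite F \<Longrightarrow> F1 \<subseteq> F \<Longrightarrow> p (sum x F - s) < p (s - s') / 2"
      using assms(1) p e unfolding rsums_def by meson
    obtain F2 where F2: "finite F2" "\<And>F. finite F \<Longrightarrow> F2 \<subseteq> F \<Longrightarrow> p (sum x F - s') < p (s - s') / 2"
      using assms(2) p e unfolding rsums_def by meson
    have "p ((sum x (F1 \<union> F2) - s') - (sum x (F1 \<union> F2) - s)) < p (s - s')"
      using sn_diff[OF p, of "sum x (F1 \<union> F2) - s'" "sum x (F1 \<union> F2) - s"]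
        F1(2)[of "F1 \<union> F2"] F2(2)[of "F1 \<union> F2"] F1(1) F2(1) by auto
    then show False by simp
  qed
  then show ?thesis using sn_separated[of "s - s'"] by simp
qed

lemma rsums_tendsto:
  "rsums R x s \<longleftrightarrow> (\<forall>p\<in>sn R. ((\<lambda>F. p (sum x F - s)) \<longlongrightarrow> 0) (finite_subsets_at_top UNIV))"
proof -
  have "((\<lambda>F. p (sum x F - s)) \<longlongrightarrow> 0) (finite_subsets_at_top UNIV) \<longleftrightarrow>
    (\<forall>e>0. \<exists>F0. finite F0 \<and> (\<forall>F. finite F \<and> F0 \<subseteq> F \<longrightarrow> p (sum x F - s) < e))" if "p \<in> sn R" for p
    using sn_nonneg[OF that] by (simp add: tendsto_iff eventually_finite_subsets_at_top)
  then show ?thesis by (simp add: rsums_def)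
qed

lemma ring_sum_THE: "ring_sum R x = (THE s. rsums R x s)"
  by (simp add: ring_sum_def rsums_tendsto)

lemma ring_sum_eq: "rsums R x s \<Longrightarrow> ring_sum R x = s"
  unfolding ring_sum_THE using rsums_unique by blast

lemma ring_sum_reindex:
  assumes "inj_on j P" "\<And>u. u \<notin> j ` P \<Longrightarrow> x' u = 0" "\<And>m. m \<in> P \<Longrightarrow> x' (j m) = x m"
    "\<And>m. m \<notin> P \<Longrightarrow> x m = 0"
  shows "ring_sum R x = ring_sum R x'"
proof -
  have "rsums R x = rsums R x'"
    by (intro ext rsums_reindex[of j P]) (use assms in auto)
  then show ?thesis by (simp add: ring_sum_THE)
qed

lemma rsums_zero: "rsums R (\<lambda>_. 0) 0"
  by (auto simp: rsums_def sn_zero)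

lemma ring_sum_zero: "ring_sum R (\<lambda>_. 0) = 0"
  by (rule ring_sum_eq[OF rsums_zero])

lemma rsums_add: assumes "rsums R x s" "rsums R y t" shows "rsums R (\<lambda>i. x i + y i) (s + t)"
  unfolding rsums_def
proof (intro ballI allI impI)
  fix p and e :: real assume p: "p \<in> sn R" and e: "0 < e"
  then have e2: "0 < e / 2" by simp
  obtain F1 where F1: "finite F1" "\<And>F. finite F \<Longrightarrow> F1 \<subseteq> F \<Longrightarrow> p (sum x F - s) < e / 2"
    using assms(1) p e2 unfolding rsums_def by meson
  obtain F2 where F2: "finite F2" "\<And>F. finite F \<Longrightarrow> F2 \<subseteq> F \<Longrightarrow> p (sum y F - t) < e / 2"
    using assms(2) p e2 unfolding rsums_def by meson
  show "\<exists>F0. finite F0 \<and> (\<forall>F. finite F \<and> F0 \<subseteq> F \<longrightarrow> p ((\<Sum>i\<in>F. x i + y i) - (s + t)) < e)"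
  proof (intro exI[of _ "F1 \<union> F2"] conjI allI impI)
    fix F assume F: "finite F \<and> F1 \<union> F2 \<subseteq> F"
    have eq: "(\<Sum>i\<in>F. x i + y i) - (s + t) = (sum x F - s) + (sum y F - t)"
      by (simp add: sum.distrib)
    have "p (sum x F - s) < e / 2" "p (sum y F - t) < e / 2" using F F1(2) F2(2) by auto
    then show "p ((\<Sum>i\<in>F. x i + y i) - (s + t)) < e"
      unfolding eq using sn_add[OF p, of "sum x F - s" "sum y F - t"] by linarith
  qed (use F1 F2 in auto)
qed

lemma rsums_additive:
  assumes S: "rsums R x s" and add: "\<And>u v. f (u + v) = f u + f v"
    and bd: "\<And>p. p \<in> sn T \<Longrightarrow> \<exists>p'\<in>sn R. \<exists>C. \<forall>u. p (f u) \<le> C * p' u"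
  shows "rsums T (\<lambda>i. f (x i)) (f s)"
  unfolding rsums_def
proof (intro ballI allI impI)
  fix p and e :: real assume p: "p \<in> sn T" and e: "0 < e"
  obtain p' C where p': "p' \<in> sn R" "\<And>u. p (f u) \<le> C * p' u" using bd[OF p] by blast
  have f0: "f 0 = 0" using add[of 0 0] by simp
  have fd: "f (u - v) = f u - f v" for u v using add[of "u - v" v] by simp
  have fs: "f (sum x F) = (\<Sum>i\<in>F. f (x i))" for F
    by (induction F rule: infinite_finite_induct) (simp_all add: f0 add)
  \<comment> \<open>The given \<open>C\<close> may be zero or negative;
    \<open>\<bar>C\<bar> + 1\<close> is a factor by which one can divide.\<close>
  have C: "p (f u) \<le> (\<bar>C\<bar> + 1) * p' u" for u
    using p'(2)[of u] sn_nonneg[OF p'(1), of u]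
    by (meson abs_ge_self add_increasing2 mult_right_mono order_trans zero_le_one)
  have e': "0 < e / (\<bar>C\<bar> + 1)" using e by (simp add: add_nonneg_pos)
  obtain F0 where F0: "finite F0" "\<And>F. finite F \<Longrightarrow> F0 \<subseteq> F \<Longrightarrow> p' (sum x F - s) < e / (\<bar>C\<bar> + 1)"
    using S p'(1) e' unfolding rsums_def by meson
  show "\<exists>F0. finite F0 \<and> (\<forall>F. finite F \<and> F0 \<subseteq> F \<longrightarrow> p ((\<Sum>i\<in>F. f (x i)) - f s) < e)"
  proof (intro exI[of _ F0] conjI allI impI F0(1))
    fix F assume F: "finite F \<and> F0 \<subseteq> F"
    have "p ((\<Sum>i\<in>F. f (x i)) - f s) \<le> (\<bar>C\<bar> + 1) * p' (sum x F - s)"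
      using C[of "sum x F - s"] by (simp add: fs fd)
    also have "\<dots> < e" using F0(2)[of F] F by (simp add: field_simps add_nonneg_pos)
    finally show "p ((\<Sum>i\<in>F. f (x i)) - f s) < e" .
  qed
qed

lemma rsums_mult_left: assumes "rsums R x s" shows "rsums R (\<lambda>i. mult R c (x i)) (mult R c s)"
proof (rule rsums_additive[OF assms, where T = R and f = "mult R c", OF mult_add_right])
  fix p assume "p \<in> sn R"
  then obtain p' where "p' \<in> sn R" "\<And>x y. p (mult R x y) \<le> p' x * p' y"
    using sn_mult by meson
  then show "\<exists>p'\<in>sn R. \<exists>C. \<forall>u. p (mult R c u) \<le> C * p' u" by blast
qed

lemma rsums_mult_right: assumes "rsums R x s" shows "rsums R (\<lambda>i. mult R (x i) c) (mult R s c)"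
proof (rule rsums_additive[OF assms, where T = R and f = "\<lambda>u. mult R u c", OF mult_add_left])
  fix p assume "p \<in> sn R"
  then obtain p' where "p' \<in> sn R" "\<And>x y. p (mult R x y) \<le> p' x * p' y"
    using sn_mult by meson
  then have "\<forall>u. p (mult R u c) \<le> p' c * p' u" by (simp add: mult.commute)
  then show "\<exists>p'\<in>sn R. \<exists>C. \<forall>u. p (mult R u c) \<le> C * p' u" using \<open>p' \<in> sn R\<close> by blast
qed

lemma rsums_uminus: "rsums R x s \<Longrightarrow> rsums R (\<lambda>i. - x i) (- s)"
  by (rule rsums_additive[where f = uminus]) (auto simp: sn_uminus intro!: bexI exI[of _ "1::real"])

lemma rsums_diff: "rsums R x s \<Longrightarrow> rsums R y t \<Longrightarrow> rsums R (\<lambda>i. x i - y i) (s - t)"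
  using rsums_add[OF _ rsums_uminus, of x s y t] by simp

lemma rsums_sum:
  "finite A \<Longrightarrow> (\<And>a. a \<in> A \<Longrightarrow> rsums R (x a) (s a)) \<Longrightarrow> rsums R (\<lambda>i. \<Sum>a\<in>A. x a i) (sum s A)"
  by (induction A rule: finite_induct) (auto simp: rsums_zero intro: rsums_add)

lemma rsums_finite:
  assumes "finite F0" "\<And>i. i \<notin> F0 \<Longrightarrow> x i = 0" shows "rsums R x (sum x F0)"
  unfolding rsums_def
proof (intro ballI allI impI exI[of _ F0] conjI assms)
  fix p e F assume "p \<in> sn R" "(0::real) < e" "finite F \<and> F0 \<subseteq> F"
  moreover have "sum x F = sum x F0" if "F0 \<subseteq> F" "finite F"
    using assms that by (intro sum.mono_neutral_right) auto
  ultimately show "p (sum x F - sum x F0) < e" by (simp add: sn_zero)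
qed

lemma rsums_le:
  assumes "rsums R x s" "p \<in> sn R" "\<And>F. finite F \<Longrightarrow> (\<Sum>i\<in>F. p (x i)) \<le> B"
  shows "p s \<le> B"
proof (rule field_le_epsilon)
  fix e :: real assume "0 < e"
  then obtain F0 where F0: "finite F0" "\<And>F. finite F \<Longrightarrow> F0 \<subseteq> F \<Longrightarrow> p (sum x F - s) < e"
    using assms(1,2) unfolding rsums_def by meson
  have "p s \<le> p (sum x F0) + p (sum x F0 - s)"
    using sn_diff[OF assms(2), of "sum x F0" "sum x F0 - s"] by simp
  also have "\<dots> \<le> B + e"
    using F0(2)[of F0] F0(1) sn_sum[OF assms(2), of x F0] assms(3)[of F0] by simp
  finally show "p s \<le> B + e" .
qed

lemma asum_tail:
  assumes "asum R x" "p \<in> sn R" "0 < e"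
  obtains F0 where "finite F0" "\<And>H. finite H \<Longrightarrow> H \<inter> F0 = {} \<Longrightarrow> (\<Sum>i\<in>H. p (x i)) < e"
proof -
  let ?S = "{\<Sum>i\<in>F. p (x i) |F. finite F}"
  obtain C where C: "\<And>F. finite F \<Longrightarrow> (\<Sum>i\<in>F. p (x i)) \<le> C"
    using assms by (auto simp: asum_def)
  have bdd: "bdd_above ?S" using C by (auto intro!: bdd_aboveI[of _ C])
  have ne: "?S \<noteq> {}" by auto
  have "Sup ?S - e < Sup ?S" using assms(3) by simp
  \<comment> \<open>A finite sum within \<open>e\<close> of the supremum leaves less than
    \<open>e\<close> for any disjoint finite set.\<close>
  then obtain F0 where F0: "finite F0" "Sup ?S - e < (\<Sum>i\<in>F0. p (x i))"
    using less_cSup_iff[OF ne bdd] by blast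
  show thesis
  proof (rule that[OF F0(1)])
    fix H assume H: "finite H" "H \<inter> F0 = {}"
    have "(\<Sum>i\<in>H. p (x i)) + (\<Sum>i\<in>F0. p (x i)) = (\<Sum>i\<in>H \<union> F0. p (x i))"
      using H F0(1) by (simp add: sum.union_disjoint)
    also have "\<dots> \<le> Sup ?S" using H F0(1) by (intro cSup_upper bdd) blast
    finally show "(\<Sum>i\<in>H. p (x i)) < e" using F0(2) by linarith
  qed
qed

text \<open>Sequential completeness yields limits of sequences only. So the countable index type is
  exhausted by the finite sets \<open>A n\<close>, and the small tails extend convergence to the net
  of all finite sets.\<close>

lemma asum_rsums:
  fixes x :: "'i::countable \<Rightarrow> 'r"
  assumes "asum R x" shows "rsums R x (ring_sum R x)"
proof -
  define A where "A n = {i::'i. to_nat i < n}" for n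
  have finA: "finite (A n)" for n
    using finite_vimageI[of "{..<n}" "to_nat :: 'i \<Rightarrow> nat"] by (simp add: A_def vimage_def)
  have mono: "A m \<subseteq> A n" if "m \<le> n" for m n using that by (auto simp: A_def)
  have cover: "\<exists>n. F \<subseteq> A n" if "finite F" for F
    using that by (auto simp: A_def intro!: exI[of _ "Suc (Max (to_nat ` F))"] simp: less_Suc_eq_le)
  have "\<exists>l. \<forall>p\<in>sn R. (\<lambda>n. p (sum x (A n) - l)) \<longlonglongrightarrow> 0"
  proof (rule sn_complete)
    fix p and e :: real assume p: "p \<in> sn R" and e: "0 < e"
    obtain F0 where F0: "finite F0" "\<And>H. finite H \<Longrightarrow> H \<inter> F0 = {} \<Longrightarrow> (\<Sum>i\<in>H. p (x i)) < e"
      using asum_tail[OF assms p e] by metis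
    obtain N where N: "F0 \<subseteq> A N" using cover[OF F0(1)] by blast
    have le: "p (sum x (A n) - sum x (A m)) < e" if "N \<le> m" "m \<le> n" for m n
    proof -
      have "sum x (A n) - sum x (A m) = sum x (A n - A m)"
        using mono[OF that(2)] finA by (simp add: sum_diff)
      then have "p (sum x (A n) - sum x (A m)) \<le> (\<Sum>i\<in>A n - A m. p (x i))"
        using sn_sum[OF p] by simp
      also have "\<dots> < e" using N mono[OF that(1)] finA by (intro F0(2)) auto
      finally show ?thesis .
    qed
    show "\<exists>N. \<forall>m\<ge>N. \<forall>n\<ge>N. p (sum x (A m) - sum x (A n)) < e"
      using le sn_commute[OF p] by (metis linear)
  qed
  then obtain l where l: "\<And>p. p \<in> sn R \<Longrightarrow> (\<lambda>n. p (sum x (A n) - l)) \<longlonglongrightarrow> 0" by blast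
  have "rsums R x l"
    unfolding rsums_def
  proof (intro ballI allI impI)
    fix p and e :: real assume p: "p \<in> sn R" and e: "0 < e"
    then have e2: "0 < e / 2" by simp
    obtain F0 where F0: "finite F0" "\<And>H. finite H \<Longrightarrow> H \<inter> F0 = {} \<Longrightarrow> (\<Sum>i\<in>H. p (x i)) < e / 2"
      using asum_tail[OF assms p e2] by metis
    show "\<exists>F0. finite F0 \<and> (\<forall>F. finite F \<and> F0 \<subseteq> F \<longrightarrow> p (sum x F - l) < e)"
    proof (intro exI[of _ F0] conjI allI impI F0(1))
      fix F assume F: "finite F \<and> F0 \<subseteq> F"
      obtain N where N: "F \<subseteq> A N" using cover F by blast
      obtain M where M: "\<And>n. n \<ge> M \<Longrightarrow> p (sum x (A n) - l) < e / 2"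
        using LIMSEQ_D[OF l[OF p] e2] by force
      let ?n = "max M N"
      have sub: "F \<subseteq> A ?n" using N mono[of N ?n] by auto
      have "sum x F - l = (sum x (A ?n) - l) - sum x (A ?n - F)"
        using sub finA by (simp add: sum_diff)
      then have "p (sum x F - l) \<le> p (sum x (A ?n) - l) + p (sum x (A ?n - F))"
        using sn_diff[OF p, of "sum x (A ?n) - l" "sum x (A ?n - F)"] by metis
      also have "p (sum x (A ?n - F)) \<le> (\<Sum>i\<in>A ?n - F. p (x i))" by (rule sn_sum[OF p])
      also have "\<dots> < e / 2" using F finA by (intro F0(2)) auto
      finally show "p (sum x F - l) < e" using M[of ?n] by simp
    qed
  qed
  then show ?thesis using ring_sum_eq by metis
qed

lemma asum_finite:
  fixes x :: "'i \<Rightarrow> 'r"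
  assumes "finite {i. x i \<noteq> 0}" shows "asum R x"
  unfolding asum_def
proof (intro ballI exI allI impI)
  fix p :: "'r \<Rightarrow> real" and F :: "'i set" assume p: "p \<in> sn R" "finite F"
  have "(\<Sum>i\<in>F. p (x i)) = (\<Sum>i\<in>F \<inter> {i. x i \<noteq> 0}. p (x i))"
    using p by (intro sum.mono_neutral_right) (auto simp: sn_zero)
  also have "\<dots> \<le> (\<Sum>i\<in>{i. x i \<noteq> 0}. p (x i))"
    using assms p by (intro sum_mono2) (auto simp: sn_nonneg)
  finally show "(\<Sum>i\<in>F. p (x i)) \<le> (\<Sum>i\<in>{i. x i \<noteq> 0}. p (x i))" .
qed

lemma asum_inj:
  assumes "asum R x" "inj f" shows "asum R (\<lambda>i. x (f i))"
  unfolding asum_def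
proof
  fix p assume "p \<in> sn R"
  then obtain C where C: "\<And>F. finite F \<Longrightarrow> (\<Sum>i\<in>F. p (x i)) \<le> C"
    using assms by (auto simp: asum_def)
  have "(\<Sum>i\<in>F. p (x (f i))) \<le> C" if "finite F" for F
    using C[of "f ` F"] that assms(2) by (simp add: sum.reindex inj_on_subset)
  then show "\<exists>C. \<forall>F. finite F \<longrightarrow> (\<Sum>i\<in>F. p (x (f i))) \<le> C" by blast
qed

text \<open>If the finite set \<open>G\<close> leaves a tail below \<open>e / 2\<close>, then any
  finitely many rows that include those met by \<open>G\<close> miss only terms outside
  \<open>G\<close>.\<close>

lemma rsums_Fubini:
  fixes z :: "'i::countable \<times> 'j::countable \<Rightarrow> 'r"
  assumes z: "asum R z"
  shows "rsums R (\<lambda>i. ring_sum R (\<lambda>j. z (i, j))) (ring_sum R z)"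
  unfolding rsums_def
proof (intro ballI allI impI)
  fix p and e :: real assume p: "p \<in> sn R" and e: "0 < e"
  let ?s = "\<lambda>i. ring_sum R (\<lambda>j. z (i, j))"
  from e have e2: "0 < e / 2" by simp
  obtain G where G: "finite G" "\<And>H. finite H \<Longrightarrow> H \<inter> G = {} \<Longrightarrow> (\<Sum>i\<in>H. p (z i)) < e / 2"
    using asum_tail[OF z p e2] by metis
  \<comment> \<open>Each row is read as a family on all pairs, so that finitely many row sums add up
    to one unconditional sum.\<close>
  have s: "rsums R (\<lambda>(i', j). if i' = i then z (i, j) else 0) (?s i)" for i
  proof -
    have "rsums R (\<lambda>j. z (i, j)) (?s i)"
      by (intro asum_rsums asum_inj[OF z]) (auto simp: inj_def)
    then show ?thesis
      by (subst (asm) rsums_reindex[where j = "\<lambda>j. (i, j)" and P = UNIV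
             and x' = "\<lambda>(i', j). if i' = i then z (i, j) else 0"])
        (auto simp: inj_on_def split: if_splits)
  qed
  show "\<exists>F0. finite F0 \<and> (\<forall>F. finite F \<and> F0 \<subseteq> F \<longrightarrow> p (sum ?s F - ring_sum R z) < e)"
  proof (intro exI[of _ "fst ` G"] conjI allI impI)
    fix F assume F: "finite F \<and> fst ` G \<subseteq> F"
    have "rsums R (\<lambda>k. \<Sum>i\<in>F. (case k of (i', j) \<Rightarrow> if i' = i then z (i, j) else 0)) (sum ?s F)"
      using F s by (intro rsums_sum) auto
    moreover have "(\<lambda>k. \<Sum>i\<in>F. (case k of (i', j) \<Rightarrow> if i' = i then z (i, j) else 0)) =
        (\<lambda>k. if fst k \<in> F then z k else 0)"
      using F by (auto simp: fun_eq_iff sum.delta' split: prod.splits)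
    ultimately have "rsums R (\<lambda>k. z k - (if fst k \<in> F then z k else 0)) (ring_sum R z - sum ?s F)"
      using asum_rsums[OF z] by (intro rsums_diff) auto
    then have "p (ring_sum R z - sum ?s F) \<le> e / 2"
    proof (rule rsums_le[OF _ p])
      fix H :: "('i \<times> 'j) set" assume H: "finite H"
      have "(\<Sum>k\<in>H. p (z k - (if fst k \<in> F then z k else 0))) =
          (\<Sum>k\<in>H - {k. fst k \<in> F}. p (z k))"
        using H by (intro sum.mono_neutral_cong_right) (auto simp: sn_zero[OF p])
      also have "\<dots> < e / 2" using H F by (intro G(2)) force+
      finally show "(\<Sum>k\<in>H. p (z k - (if fst k \<in> F then z k else 0))) \<le> e / 2" by simp
    qed
    then show "p (sum ?s F - ring_sum R z) < e" using e sn_commute[OF p] by simp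
  qed (use G in auto)
qed

lemma ideal_rsums:
  assumes "rsums R x s" "\<And>i. x i \<in> ideal R" shows "s \<in> ideal R"
proof (rule ideal_closed)
  fix P and e :: real assume P: "finite P" "P \<subseteq> sn R" "0 < e"
  have "\<forall>p\<in>P. \<exists>F0. finite F0 \<and> (\<forall>F. finite F \<and> F0 \<subseteq> F \<longrightarrow> p (sum x F - s) < e)"
    using assms(1) P by (auto simp: rsums_def)
  then obtain F0 where F0: "\<And>p. p \<in> P \<Longrightarrow> finite (F0 p)"
    "\<And>p F. p \<in> P \<Longrightarrow> finite F \<Longrightarrow> F0 p \<subseteq> F \<Longrightarrow> p (sum x F - s) < e"
    by metis
  have "p (s - sum x (\<Union>p\<in>P. F0 p)) < e" if "p \<in> P" for p
  proof -
    have "F0 p \<subseteq> (\<Union>p\<in>P. F0 p)" "finite (\<Union>p\<in>P. F0 p)" using that F0(1) P by auto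
    then show ?thesis using F0(2)[OF that] P that sn_commute[of p] by (metis subsetD)
  qed
  then show "\<exists>y\<in>ideal R. \<forall>p\<in>P. p (s - y) < e" using ideal_sum assms(2) by metis
qed

end

subsection \<open>Matrices over the natural numbers\<close>

definition spgN :: "nat spg" where
  "spgN = \<lparr>pts = UNIV, growth = poly_growth\<rparr>"

abbreviation w :: "nat \<Rightarrow> real" where
  "w n \<equiv> 1 + real n"

lemma w_pos: "0 < w n ^ k" by simp
lemma w_ge_one: "1 \<le> w n ^ k" by (simp add: one_le_power)
lemma w_mono: "k \<le> l \<Longrightarrow> w n ^ k \<le> w n ^ l" by (simp add: power_increasing)

lemma poly_growth_w: "(\<lambda>n. w n ^ k) \<in> poly_growth"
  unfolding poly_growth_def by (auto intro!: exI[of _ 1] exI[of _ k])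

lemma poly_growth_bound:
  assumes "f \<in> poly_growth" obtains C k where "0 \<le> C" "\<And>n. \<bar>f n\<bar> \<le> C * w n ^ k"
proof -
  obtain C k where C: "\<And>n. \<bar>f n\<bar> \<le> C * w n ^ k" using assms by (auto simp: poly_growth_def)
  have "0 \<le> C" using order_trans[OF abs_ge_zero C[of 0]] by simp
  then show thesis using that C by blast
qed

lemma poly_growth_dominated:
  "g \<in> poly_growth \<Longrightarrow> (\<And>n. \<bar>f n\<bar> \<le> \<bar>g n\<bar>) \<Longrightarrow> f \<in> poly_growth"
  unfolding poly_growth_def by (blast intro: order_trans)

lemma poly_growth_mono_bound: "(\<And>n. \<bar>f n\<bar> \<le> C * w n ^ k) \<Longrightarrow> f \<in> poly_growth"
  unfolding poly_growth_def by blast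

lemma inverse_squares_bounded:
  obtains B where "0 \<le> B" "\<And>F. finite F \<Longrightarrow> (\<Sum>m\<in>F. 1 / w m ^ 2) \<le> B"
proof -
  \<comment> \<open>Telescoping estimate. The weight \<open>w m ^ 2\<close> in later bounds is there
    to make the inner index summable by it.\<close>
  have le: "(\<Sum>m<Suc n. 1 / w m ^ 2) \<le> 2 - 1 / w n" for n
  proof (induction n)
    case (Suc n)
    have "1 / w (Suc n) ^ 2 \<le> 1 / (w n * w (Suc n))"
      by (intro divide_left_mono) (simp_all add: power2_eq_square mult_mono)
    also have "\<dots> = 1 / w n - 1 / w (Suc n)" by (simp add: field_simps)
    finally show ?case using Suc by simp
  qed simp
  have "(\<Sum>m\<in>F. 1 / w m ^ 2) \<le> 2" if "finite F" for F
  proof -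
    have "F \<subseteq> {..<Suc (Max F)}" using that by (auto simp: less_Suc_eq_le)
    then have "(\<Sum>m\<in>F. 1 / w m ^ 2) \<le> (\<Sum>m<Suc (Max F). 1 / w m ^ 2)"
      by (intro sum_mono2) auto
    also have "\<dots> \<le> 2 - 1 / w (Max F)" by (rule le)
    also have "\<dots> \<le> 2" by simp
    finally show ?thesis .
  qed
  then show thesis using that[of 2] by simp
qed

text \<open>\<open>Psi\<close> over the natural numbers with growth functions replaced by powers of
  \<open>w\<close>; one pair \<open>C\<close>, \<open>l\<close> serves both estimates.\<close>

definition psi :: "bool \<Rightarrow> ('k, 'r::ab_group_add) uext \<Rightarrow> (nat \<Rightarrow> nat \<Rightarrow> 'r) \<Rightarrow> bool" where
  "psi d R a \<longleftrightarrow> (if d then (\<forall>n. finite {m. a n m \<noteq> 0}) \<and> (\<forall>m. finite {n. a n m \<noteq> 0})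
     else \<forall>p\<in>sn R. \<forall>k. \<exists>C l. \<forall>n m. w n ^ k * p (a n m) \<le> C * w m ^ l \<and> w m ^ k * p (a n m) \<le> C * w n ^ l)"

definition smooth :: "bool \<Rightarrow> ('k, 'r::ab_group_add) uext \<Rightarrow> (nat \<Rightarrow> nat \<Rightarrow> 'r) \<Rightarrow> bool" where
  "smooth d R a \<longleftrightarrow> (\<forall>n m. a n m \<in> ideal R) \<and> (if d then finite {(n, m). a n m \<noteq> 0}
     else \<forall>p\<in>sn R. \<forall>k. \<exists>C. \<forall>n m. w n ^ k * w m ^ k * p (a n m) \<le> C)"

context pm_ring
begin

lemma Psi_spgN: "a \<in> Psi d R spgN spgN \<longleftrightarrow> psi d R a"
proof (cases d)
  case False
  show ?thesis
  proof
    assume a: "a \<in> Psi d R spgN spgN"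
    show "psi d R a"
      unfolding psi_def using False
    proof (simp, intro ballI allI)
      fix p k assume p: "p \<in> sn R"
      obtain g h where g: "g \<in> poly_growth" "h \<in> poly_growth"
        "\<And>n m. \<bar>w n ^ k\<bar> * p (a n m) \<le> g m" "\<And>n m. \<bar>w m ^ k\<bar> * p (a n m) \<le> h n"
      proof -
        have "\<forall>p\<in>sn R. \<forall>f\<in>poly_growth. \<forall>h\<in>poly_growth. \<exists>g\<in>poly_growth. \<exists>k\<in>poly_growth.
            \<forall>n m. \<bar>f n\<bar> * p (a n m) \<le> g m \<and> \<bar>h m\<bar> * p (a n m) \<le> k n"
          using a False by (simp add: Psi_def spgN_def)
        from this[rule_format, OF p poly_growth_w[of k] poly_growth_w[of k]] show ?thesis
          using that by blast
      qed
      obtain C l where C: "0 \<le> C" "\<And>n. \<bar>g n\<bar> \<le> C * w n ^ l" using g(1) poly_growth_bound by blast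
      obtain D l' where D: "0 \<le> D" "\<And>n. \<bar>h n\<bar> \<le> D * w n ^ l'" using g(2) poly_growth_bound by blast
      have "C * w n ^ l \<le> (C + D) * w n ^ (l + l')" "D * w n ^ l' \<le> (C + D) * w n ^ (l + l')" for n
        using C(1) D(1) w_mono[of l "l + l'" n] w_mono[of l' "l + l'" n] by (auto intro!: mult_mono)
      then have "g n \<le> (C + D) * w n ^ (l + l')" "h n \<le> (C + D) * w n ^ (l + l')" for n
        using C(2)[of n] D(2)[of n] by (meson abs_le_D1 order_trans)+
      moreover have "w n ^ k * p (a n m) \<le> g m" "w m ^ k * p (a n m) \<le> h n" for n m
        using g(3)[of n m] g(4)[of m n] by simp_all
      ultimately show "\<exists>C l. \<forall>n m. w n ^ k * p (a n m) \<le> C * w m ^ l \<and> w m ^ k * p (a n m) \<le> C * w n ^ l"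
        by (intro exI[of _ "C + D"] exI[of _ "l + l'"]) (meson order_trans)
    qed
  next
    assume a: "psi d R a"
    have "\<exists>g\<in>poly_growth. \<exists>k\<in>poly_growth. \<forall>n m. \<bar>f n\<bar> * p (a n m) \<le> g m \<and> \<bar>h m\<bar> * p (a n m) \<le> k n"
      if p: "p \<in> sn R" and f: "f \<in> poly_growth" "h \<in> poly_growth" for p f h
    proof -
      obtain C k where C: "0 \<le> C" "\<And>n. \<bar>f n\<bar> \<le> C * w n ^ k" using f(1) poly_growth_bound by blast
      obtain D k' where D: "0 \<le> D" "\<And>n. \<bar>h n\<bar> \<le> D * w n ^ k'" using f(2) poly_growth_bound by blast
      obtain C1 l where 1: "\<And>n m. w n ^ k * p (a n m) \<le> C1 * w m ^ l"
        using a False p unfolding psi_def by metis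
      obtain C2 l' where 2: "\<And>n m. w m ^ k' * p (a n m) \<le> C2 * w n ^ l'"
        using a False p unfolding psi_def by metis
      have "\<bar>f n\<bar> * p (a n m) \<le> C * (C1 * w m ^ l)" for n m
        using mult_right_mono[OF C(2)[of n] sn_nonneg[OF p, of "a n m"]]
          mult_left_mono[OF 1[of n m] C(1)] by (simp add: mult.assoc)
      moreover have "\<bar>h m\<bar> * p (a n m) \<le> D * (C2 * w n ^ l')" for n m
        using mult_right_mono[OF D(2)[of m] sn_nonneg[OF p, of "a n m"]]
          mult_left_mono[OF 2[where n = n and m = m] D(1)] by (simp add: mult.assoc)
      moreover have "(\<lambda>m. C * (C1 * w m ^ l)) \<in> poly_growth" "(\<lambda>n. D * (C2 * w n ^ l')) \<in> poly_growth"
        by (rule poly_growth_mono_bound[of _ "\<bar>C * C1\<bar>" l], simp add: abs_mult)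
           (rule poly_growth_mono_bound[of _ "\<bar>D * C2\<bar>" l'], simp add: abs_mult)
      ultimately show ?thesis
        by (intro bexI[of _ "\<lambda>m. C * (C1 * w m ^ l)"] bexI[of _ "\<lambda>n. D * (C2 * w n ^ l')"]) auto
    qed
    then show "a \<in> Psi d R spgN spgN"
      using False by (simp add: Psi_def matrix_on_def spgN_def)
  qed
qed (simp add: Psi_def psi_def matrix_on_def spgN_def)

lemma Kmat_spgN: "a \<in> Kmat d R spgN spgN \<longleftrightarrow> smooth d R a"
proof (cases d)
  case False
  have 1: "\<exists>C. \<forall>n m. w n ^ k * w m ^ k * p (a n m) \<le> C"
    if "\<forall>f\<in>poly_growth. \<forall>h\<in>poly_growth. bdd_above {\<bar>f n * h m\<bar> * p (a n m) |n m. True}" for p k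
  proof -
    have "bdd_above {\<bar>w n ^ k * w m ^ k\<bar> * p (a n m) |n m. True}"
      using that[rule_format, OF poly_growth_w[of k] poly_growth_w[of k]] .
    then obtain C where "\<And>n m. \<bar>w n ^ k * w m ^ k\<bar> * p (a n m) \<le> C"
      unfolding bdd_above_def by blast
    then show ?thesis by (auto simp: abs_mult)
  qed
  have 2: "bdd_above {\<bar>f n * h m\<bar> * p (a n m) |n m. True}"
    if a: "\<forall>k. \<exists>C. \<forall>n m. w n ^ k * w m ^ k * p (a n m) \<le> C" and p: "p \<in> sn R"
      and f: "f \<in> poly_growth" "h \<in> poly_growth" for p f h
  proof -
    obtain C k where C: "0 \<le> C" "\<And>n. \<bar>f n\<bar> \<le> C * w n ^ k" using f(1) poly_growth_bound by blast
    obtain D k' where D: "0 \<le> D" "\<And>n. \<bar>h n\<bar> \<le> D * w n ^ k'" using f(2) poly_growth_bound by blast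
    obtain B where B: "\<And>n m. w n ^ (k + k') * w m ^ (k + k') * p (a n m) \<le> B" using a by blast
    have "\<bar>f n * h m\<bar> * p (a n m) \<le> C * D * B" for n m
    proof -
      have "\<bar>f n\<bar> \<le> C * w n ^ (k + k')"
        using C(2)[of n] mult_left_mono[OF w_mono[of k "k + k'" n] C(1)] by simp
      moreover have "\<bar>h m\<bar> \<le> D * w m ^ (k + k')"
        using D(2)[of m] mult_left_mono[OF w_mono[of k' "k + k'" m] D(1)] by simp
      ultimately have "\<bar>f n * h m\<bar> \<le> C * w n ^ (k + k') * (D * w m ^ (k + k'))"
        unfolding abs_mult using C(1) by (intro mult_mono) auto
      then have "\<bar>f n * h m\<bar> * p (a n m) \<le> C * w n ^ (k + k') * (D * w m ^ (k + k')) * p (a n m)"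
        by (rule mult_right_mono[OF _ sn_nonneg[OF p]])
      also have "\<dots> = C * D * (w n ^ (k + k') * w m ^ (k + k') * p (a n m))" by simp
      also have "\<dots> \<le> C * D * B" using C(1) D(1) by (intro mult_left_mono B) simp
      finally show ?thesis .
    qed
    then show ?thesis by (auto intro!: bdd_aboveI[of _ "C * D * B"])
  qed
  have "(\<forall>f\<in>poly_growth. \<forall>h\<in>poly_growth. bdd_above {\<bar>f n * h m\<bar> * p (a n m) |n m. True}) \<longleftrightarrow>
      (\<forall>k. \<exists>C. \<forall>n m. w n ^ k * w m ^ k * p (a n m) \<le> C)" if "p \<in> sn R" for p
    using 1[of p] 2[of p] that by (intro iffI allI ballI)
  then show ?thesis using False by (simp add: Kmat_def smooth_def matrix_on_def spgN_def)
qed (auto simp: Kmat_def smooth_def matrix_on_def spgN_def)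

section \<open>Products of matrices and their associativity\<close>

lemma psi_bound:
  assumes "psi d R a" "\<not> d" "p \<in> sn R"
  obtains C l where "0 \<le> C" "\<And>n m. w n ^ k * p (a n m) \<le> C * w m ^ l"
    "\<And>n m. w m ^ k * p (a n m) \<le> C * w n ^ l"
proof -
  obtain C l where C: "\<And>n m. w n ^ k * p (a n m) \<le> C * w m ^ l \<and> w m ^ k * p (a n m) \<le> C * w n ^ l"
    using assms unfolding psi_def by meson
  have "0 \<le> w 0 ^ k * p (a 0 0)" using sn_nonneg[OF assms(3)] by simp
  also have "\<dots> \<le> C * w 0 ^ l" using C by blast
  finally have "0 \<le> C" by simp
  then show thesis using that C by blast
qed

lemma smooth_bound:
  assumes "smooth d R a" "\<not> d" "p \<in> sn R"
  obtains C where "\<And>n m. w n ^ k * w m ^ k * p (a n m) \<le> C"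
  using assms unfolding smooth_def by (simp, blast)

lemma psi_bound_all:
  assumes "psi d R a" "\<not> d" "p \<in> sn R"
  obtains C l where "0 \<le> C" "\<And>n m. p (a n m) \<le> C * w m ^ l" "\<And>n m. p (a n m) \<le> C * w n ^ l"
  using psi_bound[OF assms, of 0] by (metis mult_1 power_0)

lemma asum_bound:
  fixes x :: "nat \<Rightarrow> 'r"
  assumes "\<And>p. p \<in> sn R \<Longrightarrow> \<exists>C. \<forall>m. w m ^ 2 * p (x m) \<le> C" shows "asum R x"
  unfolding asum_def
proof
  fix p assume p: "p \<in> sn R"
  obtain B where B: "0 \<le> B" "\<And>F. finite F \<Longrightarrow> (\<Sum>m\<in>F. 1 / w m ^ 2) \<le> B"
    using inverse_squares_bounded by blast
  obtain C where C: "\<And>m. w m ^ 2 * p (x m) \<le> C" using assms[OF p] by blast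
  have "0 \<le> C" using order_trans[OF _ C[of 0]] sn_nonneg[OF p] by simp
  have "(\<Sum>i\<in>F. p (x i)) \<le> C * B" if "finite F" for F
  proof -
    have "(\<Sum>i\<in>F. p (x i)) \<le> (\<Sum>i\<in>F. C * (1 / w i ^ 2))"
      using C by (intro sum_mono) (simp add: pos_le_divide_eq mult.commute)
    also have "\<dots> \<le> C * B"
      unfolding sum_distrib_left[symmetric] using B(2)[OF that] \<open>0 \<le> C\<close> by (rule mult_left_mono)
    finally show ?thesis .
  qed
  then show "\<exists>C. \<forall>F. finite F \<longrightarrow> (\<Sum>i\<in>F. p (x i)) \<le> C" by blast
qed

lemma sum_product_pairs:
  "(\<Sum>i\<in>A \<times> B. f (fst i) * g (snd i)) = sum f A * (sum g B :: real)"
  by (simp add: sum_product sum.cartesian_product case_prod_beta)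

lemma asum_bound2:
  fixes x :: "nat \<times> nat \<Rightarrow> 'r"
  assumes "\<And>p. p \<in> sn R \<Longrightarrow> \<exists>C. \<forall>m l. w m ^ 2 * w l ^ 2 * p (x (m, l)) \<le> C" shows "asum R x"
  unfolding asum_def
proof
  fix p assume p: "p \<in> sn R"
  obtain B where B: "0 \<le> B" "\<And>F. finite F \<Longrightarrow> (\<Sum>m\<in>F. 1 / w m ^ 2) \<le> B"
    using inverse_squares_bounded by blast
  obtain C where C: "\<And>m l. w m ^ 2 * w l ^ 2 * p (x (m, l)) \<le> C" using assms[OF p] by blast
  have C0: "0 \<le> C" using order_trans[OF _ C[of 0 0]] sn_nonneg[OF p] by simp
  have "(\<Sum>i\<in>F. p (x i)) \<le> C * (B * B)" if "finite F" for F
  proof -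
    have "p (x i) \<le> C * (1 / w (fst i) ^ 2 * (1 / w (snd i) ^ 2))" for i
      using C[of "fst i" "snd i"] by (simp add: pos_le_divide_eq mult.commute)
    then have "(\<Sum>i\<in>F. p (x i)) \<le> (\<Sum>i\<in>F. C * (1 / w (fst i) ^ 2 * (1 / w (snd i) ^ 2)))"
      by (intro sum_mono) auto
    also have "\<dots> \<le> (\<Sum>i\<in>fst ` F \<times> snd ` F. C * (1 / w (fst i) ^ 2 * (1 / w (snd i) ^ 2)))"
      using that C0 by (intro sum_mono2) (auto simp: rev_image_eqI)
    also have "\<dots> = C * ((\<Sum>m\<in>fst ` F. 1 / w m ^ 2) * (\<Sum>l\<in>snd ` F. 1 / w l ^ 2))"
      unfolding sum_distrib_left[symmetric]
      by (subst sum_product_pairs[of "\<lambda>m. 1 / w m ^ 2" "\<lambda>m. 1 / w m ^ 2"]) (rule refl)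
    also have "\<dots> \<le> C * (B * B)"
      using that C0 B by (intro mult_left_mono mult_mono sum_nonneg) auto
    finally show ?thesis .
  qed
  then show "\<exists>C. \<forall>F. finite F \<longrightarrow> (\<Sum>i\<in>F. p (x i)) \<le> C" by blast
qed

text \<open>For the bound in \<open>j\<close>, the estimate of \<open>a\<close> costs
  \<open>w m ^ l1\<close> in the inner index, which the estimate of \<open>b\<close> with exponent
  \<open>l1 + 2\<close> pays for and still leaves \<open>w m ^ 2\<close> for summation. For the
  bound in \<open>n\<close> the two matrices exchange roles.\<close>

lemma psi_mult_bound:
  assumes "psi d R a" "psi d R b" "\<not> d" "p \<in> sn R"
  obtains C l where "0 \<le> C"
    "\<And>n m j. w m ^ 2 * (w n ^ k * p (mult R (a n m) (b m j))) \<le> C * w j ^ l"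
    "\<And>n m j. w m ^ 2 * (w j ^ k * p (mult R (a n m) (b m j))) \<le> C * w n ^ l"
proof -
  obtain p' where p': "p' \<in> sn R" "\<And>x y. p (mult R x y) \<le> p' x * p' y" using sn_mult[OF assms(4)] by blast
  obtain C1 l1 where 1: "0 \<le> C1" "\<And>n m. w n ^ k * p' (a n m) \<le> C1 * w m ^ l1"
    using psi_bound[OF assms(1,3) p'(1)] by metis
  obtain C2 l2 where 2: "0 \<le> C2" "\<And>m j. w m ^ (l1 + 2) * p' (b m j) \<le> C2 * w j ^ l2"
    using psi_bound[OF assms(2,3) p'(1)] by metis
  obtain C3 l3 where 3: "0 \<le> C3" "\<And>m j. w j ^ k * p' (b m j) \<le> C3 * w m ^ l3"
    using psi_bound[OF assms(2,3) p'(1)] by metis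
  obtain C4 l4 where 4: "0 \<le> C4" "\<And>n m. w m ^ (l3 + 2) * p' (a n m) \<le> C4 * w n ^ l4"
    using psi_bound[OF assms(1,3) p'(1)] by metis
  have nn: "0 \<le> p' x" for x by (rule sn_nonneg[OF p'(1)])
  have "w m ^ 2 * (w n ^ k * p (mult R (a n m) (b m j))) \<le> C1 * C2 * w j ^ l2" for n m j
  proof -
    have "w m ^ 2 * (w n ^ k * p (mult R (a n m) (b m j))) \<le> w m ^ 2 * (w n ^ k * (p' (a n m) * p' (b m j)))"
      using p'(2) by (intro mult_left_mono) auto
    also have "\<dots> = w m ^ 2 * ((w n ^ k * p' (a n m)) * p' (b m j))" by simp
    also have "\<dots> \<le> w m ^ 2 * ((C1 * w m ^ l1) * p' (b m j))"
      using 1 nn by (intro mult_left_mono mult_right_mono) auto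
    also have "\<dots> = C1 * (w m ^ (l1 + 2) * p' (b m j))" by (simp add: power_add power2_eq_square)
    also have "\<dots> \<le> C1 * (C2 * w j ^ l2)" using 1 2 by (intro mult_left_mono) auto
    finally show ?thesis by simp
  qed
  moreover have "w m ^ 2 * (w j ^ k * p (mult R (a n m) (b m j))) \<le> C4 * C3 * w n ^ l4" for n m j
  proof -
    have "w m ^ 2 * (w j ^ k * p (mult R (a n m) (b m j))) \<le> w m ^ 2 * (w j ^ k * (p' (a n m) * p' (b m j)))"
      using p'(2) by (intro mult_left_mono) auto
    also have "\<dots> = w m ^ 2 * (p' (a n m) * (w j ^ k * p' (b m j)))" by simp
    also have "\<dots> \<le> w m ^ 2 * (p' (a n m) * (C3 * w m ^ l3))"
      using 3 nn by (intro mult_left_mono) auto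
    also have "\<dots> = C3 * (w m ^ (l3 + 2) * p' (a n m))" by (simp add: power_add power2_eq_square)
    also have "\<dots> \<le> C3 * (C4 * w n ^ l4)" using 3 4 by (intro mult_left_mono) auto
    finally show ?thesis by (simp add: mult.commute mult.left_commute)
  qed
  moreover have "C1 * C2 * w j ^ l2 \<le> (C1 * C2 + C4 * C3) * w j ^ (l2 + l4)"
     "C4 * C3 * w j ^ l4 \<le> (C1 * C2 + C4 * C3) * w j ^ (l2 + l4)" for j
    using 1 2 3 4 w_mono[of l2 "l2 + l4" j] w_mono[of l4 "l2 + l4" j] by (auto intro!: mult_mono)
  ultimately show thesis
    using that[of "C1 * C2 + C4 * C3" "l2 + l4"] 1(1) 2(1) 3(1) 4(1) by (meson add_nonneg_nonneg mult_nonneg_nonneg order_trans)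
qed

lemma psi_asum:
  assumes "psi d R a" "psi d R b" shows "asum R (\<lambda>m. mult R (a n m) (b m j))"
proof (cases d)
  case True
  have "finite {m. a n m \<noteq> 0}" using assms True by (simp add: psi_def)
  then have "finite {m. mult R (a n m) (b m j) \<noteq> 0}"
    by (rule rev_finite_subset) (auto simp: mult_zero_left)
  then show ?thesis by (rule asum_finite)
next
  case False
  show ?thesis
  proof (rule asum_bound)
    fix p assume "p \<in> sn R"
    then obtain C l where "\<And>m. w m ^ 2 * (w n ^ 0 * p (mult R (a n m) (b m j))) \<le> C * w j ^ l"
      using psi_mult_bound[OF assms False, of p 0] by metis
    then show "\<exists>C. \<forall>m. w m ^ 2 * p (mult R (a n m) (b m j)) \<le> C" by auto
  qed
qed

lemma rsums_mmult:
  "psi d R a \<Longrightarrow> psi d R b \<Longrightarrow> rsums R (\<lambda>m. mult R (a n m) (b m j)) (mmult R a b n j)"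
  unfolding mmult_def by (intro asum_rsums psi_asum)

lemma rsums_weighted_le:
  fixes x :: "nat \<Rightarrow> 'r"
  assumes B: "0 \<le> B" "\<And>F. finite F \<Longrightarrow> (\<Sum>m\<in>F. 1 / w m ^ 2) \<le> B"
    and "rsums R x s" "p \<in> sn R" "0 \<le> v" "\<And>m. w m ^ 2 * (v * p (x m)) \<le> C" "0 < v"
  shows "v * p s \<le> C * B"
proof -
  have C0: "0 \<le> C" using order_trans[OF _ assms(6)[of 0]] sn_nonneg[OF assms(4)] assms(5) by simp
  have "p s \<le> C / v * B"
  proof (rule rsums_le[OF assms(3,4)])
    fix F :: "nat set" assume "finite F"
    have "(\<Sum>i\<in>F. p (x i)) \<le> (\<Sum>i\<in>F. C / v * (1 / w i ^ 2))"
      using assms(6,7) by (intro sum_mono) (simp add: field_simps)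
    also have "\<dots> \<le> C / v * B"
      unfolding sum_distrib_left[symmetric] using B(2)[OF \<open>finite F\<close>] C0 assms(7)
      by (intro mult_left_mono) auto
    finally show "(\<Sum>i\<in>F. p (x i)) \<le> C / v * B" .
  qed
  then show ?thesis using assms(7) by (simp add: field_simps)
qed

lemma mmult_nonzero:
  assumes "mmult R a b n j \<noteq> 0" shows "\<exists>m. a n m \<noteq> 0 \<and> b m j \<noteq> 0"
proof (rule ccontr)
  assume "\<not> ?thesis"
  then have "(\<lambda>m. mult R (a n m) (b m j)) = (\<lambda>_. 0)"
    by (auto simp: fun_eq_iff mult_zero_left mult_zero_right) (metis mult_zero_left mult_zero_right)
  then show False using assms by (simp add: mmult_def ring_sum_zero)
qed

lemma psi_mmult:
  assumes "psi d R a" "psi d R b" shows "psi d R (mmult R a b)"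
proof (cases d)
  case True
  have "{j. mmult R a b n j \<noteq> 0} \<subseteq> (\<Union>m\<in>{m. a n m \<noteq> 0}. {j. b m j \<noteq> 0})"
    "{n. mmult R a b n j \<noteq> 0} \<subseteq> (\<Union>m\<in>{m. b m j \<noteq> 0}. {n. a n m \<noteq> 0})" for n j
    using mmult_nonzero by fastforce+
  then show ?thesis using assms True unfolding psi_def by (simp, meson finite_UN_I finite_subset mem_Collect_eq)
next
  case False
  obtain B where B: "0 \<le> B" "\<And>F. finite F \<Longrightarrow> (\<Sum>m\<in>F. 1 / w m ^ 2) \<le> B"
    using inverse_squares_bounded by blast
  show ?thesis
    unfolding psi_def using False
  proof (simp, intro ballI allI)
    fix p k assume p: "p \<in> sn R"
    obtain C l where C: "0 \<le> C"
      "\<And>n m j. w m ^ 2 * (w n ^ k * p (mult R (a n m) (b m j))) \<le> C * w j ^ l"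
      "\<And>n m j. w m ^ 2 * (w j ^ k * p (mult R (a n m) (b m j))) \<le> C * w n ^ l"
      using psi_mult_bound[OF assms False p, of k] by metis
    have "w n ^ k * p (mmult R a b n j) \<le> C * w j ^ l * B" for n j
      using rsums_weighted_le[OF B rsums_mmult[OF assms] p _ C(2)] by simp
    moreover have "w j ^ k * p (mmult R a b n j) \<le> C * w n ^ l * B" for n j
      using rsums_weighted_le[OF B rsums_mmult[OF assms] p _ C(3)] by simp
    ultimately show "\<exists>C l. \<forall>n m. w n ^ k * p (mmult R a b n m) \<le> C * w m ^ l \<and>
        w m ^ k * p (mmult R a b n m) \<le> C * w n ^ l"
      by (intro exI[of _ "C * B"] exI[of _ l]) (simp add: mult.commute[of _ B] mult.assoc)
  qed
qed

lemma smooth_psi: assumes "smooth d R a" shows "psi d R a"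
proof (cases d)
  case True
  have f: "finite {(n, m). a n m \<noteq> 0}" using assms True by (simp add: smooth_def)
  have "{m. a n m \<noteq> 0} \<subseteq> snd ` {(n, m). a n m \<noteq> 0}" "{n. a n m \<noteq> 0} \<subseteq> fst ` {(n, m). a n m \<noteq> 0}" for n m
    by force+
  then show ?thesis using f True unfolding psi_def by (simp, meson finite_imageI finite_subset)
next
  case False
  show ?thesis
    unfolding psi_def using False
  proof (simp, intro ballI allI)
    fix p k assume p: "p \<in> sn R"
    obtain C where C: "\<And>n m. w n ^ k * w m ^ k * p (a n m) \<le> C"
      using smooth_bound[OF assms False p] by metis
    have "w n ^ k * p (a n m) \<le> w n ^ k * w m ^ k * p (a n m)"
      "w m ^ k * p (a n m) \<le> w n ^ k * w m ^ k * p (a n m)" for n m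
      using w_ge_one[of n k] w_ge_one[of m k] sn_nonneg[OF p, of "a n m"]
      by (intro mult_right_mono; simp)+
    then show "\<exists>C l. \<forall>n m. w n ^ k * p (a n m) \<le> C * w m ^ l \<and> w m ^ k * p (a n m) \<le> C * w n ^ l"
      using C by (intro exI[of _ C] exI[of _ 0]) (simp only: power_0 mult_1_right, meson order_trans)
  qed
qed

lemma smooth_mmult_right:
  assumes "smooth d R a" "psi d R b" shows "smooth d R (mmult R a b)"
proof -
  note ap = smooth_psi[OF assms(1)]
  have "mmult R a b n j \<in> ideal R" for n j
    using assms(1) by (intro ideal_rsums[OF rsums_mmult[OF ap assms(2)]] ideal_mult_right) (simp add: smooth_def)
  moreover have "finite {(n, j). mmult R a b n j \<noteq> 0}" if d
  proof (rule finite_subset)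
    show "{(n, j). mmult R a b n j \<noteq> 0} \<subseteq> (\<Union>(n, m)\<in>{(n, m). a n m \<noteq> 0}. {n} \<times> {j. b m j \<noteq> 0})"
      using mmult_nonzero by fastforce
    show "finite \<dots>" using assms that by (auto simp: smooth_def psi_def)
  qed
  moreover have "\<exists>C. \<forall>n j. w n ^ k * w j ^ k * p (mmult R a b n j) \<le> C" if nd: "\<not> d" and p: "p \<in> sn R" for p k
  proof -
    obtain p' where p': "p' \<in> sn R" "\<And>x y. p (mult R x y) \<le> p' x * p' y" using sn_mult[OF p] by blast
    obtain C2 l2 where 2: "0 \<le> C2" "\<And>m j. w j ^ k * p' (b m j) \<le> C2 * w m ^ l2"
      using psi_bound[OF assms(2) nd p'(1), of k] by metis
    \<comment> \<open>\<open>l2\<close> pays for the growth of \<open>b\<close> in the inner index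
      and \<open>2\<close> for the summation.\<close>
    obtain C1 where 1: "\<And>n m. w n ^ (k + l2 + 2) * w m ^ (k + l2 + 2) * p' (a n m) \<le> C1"
      using smooth_bound[OF assms(1) nd p'(1)] by metis
    obtain B where B: "0 \<le> B" "\<And>F. finite F \<Longrightarrow> (\<Sum>m\<in>F. 1 / w m ^ 2) \<le> B"
      using inverse_squares_bounded by blast
    have nn: "0 \<le> p' x" for x by (rule sn_nonneg[OF p'(1)])
    have "w m ^ 2 * (w n ^ k * w j ^ k * p (mult R (a n m) (b m j))) \<le> C2 * C1" for n m j
    proof -
      have "w m ^ 2 * (w n ^ k * w j ^ k * p (mult R (a n m) (b m j)))
          \<le> w m ^ 2 * (w n ^ k * w j ^ k * (p' (a n m) * p' (b m j)))"
        using p'(2) by (intro mult_left_mono) auto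
      also have "\<dots> = w m ^ 2 * (w n ^ k * p' (a n m) * (w j ^ k * p' (b m j)))" by simp
      also have "\<dots> \<le> w m ^ 2 * (w n ^ k * p' (a n m) * (C2 * w m ^ l2))"
        using 2 nn by (intro mult_left_mono) auto
      also have "\<dots> = C2 * (w n ^ k * w m ^ (l2 + 2) * p' (a n m))" by (simp add: power_add power2_eq_square)
      also have "\<dots> \<le> C2 * (w n ^ (k + l2 + 2) * w m ^ (k + l2 + 2) * p' (a n m))"
        using 2 nn by (intro mult_left_mono mult_right_mono mult_mono w_mono) auto
      also have "\<dots> \<le> C2 * C1" using 1 2 by (intro mult_left_mono) auto
      finally show ?thesis .
    qed
    then have "w n ^ k * w j ^ k * p (mmult R a b n j) \<le> C2 * C1 * B" for n j
      using rsums_weighted_le[OF B rsums_mmult[OF ap assms(2)] p] by simp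
    then show ?thesis by blast
  qed
  ultimately show ?thesis unfolding smooth_def by simp
qed

lemma smooth_mmult_left:
  assumes "psi d R a" "smooth d R b" shows "smooth d R (mmult R a b)"
proof -
  note bp = smooth_psi[OF assms(2)]
  have "mmult R a b n j \<in> ideal R" for n j
    using assms(2) by (intro ideal_rsums[OF rsums_mmult[OF assms(1) bp]] ideal_mult_left) (simp add: smooth_def)
  moreover have "finite {(n, j). mmult R a b n j \<noteq> 0}" if d
  proof (rule finite_subset)
    show "{(n, j). mmult R a b n j \<noteq> 0} \<subseteq> (\<Union>(m, j)\<in>{(m, j). b m j \<noteq> 0}. {n. a n m \<noteq> 0} \<times> {j})"
      using mmult_nonzero by fastforce
    show "finite \<dots>" using assms that by (auto simp: smooth_def psi_def)
  qed
  moreover have "\<exists>C. \<forall>n j. w n ^ k * w j ^ k * p (mmult R a b n j) \<le> C" if nd: "\<not> d" and p: "p \<in> sn R" for p k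
  proof -
    obtain p' where p': "p' \<in> sn R" "\<And>x y. p (mult R x y) \<le> p' x * p' y" using sn_mult[OF p] by blast
    obtain C2 l2 where 2: "0 \<le> C2" "\<And>n m. w n ^ k * p' (a n m) \<le> C2 * w m ^ l2"
      using psi_bound[OF assms(1) nd p'(1), of k] by metis
    obtain C1 where 1: "\<And>n m. w n ^ (k + l2 + 2) * w m ^ (k + l2 + 2) * p' (b n m) \<le> C1"
      using smooth_bound[OF assms(2) nd p'(1)] by metis
    obtain B where B: "0 \<le> B" "\<And>F. finite F \<Longrightarrow> (\<Sum>m\<in>F. 1 / w m ^ 2) \<le> B"
      using inverse_squares_bounded by blast
    have nn: "0 \<le> p' x" for x by (rule sn_nonneg[OF p'(1)])
    have "w m ^ 2 * (w n ^ k * w j ^ k * p (mult R (a n m) (b m j))) \<le> C2 * C1" for n m j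
    proof -
      have "w m ^ 2 * (w n ^ k * w j ^ k * p (mult R (a n m) (b m j)))
          \<le> w m ^ 2 * (w n ^ k * w j ^ k * (p' (a n m) * p' (b m j)))"
        using p'(2) by (intro mult_left_mono) auto
      also have "\<dots> = w m ^ 2 * ((w n ^ k * p' (a n m)) * (w j ^ k * p' (b m j)))" by simp
      also have "\<dots> \<le> w m ^ 2 * ((C2 * w m ^ l2) * (w j ^ k * p' (b m j)))"
        using 2 nn by (intro mult_left_mono mult_right_mono) auto
      also have "\<dots> = C2 * (w m ^ (l2 + 2) * w j ^ k * p' (b m j))" by (simp add: power_add power2_eq_square)
      also have "\<dots> \<le> C2 * (w m ^ (k + l2 + 2) * w j ^ (k + l2 + 2) * p' (b m j))"
        using 2 nn by (intro mult_left_mono mult_right_mono mult_mono w_mono) auto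
      also have "\<dots> \<le> C2 * C1" using 1 2 by (intro mult_left_mono) auto
      finally show ?thesis .
    qed
    then have "w n ^ k * w j ^ k * p (mmult R a b n j) \<le> C2 * C1 * B" for n j
      using rsums_weighted_le[OF B rsums_mmult[OF assms(1) bp] p] by simp
    then show ?thesis by blast
  qed
  ultimately show ?thesis unfolding smooth_def by simp
qed

lemma asum_triple:
  assumes "psi d R a" "psi d R b" "psi d R c"
  shows "asum R (\<lambda>(m, l). mult R (mult R (a n m) (b m l)) (c l j))"
proof (cases d)
  case True
  have "{(m, l). mult R (mult R (a n m) (b m l)) (c l j) \<noteq> 0} \<subseteq>
      (\<Union>m\<in>{m. a n m \<noteq> 0}. {m} \<times> {l. b m l \<noteq> 0})"
    by (force simp: mult_zero_left mult_zero_right)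
  moreover have "finite \<dots>" using assms True by (auto simp: psi_def)
  ultimately have "finite {(m, l). mult R (mult R (a n m) (b m l)) (c l j) \<noteq> 0}" by (rule finite_subset)
  then show ?thesis by (intro asum_finite) (simp add: case_prod_beta')
next
  case False
  show ?thesis
  proof (rule asum_bound2)
    fix p assume p: "p \<in> sn R"
    obtain p1 where p1: "p1 \<in> sn R" "\<And>x y. p (mult R x y) \<le> p1 x * p1 y" using sn_mult[OF p] by blast
    obtain p2 where p2: "p2 \<in> sn R" "\<And>x y. p1 (mult R x y) \<le> p2 x * p2 y" using sn_mult[OF p1(1)] by blast
    obtain C3 l3 where 3: "0 \<le> C3" "\<And>l j. p1 (c l j) \<le> C3 * w j ^ l3"
      using psi_bound_all[OF assms(3) False p1(1)] by metis
    obtain C2 l2 where 2: "0 \<le> C2" "\<And>m l. w l ^ 2 * p2 (b m l) \<le> C2 * w m ^ l2"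
      using psi_bound[OF assms(2) False p2(1), of 2] by metis
    obtain C1 l1 where 1: "0 \<le> C1" "\<And>n m. w m ^ (l2 + 2) * p2 (a n m) \<le> C1 * w n ^ l1"
      using psi_bound[OF assms(1) False p2(1), of "l2 + 2"] by metis
    have nn: "0 \<le> p2 x" "0 \<le> p1 x" for x using sn_nonneg p1 p2 by blast+
    have "w m ^ 2 * w l ^ 2 * p (mult R (mult R (a n m) (b m l)) (c l j))
        \<le> C1 * w n ^ l1 * C2 * (C3 * w j ^ l3)" for m l
    proof -
      have "p (mult R (mult R (a n m) (b m l)) (c l j)) \<le> p1 (mult R (a n m) (b m l)) * p1 (c l j)"
        by (rule p1)
      also have "\<dots> \<le> (p2 (a n m) * p2 (b m l)) * (C3 * w j ^ l3)"
        using p2 3 nn by (intro mult_mono) auto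
      finally have "w m ^ 2 * w l ^ 2 * p (mult R (mult R (a n m) (b m l)) (c l j))
        \<le> w m ^ 2 * w l ^ 2 * ((p2 (a n m) * p2 (b m l)) * (C3 * w j ^ l3))"
        by (intro mult_left_mono) auto
      also have "\<dots> = (w m ^ 2 * p2 (a n m) * (w l ^ 2 * p2 (b m l))) * (C3 * w j ^ l3)" by simp
      also have "\<dots> \<le> (w m ^ 2 * p2 (a n m) * (C2 * w m ^ l2)) * (C3 * w j ^ l3)"
        using 2 3 nn by (intro mult_right_mono mult_left_mono) auto
      also have "\<dots> = (w m ^ (l2 + 2) * p2 (a n m)) * C2 * (C3 * w j ^ l3)" by (simp add: power_add power2_eq_square)
      also have "\<dots> \<le> C1 * w n ^ l1 * C2 * (C3 * w j ^ l3)"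
        using 1 2 3 by (intro mult_right_mono) auto
      finally show ?thesis .
    qed
    then show "\<exists>C. \<forall>m l. w m ^ 2 * w l ^ 2 * p (case (m, l) of (m, l) \<Rightarrow> mult R (mult R (a n m) (b m l)) (c l j)) \<le> C"
      by auto
  qed
qed

text \<open>The two bracketings are the iterated sums, in the two orders, of the absolutely summable
  double family of \<open>asum_triple\<close>.\<close>

lemma mmult_assoc:
  assumes "psi d R a" "psi d R b" "psi d R c"
  shows "mmult R (mmult R a b) c = mmult R a (mmult R b c)"
proof (intro ext)
  fix n j
  let ?z = "\<lambda>(m, l). mult R (mult R (a n m) (b m l)) (c l j)"
  let ?z' = "\<lambda>(l, m). mult R (mult R (a n m) (b m l)) (c l j)"
  have z: "asum R ?z" by (rule asum_triple[OF assms])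
  have z': "asum R ?z'"
    using asum_inj[OF z, of prod.swap] by (simp add: case_prod_beta')
  have "mult R (mmult R a b n l) (c l j) = ring_sum R (\<lambda>m. ?z' (l, m))" for l
    using ring_sum_eq[OF rsums_mult_right[OF rsums_mmult[OF assms(1,2)]]] by simp
  then have 1: "mmult R (mmult R a b) c n j = ring_sum R ?z'"
    unfolding mmult_def[of R "mmult R a b"] using ring_sum_eq[OF rsums_Fubini[OF z']] by simp
  have "mult R (a n m) (mmult R b c m j) = ring_sum R (\<lambda>l. ?z (m, l))" for m
    using ring_sum_eq[OF rsums_mult_left[OF rsums_mmult[OF assms(2,3)]]] by (simp add: mult_assoc)
  then have 2: "mmult R a (mmult R b c) n j = ring_sum R ?z"
    unfolding mmult_def[of R a "mmult R b c"] using ring_sum_eq[OF rsums_Fubini[OF z]] by simp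
  have "ring_sum R ?z = ring_sum R ?z'"
    by (rule ring_sum_reindex[of prod.swap UNIV]) (auto simp: case_prod_beta')
  then show "mmult R (mmult R a b) c n j = mmult R a (mmult R b c) n j" using 1 2 by simp
qed

lemma mmult_add_left:
  assumes "psi d R a" "psi d R b" "psi d R c"
  shows "mmult R (\<lambda>n m. a n m + b n m) c = (\<lambda>n m. mmult R a c n m + mmult R b c n m)"
proof (intro ext)
  fix n j
  show "mmult R (\<lambda>n m. a n m + b n m) c n j = mmult R a c n j + mmult R b c n j"
    unfolding mmult_def[of R "\<lambda>n m. a n m + b n m"]
    using ring_sum_eq[OF rsums_add[OF rsums_mmult[OF assms(1,3)] rsums_mmult[OF assms(2,3)]]]
    by (simp add: mult_add_left)
qed

lemma mmult_add_right:
  assumes "psi d R a" "psi d R b" "psi d R c"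
  shows "mmult R c (\<lambda>n m. a n m + b n m) = (\<lambda>n m. mmult R c a n m + mmult R c b n m)"
proof (intro ext)
  fix n j
  show "mmult R c (\<lambda>n m. a n m + b n m) n j = mmult R c a n j + mmult R c b n j"
    unfolding mmult_def[of R c "\<lambda>n m. a n m + b n m"]
    using ring_sum_eq[OF rsums_add[OF rsums_mmult[OF assms(3,1)] rsums_mmult[OF assms(3,2)]]]
    by (simp add: mult_add_right)
qed

lemma psi_add: assumes "psi d R a" "psi d R b" shows "psi d R (\<lambda>n m. a n m + b n m)"
proof (cases d)
  case True
  have "{m. a n m + b n m \<noteq> 0} \<subseteq> {m. a n m \<noteq> 0} \<union> {m. b n m \<noteq> 0}"
    "{n. a n m + b n m \<noteq> 0} \<subseteq> {n. a n m \<noteq> 0} \<union> {n. b n m \<noteq> 0}" for n m by auto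
  then show ?thesis using assms True unfolding psi_def by (simp, meson finite_UnI finite_subset)
next
  case False
  show ?thesis
    unfolding psi_def using False
  proof (simp, intro ballI allI)
    fix p k assume p: "p \<in> sn R"
    obtain C l where C: "0 \<le> C" "\<And>n m. w n ^ k * p (a n m) \<le> C * w m ^ l" "\<And>n m. w m ^ k * p (a n m) \<le> C * w n ^ l"
      using psi_bound[OF assms(1) False p, of k] by metis
    obtain D h where D: "0 \<le> D" "\<And>n m. w n ^ k * p (b n m) \<le> D * w m ^ h" "\<And>n m. w m ^ k * p (b n m) \<le> D * w n ^ h"
      using psi_bound[OF assms(2) False p, of k] by metis
    have le: "C * w n ^ l + D * w n ^ h \<le> (C + D) * w n ^ (l + h)" for n
      using C(1) D(1) w_mono[of l "l + h" n] w_mono[of h "l + h" n]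
      by (simp add: distrib_right add_mono mult_left_mono)
    have "v * p (a n m + b n m) \<le> v * p (a n m) + v * p (b n m)" if "0 \<le> v" for n m v
      using mult_left_mono[OF sn_add[OF p, of "a n m" "b n m"] that] by (simp add: distrib_left)
    then have "w n ^ k * p (a n m + b n m) \<le> w n ^ k * p (a n m) + w n ^ k * p (b n m)"
      "w m ^ k * p (a n m + b n m) \<le> w m ^ k * p (a n m) + w m ^ k * p (b n m)" for n m by simp_all
    then show "\<exists>C l. \<forall>n m. w n ^ k * p (a n m + b n m) \<le> C * w m ^ l \<and> w m ^ k * p (a n m + b n m) \<le> C * w n ^ l"
      using le C(2,3) D(2,3)
      by (intro exI[of _ "C + D"] exI[of _ "l + h"]) (smt (verit, best))
  qed
qed

lemma psi_uminus: "psi d R a \<Longrightarrow> psi d R (\<lambda>n m. - a n m)"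
  by (auto simp: psi_def sn_uminus)

lemma psi_zero: "psi d R (\<lambda>n m. 0)"
  by (auto simp: psi_def sn_zero intro!: exI[of _ 0])

lemma smooth_zero: "smooth d R (\<lambda>n m. 0)"
  by (auto simp: smooth_def sn_zero ideal_zero intro!: exI[of _ 0])

lemma smooth_uminus: "smooth d R a \<Longrightarrow> smooth d R (\<lambda>n m. - a n m)"
  by (auto simp: smooth_def sn_uminus ideal_uminus)

lemma smooth_add: assumes "smooth d R a" "smooth d R b" shows "smooth d R (\<lambda>n m. a n m + b n m)"
proof -
  have "finite {(n, m). a n m + b n m \<noteq> 0}" if d
  proof (rule finite_subset)
    show "{(n, m). a n m + b n m \<noteq> 0} \<subseteq> {(n, m). a n m \<noteq> 0} \<union> {(n, m). b n m \<noteq> 0}" by auto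
    show "finite \<dots>" using assms that by (simp add: smooth_def)
  qed
  moreover have "\<exists>C. \<forall>n m. w n ^ k * w m ^ k * p (a n m + b n m) \<le> C" if nd: "\<not> d" and p: "p \<in> sn R" for p k
  proof -
    obtain C where C: "\<And>n m. w n ^ k * w m ^ k * p (a n m) \<le> C"
      using smooth_bound[OF assms(1) nd p] by metis
    obtain D where D: "\<And>n m. w n ^ k * w m ^ k * p (b n m) \<le> D"
      using smooth_bound[OF assms(2) nd p] by metis
    have "w n ^ k * w m ^ k * p (a n m + b n m) \<le> w n ^ k * w m ^ k * p (a n m) + w n ^ k * w m ^ k * p (b n m)" for n m
      unfolding distrib_left[symmetric] by (intro mult_left_mono sn_add p) simp
    then show ?thesis using C D by (intro exI[of _ "C + D"]) (meson add_mono order_trans)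
  qed
  ultimately show ?thesis using assms by (simp add: smooth_def ideal_add)
qed

lemma ring_sum_single:
  assumes "\<And>i. i \<noteq> c \<Longrightarrow> x i = 0" shows "ring_sum R x = x c"
  using ring_sum_eq[OF rsums_finite[of "{c}" x]] assms by simp

text \<open>If row and column numbers are polynomially comparable on the support, a weight in one
  index can be traded for a power of the weight in the other, and each row and column is finite.
  This covers diagonal projections and the matrices of injections.\<close>

lemma psi_band:
  assumes bd: "\<And>p. p \<in> sn R \<Longrightarrow> \<exists>B. \<forall>n m. p (a n m) \<le> B"
    and supp: "\<And>n m. a n m \<noteq> 0 \<Longrightarrow> w n \<le> C * w m ^ l \<and> w m \<le> C * w n ^ l"
  shows "psi d R a"
proof (cases d)
  case True
  have bnd: "finite {m. w m \<le> D}" for D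
  proof (rule finite_subset)
    show "{m. w m \<le> D} \<subseteq> {..nat \<lceil>D\<rceil>}" by (auto simp: le_nat_iff) linarith
  qed simp
  have "{m. a n m \<noteq> 0} \<subseteq> {m. w m \<le> C * w n ^ l}" "{n. a n m \<noteq> 0} \<subseteq> {n. w n \<le> C * w m ^ l}" for n m
    using supp by auto
  then show ?thesis using True bnd unfolding psi_def by (simp, meson finite_subset)
next
  case False
  show ?thesis
    unfolding psi_def using False
  proof (simp, intro ballI allI)
    fix p k assume p: "p \<in> sn R"
    obtain B where B: "\<And>n m. p (a n m) \<le> B" using bd[OF p] by blast
    have B0: "0 \<le> B" using order_trans[OF sn_nonneg[OF p] B] .
    have le: "u ^ k * p (a n m) \<le> \<bar>C\<bar> ^ k * B * v ^ (l * k)"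
      if "a n m \<noteq> 0 \<Longrightarrow> u \<le> C * v ^ l" "0 \<le> u" "0 \<le> v" for u v n m
    proof (cases "a n m = 0")
      case True
      then show ?thesis using B0 that by (simp add: sn_zero[OF p])
    next
      case nz: False
      have "u \<le> \<bar>C\<bar> * v ^ l"
        using that(1)[OF nz] mult_right_mono[OF abs_ge_self[of C], of "v ^ l"] that(3) by simp
      then have "u ^ k \<le> (\<bar>C\<bar> * v ^ l) ^ k" using that(2) by (rule power_mono)
      then have "u ^ k * p (a n m) \<le> (\<bar>C\<bar> * v ^ l) ^ k * B"
        using B that sn_nonneg[OF p] by (intro mult_mono) auto
      then show ?thesis by (simp add: power_mult_distrib power_mult[symmetric] mult_ac)
    qed
    show "\<exists>C l. \<forall>n m. w n ^ k * p (a n m) \<le> C * w m ^ l \<and> w m ^ k * p (a n m) \<le> C * w n ^ l"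
      using supp by (intro exI[of _ "\<bar>C\<bar> ^ k * B"] exI[of _ "l * k"] allI conjI le) auto
  qed
qed

end

subsection \<open>Two disjoint copies of the natural numbers\<close>

text \<open>Under the pairing function the natural numbers are layers of copies of themselves.
  \<open>sh0\<close> is the inclusion of layer 0 and \<open>sh1\<close> moves every layer up by one;
  the two ranges are complementary.\<close>

definition sh0 :: "nat \<Rightarrow> nat" where
  "sh0 m = prod_encode (m, 0)"

definition sh1 :: "nat \<Rightarrow> nat" where
  "sh1 k = (case prod_decode k of (m, n) \<Rightarrow> prod_encode (m, Suc n))"

abbreviation dfst :: "nat \<Rightarrow> nat" where "dfst u \<equiv> fst (prod_decode u)"
abbreviation dsnd :: "nat \<Rightarrow> nat" where "dsnd u \<equiv> snd (prod_decode u)"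

lemma sh_decode [simp]:
  "prod_decode (sh0 m) = (m, 0)" "prod_decode (sh1 k) = (dfst k, Suc (dsnd k))"
  by (simp_all add: sh0_def sh1_def case_prod_beta)

lemma sh_inject [simp]: "sh0 m = sh0 n \<longleftrightarrow> m = n" "sh1 m = sh1 n \<longleftrightarrow> m = n"
  "sh0 m \<noteq> sh1 n" "sh1 m \<noteq> sh0 n"
proof -
  show "sh0 m = sh0 n \<longleftrightarrow> m = n" by (simp add: sh0_def)
  show "sh1 m = sh1 n \<longleftrightarrow> m = n"
    by (metis Pair_inject nat.inject prod.collapse prod_decode_inverse sh_decode(2))
  show "sh0 m \<noteq> sh1 n" "sh1 m \<noteq> sh0 n"
    by (metis nat.distinct(1) sh_decode snd_conv)+
qed

lemma sh_cases: obtains m where "u = sh0 m" | m where "u = sh1 m"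
proof (cases "dsnd u")
  case 0
  then have "u = sh0 (dfst u)" by (simp add: sh0_def flip: prod.collapse) (metis prod.collapse prod_decode_inverse)
  then show thesis using that by blast
next
  case (Suc n)
  then have "u = sh1 (prod_encode (dfst u, n))"
    by (simp add: sh1_def) (metis prod.collapse prod_decode_inverse)
  then show thesis using that by blast
qed

text \<open>Cantor's pairing is quadratic, as its triangular numbers show; so coding pairs by
  numbers distorts weights only polynomially.\<close>

lemma w_encode_le: "w (prod_encode (m, n)) \<le> (w m * w n) ^ 2"
proof -
  have t: "2 * triangle k = k * (k + 1)" for k by (induction k) simp_all
  have "2 * (1 + prod_encode (m, n)) \<le> 2 * (1 + m + n) ^ 2"
    using t[of "m + n"] by (simp add: prod_encode_def power2_eq_square algebra_simps)
  also have "\<dots> \<le> 2 * ((1 + m) * (1 + n)) ^ 2" by (intro mult_left_mono power_mono) simp_all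
  finally have "1 + prod_encode (m, n) \<le> ((1 + m) * (1 + n)) ^ 2" by simp
  then have "real (1 + prod_encode (m, n)) \<le> real (((1 + m) * (1 + n)) ^ 2)" by (rule of_nat_mono)
  then show ?thesis by (simp add: algebra_simps)
qed

lemma dfst_le: "dfst u \<le> u" and dsnd_le: "dsnd u \<le> u"
  by (metis le_prod_encode_1 prod.collapse prod_decode_inverse)
    (metis le_prod_encode_2 prod.collapse prod_decode_inverse)

lemma w_le_decode: "w u \<le> (w (dfst u) * w (dsnd u)) ^ 2"
  using w_encode_le[of "dfst u" "dsnd u"] by simp

text \<open>Comparison in both directions is what makes the matrix of \<open>f\<close> and its
  transpose of pseudodifferential size.\<close>

definition comparable :: "(nat \<Rightarrow> nat) \<Rightarrow> bool" where
  "comparable f \<longleftrightarrow> inj f \<and> (\<exists>C l. \<forall>n. w (f n) \<le> C * w n ^ l \<and> w n \<le> C * w (f n) ^ l)"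

lemma comparable_sh0: "comparable sh0"
proof -
  have "w (sh0 n) \<le> 1 * w n ^ 2" for n using w_encode_le[of n 0] by (simp add: sh0_def)
  moreover have "w n \<le> 1 * w (sh0 n) ^ 2" for n
  proof -
    have "w n \<le> w (sh0 n)" using le_prod_encode_1[of n 0] by (simp add: sh0_def)
    also have "\<dots> \<le> w (sh0 n) ^ 2" using w_mono[of 1 2 "sh0 n"] by simp
    finally show ?thesis by simp
  qed
  ultimately show ?thesis unfolding comparable_def inj_def by (metis sh_inject(1))
qed

lemma comparable_sh1: "comparable sh1"
proof -
  have "w (sh1 n) \<le> 4 * w n ^ 4" for n
  proof -
    have "w (sh1 n) \<le> (w (dfst n) * w (Suc (dsnd n))) ^ 2"
      using w_le_decode[of "sh1 n"] by simp
    also have "\<dots> \<le> (w n * (2 * w n)) ^ 2"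
      using dfst_le[of n] dsnd_le[of n] by (intro power_mono mult_mono) auto
    also have "\<dots> = 4 * w n ^ 4" by (simp add: power2_eq_square power4_eq_xxxx algebra_simps)
    finally show ?thesis .
  qed
  moreover have "w n \<le> 4 * w (sh1 n) ^ 4" for n
  proof -
    have "w n \<le> (w (dfst n) * w (dsnd n)) ^ 2" by (rule w_le_decode)
    also have "\<dots> \<le> (w (sh1 n) * w (sh1 n)) ^ 2"
      using dfst_le[of "sh1 n"] dsnd_le[of "sh1 n"] by (intro power_mono mult_mono) auto
    also have "\<dots> = w (sh1 n) ^ 4" by (simp add: eval_nat_numeral)
    also have "\<dots> \<le> 4 * w (sh1 n) ^ 4" by simp
    finally show ?thesis .
  qed
  ultimately show ?thesis unfolding comparable_def inj_def by (metis sh_inject(2))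
qed

subsection \<open>Matrices of injections, and inflation\<close>

definition emat :: "('k, 'r::ab_group_add) uext \<Rightarrow> (nat \<Rightarrow> nat) \<Rightarrow> nat \<Rightarrow> nat \<Rightarrow> 'r" where
  "emat R f u v = (if u = f v then unit R else 0)"

definition tmat :: "('k, 'r::ab_group_add) uext \<Rightarrow> (nat \<Rightarrow> nat) \<Rightarrow> nat \<Rightarrow> nat \<Rightarrow> 'r" where
  "tmat R f u v = (if v = f u then unit R else 0)"

text \<open>This is \<open>a \<otimes> 1\<close>: one copy of \<open>a\<close> on each layer.
  Shifting the layers by \<open>sh1\<close> reproduces all copies but the one on layer 0, which is
  the recursion behind the swindle.\<close>

definition inflate :: "(nat \<Rightarrow> nat \<Rightarrow> 'r::zero) \<Rightarrow> nat \<Rightarrow> nat \<Rightarrow> 'r" where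
  "inflate a u v = (if dsnd u = dsnd v then a (dfst u) (dfst v) else 0)"

context pm_ring
begin

lemma psi_emat_tmat:
  assumes "comparable f" shows "psi d R (emat R f)" "psi d R (tmat R f)"
proof -
  from assms
  obtain C l where C: "\<And>n. w (f n) \<le> C * w n ^ l \<and> w n \<le> C * w (f n) ^ l"
    unfolding comparable_def by blast
  have "\<exists>B. \<forall>n m. p (emat R f n m) \<le> B" "\<exists>B. \<forall>n m. p (tmat R f n m) \<le> B" if "p \<in> sn R" for p
    using sn_nonneg[OF that, of "unit R"] sn_zero[OF that]
    by (auto simp: emat_def tmat_def intro!: exI[of _ "p (unit R)"])
  note bd = this
  show "psi d R (emat R f)" "psi d R (tmat R f)"
    by (rule psi_band[OF bd(1), where C = C and l = l], assumption,
          use C in \<open>auto simp: emat_def split: if_splits\<close>)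
       (rule psi_band[OF bd(2), where C = C and l = l], assumption,
          use C in \<open>auto simp: tmat_def split: if_splits\<close>)
qed

lemma mone_emat: "mone R spgN = emat R (\<lambda>n. n)"
  by (simp add: fun_eq_iff mone_def emat_def spgN_def)

lemma comparable_id: "comparable (\<lambda>n. n)"
  unfolding comparable_def by (auto intro!: exI[of _ 1] exI[of _ 1])

lemma psi_mone: "psi d R (mone R spgN)"
  unfolding mone_emat by (rule psi_emat_tmat(1)[OF comparable_id])

lemma mmult_emat_right: "mmult R a (emat R f) n j = a n (f j)"
  unfolding mmult_def by (subst ring_sum_single[of "f j"]) (auto simp: emat_def mult_zero_right unit_right)

lemma mmult_tmat_left: "mmult R (tmat R f) b n j = b (f n) j"
  unfolding mmult_def by (subst ring_sum_single[of "f n"]) (auto simp: tmat_def mult_zero_left unit_left)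

lemma mmult_tmat_right:
  assumes "inj f"
  shows "mmult R a (tmat R f) n (f j) = a n j"
  unfolding mmult_def using assms
  by (subst ring_sum_single[of j]) (auto simp: tmat_def mult_zero_right unit_right inj_def)

lemma mmult_tmat_right_zero:
  assumes "j \<notin> range f" shows "mmult R a (tmat R f) n j = 0"
proof -
  have "(\<lambda>m. mult R (a n m) (tmat R f m j)) = (\<lambda>_. 0)" using assms by (auto simp: fun_eq_iff tmat_def mult_zero_right)
  then show ?thesis by (simp add: mmult_def ring_sum_zero)
qed

lemma mmult_emat_left:
  assumes "inj f" shows "mmult R (emat R f) b (f n) j = b n j"
  unfolding mmult_def using assms
  by (subst ring_sum_single[of n]) (auto simp: emat_def mult_zero_left unit_left inj_def)

lemma mmult_emat_left_zero:
  assumes "n \<notin> range f" shows "mmult R (emat R f) b n j = 0"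
proof -
  have "(\<lambda>m. mult R (emat R f n m) (b m j)) = (\<lambda>_. 0)" using assms by (auto simp: fun_eq_iff emat_def mult_zero_left)
  then show ?thesis by (simp add: mmult_def ring_sum_zero)
qed

lemma mmult_mone_left: "mmult R (mone R spgN) a = a"
  using mmult_emat_left[of "\<lambda>n. n" a] by (simp add: mone_emat fun_eq_iff)

lemma mmult_mone_right: "mmult R a (mone R spgN) = a"
  by (simp add: mone_emat fun_eq_iff mmult_emat_right)

lemma sandwich:
  assumes "inj f" "inj g"
  shows "mmult R (mmult R (emat R f) a) (tmat R g) (f n) (g m) = a n m"
    "u \<notin> range f \<or> v \<notin> range g \<Longrightarrow> mmult R (mmult R (emat R f) a) (tmat R g) u v = 0"
proof -
  show "mmult R (mmult R (emat R f) a) (tmat R g) (f n) (g m) = a n m"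
    using assms by (simp add: mmult_tmat_right mmult_emat_left)
  assume *: "u \<notin> range f \<or> v \<notin> range g"
  show "mmult R (mmult R (emat R f) a) (tmat R g) u v = 0"
  proof (cases "v \<in> range g")
    case True
    then show ?thesis using * assms by (auto simp: mmult_tmat_right mmult_emat_left_zero)
  qed (simp add: mmult_tmat_right_zero)
qed

lemma inj_sh: "inj sh0" "inj sh1"
  by (simp_all add: inj_def)

lemma inflate_eq:
  "inflate a u v = mmult R (mmult R (emat R sh0) a) (tmat R sh0) u v +
     mmult R (mmult R (emat R sh1) (inflate a)) (tmat R sh1) u v"
proof -
  note s = sandwich[OF inj_sh(1) inj_sh(1)] sandwich[OF inj_sh(2) inj_sh(2)]
  have r: "sh0 m \<notin> range sh1" "sh1 m \<notin> range sh0" for m by auto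
  show ?thesis
    by (cases u rule: sh_cases; cases v rule: sh_cases) (simp_all add: s r, simp_all add: inflate_def)
qed

lemma inflate_mmult: "mmult R (inflate a) (inflate b) = inflate (mmult R a b)"
proof (intro ext)
  fix u v
  show "mmult R (inflate a) (inflate b) u v = inflate (mmult R a b) u v"
  proof (cases "dsnd u = dsnd v")
    case True
    have "ring_sum R (\<lambda>m. mult R (a (dfst u) m) (b m (dfst v))) =
        ring_sum R (\<lambda>k. mult R (inflate a u k) (inflate b k v))"
    proof (rule ring_sum_reindex[of "\<lambda>m. prod_encode (m, dsnd u)" UNIV])
      fix k assume "k \<notin> range (\<lambda>m. prod_encode (m, dsnd u))"
      then have "dsnd k \<noteq> dsnd u" by (metis prod.collapse prod_decode_inverse rangeI)
      then show "mult R (inflate a u k) (inflate b k v) = 0" by (simp add: inflate_def mult_zero_left)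
    qed (use True in \<open>auto simp: inj_def inflate_def\<close>)
    then show ?thesis using True by (simp add: mmult_def inflate_def)
  next
    case False
    then have "(\<lambda>k. mult R (inflate a u k) (inflate b k v)) = (\<lambda>_. 0)"
      by (auto simp: inflate_def mult_zero_left mult_zero_right)
    then show ?thesis using False by (simp add: mmult_def inflate_def ring_sum_zero)
  qed
qed

lemma psi_inflate: assumes "psi d R a" shows "psi d R (inflate a)"
proof (cases d)
  case True
  have "{v. inflate a u v \<noteq> 0} \<subseteq> (\<lambda>m. prod_encode (m, dsnd u)) ` {m. a (dfst u) m \<noteq> 0}"
    "{v. inflate a v u \<noteq> 0} \<subseteq> (\<lambda>m. prod_encode (m, dsnd u)) ` {m. a m (dfst u) \<noteq> 0}" for u
    by (auto simp: inflate_def image_iff split: if_splits) (metis prod.collapse prod_decode_inverse)+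
  then show ?thesis using assms True unfolding psi_def by (simp, meson finite_imageI finite_subset)
next
  case False
  show ?thesis
    unfolding psi_def using False
  proof (simp, intro ballI allI)
    fix p k assume p: "p \<in> sn R"
    \<comment> \<open>A code weighs at most the square of the product of the weights of its
      coordinates, hence \<open>2 * k\<close>. The layer is common to row and column, so its weight
      is simply carried over to the other side.\<close>
    obtain C l where C: "0 \<le> C" "\<And>n m. w n ^ (2 * k) * p (a n m) \<le> C * w m ^ l"
      "\<And>n m. w m ^ (2 * k) * p (a n m) \<le> C * w n ^ l"
      using psi_bound[OF assms False p, of "2 * k"] by metis
    have le: "w u ^ k * x \<le> C * w v ^ (l + 2 * k)"
      if x: "0 \<le> x" "w (dfst u) ^ (2 * k) * x \<le> C * w (dfst v) ^ l" and "dsnd u = dsnd v" for u v x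
    proof -
      have "w u ^ k \<le> ((w (dfst u) * w (dsnd u)) ^ 2) ^ k" by (intro power_mono w_le_decode) simp
      also have "\<dots> = w (dfst u) ^ (2 * k) * w (dsnd v) ^ (2 * k)"
        by (simp add: power_mult_distrib power_mult that(3))
      finally have "w u ^ k * x \<le> w (dfst u) ^ (2 * k) * w (dsnd v) ^ (2 * k) * x"
        using x(1) by (rule mult_right_mono)
      also have "\<dots> = (w (dfst u) ^ (2 * k) * x) * w (dsnd v) ^ (2 * k)" by simp
      also have "\<dots> \<le> (C * w (dfst v) ^ l) * w (dsnd v) ^ (2 * k)" using x(2) by (intro mult_right_mono) auto
      also have "\<dots> \<le> (C * w v ^ l) * w v ^ (2 * k)"
        using C(1) dfst_le[of v] dsnd_le[of v] by (intro mult_mono power_mono) auto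
      finally show ?thesis by (simp add: power_add)
    qed
    have "w u ^ k * p (inflate a u v) \<le> C * w v ^ (l + 2 * k)"
      "w v ^ k * p (inflate a u v) \<le> C * w u ^ (l + 2 * k)" for u v
      using le[OF sn_nonneg[OF p] C(2), of u v] le[OF sn_nonneg[OF p] C(3), of v u] C(1)
      by (auto simp: inflate_def sn_zero[OF p])
    then show "\<exists>C l. \<forall>n m. w n ^ k * p (inflate a n m) \<le> C * w m ^ l \<and> w m ^ k * p (inflate a n m) \<le> C * w n ^ l"
      by blast
  qed
qed

end

subsection \<open>The universal ring of matrices\<close>

text \<open>A typedef cannot depend on the coefficient ring \<open>R\<close> of a theorem.  An element of the following
  type is therefore a family of pairs of matrices, one for each convention \<open>d\<close> and each suitable
  \<open>R\<close>: the product of the rings of pairs of matrices.\<close>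

typedef (overloaded) ('k, 'r::ab_group_add) mring =
  "{f :: bool \<Rightarrow> ('k, 'r) uext \<Rightarrow> bool \<Rightarrow> nat \<Rightarrow> nat \<Rightarrow> 'r.
     \<forall>d R i. if pm_ring R then psi d R (f d R i) else f d R i = (\<lambda>_ _. 0)}"
  morphisms mat Abs_mring
  by (rule exI[of _ "\<lambda>_ _ _ _ _. 0"]) (auto simp: pm_ring.psi_zero)

definition mk :: "(bool \<Rightarrow> ('k, 'r::ab_group_add) uext \<Rightarrow> bool \<Rightarrow> nat \<Rightarrow> nat \<Rightarrow> 'r) \<Rightarrow> ('k, 'r) mring" where
  "mk F = Abs_mring (\<lambda>d R i. if pm_ring R then F d R i else (\<lambda>_ _. 0))"

lemma mat_mk:
  assumes "\<And>d R i. pm_ring R \<Longrightarrow> psi d R (F d R i)"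
  shows "mat (mk F) d R i = (if pm_ring R then F d R i else (\<lambda>_ _. 0))"
  unfolding mk_def using assms by (subst Abs_mring_inverse) auto

lemma psi_mat: "pm_ring R \<Longrightarrow> psi d R (mat f d R i)"
  using mat[of f] by simp

lemma mat_bad: "\<not> pm_ring R \<Longrightarrow> mat f d R i = (\<lambda>_ _. 0)"
  using mat[of f] by simp

lemma mring_eqI:
  assumes "\<And>d R i. pm_ring R \<Longrightarrow> mat f d R i = mat g d R i" shows "f = g"
proof -
  have "mat f d R i = mat g d R i" for d R i
    using assms by (cases "pm_ring R") (simp_all add: mat_bad)
  then have "mat f = mat g" by (intro ext) simp
  then show ?thesis by (simp add: mat_inject)
qed

instantiation mring :: (type, ab_group_add) "{ring, monoid_mult}"
begin

definition zero_mring :: "('a, 'b) mring" where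
  "0 = mk (\<lambda>d R i n m. 0)"
definition one_mring :: "('a, 'b) mring" where
  "1 = mk (\<lambda>d R i. mone R spgN)"
definition plus_mring :: "('a, 'b) mring \<Rightarrow> ('a, 'b) mring \<Rightarrow> ('a, 'b) mring" where
  "f + g = mk (\<lambda>d R i n m. mat f d R i n m + mat g d R i n m)"
definition uminus_mring :: "('a, 'b) mring \<Rightarrow> ('a, 'b) mring" where
  "- f = mk (\<lambda>d R i n m. - mat f d R i n m)"
definition minus_mring :: "('a, 'b) mring \<Rightarrow> ('a, 'b) mring \<Rightarrow> ('a, 'b) mring" where
  "f - g = f + - (g :: ('a, 'b) mring)"
definition times_mring :: "('a, 'b) mring \<Rightarrow> ('a, 'b) mring \<Rightarrow> ('a, 'b) mring" where
  "f * g = mk (\<lambda>d R i. mmult R (mat f d R i) (mat g d R i))"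

lemma mat_zero: "mat 0 d R i = (\<lambda>_ _. 0)"
  unfolding zero_mring_def by (subst mat_mk) (auto intro: pm_ring.psi_zero)
lemma mat_one: "pm_ring R \<Longrightarrow> mat 1 d R i = mone R spgN"
  unfolding one_mring_def by (subst mat_mk) (auto intro: pm_ring.psi_mone)
lemma mat_add: "mat (f + g) d R i = (\<lambda>n m. mat f d R i n m + mat g d R i n m)"
  unfolding plus_mring_def by (subst mat_mk) (auto intro: pm_ring.psi_add psi_mat simp: mat_bad)
lemma mat_uminus: "mat (- f) d R i = (\<lambda>n m. - mat f d R i n m)"
  unfolding uminus_mring_def by (subst mat_mk) (auto intro: pm_ring.psi_uminus psi_mat simp: mat_bad)
lemma mat_diff: "mat (f - g) d R i = (\<lambda>n m. mat f d R i n m - mat g d R i n m)"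
  unfolding minus_mring_def by (simp add: mat_add mat_uminus)
lemma mat_mult: "pm_ring R \<Longrightarrow> mat (f * g) d R i = mmult R (mat f d R i) (mat g d R i)"
  unfolding times_mring_def by (subst mat_mk) (auto intro: pm_ring.psi_mmult psi_mat)

instance
proof
  fix f g h :: "('a, 'b) mring"
  show "f + g + h = f + (g + h)" by (rule mring_eqI) (simp add: mat_add add.assoc)
  show "f + g = g + f" by (rule mring_eqI) (simp add: mat_add add.commute)
  show "0 + f = f" by (rule mring_eqI) (simp add: mat_add mat_zero)
  show "- f + f = 0" by (rule mring_eqI) (simp add: mat_add mat_zero mat_uminus)
  show "f - g = f + - g" by (simp add: minus_mring_def)
  show "f * g * h = f * (g * h)"
    by (rule mring_eqI) (simp add: mat_mult pm_ring.mmult_assoc[OF _ psi_mat psi_mat psi_mat])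
  show "1 * f = f" by (rule mring_eqI) (simp add: mat_mult mat_one pm_ring.mmult_mone_left)
  show "f * 1 = f" by (rule mring_eqI) (simp add: mat_mult mat_one pm_ring.mmult_mone_right)
  show "(f + g) * h = f * h + g * h"
    by (rule mring_eqI) (simp add: mat_mult mat_add pm_ring.mmult_add_left[OF _ psi_mat psi_mat psi_mat])
  show "f * (g + h) = f * g + f * h"
    by (rule mring_eqI) (simp add: mat_mult mat_add pm_ring.mmult_add_right[OF _ psi_mat psi_mat psi_mat])
qed

end

lemmas mat_simps = mat_zero mat_one mat_add mat_uminus mat_diff mat_mult

definition S0 :: "('k, 'r::ab_group_add) mring" where "S0 = mk (\<lambda>d R i. emat R sh0)"
definition S1 :: "('k, 'r::ab_group_add) mring" where "S1 = mk (\<lambda>d R i. emat R sh1)"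
definition T0 :: "('k, 'r::ab_group_add) mring" where "T0 = mk (\<lambda>d R i. tmat R sh0)"
definition T1 :: "('k, 'r::ab_group_add) mring" where "T1 = mk (\<lambda>d R i. tmat R sh1)"
definition infl :: "('k, 'r::ab_group_add) mring \<Rightarrow> ('k, 'r) mring" where
  "infl f = mk (\<lambda>d R i. inflate (mat f d R i))"
definition cst :: "bool \<Rightarrow> ('k, 'r::ab_group_add) mring \<Rightarrow> ('k, 'r) mring" where
  "cst j f = mk (\<lambda>d R i. mat f d R j)"

text \<open>The component \<open>True\<close> is the first entry of a pair \<open>\<langle>b, a\<rangle>\<close>.\<close>

definition Gpairs :: "bool \<Rightarrow> ('k, 'r::ab_group_add) uext \<Rightarrow> ('k, 'r) mring set" where
  "Gpairs d R = {f. smooth d R (\<lambda>n m. mat f d R True n m - mat f d R False n m)}"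

lemma mat_cuntz:
  assumes "pm_ring R"
  shows "mat S0 d R i = emat R sh0" "mat S1 d R i = emat R sh1"
    "mat T0 d R i = tmat R sh0" "mat T1 d R i = tmat R sh1"
  using assms unfolding S0_def S1_def T0_def T1_def
  by (simp_all add: mat_mk pm_ring.psi_emat_tmat comparable_sh0 comparable_sh1)

lemma mat_infl: "pm_ring R \<Longrightarrow> mat (infl f) d R i = inflate (mat f d R i)"
  unfolding infl_def by (simp add: mat_mk pm_ring.psi_inflate psi_mat)

lemma mat_cst: "mat (cst j f) d R i = mat f d R j"
  unfolding cst_def by (cases "pm_ring R") (simp_all add: mat_mk psi_mat mat_bad)

lemma cst_simps:
  "cst j (f + g) = cst j f + cst j g" "cst j (f * g) = cst j f * cst j g" "cst j 1 = 1"
  "cst j (cst k f) = cst k f" "cst j S0 = S0" "cst j S1 = S1" "cst j T0 = T0" "cst j T1 = T1"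
  "cst j (infl f) = infl (cst j f)"
  by (rule mring_eqI; simp add: mat_cst mat_simps mat_cuntz mat_infl)+

lemma stable_mring:
  fixes R :: "('k, 'r::ab_group_add) uext"
  assumes R: "pm_ring R" shows "stable (Gpairs d R) (cst False) S0 S1 T0 T1 infl"
proof -
  interpret pm_ring R by (rule R)
  have ts: "mmult R' (tmat R' f) (emat R' g) = (\<lambda>n m. if f n = g m then unit R' else 0)"
    if "pm_ring R'" for R' :: "('k, 'r) uext" and f g
    using that by (auto simp: fun_eq_iff pm_ring.mmult_tmat_left emat_def)
  show ?thesis
  proof
    fix x y :: "('k, 'r) mring"
    show "x \<in> Gpairs d R \<Longrightarrow> y \<in> Gpairs d R \<Longrightarrow> x + y \<in> Gpairs d R"
      using smooth_add[of d "\<lambda>n m. mat x d R True n m - mat x d R False n m"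
           "\<lambda>n m. mat y d R True n m - mat y d R False n m"]
      by (simp add: Gpairs_def mat_add algebra_simps)
    show "x \<in> Gpairs d R \<Longrightarrow> - x \<in> Gpairs d R"
      using smooth_uminus[of d "\<lambda>n m. mat x d R True n m - mat x d R False n m"]
      by (simp add: Gpairs_def mat_uminus algebra_simps)
    show "x * y \<in> Gpairs d R" if "x \<in> Gpairs d R" "y \<in> Gpairs d R"
    proof -
      let ?c = "\<lambda>x. cst True x - cst False x"
      have s: "smooth d R (mat (?c z) d R i) \<longleftrightarrow> z \<in> Gpairs d R" for z i
        by (simp add: Gpairs_def mat_diff mat_cst)
      \<comment> \<open>Leibniz rule for the difference of a pair: each summand has one rapidly
        decreasing factor.\<close>
      have "?c (x * y) = ?c x * cst True y + cst False x * ?c y"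
        by (simp add: cst_simps algebra_simps)
      moreover have "smooth d R (mat (?c x * cst True y) d R True)"
        "smooth d R (mat (cst False x * ?c y) d R True)"
        using smooth_mmult_right[OF _ psi_mat[OF R]] smooth_mmult_left[OF psi_mat[OF R]] that R
        by (simp_all add: mat_mult s)
      ultimately have "smooth d R (mat (?c (x * y)) d R True)"
        by (simp only: mat_add smooth_add)
      then show ?thesis using s by blast
    qed
    show "cst False x \<in> Gpairs d R" by (simp add: Gpairs_def mat_cst smooth_zero)
    show "infl x = S0 * x * T0 + S1 * infl x * T1"
      by (rule mring_eqI) (simp add: mat_add mat_mult mat_cuntz mat_infl fun_eq_iff pm_ring.inflate_eq)
    show "infl (x * y) = infl x * infl y"
      by (rule mring_eqI) (simp add: mat_infl mat_mult pm_ring.inflate_mmult)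
    show "T0 * S0 = (1 :: ('k, 'r) mring)" "T1 * S1 = (1 :: ('k, 'r) mring)"
      "T0 * S1 = (0 :: ('k, 'r) mring)" "T1 * S0 = (0 :: ('k, 'r) mring)"
      by (rule mring_eqI; simp add: mat_mult mat_cuntz ts mat_one mat_zero mone_def spgN_def)+
    show "S0 * T0 + S1 * T1 = (1 :: ('k, 'r) mring)"
    proof (rule mring_eqI)
      fix d' i and R' :: "('k, 'r) uext" assume R': "pm_ring R'"
      have "mmult R' (emat R' sh0) (tmat R' sh0) u v + mmult R' (emat R' sh1) (tmat R' sh1) u v
         = mone R' spgN u v" for u v
      proof -
        note s = pm_ring.mmult_tmat_right[OF R' pm_ring.inj_sh(1)[OF R']]
          pm_ring.mmult_tmat_right[OF R' pm_ring.inj_sh(2)[OF R']]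
          pm_ring.mmult_tmat_right_zero[OF R']
        have r: "sh0 m \<notin> range sh1" "sh1 m \<notin> range sh0" for m by auto
        show ?thesis
          by (cases v rule: sh_cases) (auto simp: s r emat_def mone_def spgN_def)
      qed
      then show "mat (S0 * T0 + S1 * T1) d' R' i = mat 1 d' R' i"
        using R' by (simp add: mat_add mat_mult mat_cuntz mat_one fun_eq_iff)
    qed
  qed (simp_all add: cst_simps)
qed

text \<open>Zero in all components other than \<open>(d, R)\<close>. In general the unit of
  \<open>mring\<close> is thus no lift, and the projections \<open>dgl\<close> below stand in for
  it.\<close>

definition lift :: "bool \<Rightarrow> ('k, 'r::ab_group_add) uext \<Rightarrow> (nat \<Rightarrow> nat \<Rightarrow> 'r) \<Rightarrow> (nat \<Rightarrow> nat \<Rightarrow> 'r) \<Rightarrow> ('k, 'r) mring" where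
  "lift d R b a = mk (\<lambda>d' R' i n m. if d' = d \<and> R' = R then if i then b n m else a n m else 0)"

lemma mat_lift:
  assumes "pm_ring R" "psi d R a" "psi d R b"
  shows "mat (lift d R b a) d' R' i = (if d' = d \<and> R' = R then if i then b else a else (\<lambda>_ _. 0))"
proof -
  have "psi d' R' (\<lambda>n m. if d' = d \<and> R' = R then if i then b n m else a n m else 0)"
    if "pm_ring R'" for d' R' i
    using assms pm_ring.psi_zero[OF that] by (cases "d' = d \<and> R' = R"; cases i) auto
  then show ?thesis using assms unfolding lift_def by (subst mat_mk) auto
qed

subsection \<open>Kronecker products\<close>

definition krm :: "('r \<Rightarrow> 's \<Rightarrow> 't) \<Rightarrow> (nat \<Rightarrow> nat \<Rightarrow> 'r) \<Rightarrow> (nat \<Rightarrow> nat \<Rightarrow> 's) \<Rightarrow> nat \<Rightarrow> nat \<Rightarrow> 't" where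
  "krm t a b u v = t (a (dfst u) (dfst v)) (b (dsnd u) (dsnd v))"

text \<open>Common framework for the completed tensor product and, with \<open>t\<close> the
  multiplication, for a commutative ring.\<close>

locale bilin = R: pm_ring R + S: pm_ring S + T: pm_ring T
  for R :: "('k, 'r::ab_group_add) uext" and S :: "('k, 's::ab_group_add) uext"
    and T :: "('k, 't::ab_group_add) uext" +
  fixes t :: "'r \<Rightarrow> 's \<Rightarrow> 't"
  assumes t_add_left: "t (x + x') y = t x y + t x' y"
    and t_add_right: "t x (y + y') = t x y + t x y'"
    and t_mult: "mult T (t x y) (t x' y') = t (mult R x x') (mult S y y')"
    and t_bound: "r \<in> sn T \<Longrightarrow> \<exists>p\<in>sn R. \<exists>q\<in>sn S. \<forall>x y. r (t x y) \<le> p x * q y"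
    and t_ideal: "x \<in> ideal R \<Longrightarrow> y \<in> ideal S \<Longrightarrow> t x y \<in> ideal T"
begin

lemma t_zero_left: "t 0 y = 0" using t_add_left[of 0 0 y] by simp
lemma t_zero_right: "t x 0 = 0" using t_add_right[of x 0 0] by simp
lemma t_diff_right: "t x (y - y') = t x y - t x y'"
  using t_add_right[of x "y - y'" y'] by simp

lemma rsums_t_left: assumes "rsums R x s" shows "rsums T (\<lambda>i. t (x i) y) (t s y)"
proof (rule R.rsums_additive[OF assms, where f = "\<lambda>u. t u y", OF t_add_left])
  fix r assume "r \<in> sn T"
  then obtain p q where "p \<in> sn R" "\<And>x y. r (t x y) \<le> p x * q y" using t_bound by meson
  then have "\<forall>u. r (t u y) \<le> q y * p u" by (simp add: mult.commute)
  then show "\<exists>p\<in>sn R. \<exists>C. \<forall>u. r (t u y) \<le> C * p u" using \<open>p \<in> sn R\<close> by blast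
qed

lemma rsums_t_right: assumes "rsums S y s" shows "rsums T (\<lambda>i. t x (y i)) (t x s)"
proof (rule S.rsums_additive[OF assms, where f = "t x", OF t_add_right])
  fix r assume "r \<in> sn T"
  then obtain p q where "q \<in> sn S" "\<And>x y. r (t x y) \<le> p x * q y" using t_bound by meson
  then show "\<exists>q\<in>sn S. \<exists>C. \<forall>u. r (t x u) \<le> C * q u" by blast
qed

lemma ring_sum_t:
  fixes x :: "nat \<Rightarrow> 'r" and y :: "nat \<Rightarrow> 's"
  assumes x: "asum R x" and y: "asum S y"
  shows "ring_sum T (\<lambda>k. t (x (dfst k)) (y (dsnd k))) = t (ring_sum R x) (ring_sum S y)"
proof -
  let ?z = "\<lambda>(m, n). t (x m) (y n)"
  have z: "asum T ?z"
    unfolding asum_def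
  proof
    fix r assume "r \<in> sn T"
    then obtain p q where pq: "p \<in> sn R" "q \<in> sn S" "\<And>x y. r (t x y) \<le> p x * q y" using t_bound by meson
    obtain C where C: "\<And>F. finite F \<Longrightarrow> (\<Sum>i\<in>F. p (x i)) \<le> C" using x pq(1) by (auto simp: asum_def)
    obtain D where D: "\<And>F. finite F \<Longrightarrow> (\<Sum>i\<in>F. q (y i)) \<le> D" using y pq(2) by (auto simp: asum_def)
    have nn: "0 \<le> p u" "0 \<le> q v" for u v using R.sn_nonneg S.sn_nonneg pq by auto
    have "(\<Sum>i\<in>F. r (?z i)) \<le> C * D" if "finite F" for F
    proof -
      have "(\<Sum>i\<in>F. r (?z i)) \<le> (\<Sum>i\<in>F. p (x (fst i)) * q (y (snd i)))"
        using pq(3) by (intro sum_mono) (simp add: case_prod_beta)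
      also have "\<dots> \<le> (\<Sum>i\<in>fst ` F \<times> snd ` F. p (x (fst i)) * q (y (snd i)))"
        using that nn by (intro sum_mono2) (auto simp: rev_image_eqI)
      also have "\<dots> = (\<Sum>m\<in>fst ` F. p (x m)) * (\<Sum>n\<in>snd ` F. q (y n))"
        by (rule R.sum_product_pairs)
      also have "\<dots> \<le> C * D"
        using that nn C[of "fst ` F"] C[of "{}"] D by (intro mult_mono sum_nonneg) auto
      finally show ?thesis .
    qed
    then show "\<exists>C. \<forall>F. finite F \<longrightarrow> (\<Sum>i\<in>F. r (?z i)) \<le> C" by blast
  qed
  have "ring_sum T (\<lambda>k. t (x (dfst k)) (y (dsnd k))) = ring_sum T ?z"
    by (rule T.ring_sum_reindex[of prod_decode UNIV])
      (auto simp: inj_prod_decode case_prod_beta surj_prod_decode)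
  also have "\<dots> = ring_sum T (\<lambda>m. ring_sum T (\<lambda>n. ?z (m, n)))"
    using T.ring_sum_eq[OF T.rsums_Fubini[OF z]] by simp
  also have "(\<lambda>m. ring_sum T (\<lambda>n. ?z (m, n))) = (\<lambda>m. t (x m) (ring_sum S y))"
    using T.ring_sum_eq[OF rsums_t_right[OF S.asum_rsums[OF y]]] by simp
  also have "ring_sum T \<dots> = t (ring_sum R x) (ring_sum S y)"
    using T.ring_sum_eq[OF rsums_t_left[OF R.asum_rsums[OF x]]] by simp
  finally show ?thesis .
qed

lemma mmult_krm:
  assumes "psi d R a" "psi d R a'" "psi d S b" "psi d S b'"
  shows "mmult T (krm t a b) (krm t a' b') = krm t (mmult R a a') (mmult S b b')"
  using ring_sum_t[OF R.psi_asum[OF assms(1,2)] S.psi_asum[OF assms(3,4)]]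
  by (simp add: fun_eq_iff krm_def mmult_def t_mult)

lemma krm_nonzero: "krm t a b u v \<noteq> 0 \<Longrightarrow> a (dfst u) (dfst v) \<noteq> 0 \<and> b (dsnd u) (dsnd v) \<noteq> 0"
  by (auto simp: krm_def t_zero_left t_zero_right)

lemma mem_encode_image: "dfst u \<in> A \<Longrightarrow> dsnd u \<in> B \<Longrightarrow> u \<in> prod_encode ` (A \<times> B)"
  by (metis SigmaI image_eqI prod.collapse prod_decode_inverse)

lemma psi_krm: assumes "psi d R a" "psi d S b" shows "psi d T (krm t a b)"
proof (cases d)
  case True
  have "{v. krm t a b u v \<noteq> 0} \<subseteq> prod_encode ` ({m. a (dfst u) m \<noteq> 0} \<times> {m. b (dsnd u) m \<noteq> 0})"
    "{v. krm t a b v u \<noteq> 0} \<subseteq> prod_encode ` ({m. a m (dfst u) \<noteq> 0} \<times> {m. b m (dsnd u) \<noteq> 0})" for u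
    using krm_nonzero by (auto intro!: mem_encode_image)
  moreover have "finite (prod_encode ` ({m. a n m \<noteq> 0} \<times> {m. b n' m \<noteq> 0}))"
    "finite (prod_encode ` ({m. a m n \<noteq> 0} \<times> {m. b m n' \<noteq> 0}))" for n n'
    using assms True by (auto simp: psi_def)
  ultimately show ?thesis using True unfolding psi_def by (simp, meson finite_subset)
next
  case False
  show ?thesis
    unfolding psi_def using False
  proof (simp, intro ballI allI)
    fix r k assume "r \<in> sn T"
    then obtain p q where pq: "p \<in> sn R" "q \<in> sn S" "\<And>x y. r (t x y) \<le> p x * q y" using t_bound by meson
    \<comment> \<open>As for \<open>inflate\<close>, coding a pair by one number doubles the
      exponent; here each coordinate is bounded by its own factor.\<close>
    obtain C l where C: "0 \<le> C" "\<And>n m. w n ^ (2 * k) * p (a n m) \<le> C * w m ^ l"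
      "\<And>n m. w m ^ (2 * k) * p (a n m) \<le> C * w n ^ l"
      using R.psi_bound[OF assms(1) False pq(1), of "2 * k"] by metis
    obtain D h where D: "0 \<le> D" "\<And>n m. w n ^ (2 * k) * q (b n m) \<le> D * w m ^ h"
      "\<And>n m. w m ^ (2 * k) * q (b n m) \<le> D * w n ^ h"
      using S.psi_bound[OF assms(2) False pq(2), of "2 * k"] by metis
    have nn: "0 \<le> p u" "0 \<le> q v" for u v using R.sn_nonneg S.sn_nonneg pq by auto
    have le: "w u ^ k * z \<le> C * D * w v ^ (l + h)"
      if "z \<le> x * y" "0 \<le> x" "0 \<le> y" "w (dfst u) ^ (2 * k) * x \<le> C * w (dfst v) ^ l"
        "w (dsnd u) ^ (2 * k) * y \<le> D * w (dsnd v) ^ h" for u v x y z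
    proof -
      have "w u ^ k \<le> ((w (dfst u) * w (dsnd u)) ^ 2) ^ k" by (intro power_mono w_le_decode) simp
      also have "\<dots> = w (dfst u) ^ (2 * k) * w (dsnd u) ^ (2 * k)"
        by (simp add: power_mult_distrib power_mult)
      finally have "w u ^ k * z \<le> w (dfst u) ^ (2 * k) * w (dsnd u) ^ (2 * k) * (x * y)"
        using that(1-3) by (meson mult_left_mono mult_right_mono order_trans zero_le_power w_pos less_imp_le mult_nonneg_nonneg)
      also have "\<dots> = (w (dfst u) ^ (2 * k) * x) * (w (dsnd u) ^ (2 * k) * y)" by simp
      also have "\<dots> \<le> (C * w (dfst v) ^ l) * (D * w (dsnd v) ^ h)"
        by (rule mult_mono[OF that(4,5)]) (use that C(1) in auto)
      also have "\<dots> \<le> (C * w v ^ l) * (D * w v ^ h)"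
        using C(1) D(1) dfst_le[of v] dsnd_le[of v] by (intro mult_mono power_mono) auto
      finally show ?thesis by (simp add: power_add mult_ac)
    qed
    have "w u ^ k * r (krm t a b u v) \<le> C * D * w v ^ (l + h)"
      "w v ^ k * r (krm t a b u v) \<le> C * D * w u ^ (l + h)" for u v
      unfolding krm_def by (rule le[OF pq(3) nn C(2) D(2)], rule le[OF pq(3) nn C(3) D(3)])
    then show "\<exists>C l. \<forall>n m. w n ^ k * r (krm t a b n m) \<le> C * w m ^ l \<and> w m ^ k * r (krm t a b n m) \<le> C * w n ^ l"
      by blast
  qed
qed

lemma smooth_krm: assumes "smooth d R a" "smooth d S b" shows "smooth d T (krm t a b)"
proof -
  have "krm t a b u v \<in> ideal T" for u v
    using assms by (simp add: smooth_def krm_def t_ideal)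
  moreover have "finite {(u, v). krm t a b u v \<noteq> 0}" if d
  proof (rule finite_subset)
    let ?A = "{(n, m). a n m \<noteq> 0}" and ?B = "{(n, m). b n m \<noteq> 0}"
    show "{(u, v). krm t a b u v \<noteq> 0} \<subseteq>
        prod_encode ` (fst ` ?A \<times> fst ` ?B) \<times> prod_encode ` (snd ` ?A \<times> snd ` ?B)"
    proof (clarsimp, intro conjI mem_encode_image)
      fix u v assume "krm t a b u v \<noteq> 0"
      then have "(dfst u, dfst v) \<in> ?A" "(dsnd u, dsnd v) \<in> ?B" using krm_nonzero by auto
      then show "dfst u \<in> fst ` ?A" "dfst v \<in> snd ` ?A" "dsnd u \<in> fst ` ?B" "dsnd v \<in> snd ` ?B"
        by (auto simp: image_iff intro: bexI[rotated])
    qed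
    show "finite (prod_encode ` (fst ` ?A \<times> fst ` ?B) \<times> prod_encode ` (snd ` ?A \<times> snd ` ?B))"
      using assms that by (auto simp: smooth_def)
  qed
  moreover have "\<exists>C. \<forall>u v. w u ^ k * w v ^ k * r (krm t a b u v) \<le> C"
    if nd: "\<not> d" and r: "r \<in> sn T" for r k
  proof -
    obtain p q where pq: "p \<in> sn R" "q \<in> sn S" "\<And>x y. r (t x y) \<le> p x * q y" using t_bound[OF r] by meson
    obtain C where C: "\<And>n m. w n ^ (2 * k) * w m ^ (2 * k) * p (a n m) \<le> C"
      using R.smooth_bound[OF assms(1) nd pq(1)] by metis
    obtain D where D: "\<And>n m. w n ^ (2 * k) * w m ^ (2 * k) * q (b n m) \<le> D"
      using S.smooth_bound[OF assms(2) nd pq(2)] by metis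
    have nn: "0 \<le> p u" "0 \<le> q v" for u v using R.sn_nonneg S.sn_nonneg pq by auto
    have C0: "0 \<le> C" using order_trans[OF _ C[of 0 0]] nn by simp
    have wle: "w u ^ k \<le> w (dfst u) ^ (2 * k) * w (dsnd u) ^ (2 * k)" for u
    proof -
      have "w u ^ k \<le> ((w (dfst u) * w (dsnd u)) ^ 2) ^ k" by (intro power_mono w_le_decode) simp
      then show ?thesis by (simp add: power_mult_distrib power_mult)
    qed
    have "w u ^ k * w v ^ k * r (krm t a b u v) \<le> C * D" for u v
    proof -
      have "w u ^ k * w v ^ k * r (krm t a b u v) \<le>
          w u ^ k * w v ^ k * (p (a (dfst u) (dfst v)) * q (b (dsnd u) (dsnd v)))"
        using pq(3) by (intro mult_left_mono) (auto simp: krm_def)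
      also have "\<dots> \<le> (w (dfst u) ^ (2 * k) * w (dsnd u) ^ (2 * k)) * (w (dfst v) ^ (2 * k) * w (dsnd v) ^ (2 * k)) *
          (p (a (dfst u) (dfst v)) * q (b (dsnd u) (dsnd v)))"
        using nn wle by (intro mult_right_mono mult_mono) auto
      also have "\<dots> = (w (dfst u) ^ (2 * k) * w (dfst v) ^ (2 * k) * p (a (dfst u) (dfst v))) *
          (w (dsnd u) ^ (2 * k) * w (dsnd v) ^ (2 * k) * q (b (dsnd u) (dsnd v)))" by simp
      also have "\<dots> \<le> C * D" using C D nn C0 by (intro mult_mono) auto
      finally show ?thesis .
    qed
    then show ?thesis by blast
  qed
  ultimately show ?thesis unfolding smooth_def by simp
qed

definition kr :: "bool \<Rightarrow> ('k, 'r) mring \<Rightarrow> ('k, 's) mring \<Rightarrow> ('k, 't) mring" where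
  "kr d f g = lift d T (krm t (mat f d R True) (mat g d S True)) (krm t (mat f d R False) (mat g d S False))"

lemma mat_kr: "mat (kr d f g) d' T' i =
    (if d' = d \<and> T' = T then krm t (mat f d R i) (mat g d S i) else (\<lambda>_ _. 0))"
  unfolding kr_def
  by (subst mat_lift) (auto intro: psi_krm psi_mat R.pm_ring_axioms S.pm_ring_axioms T.pm_ring_axioms)

lemma tensor_mring:
  "tensor (Gpairs d R) (cst False) S0 S1 T0 T1 infl (Gpairs d S) (cst False) S0 S1 T0 T1 infl
     (Gpairs d T) (cst False) S0 S1 T0 T1 infl (cst True) (kr d)"
proof -
  note pm = R.pm_ring_axioms S.pm_ring_axioms T.pm_ring_axioms
  interpret X: stable "Gpairs d R" "cst False" S0 S1 T0 T1 infl by (rule stable_mring[OF pm(1)])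
  interpret Y: stable "Gpairs d S" "cst False" S0 S1 T0 T1 infl by (rule stable_mring[OF pm(2)])
  interpret Z: stable "Gpairs d T" "cst False" S0 S1 T0 T1 infl by (rule stable_mring[OF pm(3)])
  show ?thesis
  proof
    fix x x' :: "('k, 'r) mring" and v v' :: "('k, 's) mring"
    show "kr d (x + x') v = kr d x v + kr d x' v" "kr d x (v + v') = kr d x v + kr d x v'"
      by (rule mring_eqI; auto simp: mat_kr mat_simps krm_def t_add_left t_add_right fun_eq_iff)+
    have z: "mmult T' (\<lambda>_ _. 0) (\<lambda>_ _. 0) = (\<lambda>_ _. 0)" if "pm_ring T'" for T' :: "('k, 't) uext"
      using that by (simp add: mmult_def pm_ring.mult_zero_left pm_ring.ring_sum_zero)
    show "kr d x v * kr d x' v' = kr d (x * x') (v * v')"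
      by (rule mring_eqI)
        (auto simp: mat_kr mat_mult z pm mmult_krm[OF psi_mat psi_mat psi_mat psi_mat])
    show "cst False (kr d x v) = kr d (cst False x) (cst False v)"
      by (rule mring_eqI) (auto simp: mat_kr mat_cst)
    show "kr d (cst True x - cst False x) v \<in> Gpairs d T" if "x \<in> Gpairs d R" "v \<in> Gpairs d S"
    proof -
      let ?x = "\<lambda>n m. mat x d R True n m - mat x d R False n m"
      let ?v = "\<lambda>n m. mat v d S True n m - mat v d S False n m"
      have "smooth d T (krm t ?x ?v)" using that by (intro smooth_krm) (simp_all add: Gpairs_def)
      moreover have "krm t ?x ?v = (\<lambda>n m. krm t ?x (mat v d S True) n m - krm t ?x (mat v d S False) n m)"
        by (simp add: fun_eq_iff krm_def t_diff_right)
      ultimately show ?thesis by (simp add: Gpairs_def mat_kr mat_diff mat_cst)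
    qed
  qed (simp_all add: cst_simps)
qed

end

section \<open>Cutting a regular idempotent down to its index set\<close>

context stable
begin

text \<open>Over the index set itself the diagonal entry is \<open>e + h11\<close>; the discrepancy
  to \<open>1 + h11\<close> is the orthogonal constant \<open>0 \<oplus> (1 - e)\<close>.\<close>

lemma regular_cut:
  assumes "regular e U" "e * e = e" "\<pi> e = e"
  shows "idem (dsm e e * U)" "seq (dsm e e * U) U"
proof -
  from assms(1) obtain h00 h01 h10 h11 where h: "h00 \<in> G" "h01 \<in> G" "h10 \<in> G" "h11 \<in> G"
     "idem U" "U = blk h00 h01 h10 (1 + h11)"
     "e * h00 * e = h00" "e * h01 * e = h01" "e * h10 * e = h10" "e * h11 * e = h11"
    unfolding regular_def by auto
  have eh: "e * h00 = h00" "h00 * e = h00" "e * h01 = h01" "h01 * e = h01"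
      "e * h10 = h10" "h10 * e = h10" "e * h11 = h11" "h11 * e = h11"
    using h(7-10) assms(2) by (metis mult.assoc)+
  let ?E = "dsm e e"
  have 1: "?E * U = blk h00 h01 h10 (e + h11)" "U * ?E = blk h00 h01 h10 (e + h11)"
    by (simp_all add: dsm_def h(6) blk_mult eh distrib_left distrib_right)
  have UU: "U * U = U" "U \<in> G" using h(5) by (auto simp: idem_def)
  have "?E * U * (?E * U) = ?E * (?E * U) * U" by (metis 1 mult.assoc)
  also have "\<dots> = ?E * U" by (metis UU(1) assms(2) dsm_mult mult.assoc)
  finally show i: "idem (?E * U)"
    using UU assms by (simp add: idem_def G_mult dsm_G G_C)
  let ?c = "dsm 0 (1 - e)"
  have c: "idem ?c" "\<pi> ?c = ?c"
    using assms by (simp_all add: idem_def dsm_mult dsm_G G_intros G_C pi_dsm pi_simps algebra_simps)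
  have cc: "?c = blk 0 0 0 (1 - e)" by (simp add: dsm_def)
  have "?E * U + ?c = U" unfolding 1 cc by (simp add: blk_add h(6) add.commute)
  moreover have "seq (?E * U + ?c) (?E * U)"
    by (rule seq_orth_trivial[OF i c]; unfold 1 cc; simp add: blk_mult blk_zero algebra_simps eh assms)
  ultimately show "seq (?E * U) U" using seq_sym by metis
qed

lemma regular_zero: "regular 0 (blk 0 0 0 1)"
  unfolding regular_def
  by (auto simp: idem_def blk_mult blk_G G_intros pi_zero intro!: bexI[of _ 0])

lemma regular_zero_unique: "regular 0 U \<Longrightarrow> U = blk 0 0 0 1"
  unfolding regular_def by auto

end

subsection \<open>Embedding index sets into the natural numbers\<close>

text \<open>Unlike the bijection in \<open>is_spg\<close>, \<open>j\<close> may have any image. So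
  finite and infinite index sets are treated alike, and sums and products never have to be
  renumbered.\<close>

definition is_emb :: "('i \<Rightarrow> nat) \<Rightarrow> 'i spg \<Rightarrow> bool" where
  "is_emb j \<Omega> \<longleftrightarrow> inj_on j (pts \<Omega>) \<and>
     growth \<Omega> = {f. \<exists>g\<in>poly_growth. \<forall>x\<in>pts \<Omega>. f x = g (j x)}"

lemma is_emb_finite:
  assumes "finite (pts \<Omega>)" "growth \<Omega> = UNIV" "inj_on j (pts \<Omega>)" shows "is_emb j \<Omega>"
proof -
  have "\<exists>g\<in>poly_growth. \<forall>x\<in>pts \<Omega>. f x = g (j x)" for f
  proof (intro bexI ballI)
    \<comment> \<open>Extension by zero is bounded on a finite set, so every injection of a finite
      index set is an embedding.\<close>
    let ?g = "\<lambda>n. if n \<in> j ` pts \<Omega> then f (inv_into (pts \<Omega>) j n) else 0"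
    show "f x = ?g (j x)" if "x \<in> pts \<Omega>" for x using that assms(3) by simp
    have le: "\<bar>f x\<bar> \<le> (\<Sum>x\<in>pts \<Omega>. \<bar>f x\<bar>)" if "x \<in> pts \<Omega>" for x
      using assms(1) that by (intro member_le_sum) auto
    have "\<bar>?g n\<bar> \<le> (\<Sum>x\<in>pts \<Omega>. \<bar>f x\<bar>) * w n ^ 0" for n
      using le[OF inv_into_into[of n j "pts \<Omega>"]] by (auto intro: sum_nonneg)
    then show "?g \<in> poly_growth" by (rule poly_growth_mono_bound)
  qed
  then show ?thesis using assms by (auto simp: is_emb_def)
qed

lemma is_spg_emb: assumes "is_spg \<Omega>" obtains j where "is_emb j \<Omega>"
  using assms unfolding is_spg_def
proof (elim disjE exE conjE)
  assume "finite (pts \<Omega>)" "growth \<Omega> = UNIV"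
  moreover from this(1) obtain j :: "'a \<Rightarrow> nat" where "inj_on j (pts \<Omega>)"
    by (meson finite_imp_inj_to_nat_seg)
  ultimately show thesis using that is_emb_finite by blast
next
  fix q assume "bij_betw q (pts \<Omega>) (UNIV :: nat set)"
    "growth \<Omega> = {f. \<exists>g\<in>poly_growth. \<forall>x\<in>pts \<Omega>. f x = g (q x)}"
  then show thesis using that unfolding is_emb_def bij_betw_def by blast
qed

lemma is_emb_spgN: "is_emb (\<lambda>n. n) spgN"
proof -
  have "(\<exists>g\<in>poly_growth. \<forall>x. f x = g x) \<longleftrightarrow> f \<in> poly_growth" for f
    by (metis ext)
  then show ?thesis by (simp add: is_emb_def spgN_def)
qed

lemma is_spg_spgN: "is_spg spgN"
proof -
  have "(\<exists>g\<in>poly_growth. \<forall>x. f x = g (id x)) \<longleftrightarrow> f \<in> poly_growth" for f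
    by (metis ext id_apply)
  then show ?thesis
    unfolding is_spg_def by (intro disjI2 exI[of _ id]) (simp add: spgN_def)
qed

lemma poly_growth_add: assumes "f \<in> poly_growth" "g \<in> poly_growth" shows "(\<lambda>n. f n + g n) \<in> poly_growth"
proof -
  obtain C k where C: "0 \<le> C" "\<And>n. \<bar>f n\<bar> \<le> C * w n ^ k" using assms(1) poly_growth_bound by blast
  obtain D l where D: "0 \<le> D" "\<And>n. \<bar>g n\<bar> \<le> D * w n ^ l" using assms(2) poly_growth_bound by blast
  have "\<bar>f n + g n\<bar> \<le> (C + D) * w n ^ (k + l)" for n
  proof -
    have "\<bar>f n + g n\<bar> \<le> C * w n ^ k + D * w n ^ l" using C(2)[of n] D(2)[of n] by linarith
    also have "\<dots> \<le> C * w n ^ (k + l) + D * w n ^ (k + l)"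
      using C(1) D(1) by (intro add_mono mult_left_mono w_mono) auto
    finally show ?thesis by (simp add: distrib_right)
  qed
  then show ?thesis by (rule poly_growth_mono_bound)
qed

lemma comparable_growth:
  assumes "comparable f" "g \<in> poly_growth"
  shows "(\<lambda>n. g (f n)) \<in> poly_growth" (is ?A)
    and "\<exists>g'\<in>poly_growth. (\<forall>n. g' (f n) = g n) \<and> (\<forall>u. u \<notin> range f \<longrightarrow> g' u = 0)" (is ?B)
proof -
  obtain C l where C: "\<And>n. w (f n) \<le> C * w n ^ l \<and> w n \<le> C * w (f n) ^ l"
    using assms(1) unfolding comparable_def by blast
  obtain D k where D: "0 \<le> D" "\<And>n. \<bar>g n\<bar> \<le> D * w n ^ k" using assms(2) poly_growth_bound by blast
  have pw: "D * u ^ k \<le> D * C ^ k * v ^ (l * k)" if "u \<le> C * v ^ l" "0 \<le> u" for u v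
  proof -
    have "u ^ k \<le> (C * v ^ l) ^ k" by (rule power_mono[OF that])
    then show ?thesis using mult_left_mono[OF _ D(1)] by (simp add: power_mult_distrib power_mult mult.assoc)
  qed
  have "\<bar>g (f n)\<bar> \<le> D * C ^ k * w n ^ (l * k)" for n
    using D(2)[of "f n"] pw[of "w (f n)" "w n"] C[of n] by linarith
  then show ?A by (rule poly_growth_mono_bound)
  have inj: "inj f" using assms(1) by (simp add: comparable_def)
  let ?g = "\<lambda>u. if u \<in> range f then g (inv f u) else 0"
  have "\<bar>?g u\<bar> \<le> \<bar>D * C ^ k\<bar> * w u ^ (l * k)" for u
  proof (cases "u \<in> range f")
    case True
    then obtain n where n: "u = f n" by blast
    have "\<bar>g n\<bar> \<le> D * C ^ k * w u ^ (l * k)"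
      using D(2)[of n] pw[of "w n" "w (f n)"] C[of n] by (simp add: n)
    also have "\<dots> \<le> \<bar>D * C ^ k\<bar> * w u ^ (l * k)" by (intro mult_right_mono) auto
    finally show ?thesis using inj by (simp add: n)
  qed simp
  then have "?g \<in> poly_growth" by (rule poly_growth_mono_bound)
  then show ?B using inj by (intro bexI[of _ ?g]) auto
qed

definition jsum :: "('i \<Rightarrow> nat) \<Rightarrow> ('j \<Rightarrow> nat) \<Rightarrow> 'i + 'j \<Rightarrow> nat" where
  "jsum j k = case_sum (\<lambda>n. sh0 (j n)) (\<lambda>n. sh1 (k n))"

lemma jsum_simps [simp]: "jsum j k (Inl n) = sh0 (j n)" "jsum j k (Inr m) = sh1 (k m)"
  by (simp_all add: jsum_def)

lemma is_emb_sum: assumes "is_emb j \<Omega>" "is_emb k \<Xi>" shows "is_emb (jsum j k) (spg_sum \<Omega> \<Xi>)"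
proof -
  have inj: "inj_on (jsum j k) (pts (spg_sum \<Omega> \<Xi>))"
    using assms by (auto simp: is_emb_def spg_sum_def intro!: inj_onI dest: inj_onD)
  have "(f \<circ> Inl \<in> growth \<Omega> \<and> f \<circ> Inr \<in> growth \<Xi>) \<longleftrightarrow>
      (\<exists>g\<in>poly_growth. \<forall>x\<in>pts \<Omega> <+> pts \<Xi>. f x = g (jsum j k x))" for f
  proof
    assume "f \<circ> Inl \<in> growth \<Omega> \<and> f \<circ> Inr \<in> growth \<Xi>"
    then obtain g1 g2 where g: "g1 \<in> poly_growth" "g2 \<in> poly_growth"
      "\<And>n. n \<in> pts \<Omega> \<Longrightarrow> f (Inl n) = g1 (j n)" "\<And>n. n \<in> pts \<Xi> \<Longrightarrow> f (Inr n) = g2 (k n)"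
      using assms by (auto simp: is_emb_def)
    obtain g1' where 1: "g1' \<in> poly_growth" "\<And>n. g1' (sh0 n) = g1 n" "\<And>u. u \<notin> range sh0 \<Longrightarrow> g1' u = 0"
      using comparable_growth(2)[OF comparable_sh0 g(1)] by blast
    obtain g2' where 2: "g2' \<in> poly_growth" "\<And>n. g2' (sh1 n) = g2 n" "\<And>u. u \<notin> range sh1 \<Longrightarrow> g2' u = 0"
      using comparable_growth(2)[OF comparable_sh1 g(2)] by blast
    have r: "sh0 m \<notin> range sh1" "sh1 m \<notin> range sh0" for m by auto
    show "\<exists>g\<in>poly_growth. \<forall>x\<in>pts \<Omega> <+> pts \<Xi>. f x = g (jsum j k x)"
      using 1 2 g r by (intro bexI[of _ "\<lambda>n. g1' n + g2' n"] poly_growth_add) auto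
  next
    assume "\<exists>g\<in>poly_growth. \<forall>x\<in>pts \<Omega> <+> pts \<Xi>. f x = g (jsum j k x)"
    then obtain g where g: "g \<in> poly_growth" "\<And>x. x \<in> pts \<Omega> <+> pts \<Xi> \<Longrightarrow> f x = g (jsum j k x)" by blast
    have "f (Inl n) = g (sh0 (j n))" if "n \<in> pts \<Omega>" for n using g(2)[OF InlI[OF that]] by simp
    then have "f \<circ> Inl \<in> growth \<Omega>"
      using assms(1) comparable_growth(1)[OF comparable_sh0 g(1)] unfolding is_emb_def by auto
    have "f (Inr n) = g (sh1 (k n))" if "n \<in> pts \<Xi>" for n using g(2)[OF InrI[OF that]] by simp
    then have "f \<circ> Inr \<in> growth \<Xi>"
      using assms(2) comparable_growth(1)[OF comparable_sh1 g(1)] unfolding is_emb_def by auto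
    then show "f \<circ> Inl \<in> growth \<Omega> \<and> f \<circ> Inr \<in> growth \<Xi>" using \<open>f \<circ> Inl \<in> growth \<Omega>\<close> by simp
  qed
  then show ?thesis using inj by (auto simp: is_emb_def spg_sum_def)
qed

definition jprod :: "('i \<Rightarrow> nat) \<Rightarrow> ('j \<Rightarrow> nat) \<Rightarrow> 'i \<times> 'j \<Rightarrow> nat" where
  "jprod j k = (\<lambda>(n, m). prod_encode (j n, k m))"

lemma is_emb_prod: assumes "is_emb j \<Omega>" "is_emb k \<Xi>" shows "is_emb (jprod j k) (spg_prod \<Omega> \<Xi>)"
proof -
  let ?J = "jprod j k" and ?P = "pts \<Omega> \<times> pts \<Xi>"
  have inj: "inj_on ?J ?P"
    using assms by (auto simp: is_emb_def jprod_def intro!: inj_onI dest: inj_onD)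
  have wJ: "w (j n) \<le> w (?J (n, m))" "w (k m) \<le> w (?J (n, m))" for n m
    using le_prod_encode_1[of "j n" "k m"] le_prod_encode_2[of "k m" "j n"] by (simp_all add: jprod_def)
  have "(\<exists>f1\<in>growth \<Omega>. \<exists>f2\<in>growth \<Xi>. \<forall>n\<in>pts \<Omega>. \<forall>m\<in>pts \<Xi>. \<bar>f (n, m)\<bar> \<le> f1 n * f2 m) \<longleftrightarrow>
      (\<exists>g\<in>poly_growth. \<forall>x\<in>?P. f x = g (?J x))" for f
  proof
    assume "\<exists>f1\<in>growth \<Omega>. \<exists>f2\<in>growth \<Xi>. \<forall>n\<in>pts \<Omega>. \<forall>m\<in>pts \<Xi>. \<bar>f (n, m)\<bar> \<le> f1 n * f2 m"
    then obtain g1 g2 where g: "g1 \<in> poly_growth" "g2 \<in> poly_growth"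
      "\<And>n m. n \<in> pts \<Omega> \<Longrightarrow> m \<in> pts \<Xi> \<Longrightarrow> \<bar>f (n, m)\<bar> \<le> g1 (j n) * g2 (k m)"
      using assms unfolding is_emb_def by auto
    obtain C l where C: "0 \<le> C" "\<And>n. \<bar>g1 n\<bar> \<le> C * w n ^ l" using g(1) poly_growth_bound by blast
    obtain D h where D: "0 \<le> D" "\<And>n. \<bar>g2 n\<bar> \<le> D * w n ^ h" using g(2) poly_growth_bound by blast
    let ?g = "\<lambda>u. if u \<in> ?J ` ?P then f (inv_into ?P ?J u) else 0"
    have "\<bar>?g u\<bar> \<le> C * D * w u ^ (l + h)" for u
    proof (cases "u \<in> ?J ` ?P")
      case True
      then obtain n m where u: "u = ?J (n, m)" "n \<in> pts \<Omega>" "m \<in> pts \<Xi>" by auto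
      have "\<bar>f (n, m)\<bar> \<le> \<bar>g1 (j n)\<bar> * \<bar>g2 (k m)\<bar>"
        using g(3)[OF u(2,3)] by (metis abs_ge_self abs_mult order_trans)
      also have "\<dots> \<le> (C * w (j n) ^ l) * (D * w (k m) ^ h)"
        by (rule mult_mono[OF C(2) D(2)]) (use C(1) in auto)
      also have "\<dots> \<le> (C * w u ^ l) * (D * w u ^ h)"
        using C(1) D(1) wJ[where n = n and m = m] by (intro mult_mono mult_left_mono power_mono) (auto simp: u)
      finally show ?thesis using u inj by (simp add: inv_into_f_f power_add mult_ac)
    qed (use C D in simp)
    then have "?g \<in> poly_growth" by (rule poly_growth_mono_bound)
    then show "\<exists>g\<in>poly_growth. \<forall>x\<in>?P. f x = g (?J x)"
      using inj by (intro bexI[of _ ?g]) auto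
  next
    assume "\<exists>g\<in>poly_growth. \<forall>x\<in>?P. f x = g (?J x)"
    then obtain g where g: "g \<in> poly_growth" "\<And>x. x \<in> ?P \<Longrightarrow> f x = g (?J x)" by blast
    obtain C l where C: "0 \<le> C" "\<And>n. \<bar>g n\<bar> \<le> C * w n ^ l" using g(1) poly_growth_bound by blast
    \<comment> \<open>The quadratic bound on codes splits a polynomial in the code into a product of
      polynomials in the coordinates.\<close>
    have "\<bar>f (n, m)\<bar> \<le> (C * w (j n) ^ (2 * l)) * w (k m) ^ (2 * l)" if "n \<in> pts \<Omega>" "m \<in> pts \<Xi>" for n m
    proof -
      have "\<bar>f (n, m)\<bar> \<le> C * w (?J (n, m)) ^ l" using g(2)[of "(n, m)"] C(2) that by simp
      also have "\<dots> \<le> C * ((w (j n) * w (k m)) ^ 2) ^ l"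
        using C(1) w_encode_le[of "j n" "k m"] by (intro mult_left_mono power_mono) (auto simp: jprod_def)
      also have "\<dots> = (C * w (j n) ^ (2 * l)) * w (k m) ^ (2 * l)"
        by (simp add: power_mult_distrib power_mult)
      finally show ?thesis .
    qed
    moreover have "(\<lambda>n. C * w n ^ (2 * l)) \<in> poly_growth"
      by (rule poly_growth_mono_bound[of _ "\<bar>C\<bar>" "2 * l"]) (simp add: abs_mult)
    then have "(\<lambda>n. C * w (j n) ^ (2 * l)) \<in> growth \<Omega>"
      using assms(1) unfolding is_emb_def by auto
    moreover have "(\<lambda>n. w (k n) ^ (2 * l)) \<in> growth \<Xi>"
      using assms(2) poly_growth_w[of "2 * l"] unfolding is_emb_def by auto
    ultimately show "\<exists>f1\<in>growth \<Omega>. \<exists>f2\<in>growth \<Xi>. \<forall>n\<in>pts \<Omega>. \<forall>m\<in>pts \<Xi>. \<bar>f (n, m)\<bar> \<le> f1 n * f2 m"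
      by (intro bexI[of _ "\<lambda>n. C * w (j n) ^ (2 * l)"] bexI[of _ "\<lambda>n. w (k n) ^ (2 * l)"]) auto
  qed
  then show ?thesis using inj by (auto simp: is_emb_def spg_prod_def)
qed

text \<open>Prepares the reduction of the left tensor product to the right one by exchanging the
  factors.\<close>

lemma is_emb_swap:
  assumes "is_emb j (spg_prod \<Xi> \<Omega>)" shows "is_emb (\<lambda>(n, m). j (m, n)) (spg_prod \<Omega> \<Xi>)"
proof -
  have inj: "inj_on (\<lambda>(n, m). j (m, n)) (pts \<Omega> \<times> pts \<Xi>)"
    using assms by (auto simp: is_emb_def spg_prod_def intro!: inj_onI dest: inj_onD)
  have 1: "f \<in> growth (spg_prod \<Omega> \<Xi>) \<longleftrightarrow> (\<lambda>(m, n). f (n, m)) \<in> growth (spg_prod \<Xi> \<Omega>)" for f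
  proof -
    have comm: "\<exists>f1\<in>B. \<exists>f2\<in>A. \<forall>n\<in>Q. \<forall>m\<in>P. F m n \<le> f1 n * f2 m"
      if h: "\<exists>f1\<in>A. \<exists>f2\<in>B. \<forall>n\<in>P. \<forall>m\<in>Q. F n m \<le> f1 n * f2 m"
      for A :: "('c \<Rightarrow> real) set" and B :: "('d \<Rightarrow> real) set" and P Q F
    proof -
      obtain f1 f2 where "f1 \<in> A" "f2 \<in> B" "\<forall>n\<in>P. \<forall>m\<in>Q. F n m \<le> f1 n * f2 m" using h by blast
      then show ?thesis by (intro bexI[of _ f2] bexI[of _ f1]) (auto simp: mult.commute)
    qed
    show ?thesis unfolding spg_prod_def by (simp, rule iffI) (erule comm)+
  qed
  have 2: "growth (spg_prod \<Xi> \<Omega>) = {f. \<exists>g\<in>poly_growth. \<forall>x\<in>pts (spg_prod \<Xi> \<Omega>). f x = g (j x)}"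
    using assms by (simp add: is_emb_def)
  have 3: "(\<forall>x\<in>pts (spg_prod \<Xi> \<Omega>). (\<lambda>(m, n). f (n, m)) x = g (j x)) \<longleftrightarrow>
      (\<forall>x\<in>pts (spg_prod \<Omega> \<Xi>). f x = g ((\<lambda>(n, m). j (m, n)) x))" for f g
    by (auto simp: spg_prod_def)
  have "f \<in> growth (spg_prod \<Omega> \<Xi>) \<longleftrightarrow>
      (\<exists>g\<in>poly_growth. \<forall>x\<in>pts (spg_prod \<Omega> \<Xi>). f x = g ((\<lambda>(n, m). j (m, n)) x))" for f
    unfolding 1[of f] 2 mem_Collect_eq 3[of f] by (rule refl)
  then have "growth (spg_prod \<Omega> \<Xi>) =
      {f. \<exists>g\<in>poly_growth. \<forall>x\<in>pts (spg_prod \<Omega> \<Xi>). f x = g ((\<lambda>(n, m). j (m, n)) x)}" by blast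
  moreover have "inj_on (\<lambda>(n, m). j (m, n)) (pts (spg_prod \<Omega> \<Xi>))" using inj by (simp add: spg_prod_def)
  ultimately show ?thesis unfolding is_emb_def by blast
qed

section \<open>Transport of matrices along embeddings\<close>

lemma emb_growthI: "is_emb j \<Omega> \<Longrightarrow> g \<in> poly_growth \<Longrightarrow> (\<lambda>x. g (j x)) \<in> growth \<Omega>"
  unfolding is_emb_def by auto

lemma emb_growthD:
  assumes "is_emb j \<Omega>" "f \<in> growth \<Omega>"
  obtains g where "g \<in> poly_growth" "\<And>x. x \<in> pts \<Omega> \<Longrightarrow> f x = g (j x)"
  using assms unfolding is_emb_def by auto

text \<open>Extension by zero along two embeddings. It is multiplicative, but an identity matrix
  becomes the projection \<open>dg\<close> onto the image.\<close>

definition em :: "('i \<Rightarrow> nat) \<Rightarrow> 'i spg \<Rightarrow> ('j \<Rightarrow> nat) \<Rightarrow> 'j spg \<Rightarrow> ('i \<Rightarrow> 'j \<Rightarrow> 'r::zero) \<Rightarrow> nat \<Rightarrow> nat \<Rightarrow> 'r" where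
  "em j \<Omega> k \<Xi> a u v = (if u \<in> j ` pts \<Omega> \<and> v \<in> k ` pts \<Xi>
     then a (inv_into (pts \<Omega>) j u) (inv_into (pts \<Xi>) k v) else 0)"

definition res :: "('i \<Rightarrow> nat) \<Rightarrow> 'i spg \<Rightarrow> ('j \<Rightarrow> nat) \<Rightarrow> 'j spg \<Rightarrow> (nat \<Rightarrow> nat \<Rightarrow> 'r::zero) \<Rightarrow> 'i \<Rightarrow> 'j \<Rightarrow> 'r" where
  "res j \<Omega> k \<Xi> A = (\<lambda>n m. if n \<in> pts \<Omega> \<and> m \<in> pts \<Xi> then A (j n) (k m) else 0)"

lemma is_emb_inj: "is_emb j \<Omega> \<Longrightarrow> inj_on j (pts \<Omega>)"
  by (simp add: is_emb_def)

lemma em_at: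
  "is_emb j \<Omega> \<Longrightarrow> is_emb k \<Xi> \<Longrightarrow> n \<in> pts \<Omega> \<Longrightarrow> m \<in> pts \<Xi> \<Longrightarrow> em j \<Omega> k \<Xi> a (j n) (k m) = a n m"
  by (simp add: em_def is_emb_def)

lemma em_off: "u \<notin> j ` pts \<Omega> \<or> v \<notin> k ` pts \<Xi> \<Longrightarrow> em j \<Omega> k \<Xi> a u v = 0"
  by (auto simp: em_def)

lemma em_eqI:
  assumes "is_emb j \<Omega>" "is_emb k \<Xi>"
    "\<And>n m. n \<in> pts \<Omega> \<Longrightarrow> m \<in> pts \<Xi> \<Longrightarrow> A (j n) (k m) = a n m"
    "\<And>u v. u \<notin> j ` pts \<Omega> \<or> v \<notin> k ` pts \<Xi> \<Longrightarrow> A u v = 0"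
  shows "em j \<Omega> k \<Xi> a = A"
proof (intro ext)
  fix u v
  show "em j \<Omega> k \<Xi> a u v = A u v"
  proof (cases "u \<in> j ` pts \<Omega> \<and> v \<in> k ` pts \<Xi>")
    case True
    then show ?thesis using assms by (auto simp: em_at)
  next
    case False
    then have "u \<notin> j ` pts \<Omega> \<or> v \<notin> k ` pts \<Xi>" by blast
    then show ?thesis using em_off[of u j \<Omega> v k \<Xi> a] assms(4)[of u v] by simp
  qed
qed

lemma em_inject:
  assumes "is_emb j \<Omega>" "is_emb k \<Xi>" "matrix_on \<Omega> \<Xi> a" "matrix_on \<Omega> \<Xi> b" "em j \<Omega> k \<Xi> a = em j \<Omega> k \<Xi> b"
  shows "a = b"
proof (intro ext)
  fix n m
  show "a n m = b n m"
    using assms em_at[OF assms(1,2), of n m a] em_at[OF assms(1,2), of n m b]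
    by (cases "n \<in> pts \<Omega> \<and> m \<in> pts \<Xi>") (auto simp: matrix_on_def)
qed

lemma matrix_on_res: "matrix_on \<Omega> \<Xi> (res j \<Omega> k \<Xi> A)"
  by (simp add: res_def matrix_on_def)

lemma em_res:
  assumes "is_emb j \<Omega>" "is_emb k \<Xi>" "\<And>u v. u \<notin> j ` pts \<Omega> \<or> v \<notin> k ` pts \<Xi> \<Longrightarrow> A u v = 0"
  shows "em j \<Omega> k \<Xi> (res j \<Omega> k \<Xi> A) = A"
  by (rule em_eqI) (use assms in \<open>auto simp: res_def\<close>)

lemma em_minus: "em j \<Omega> k \<Xi> (mminus a b) = (\<lambda>n m. em j \<Omega> k \<Xi> a n m - em j \<Omega> k \<Xi> b n m)"
  by (auto simp: fun_eq_iff em_def mminus_def)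

lemma em_add: "em j \<Omega> k \<Xi> (madd a b) = (\<lambda>n m. em j \<Omega> k \<Xi> a n m + em j \<Omega> k \<Xi> b n m)"
  by (auto simp: fun_eq_iff em_def madd_def)

lemma em_zero: "em j \<Omega> k \<Xi> mzero = (\<lambda>_ _. 0)"
  by (auto simp: fun_eq_iff em_def mzero_def)

definition dg :: "('k, 'r::ab_group_add) uext \<Rightarrow> nat set \<Rightarrow> nat \<Rightarrow> nat \<Rightarrow> 'r" where
  "dg R E u v = (if u = v \<and> u \<in> E then unit R else 0)"

lemma em_mone: assumes "is_emb j \<Omega>" shows "em j \<Omega> j \<Omega> (mone R \<Omega>) = dg R (j ` pts \<Omega>)"
  by (rule em_eqI[OF assms assms]) (use is_emb_inj[OF assms] in \<open>auto simp: dg_def mone_def inj_on_def\<close>)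

lemma mone_spgN: "mone R spgN = dg R UNIV"
  by (simp add: fun_eq_iff mone_def dg_def spgN_def)

text \<open>Left inverse of \<open>sh1\<close>. The truncated subtraction on layer 0 does not
  matter, as \<open>bm\<close> consults \<open>pr\<close> only off that layer.\<close>

definition pr :: "nat \<Rightarrow> nat" where
  "pr u = prod_encode (dfst u, dsnd u - 1)"

lemma pr_sh1 [simp]: "pr (sh1 k) = k"
  by (simp add: pr_def)

text \<open>Entrywise counterpart of \<open>blk\<close>, and, by \<open>em_block\<close>, of
  \<open>block\<close> on sums of index sets.\<close>

definition bm :: "(nat \<Rightarrow> nat \<Rightarrow> 'r) \<Rightarrow> (nat \<Rightarrow> nat \<Rightarrow> 'r) \<Rightarrow> (nat \<Rightarrow> nat \<Rightarrow> 'r) \<Rightarrow> (nat \<Rightarrow> nat \<Rightarrow> 'r) \<Rightarrow> nat \<Rightarrow> nat \<Rightarrow> 'r" where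
  "bm A B C D u v = (if dsnd u = 0 then if dsnd v = 0 then A (dfst u) (dfst v) else B (dfst u) (pr v)
     else if dsnd v = 0 then C (pr u) (dfst v) else D (pr u) (pr v))"

lemma bm_simps [simp]:
  "bm A B C D (sh0 n) (sh0 m) = A n m" "bm A B C D (sh0 n) (sh1 m) = B n m"
  "bm A B C D (sh1 n) (sh0 m) = C n m" "bm A B C D (sh1 n) (sh1 m) = D n m"
  by (simp_all add: bm_def)

lemma bm_eqI:
  assumes "\<And>n m. M (sh0 n) (sh0 m) = A n m" "\<And>n m. M (sh0 n) (sh1 m) = B n m"
    "\<And>n m. M (sh1 n) (sh0 m) = C n m" "\<And>n m. M (sh1 n) (sh1 m) = D n m"
  shows "M = bm A B C D"
proof (intro ext)
  fix u v show "M u v = bm A B C D u v"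
    by (cases u rule: sh_cases; cases v rule: sh_cases) (simp_all add: assms)
qed

lemma pts_sum: "pts (spg_sum \<Omega> \<Xi>) = pts \<Omega> <+> pts \<Xi>"
  by (simp add: spg_sum_def)

lemma jsum_image:
  "sh0 u \<in> jsum j k ` pts (spg_sum \<Omega> \<Xi>) \<longleftrightarrow> u \<in> j ` pts \<Omega>"
  "sh1 u \<in> jsum j k ` pts (spg_sum \<Omega> \<Xi>) \<longleftrightarrow> u \<in> k ` pts \<Xi>"
  by (auto simp: pts_sum image_iff) (metis InlI jsum_simps(1) sh_inject(1), metis InrI jsum_simps(2) sh_inject(2))

lemma em_block:
  assumes "is_emb j \<Omega>" "is_emb k \<Xi>"
  shows "em (jsum j k) (spg_sum \<Omega> \<Xi>) (jsum j k) (spg_sum \<Omega> \<Xi>) (block a b c e) =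
    bm (em j \<Omega> j \<Omega> a) (em j \<Omega> k \<Xi> b) (em k \<Xi> j \<Omega> c) (em k \<Xi> k \<Xi> e)"
proof (rule em_eqI[OF is_emb_sum[OF assms] is_emb_sum[OF assms]])
  fix n m assume "n \<in> pts (spg_sum \<Omega> \<Xi>)" "m \<in> pts (spg_sum \<Omega> \<Xi>)"
  then show "bm (em j \<Omega> j \<Omega> a) (em j \<Omega> k \<Xi> b) (em k \<Xi> j \<Omega> c) (em k \<Xi> k \<Xi> e) (jsum j k n) (jsum j k m)
      = block a b c e n m"
    using assms by (auto simp: pts_sum block_def em_at)
next
  fix u v assume "u \<notin> jsum j k ` pts (spg_sum \<Omega> \<Xi>) \<or> v \<notin> jsum j k ` pts (spg_sum \<Omega> \<Xi>)"
  then show "bm (em j \<Omega> j \<Omega> a) (em j \<Omega> k \<Xi> b) (em k \<Xi> j \<Omega> c) (em k \<Xi> k \<Xi> e) u v = 0"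
    by (cases u rule: sh_cases; cases v rule: sh_cases) (simp_all add: jsum_image em_off)
qed

lemma matrix_on_block:
  "matrix_on \<Omega> \<Omega> a \<Longrightarrow> matrix_on \<Omega> \<Xi> b \<Longrightarrow> matrix_on \<Xi> \<Omega> c \<Longrightarrow> matrix_on \<Xi> \<Xi> e \<Longrightarrow>
    matrix_on (spg_sum \<Omega> \<Xi>) (spg_sum \<Omega> \<Xi>) (block a b c e)"
  unfolding matrix_on_def block_def by (auto simp: pts_sum split: sum.split)

lemma matrix_on_simps:
  "matrix_on \<Omega> \<Xi> mzero" "matrix_on \<Omega> \<Omega> (mone R \<Omega>)"
  "matrix_on \<Omega> \<Xi> a \<Longrightarrow> matrix_on \<Omega> \<Xi> b \<Longrightarrow> matrix_on \<Omega> \<Xi> (madd a b)"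
  "matrix_on \<Omega> \<Xi> a \<Longrightarrow> matrix_on \<Omega> \<Xi> b \<Longrightarrow> matrix_on \<Omega> \<Xi> (mminus a b)"
  by (auto simp: matrix_on_def mzero_def mone_def madd_def mminus_def)

context pm_ring
begin

lemma matrix_on_mmult:
  assumes "matrix_on \<Omega> \<Xi> a" "matrix_on \<Xi> \<Upsilon> b" shows "matrix_on \<Omega> \<Upsilon> (mmult R a b)"
  unfolding matrix_on_def
proof (intro allI impI)
  fix n m assume "n \<notin> pts \<Omega> \<or> m \<notin> pts \<Upsilon>"
  then have "(\<lambda>i. mult R (a n i) (b i m)) = (\<lambda>_. 0)"
    using assms by (auto simp: matrix_on_def mult_zero_left mult_zero_right)
  then show "mmult R a b n m = 0" by (simp add: mmult_def ring_sum_zero)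
qed

lemma em_mmult:
  assumes j: "is_emb j \<Omega>" "is_emb k \<Xi>" "is_emb l \<Upsilon>" and "matrix_on \<Omega> \<Xi> a" "matrix_on \<Xi> \<Upsilon> b"
  shows "em j \<Omega> l \<Upsilon> (mmult R a b) = mmult R (em j \<Omega> k \<Xi> a) (em k \<Xi> l \<Upsilon> b)"
proof (rule em_eqI[OF j(1,3)])
  fix n m assume nm: "n \<in> pts \<Omega>" "m \<in> pts \<Upsilon>"
  have "ring_sum R (\<lambda>i. mult R (a n i) (b i m)) =
      ring_sum R (\<lambda>i. mult R (em j \<Omega> k \<Xi> a (j n) i) (em k \<Xi> l \<Upsilon> b i (l m)))"
    by (rule ring_sum_reindex[of k "pts \<Xi>"])
      (use assms nm is_emb_inj[OF j(2)] in \<open>auto simp: em_at em_off mult_zero_left matrix_on_def\<close>)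
  then show "mmult R (em j \<Omega> k \<Xi> a) (em k \<Xi> l \<Upsilon> b) (j n) (l m) = mmult R a b n m"
    by (simp add: mmult_def)
next
  fix u v assume "u \<notin> j ` pts \<Omega> \<or> v \<notin> l ` pts \<Upsilon>"
  then have "(\<lambda>i. mult R (em j \<Omega> k \<Xi> a u i) (em k \<Xi> l \<Upsilon> b i v)) = (\<lambda>_. 0)"
    by (auto simp: em_off mult_zero_left mult_zero_right)
  then show "mmult R (em j \<Omega> k \<Xi> a) (em k \<Xi> l \<Upsilon> b) u v = 0"
    by (simp add: mmult_def ring_sum_zero)
qed

text \<open>The growth functions of an index set are exactly the pullbacks of functions of
  polynomial growth, so estimates transfer in both directions, and off the image all entries
  vanish.\<close>

lemma Psi_em:
  assumes j: "is_emb j \<Omega>" "is_emb k \<Xi>" and a: "matrix_on \<Omega> \<Xi> a"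
  shows "a \<in> Psi d R \<Omega> \<Xi> \<longleftrightarrow> psi d R (em j \<Omega> k \<Xi> a)"
proof (cases d)
  case True
  let ?A = "em j \<Omega> k \<Xi> a"
  have inj: "inj_on j (pts \<Omega>)" "inj_on k (pts \<Xi>)" using j by (auto simp: is_emb_def)
  have nz: "n \<in> pts \<Omega> \<and> m \<in> pts \<Xi>" if "a n m \<noteq> 0" for n m using a that by (auto simp: matrix_on_def)
  have row: "{v. ?A (j n) v \<noteq> 0} = k ` {m. a n m \<noteq> 0}" if "n \<in> pts \<Omega>" for n
  proof (intro set_eqI iffI)
    fix v assume v: "v \<in> {v. ?A (j n) v \<noteq> 0}"
    then obtain m where m: "v = k m" "m \<in> pts \<Xi>" using em_off[of "j n" j \<Omega> v k \<Xi> a] by auto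
    then show "v \<in> k ` {m. a n m \<noteq> 0}" using v em_at[OF j that m(2), of a] by auto
  next
    fix v assume "v \<in> k ` {m. a n m \<noteq> 0}"
    then obtain m where m: "v = k m" "a n m \<noteq> 0" by blast
    then show "v \<in> {v. ?A (j n) v \<noteq> 0}" using nz[OF m(2)] em_at[OF j that, of m a] by simp
  qed
  have col: "{u. ?A u (k m) \<noteq> 0} = j ` {n. a n m \<noteq> 0}" if "m \<in> pts \<Xi>" for m
  proof (intro set_eqI iffI)
    fix u assume u: "u \<in> {u. ?A u (k m) \<noteq> 0}"
    then obtain n where n: "u = j n" "n \<in> pts \<Omega>" using em_off[of u j \<Omega> "k m" k \<Xi> a] by auto
    then show "u \<in> j ` {n. a n m \<noteq> 0}" using u em_at[OF j n(2) that, of a] by auto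
  next
    fix u assume "u \<in> j ` {n. a n m \<noteq> 0}"
    then obtain n where n: "u = j n" "a n m \<noteq> 0" by blast
    then show "u \<in> {u. ?A u (k m) \<noteq> 0}" using nz[OF n(2)] em_at[OF j _ that, of n a] by simp
  qed
  have fr: "finite {v. ?A (j n) v \<noteq> 0} \<longleftrightarrow> finite {m. a n m \<noteq> 0}" if "n \<in> pts \<Omega>" for n
    unfolding row[OF that] using nz by (intro finite_image_iff inj_on_subset[OF inj(2)]) auto
  have fc: "finite {u. ?A u (k m) \<noteq> 0} \<longleftrightarrow> finite {n. a n m \<noteq> 0}" if "m \<in> pts \<Xi>" for m
    unfolding col[OF that] using nz by (intro finite_image_iff inj_on_subset[OF inj(1)]) auto
  have "(\<forall>n. finite {m. a n m \<noteq> 0}) \<longleftrightarrow> (\<forall>u. finite {v. ?A u v \<noteq> 0})"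
  proof
    assume *: "\<forall>n. finite {m. a n m \<noteq> 0}"
    show "\<forall>u. finite {v. ?A u v \<noteq> 0}"
    proof
      fix u show "finite {v. ?A u v \<noteq> 0}"
        using * fr by (cases "u \<in> j ` pts \<Omega>") (auto simp: em_off)
    qed
  next
    assume *: "\<forall>u. finite {v. ?A u v \<noteq> 0}"
    show "\<forall>n. finite {m. a n m \<noteq> 0}"
    proof
      fix n
      have "{m. a n m \<noteq> 0} = {}" if "n \<notin> pts \<Omega>" using nz that by blast
      then show "finite {m. a n m \<noteq> 0}"
        using * fr[of n] by (cases "n \<in> pts \<Omega>") simp_all
    qed
  qed
  moreover have "(\<forall>m. finite {n. a n m \<noteq> 0}) \<longleftrightarrow> (\<forall>v. finite {u. ?A u v \<noteq> 0})"
  proof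
    assume *: "\<forall>m. finite {n. a n m \<noteq> 0}"
    show "\<forall>v. finite {u. ?A u v \<noteq> 0}"
    proof
      fix v show "finite {u. ?A u v \<noteq> 0}"
        using * fc by (cases "v \<in> k ` pts \<Xi>") (auto simp: em_off)
    qed
  next
    assume *: "\<forall>v. finite {u. ?A u v \<noteq> 0}"
    show "\<forall>m. finite {n. a n m \<noteq> 0}"
    proof
      fix m
      have "{n. a n m \<noteq> 0} = {}" if "m \<notin> pts \<Xi>" using nz that by blast
      then show "finite {n. a n m \<noteq> 0}"
        using * fc[of m] by (cases "m \<in> pts \<Xi>") simp_all
    qed
  qed
  ultimately show ?thesis using True a by (simp add: Psi_def psi_def)
next
  case False
  let ?A = "em j \<Omega> k \<Xi> a"
  show ?thesis
    unfolding Psi_spgN[symmetric]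
  proof
    assume "a \<in> Psi d R \<Omega> \<Xi>"
    then have *: "\<forall>p\<in>sn R. \<forall>f\<in>growth \<Omega>. \<forall>h\<in>growth \<Xi>. \<exists>g\<in>growth \<Xi>. \<exists>k\<in>growth \<Omega>.
        \<forall>n\<in>pts \<Omega>. \<forall>m\<in>pts \<Xi>. \<bar>f n\<bar> * p (a n m) \<le> g m \<and> \<bar>h m\<bar> * p (a n m) \<le> k n"
      using False by (simp add: Psi_def)
    have "\<exists>g\<in>poly_growth. \<exists>k\<in>poly_growth. \<forall>n m. \<bar>f n\<bar> * p (?A n m) \<le> g m \<and> \<bar>h m\<bar> * p (?A n m) \<le> k n"
      if p: "p \<in> sn R" and f: "f \<in> poly_growth" "h \<in> poly_growth" for p f h
    proof -
      obtain g k' where g: "g \<in> growth \<Xi>" "k' \<in> growth \<Omega>"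
        "\<And>n m. n \<in> pts \<Omega> \<Longrightarrow> m \<in> pts \<Xi> \<Longrightarrow> \<bar>f (j n)\<bar> * p (a n m) \<le> g m \<and> \<bar>h (k m)\<bar> * p (a n m) \<le> k' n"
        using *[rule_format, OF p emb_growthI[OF j(1) f(1)] emb_growthI[OF j(2) f(2)]] by auto
      obtain g1 where g1: "g1 \<in> poly_growth" "\<And>m. m \<in> pts \<Xi> \<Longrightarrow> g m = g1 (k m)"
        using emb_growthD[OF j(2) g(1)] by metis
      obtain k1 where k1: "k1 \<in> poly_growth" "\<And>m. m \<in> pts \<Omega> \<Longrightarrow> k' m = k1 (j m)"
        using emb_growthD[OF j(1) g(2)] by metis
      \<comment> \<open>Off the image nothing is known about the sign of \<open>g1\<close> and
        \<open>k1\<close>; absolute values give bounds valid everywhere.\<close>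
      have "\<bar>f u\<bar> * p (?A u v) \<le> \<bar>g1 v\<bar> \<and> \<bar>h v\<bar> * p (?A u v) \<le> \<bar>k1 u\<bar>" for u v
      proof (cases "u \<in> j ` pts \<Omega> \<and> v \<in> k ` pts \<Xi>")
        case True
        then obtain n m where "u = j n" "v = k m" "n \<in> pts \<Omega>" "m \<in> pts \<Xi>" by auto
        then show ?thesis using g(3)[of n m] g1(2)[of m] k1(2)[of n] by (auto simp: em_at[OF j])
      next
        case False
        then have "?A u v = 0" by (intro em_off) auto
        then show ?thesis by (simp add: sn_zero[OF p])
      qed
      moreover have "(\<lambda>v. \<bar>g1 v\<bar>) \<in> poly_growth" "(\<lambda>v. \<bar>k1 v\<bar>) \<in> poly_growth"
        using poly_growth_dominated[OF g1(1)] poly_growth_dominated[OF k1(1)] by simp_all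
      ultimately show ?thesis
        by (intro bexI[of _ "\<lambda>v. \<bar>g1 v\<bar>"] bexI[of _ "\<lambda>v. \<bar>k1 v\<bar>"]) auto
    qed
    then show "?A \<in> Psi d R spgN spgN" using False by (simp add: Psi_def matrix_on_def spgN_def)
  next
    assume "?A \<in> Psi d R spgN spgN"
    then have *: "\<forall>p\<in>sn R. \<forall>f\<in>poly_growth. \<forall>h\<in>poly_growth. \<exists>g\<in>poly_growth. \<exists>k\<in>poly_growth.
        \<forall>n m. \<bar>f n\<bar> * p (?A n m) \<le> g m \<and> \<bar>h m\<bar> * p (?A n m) \<le> k n"
      using False by (simp add: Psi_def spgN_def)
    have "\<exists>g\<in>growth \<Xi>. \<exists>k\<in>growth \<Omega>.
        \<forall>n\<in>pts \<Omega>. \<forall>m\<in>pts \<Xi>. \<bar>f n\<bar> * p (a n m) \<le> g m \<and> \<bar>h m\<bar> * p (a n m) \<le> k n"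
      if p: "p \<in> sn R" and f: "f \<in> growth \<Omega>" "h \<in> growth \<Xi>" for p f h
    proof -
      obtain f1 where f1: "f1 \<in> poly_growth" "\<And>n. n \<in> pts \<Omega> \<Longrightarrow> f n = f1 (j n)"
        using emb_growthD[OF j(1) f(1)] by metis
      obtain h1 where h1: "h1 \<in> poly_growth" "\<And>n. n \<in> pts \<Xi> \<Longrightarrow> h n = h1 (k n)"
        using emb_growthD[OF j(2) f(2)] by metis
      obtain g k' where g: "g \<in> poly_growth" "k' \<in> poly_growth"
        "\<And>n m. \<bar>f1 n\<bar> * p (?A n m) \<le> g m \<and> \<bar>h1 m\<bar> * p (?A n m) \<le> k' n"
        using *[rule_format, OF p f1(1) h1(1)] by auto
      have "\<bar>f n\<bar> * p (a n m) \<le> g (k m) \<and> \<bar>h m\<bar> * p (a n m) \<le> k' (j n)"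
        if "n \<in> pts \<Omega>" "m \<in> pts \<Xi>" for n m
        using g(3)[of "j n" "k m"] f1(2)[OF that(1)] h1(2)[OF that(2)] em_at[OF j that, of a] by simp
      then show ?thesis
        by (intro bexI[OF _ emb_growthI[OF j(2) g(1)]] bexI[OF _ emb_growthI[OF j(1) g(2)]]) auto
    qed
    then show "a \<in> Psi d R \<Omega> \<Xi>" using False a by (simp add: Psi_def)
  qed
qed

lemma Kmat_em:
  assumes j: "is_emb j \<Omega>" "is_emb k \<Xi>" and a: "matrix_on \<Omega> \<Xi> a"
  shows "a \<in> Kmat d R \<Omega> \<Xi> \<longleftrightarrow> smooth d R (em j \<Omega> k \<Xi> a)"
proof -
  let ?A = "em j \<Omega> k \<Xi> a"
  have nz: "n \<in> pts \<Omega> \<and> m \<in> pts \<Xi>" if "a n m \<noteq> 0" for n m using a that by (auto simp: matrix_on_def)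
  have ideal: "(\<forall>n m. a n m \<in> ideal R) \<longleftrightarrow> (\<forall>u v. ?A u v \<in> ideal R)"
  proof
    assume "\<forall>n m. a n m \<in> ideal R"
    then show "\<forall>u v. ?A u v \<in> ideal R" by (simp add: em_def ideal_zero)
  next
    assume *: "\<forall>u v. ?A u v \<in> ideal R"
    show "\<forall>n m. a n m \<in> ideal R"
    proof (intro allI)
      fix n m show "a n m \<in> ideal R"
        using nz[of n m] *[rule_format, of "j n" "k m"] em_at[OF j, of n m a] ideal_zero
        by (cases "a n m = 0") auto
    qed
  qed
  show ?thesis
  proof (cases d)
    case True
    have "{(u, v). ?A u v \<noteq> 0} = (\<lambda>(n, m). (j n, k m)) ` {(n, m). a n m \<noteq> 0}"
    proof (intro set_eqI iffI; clarsimp)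
      fix u v assume "?A u v \<noteq> 0"
      then obtain n m where nm: "u = j n" "v = k m" "n \<in> pts \<Omega>" "m \<in> pts \<Xi>"
        using em_off by (metis imageE)
      then have "a n m \<noteq> 0" using \<open>?A u v \<noteq> 0\<close> em_at[OF j nm(3,4), of a] by simp
      then show "(u, v) \<in> (\<lambda>(n, m). (j n, k m)) ` {(n, m). a n m \<noteq> 0}" using nm by force
    next
      fix n m assume "a n m \<noteq> 0" "?A (j n) (k m) = 0"
      then show False using nz[of n m] em_at[OF j, of n m a] by simp
    qed
    moreover have "inj_on (\<lambda>(n, m). (j n, k m)) {(n, m). a n m \<noteq> 0}"
      using nz is_emb_inj[OF j(1)] is_emb_inj[OF j(2)] by (auto simp: inj_on_def)
    ultimately have "finite {(u, v). ?A u v \<noteq> 0} \<longleftrightarrow> finite {(n, m). a n m \<noteq> 0}"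
      by (simp add: finite_image_iff)
    then show ?thesis using True a ideal by (simp add: Kmat_def smooth_def)
  next
    case False
    show ?thesis
      unfolding Kmat_spgN[symmetric]
    proof
      assume "a \<in> Kmat d R \<Omega> \<Xi>"
      then have *: "\<forall>p\<in>sn R. \<forall>f\<in>growth \<Omega>. \<forall>h\<in>growth \<Xi>.
          bdd_above {\<bar>f n * h m\<bar> * p (a n m) | n m. n \<in> pts \<Omega> \<and> m \<in> pts \<Xi>}" "\<forall>n m. a n m \<in> ideal R"
        using False by (simp_all add: Kmat_def)
      have "bdd_above {\<bar>f n * h m\<bar> * p (?A n m) | n m. True}"
        if p: "p \<in> sn R" and f: "f \<in> poly_growth" "h \<in> poly_growth" for p f h
      proof -
        have "bdd_above {\<bar>f (j n) * h (k m)\<bar> * p (a n m) | n m. n \<in> pts \<Omega> \<and> m \<in> pts \<Xi>}"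
          using *(1)[rule_format, OF p emb_growthI[OF j(1) f(1)] emb_growthI[OF j(2) f(2)]] .
        then obtain C where C: "\<And>n m. n \<in> pts \<Omega> \<Longrightarrow> m \<in> pts \<Xi> \<Longrightarrow> \<bar>f (j n) * h (k m)\<bar> * p (a n m) \<le> C"
          unfolding bdd_above_def by blast
        have "\<bar>f u * h v\<bar> * p (?A u v) \<le> \<bar>C\<bar>" for u v
        proof (cases "u \<in> j ` pts \<Omega> \<and> v \<in> k ` pts \<Xi>")
          case True
          then obtain n m where "u = j n" "v = k m" "n \<in> pts \<Omega>" "m \<in> pts \<Xi>" by auto
          then show ?thesis using C[of n m] by (simp add: em_at[OF j])
        next
          case False
          then have "?A u v = 0" by (intro em_off) auto
          then show ?thesis by (simp add: sn_zero[OF p])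
        qed
        then show ?thesis by (auto intro!: bdd_aboveI[of _ "\<bar>C\<bar>"])
      qed
      then show "?A \<in> Kmat d R spgN spgN"
        using False * ideal by (simp add: Kmat_def matrix_on_def spgN_def)
    next
      assume "?A \<in> Kmat d R spgN spgN"
      then have *: "\<forall>p\<in>sn R. \<forall>f\<in>poly_growth. \<forall>h\<in>poly_growth.
          bdd_above {\<bar>f n * h m\<bar> * p (?A n m) | n m. True}" "\<forall>n m. ?A n m \<in> ideal R"
        using False by (simp_all add: Kmat_def spgN_def)
      have "bdd_above {\<bar>f n * h m\<bar> * p (a n m) | n m. n \<in> pts \<Omega> \<and> m \<in> pts \<Xi>}"
        if p: "p \<in> sn R" and f: "f \<in> growth \<Omega>" "h \<in> growth \<Xi>" for p f h
      proof -
        obtain f1 where f1: "f1 \<in> poly_growth" "\<And>n. n \<in> pts \<Omega> \<Longrightarrow> f n = f1 (j n)"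
          using emb_growthD[OF j(1) f(1)] by metis
        obtain h1 where h1: "h1 \<in> poly_growth" "\<And>n. n \<in> pts \<Xi> \<Longrightarrow> h n = h1 (k n)"
          using emb_growthD[OF j(2) f(2)] by metis
        show ?thesis
        proof (rule bdd_above_mono[OF *(1)[rule_format, OF p f1(1) h1(1)]], clarsimp)
          fix n m assume nm: "n \<in> pts \<Omega>" "m \<in> pts \<Xi>"
          then show "\<exists>n' m'. \<bar>f n * h m\<bar> * p (a n m) = \<bar>f1 n' * h1 m'\<bar> * p (?A n' m')"
            using f1(2) h1(2) em_at[OF j nm, of a] by metis
        qed
      qed
      then show "a \<in> Kmat d R \<Omega> \<Xi>" using False a * ideal by (simp add: Kmat_def)
    qed
  qed
qed

end

lemma jsum_pts: "jsum j k ` pts (spg_sum \<Omega> \<Xi>) = sh0 ` j ` pts \<Omega> \<union> sh1 ` k ` pts \<Xi>"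
  by (simp add: pts_sum Plus_def image_Un image_image)

context pm_ring
begin

lemma psi_dg: "psi d R (dg R E)"
proof (rule psi_band[where C = 1 and l = 1])
  fix p assume "p \<in> sn R"
  then have "p (dg R E n m) \<le> p (unit R)" for n m
    using sn_nonneg[of p "unit R"] sn_zero[of p] by (simp add: dg_def)
  then show "\<exists>B. \<forall>n m. p (dg R E n m) \<le> B" by blast
qed (auto simp: dg_def split: if_splits)

lemma mmult_dg_left: "mmult R (dg R E) a u v = (if u \<in> E then a u v else 0)"
  unfolding mmult_def
  by (subst ring_sum_single[of u]) (auto simp: dg_def mult_zero_left unit_left)

lemma mmult_dg_right: "mmult R a (dg R E) u v = (if v \<in> E then a u v else 0)"
  unfolding mmult_def
  by (subst ring_sum_single[of v]) (auto simp: dg_def mult_zero_right unit_right)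

lemma mmult_zero: "mmult R (\<lambda>_ _. 0) a = (\<lambda>_ _. 0)" "mmult R a (\<lambda>_ _. 0) = (\<lambda>_ _. 0)"
  by (simp_all add: mmult_def mult_zero_left mult_zero_right ring_sum_zero)

end

section \<open>Lifted matrices and projections in the universal ring\<close>

locale mat_pairs = pm_ring R for R :: "('k, 'r::ab_group_add) uext" +
  fixes d :: bool
begin

sublocale stable "Gpairs d R" "cst False" S0 S1 T0 T1 infl
  by (rule stable_mring[OF pm_ring_axioms])

lemmas mat_lft = mat_lift[OF pm_ring_axioms]

lemma mat_lft_here [simp]:
  "psi d R a \<Longrightarrow> psi d R b \<Longrightarrow> mat (lift d R b a) d R i = (if i then b else a)"
  by (simp add: mat_lft)

lemma lift_mult:
  assumes "psi d R a" "psi d R b" "psi d R a'" "psi d R b'"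
  shows "lift d R b a * lift d R b' a' = lift d R (mmult R b b') (mmult R a a')"
  by (rule mring_eqI) (auto simp: mat_mult mat_lft assms psi_mmult pm_ring.mmult_zero)

lemma lift_zero: "lift d R (\<lambda>_ _. 0) (\<lambda>_ _. 0) = 0"
  by (rule mring_eqI) (auto simp: mat_lft psi_zero mat_zero)

lemma lift_add:
  assumes "psi d R a" "psi d R b" "psi d R a'" "psi d R b'"
  shows "lift d R b a + lift d R b' a' = lift d R (\<lambda>n m. b n m + b' n m) (\<lambda>n m. a n m + a' n m)"
  by (rule mring_eqI) (auto simp: mat_add mat_lft assms psi_add)

lemma psi_minus: "psi d R a \<Longrightarrow> psi d R b \<Longrightarrow> psi d R (\<lambda>n m. a n m - b n m)"
  using psi_add[OF _ psi_uminus, of d a b] by simp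

lemma lift_diff:
  assumes "psi d R a" "psi d R b" "psi d R a'" "psi d R b'"
  shows "lift d R b a - lift d R b' a' = lift d R (\<lambda>n m. b n m - b' n m) (\<lambda>n m. a n m - a' n m)"
  by (rule mring_eqI) (auto simp: mat_diff mat_lft assms psi_minus)

lemma mat_blk:
  assumes R': "pm_ring R'"
  shows "mat (blk f g h k) d' R' i = bm (mat f d' R' i) (mat g d' R' i) (mat h d' R' i) (mat k d' R' i)"
proof -
  interpret P: pm_ring R' by (rule R')
  have r: "sh0 m \<notin> range sh1" "sh1 m \<notin> range sh0" for m by auto
  note s = P.sandwich[OF P.inj_sh(1) P.inj_sh(1)] P.sandwich[OF P.inj_sh(1) P.inj_sh(2)]
    P.sandwich[OF P.inj_sh(2) P.inj_sh(1)] P.sandwich[OF P.inj_sh(2) P.inj_sh(2)]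
  show ?thesis
    by (rule bm_eqI) (simp_all add: blk_def mat_add mat_mult mat_cuntz R' s r)
qed

lemma psi_bm:
  assumes "psi d R A" "psi d R B" "psi d R C" "psi d R D" shows "psi d R (bm A B C D)"
  using psi_mat[OF pm_ring_axioms, of d "blk (lift d R A A) (lift d R B B) (lift d R C C) (lift d R D D)" True]
  by (simp add: mat_blk[OF pm_ring_axioms] assms)

lemma lift_blk:
  assumes "psi d R A" "psi d R B" "psi d R C" "psi d R D"
    "psi d R A'" "psi d R B'" "psi d R C'" "psi d R D'"
  shows "blk (lift d R A A') (lift d R B B') (lift d R C C') (lift d R D D') =
    lift d R (bm A B C D) (bm A' B' C' D')"
proof (rule mring_eqI)
  fix d' i and R' :: "('k, 'r) uext" assume "pm_ring R'"
  moreover have "bm (\<lambda>_ _. 0) (\<lambda>_ _. 0) (\<lambda>_ _. 0) (\<lambda>_ _. 0) = (\<lambda>_ _. 0::'r)"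
    by (rule bm_eqI[symmetric]) simp_all
  ultimately show "mat (blk (lift d R A A') (lift d R B B') (lift d R C C') (lift d R D D')) d' R' i =
      mat (lift d R (bm A B C D) (bm A' B' C' D')) d' R' i"
    by (auto simp: mat_blk mat_lft assms psi_bm)
qed

lemma lift_dsm:
  assumes "psi d R A" "psi d R D" "psi d R A'" "psi d R D'"
  shows "dsm (lift d R A A') (lift d R D D') =
    lift d R (bm A (\<lambda>_ _. 0) (\<lambda>_ _. 0) D) (bm A' (\<lambda>_ _. 0) (\<lambda>_ _. 0) D')"
  unfolding dsm_def lift_zero[symmetric] by (intro lift_blk assms psi_zero)

lemma lift_G:
  assumes "psi d R a" "psi d R b"
  shows "lift d R b a \<in> Gpairs d R \<longleftrightarrow> smooth d R (\<lambda>n m. b n m - a n m)"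
  by (simp add: Gpairs_def assms)

lemma cst_lift:
  assumes "psi d R a" "psi d R b"
  shows "cst True (lift d R b a) = lift d R b b" "cst False (lift d R b a) = lift d R a a"
  by (rule mring_eqI; auto simp: mat_cst mat_lft assms)+

text \<open>The identity matrix of an index set with image \<open>E\<close>, as an element of the
  universal ring.\<close>

definition dgl :: "nat set \<Rightarrow> ('k, 'r) mring" where
  "dgl E = lift d R (dg R E) (dg R E)"

lemma dgl_props: "cst False (dgl E) = dgl E" "dgl E * dgl E = dgl E" "idem (dgl E)"
proof -
  show 1: "cst False (dgl E) = dgl E" by (simp add: dgl_def cst_lift psi_dg)
  have "mmult R (dg R E) (dg R E) = dg R E" by (auto simp: fun_eq_iff mmult_dg_left dg_def)
  then show 2: "dgl E * dgl E = dgl E" by (simp add: dgl_def lift_mult psi_dg)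
  show "idem (dgl E)" using 1 2 by (simp add: idem_def G_C)
qed

lemma dgl_dsm: "dsm (dgl E) (dgl F) = dgl (sh0 ` E \<union> sh1 ` F)"
proof -
  have "bm (dg R E) (\<lambda>_ _. 0) (\<lambda>_ _. 0) (dg R F) = dg R (sh0 ` E \<union> sh1 ` F)"
    by (rule bm_eqI[symmetric]) (auto simp: dg_def)
  then show ?thesis by (simp add: dgl_def lift_dsm psi_dg)
qed

lemma dgl_empty: "dgl {} = 0"
proof -
  have "dg R {} = (\<lambda>_ _. 0)" by (simp add: dg_def fun_eq_iff)
  then show ?thesis by (simp add: dgl_def lift_zero)
qed

subsection \<open>Pairs of idempotents as elements of the universal ring\<close>

definition io :: "('i \<Rightarrow> nat) \<Rightarrow> ('i, 'r) mpair \<Rightarrow> ('k, 'r) mring" where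
  "io j p = lift d R (em j (idx p) j (idx p) (fstm p)) (em j (idx p) j (idx p) (sndm p))"

text \<open>Membership in \<open>G2\<close>, relative to a chosen embedding. Asking for an embedding
  instead of \<open>is_spg\<close> lets pairs over sums and products of index sets qualify at
  once.\<close>

definition vp :: "('i \<Rightarrow> nat) \<Rightarrow> ('i, 'r) mpair \<Rightarrow> bool" where
  "vp j p \<longleftrightarrow> is_emb j (idx p) \<and>
     matrix_on (idx p) (idx p) (fstm p) \<and> matrix_on (idx p) (idx p) (sndm p) \<and>
     psi d R (em j (idx p) j (idx p) (fstm p)) \<and> psi d R (em j (idx p) j (idx p) (sndm p)) \<and>
     idem (io j p)"

lemma Psi_matrix_on: "a \<in> Psi d R \<Omega> \<Xi> \<Longrightarrow> matrix_on \<Omega> \<Xi> a"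
  by (simp add: Psi_def)

lemma Psi_psi: "is_emb j \<Omega> \<Longrightarrow> is_emb k \<Xi> \<Longrightarrow> a \<in> Psi d R \<Omega> \<Xi> \<Longrightarrow> psi d R (em j \<Omega> k \<Xi> a)"
  using Psi_em Psi_matrix_on by blast

lemma vpI:
  assumes j: "is_emb j (idx p)"
    and P: "fstm p \<in> Psi d R (idx p) (idx p)" "sndm p \<in> Psi d R (idx p) (idx p)"
    and i: "mmult R (fstm p) (fstm p) = fstm p" "mmult R (sndm p) (sndm p) = sndm p"
    and K: "mminus (fstm p) (sndm p) \<in> Kmat d R (idx p) (idx p)"
  shows "vp j p"
proof -
  note m = Psi_matrix_on[OF P(1)] Psi_matrix_on[OF P(2)]
  note ps = Psi_psi[OF j j P(1)] Psi_psi[OF j j P(2)]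
  have "smooth d R (em j (idx p) j (idx p) (mminus (fstm p) (sndm p)))"
    using K Kmat_em[OF j j, of "mminus (fstm p) (sndm p)" d] m by (simp add: matrix_on_simps)
  then have "io j p \<in> Gpairs d R" by (simp add: io_def lift_G ps em_minus)
  moreover have "io j p * io j p = io j p"
    by (simp add: io_def lift_mult ps em_mmult[OF j j j, symmetric] m i)
  ultimately show ?thesis using j m ps by (simp add: vp_def idem_def)
qed

lemma G2_vp: assumes "p \<in> G2 d R" obtains j where "vp j p"
proof -
  have "is_spg (idx p)" using assms by (simp add: G2_def)
  then obtain j where "is_emb j (idx p)" by (rule is_spg_emb)
  then have "vp j p" using assms by (intro vpI) (auto simp: G2_def)
  then show thesis by (rule that)
qed

lemma em_corner:
  assumes "is_emb j \<Omega>" "is_emb k \<Xi>"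
  shows "mmult R (dg R (j ` pts \<Omega>)) (em j \<Omega> k \<Xi> a) = em j \<Omega> k \<Xi> a"
    "mmult R (em j \<Omega> k \<Xi> a) (dg R (k ` pts \<Xi>)) = em j \<Omega> k \<Xi> a"
  by (auto simp: fun_eq_iff mmult_dg_left mmult_dg_right em_off)

lemma io_corner:
  assumes "vp j p"
  shows "dgl (j ` pts (idx p)) * io j p = io j p" "io j p * dgl (j ` pts (idx p)) = io j p"
  using assms by (simp_all add: vp_def dgl_def io_def lift_mult psi_dg em_corner)

lemma vp_idem: "vp j p \<Longrightarrow> idem (io j p)"
  by (simp add: vp_def)

lemma vp_psum:
  assumes "vp j p" "vp k q"
  shows "vp (jsum j k) (psum p q)" "io (jsum j k) (psum p q) = dsm (io j p) (io k q)"
proof -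
  have e: "is_emb j (idx p)" "is_emb k (idx q)" using assms by (auto simp: vp_def)
  have ps: "psi d R (em j (idx p) j (idx p) (fstm p))" "psi d R (em j (idx p) j (idx p) (sndm p))"
    "psi d R (em k (idx q) k (idx q) (fstm q))" "psi d R (em k (idx q) k (idx q) (sndm q))"
    using assms by (auto simp: vp_def)
  show io: "io (jsum j k) (psum p q) = dsm (io j p) (io k q)"
    by (simp add: io_def psum_def dsum_def em_block[OF e] em_zero lift_dsm ps)
  show "vp (jsum j k) (psum p q)"
    unfolding vp_def
  proof (intro conjI)
    show "idem (io (jsum j k) (psum p q))" unfolding io by (intro idem_dsm vp_idem assms)
  qed (use assms e ps in \<open>simp_all add: psum_def is_emb_sum dsum_def matrix_on_block matrix_on_simps vp_def
      em_block em_zero psi_bm psi_zero\<close>)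
qed

lemma vp_pzero: assumes "is_emb j \<Omega>" shows "vp j (pzero \<Omega>)" "io j (pzero \<Omega>) = 0"
proof -
  show "io j (pzero \<Omega>) = 0" by (simp add: io_def pzero_def em_zero lift_zero)
  then show "vp j (pzero \<Omega>)"
    using assms by (simp add: vp_def idem_zero) (simp add: pzero_def em_zero matrix_on_simps psi_zero)
qed

lemma vp_pzero':
  assumes "is_emb j \<Omega>" shows "vp j (pzero' R \<Omega>)" "io j (pzero' R \<Omega>) = dgl (j ` pts \<Omega>)"
proof -
  show "io j (pzero' R \<Omega>) = dgl (j ` pts \<Omega>)" using assms by (simp add: io_def pzero'_def em_mone dgl_def)
  then show "vp j (pzero' R \<Omega>)"
    using assms by (simp add: vp_def dgl_props) (simp add: pzero'_def em_mone matrix_on_simps psi_dg)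
qed

section \<open>Algebraic homotopy is stable equivalence\<close>

lemma Psi2_lift:
  assumes j: "is_emb j \<Omega>" "is_emb k \<Xi>" and P: "(B, A) \<in> Psi2 d R \<Omega> \<Xi>"
  shows "matrix_on \<Omega> \<Xi> B" "matrix_on \<Omega> \<Xi> A" "psi d R (em j \<Omega> k \<Xi> B)" "psi d R (em j \<Omega> k \<Xi> A)"
    "lift d R (em j \<Omega> k \<Xi> B) (em j \<Omega> k \<Xi> A) \<in> Gpairs d R"
proof -
  have P': "B \<in> Psi d R \<Omega> \<Xi>" "A \<in> Psi d R \<Omega> \<Xi>" "mminus B A \<in> Kmat d R \<Omega> \<Xi>"
    using P by (auto simp: Psi2_def)
  show m: "matrix_on \<Omega> \<Xi> B" "matrix_on \<Omega> \<Xi> A" using P' Psi_matrix_on by auto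
  show ps: "psi d R (em j \<Omega> k \<Xi> B)" "psi d R (em j \<Omega> k \<Xi> A)" by (rule Psi_psi[OF j P'(1)], rule Psi_psi[OF j P'(2)])
  have "smooth d R (em j \<Omega> k \<Xi> (mminus B A))"
    using P'(3) Kmat_em[OF j, of "mminus B A" d] m by (simp add: matrix_on_simps)
  then show "lift d R (em j \<Omega> k \<Xi> B) (em j \<Omega> k \<Xi> A) \<in> Gpairs d R"
    by (simp add: lift_G ps em_minus)
qed

text \<open>The conjugating matrices lift to elements \<open>g\<close> and \<open>g'\<close> with
  \<open>g' * g\<close> the projection onto the source index set, and the added pairs are constant:
  this is the situation of \<open>seq_if_conj\<close>.\<close>

lemma homotopic_seq:
  fixes p :: "('i, 'r) mpair" and q :: "('j, 'r) mpair"
  assumes p: "vp j p" and q: "vp k q" and hom: "alg_homotopic d R p q"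
  shows "seq (io j p) (io k q)"
proof -
  obtain \<Omega>10 \<Omega>11 \<Omega>20 \<Omega>21 :: "nat spg" and q1 q2 B A B' A' where
    spg: "is_spg \<Omega>10" "is_spg \<Omega>11" "is_spg \<Omega>20" "is_spg \<Omega>21"
    and qs: "q1 = psum (psum p (pzero \<Omega>10)) (pzero' R \<Omega>11)" "q2 = psum (psum q (pzero \<Omega>20)) (pzero' R \<Omega>21)"
    and P: "(B, A) \<in> Psi2 d R (idx q2) (idx q1)" "(B', A') \<in> Psi2 d R (idx q1) (idx q2)"
    and eqs: "mmult R B' B = mone R (idx q1)" "mmult R A' A = mone R (idx q1)"
      "mmult R (mmult R B (fstm q1)) B' = fstm q2" "mmult R (mmult R A (sndm q1)) A' = sndm q2"
    using hom unfolding alg_homotopic_def Let_def by blast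
  obtain j10 j11 j20 j21 where e: "is_emb j10 \<Omega>10" "is_emb j11 \<Omega>11" "is_emb j20 \<Omega>20" "is_emb j21 \<Omega>21"
    using spg is_spg_emb by metis
  define J where "J = jsum (jsum j j10) j11"
  define K where "K = jsum (jsum k j20) j21"
  note v1 = vp_psum[OF vp_psum(1)[OF p vp_pzero(1)[OF e(1)]] vp_pzero'(1)[OF e(2)]]
  note v2 = vp_psum[OF vp_psum(1)[OF q vp_pzero(1)[OF e(3)]] vp_pzero'(1)[OF e(4)]]
  have vJ: "vp J q1" "vp K q2" using v1(1) v2(1) by (simp_all add: J_def K_def qs)
  have io: "io J q1 = dsm (dsm (io j p) 0) (dgl (j11 ` pts \<Omega>11))"
    "io K q2 = dsm (dsm (io k q) 0) (dgl (j21 ` pts \<Omega>21))"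
    using v1(2) v2(2) vp_psum(2)[OF p vp_pzero(1)[OF e(1)]] vp_psum(2)[OF q vp_pzero(1)[OF e(3)]]
      vp_pzero(2)[OF e(1)] vp_pzero(2)[OF e(3)] vp_pzero'(2)[OF e(2)] vp_pzero'(2)[OF e(4)]
    by (simp_all add: J_def K_def qs)
  have eJ: "is_emb J (idx q1)" "is_emb K (idx q2)" using vJ by (auto simp: vp_def)
  have mq: "matrix_on (idx q1) (idx q1) (fstm q1)" "matrix_on (idx q1) (idx q1) (sndm q1)"
    "psi d R (em J (idx q1) J (idx q1) (fstm q1))" "psi d R (em J (idx q1) J (idx q1) (sndm q1))"
    using vJ(1) by (auto simp: vp_def)
  note L = Psi2_lift[OF eJ(2,1) P(1)] and L' = Psi2_lift[OF eJ P(2)]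
  define g where "g = lift d R (em K (idx q2) J (idx q1) B) (em K (idx q2) J (idx q1) A)"
  define g' where "g' = lift d R (em J (idx q1) K (idx q2) B') (em J (idx q1) K (idx q2) A')"
  have "g' * g = dgl (J ` pts (idx q1))"
    by (simp add: g_def g'_def lift_mult L L' em_mmult[OF eJ(1,2,1), symmetric] eqs em_mone eJ dgl_def)
  moreover have "mmult R (mmult R (em K (idx q2) J (idx q1) B) (em J (idx q1) J (idx q1) (fstm q1)))
      (em J (idx q1) K (idx q2) B') = em K (idx q2) K (idx q2) (fstm q2)"
    "mmult R (mmult R (em K (idx q2) J (idx q1) A) (em J (idx q1) J (idx q1) (sndm q1)))
      (em J (idx q1) K (idx q2) A') = em K (idx q2) K (idx q2) (sndm q2)"
    by (simp_all add: L(1,2) L'(1,2) mq matrix_on_mmult[OF L(1) mq(1)] matrix_on_mmult[OF L(2) mq(2)] eqs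
        em_mmult[OF eJ(2,1,1), symmetric] em_mmult[OF eJ(2,1,2), symmetric])
  then have "g * io J q1 * g' = io K q2"
    by (simp add: g_def g'_def io_def lift_mult L(3,4) L'(3,4) mq psi_mmult)
  moreover have "g \<in> Gpairs d R" "g' \<in> Gpairs d R" using L(5) L'(5) by (simp_all add: g_def g'_def)
  ultimately show ?thesis
    using seq_if_conj[OF vp_idem[OF p] vp_idem[OF q] dgl_props(3,1) dgl_props(3,1)]
      io io_corner(1)[OF vJ(1)] by metis
qed

text \<open>The element \<open>g\<close> of \<open>idem_pair_iso\<close> is supported in the corners
  of the two index sets and so restricts to honest matrices over them. Its two extra slots are
  realised by adding \<open>spgN\<close> once with zero and once with unit matrices.\<close>

lemma seq_homotopic:
  fixes p :: "('i, 'r) mpair" and q :: "('j, 'r) mpair"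
  assumes p: "vp j p" and q: "vp k q" and seq: "seq (io j p) (io k q)"
  shows "alg_homotopic d R p q"
proof -
  define q1 where "q1 = psum (psum p (pzero spgN)) (pzero' R spgN)"
  define q2 where "q2 = psum (psum q (pzero spgN)) (pzero' R spgN)"
  define J where "J = jsum (jsum j (\<lambda>n. n)) (\<lambda>n. n)"
  define K where "K = jsum (jsum k (\<lambda>n. n)) (\<lambda>n. n)"
  note eN = is_emb_spgN
  note v1 = vp_psum[OF vp_psum(1)[OF p vp_pzero(1)[OF eN]] vp_pzero'(1)[OF eN]]
  note v2 = vp_psum[OF vp_psum(1)[OF q vp_pzero(1)[OF eN]] vp_pzero'(1)[OF eN]]
  have vJ: "vp J q1" "vp K q2" using v1(1) v2(1) by (simp_all add: J_def K_def q1_def q2_def)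
  have im': "pts spgN = UNIV" and im: "(\<lambda>n. n) ` pts spgN = UNIV" by (simp_all add: spgN_def)
  have io: "io J q1 = dsm (dsm (io j p) 0) (dgl UNIV)" "io K q2 = dsm (dsm (io k q) 0) (dgl UNIV)"
    using v1(2) v2(2) vp_psum(2)[OF p vp_pzero(1)[OF eN]] vp_psum(2)[OF q vp_pzero(1)[OF eN]]
      vp_pzero(2)[OF eN] vp_pzero'(2)[OF eN] im
    by (simp_all add: J_def K_def q1_def q2_def)
  have eJ: "is_emb J (idx q1)" "is_emb K (idx q2)" using vJ by (auto simp: vp_def)
  have mq: "matrix_on (idx q1) (idx q1) (fstm q1)" "matrix_on (idx q1) (idx q1) (sndm q1)"
    "matrix_on (idx q2) (idx q2) (fstm q2)" "matrix_on (idx q2) (idx q2) (sndm q2)"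
    "psi d R (em J (idx q1) J (idx q1) (fstm q1))" "psi d R (em J (idx q1) J (idx q1) (sndm q1))"
    "psi d R (em K (idx q2) K (idx q2) (fstm q2))" "psi d R (em K (idx q2) K (idx q2) (sndm q2))"
    using vJ by (auto simp: vp_def)
  let ?e = "dgl (j ` pts (idx p))" and ?f = "dgl (k ` pts (idx q))"
  obtain g g' where g: "g \<in> Gpairs d R" "g' \<in> Gpairs d R"
    "dsm (dsm ?f 1) 1 * g = g" "g * dsm (dsm ?e 1) 1 = g" "dsm (dsm ?e 1) 1 * g' = g'" "g' * dsm (dsm ?f 1) 1 = g'"
    "g * g' = dsm (dsm ?f 1) 1" "g' * g = dsm (dsm ?e 1) 1"
    "g * dsm (dsm (io j p) 0) 1 * g' = dsm (dsm (io k q) 0) 1"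
    using idem_pair_iso[OF vp_idem[OF p] dgl_props(1,3) io_corner[OF p] vp_idem[OF q] dgl_props(1,3) io_corner[OF q] seq]
    by metis
  note pm = pm_ring_axioms
  \<comment> \<open>The two elements agree in the component \<open>(d, R)\<close>, which is all that
    matters here, but in general not in the others.\<close>
  have m1: "mat 1 d R i = mat (dgl UNIV) d R i" for i
    by (simp add: mat_one[OF pm] dgl_def psi_dg mone_spgN)
  have E: "mat (dsm (dsm ?e 1) 1) d R i = dg R (J ` pts (idx q1))" for i
  proof -
    have "mat (dsm (dsm ?e 1) 1) d R i = mat (dsm (dsm ?e (dgl UNIV)) (dgl UNIV)) d R i"
      by (simp add: dsm_def mat_blk[OF pm] m1)
    moreover have "sh0 ` (sh0 ` j ` pts (idx p) \<union> range sh1) \<union> range sh1 = J ` pts (idx q1)"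
      by (simp add: J_def q1_def psum_def pzero_def pzero'_def jsum_pts im')
    ultimately show ?thesis by (simp add: dgl_dsm) (simp add: dgl_def psi_dg)
  qed
  have F: "mat (dsm (dsm ?f 1) 1) d R i = dg R (K ` pts (idx q2))" for i
  proof -
    have "mat (dsm (dsm ?f 1) 1) d R i = mat (dsm (dsm ?f (dgl UNIV)) (dgl UNIV)) d R i"
      by (simp add: dsm_def mat_blk[OF pm] m1)
    moreover have "sh0 ` (sh0 ` k ` pts (idx q) \<union> range sh1) \<union> range sh1 = K ` pts (idx q2)"
      by (simp add: K_def q2_def psum_def pzero_def pzero'_def jsum_pts im')
    ultimately show ?thesis by (simp add: dgl_dsm) (simp add: dgl_def psi_dg)
  qed
  have mP: "mat (dsm (dsm (io j p) 0) 1) d R i = mat (io J q1) d R i"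
    "mat (dsm (dsm (io k q) 0) 1) d R i = mat (io K q2) d R i" for i
    by (simp_all add: io dsm_def mat_blk[OF pm] m1)
  define b where "b i = mat g d R i" for i
  define b' where "b' i = mat g' d R i" for i
  have bsupp: "b i u v = 0" if "u \<notin> K ` pts (idx q2) \<or> v \<notin> J ` pts (idx q1)" for i u v
  proof -
    have "mmult R (dg R (K ` pts (idx q2))) (b i) = b i" "mmult R (b i) (dg R (J ` pts (idx q1))) = b i"
      using arg_cong[OF g(3), of "\<lambda>x. mat x d R i"] arg_cong[OF g(4), of "\<lambda>x. mat x d R i"]
      by (simp_all add: mat_mult[OF pm] b_def E F)
    then show ?thesis using that mmult_dg_left mmult_dg_right by metis
  qed
  have bsupp': "b' i u v = 0" if "u \<notin> J ` pts (idx q1) \<or> v \<notin> K ` pts (idx q2)" for i u v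
  proof -
    have "mmult R (dg R (J ` pts (idx q1))) (b' i) = b' i" "mmult R (b' i) (dg R (K ` pts (idx q2))) = b' i"
      using arg_cong[OF g(5), of "\<lambda>x. mat x d R i"] arg_cong[OF g(6), of "\<lambda>x. mat x d R i"]
      by (simp_all add: mat_mult[OF pm] b'_def E F)
    then show ?thesis using that mmult_dg_left mmult_dg_right by metis
  qed
  define B where "B i = res K (idx q2) J (idx q1) (b i)" for i
  define B' where "B' i = res J (idx q1) K (idx q2) (b' i)" for i
  have emB: "em K (idx q2) J (idx q1) (B i) = b i" for i
    unfolding B_def by (rule em_res[OF eJ(2,1) bsupp])
  have emB': "em J (idx q1) K (idx q2) (B' i) = b' i" for i
    unfolding B'_def by (rule em_res[OF eJ(1,2) bsupp'])
  have mB: "matrix_on (idx q2) (idx q1) (B i)" "matrix_on (idx q1) (idx q2) (B' i)" for i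
    by (simp_all add: B_def B'_def matrix_on_res)
  have "(B True, B False) \<in> Psi2 d R (idx q2) (idx q1)"
    using g(1) psi_mat[OF pm, of d g]
    by (simp add: Psi2_def Psi_em[OF eJ(2,1)] Kmat_em[OF eJ(2,1)] mB matrix_on_simps em_minus emB Gpairs_def)
      (simp add: b_def)
  moreover have "(B' True, B' False) \<in> Psi2 d R (idx q1) (idx q2)"
    using g(2) psi_mat[OF pm, of d g']
    by (simp add: Psi2_def Psi_em[OF eJ(1,2)] Kmat_em[OF eJ(1,2)] mB matrix_on_simps em_minus emB' Gpairs_def)
      (simp add: b'_def)
  moreover have "mmult R (B i) (B' i) = mone R (idx q2)" for i
    by (rule em_inject[OF eJ(2,2)])
      (simp_all add: matrix_on_mmult[OF mB(1) mB(2)] matrix_on_simps em_mmult[OF eJ(2,1,2) mB(1) mB(2)]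
        emB emB' em_mone eJ F[of i, folded g(7), unfolded mat_mult[OF pm]] b_def b'_def)
  moreover have "mmult R (B' i) (B i) = mone R (idx q1)" for i
    by (rule em_inject[OF eJ(1,1)])
      (simp_all add: matrix_on_mmult[OF mB(2) mB(1)] matrix_on_simps em_mmult[OF eJ(1,2,1) mB(2) mB(1)]
        emB emB' em_mone eJ E[of i, folded g(8), unfolded mat_mult[OF pm]] b_def b'_def)
  moreover have conj: "mmult R (mmult R (b i) (mat (io J q1) d R i)) (b' i) = mat (io K q2) d R i" for i
    using arg_cong[OF g(9), of "\<lambda>x. mat x d R i"] by (simp add: mat_mult[OF pm] mP b_def b'_def)
  have "mmult R (mmult R (B True) (fstm q1)) (B' True) = fstm q2"
    using conj[of True]
    by (intro em_inject[OF eJ(2,2)])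
      (simp_all add: mB mq matrix_on_mmult[OF mB(1) mq(1)] matrix_on_mmult[OF matrix_on_mmult[OF mB(1) mq(1)] mB(2)]
        em_mmult[OF eJ(2,1,1)] em_mmult[OF eJ(2,1,2)] emB emB' io_def)
  moreover have "mmult R (mmult R (B False) (sndm q1)) (B' False) = sndm q2"
    using conj[of False]
    by (intro em_inject[OF eJ(2,2)])
      (simp_all add: mB mq matrix_on_mmult[OF mB(1) mq(2)] matrix_on_mmult[OF matrix_on_mmult[OF mB(1) mq(2)] mB(2)]
        em_mmult[OF eJ(2,1,1)] em_mmult[OF eJ(2,1,2)] emB emB' io_def)
  ultimately show ?thesis
    unfolding alg_homotopic_def Let_def q1_def[symmetric] q2_def[symmetric]
    using is_spg_spgN q1_def q2_def by blast
qed

lemma homotopic_iff: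
  "vp j p \<Longrightarrow> vp k q \<Longrightarrow> alg_homotopic d R p q \<longleftrightarrow> seq (io j p) (io k q)"
  using homotopic_seq seq_homotopic by blast

section \<open>Regular idempotents over an index set\<close>

lemma mmult_idem_dg:
  "mmult R (bm (\<lambda>_ _. 0) (\<lambda>_ _. 0) (\<lambda>_ _. 0) (dg R E)) (bm (\<lambda>_ _. 0) (\<lambda>_ _. 0) (\<lambda>_ _. 0) (dg R E)) =
    bm (\<lambda>_ _. 0) (\<lambda>_ _. 0) (\<lambda>_ _. 0) (dg R E)"
proof -
  have eq: "dsm 0 (dgl E) = lift d R (bm (\<lambda>_ _. 0) (\<lambda>_ _. 0) (\<lambda>_ _. 0) (dg R E)) (bm (\<lambda>_ _. 0) (\<lambda>_ _. 0) (\<lambda>_ _. 0) (dg R E))"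
    unfolding lift_zero[symmetric] dgl_def by (simp add: lift_dsm psi_dg psi_zero)
  have "dsm 0 (dgl E) * dsm 0 (dgl E) = dsm 0 (dgl E)" by (simp add: dsm_mult dgl_props)
  from arg_cong[OF this, of "\<lambda>x. mat x d R True"] show ?thesis
    by (simp add: mat_mult[OF pm_ring_axioms] eq psi_bm psi_dg psi_zero)
qed

definition reg_pair :: "'i spg \<Rightarrow> ('i + 'i \<Rightarrow> 'i + 'i \<Rightarrow> 'r) \<Rightarrow> ('i + 'i, 'r) mpair" where
  "reg_pair \<Xi> U = \<lparr>idx = spg_sum \<Xi> \<Xi>, fstm = U, sndm = dsum mzero (mone R \<Xi>)\<rparr>"

text \<open>Embedding the given matrix yields \<open>V\<close> with \<open>?e\<close> on the
  diagonal; adding the constant \<open>?c\<close> completes it to the form with the full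
  \<open>1\<close>, and \<open>regular_cut\<close> compares the two.\<close>

lemma vp_regular:
  fixes \<Xi> :: "'i spg"
  assumes j: "is_emb j \<Xi>" and U0: "regular_idem d R \<Xi> U0"
  obtains U where "vp (jsum j j) (reg_pair \<Xi> U0)" "regular (dgl (j ` pts \<Xi>)) U"
    "seq (io (jsum j j) (reg_pair \<Xi> U0)) U"
proof -
  let ?em = "em j \<Xi> j \<Xi>"
  let ?e = "dgl (j ` pts \<Xi>)"
  obtain h00 h01 h10 h11 where K: "h00 \<in> Kmat d R \<Xi> \<Xi>" "h01 \<in> Kmat d R \<Xi> \<Xi>" "h10 \<in> Kmat d R \<Xi> \<Xi>" "h11 \<in> Kmat d R \<Xi> \<Xi>"
    and U: "U0 = block h00 h01 h10 (madd (mone R \<Xi>) h11)" "mmult R U0 U0 = U0"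
    and rel: "mmult R h00 h10 = mzero" "mmult R h01 h00 = mzero" "mmult R h00 h11 = mzero" "mmult R h01 h01 = mzero"
      "mmult R h10 h10 = mzero" "mmult R h11 h00 = mzero" "mmult R h10 h11 = mzero" "mmult R h11 h01 = mzero"
    using U0 unfolding regular_idem_def by blast
  have m: "matrix_on \<Xi> \<Xi> h00" "matrix_on \<Xi> \<Xi> h01" "matrix_on \<Xi> \<Xi> h10" "matrix_on \<Xi> \<Xi> h11"
    using K by (auto simp: Kmat_def)
  have s: "smooth d R (?em h00)" "smooth d R (?em h01)" "smooth d R (?em h10)" "smooth d R (?em h11)"
    using K m Kmat_em[OF j j] by auto
  note ps = s[THEN smooth_psi]
  define hl where "hl h = lift d R (?em h) (\<lambda>_ _. 0)" for h
  define U where "U = blk (hl h00) (hl h01) (hl h10) (1 + hl h11)"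
  define V where "V = blk (hl h00) (hl h01) (hl h10) (?e + hl h11)"
  have hG: "hl h \<in> Gpairs d R" "cst False (hl h) = 0" if "smooth d R (?em h)" for h
    using that smooth_psi[OF that] by (simp_all add: hl_def lift_G cst_lift psi_zero lift_zero)
  have he: "?e * hl h = hl h" "hl h * ?e = hl h" if "smooth d R (?em h)" for h
    using smooth_psi[OF that] em_corner[OF j j]
    by (simp_all add: hl_def dgl_def lift_mult psi_zero psi_dg mmult_zero)
  have hh: "hl h * hl k = 0" if "matrix_on \<Xi> \<Xi> h" "matrix_on \<Xi> \<Xi> k" "smooth d R (?em h)" "smooth d R (?em k)" "mmult R h k = mzero" for h k
  proof -
    have "mmult R (?em h) (?em k) = (\<lambda>_ _. 0)"
      by (simp add: em_mmult[OF j j j that(1,2), symmetric] that(5) em_zero)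
    then show ?thesis
      using smooth_psi[OF that(3)] smooth_psi[OF that(4)]
      by (simp add: hl_def lift_mult psi_zero mmult_zero lift_zero)
  qed
  have emU: "em (jsum j j) (spg_sum \<Xi> \<Xi>) (jsum j j) (spg_sum \<Xi> \<Xi>) U0 =
      bm (?em h00) (?em h01) (?em h10) (\<lambda>n m. dg R (j ` pts \<Xi>) n m + ?em h11 n m)"
    by (simp add: U(1) em_block[OF j j] em_add em_mone[OF j])
  have emP: "em (jsum j j) (spg_sum \<Xi> \<Xi>) (jsum j j) (spg_sum \<Xi> \<Xi>) (dsum mzero (mone R \<Xi>)) =
      bm (\<lambda>_ _. 0) (\<lambda>_ _. 0) (\<lambda>_ _. 0) (dg R (j ` pts \<Xi>))"
    by (simp add: dsum_def em_block[OF j j] em_zero em_mone[OF j])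
  have mU: "matrix_on (spg_sum \<Xi> \<Xi>) (spg_sum \<Xi> \<Xi>) U0"
    unfolding U(1) by (intro matrix_on_block m matrix_on_simps)
  have mP: "matrix_on (spg_sum \<Xi> \<Xi>) (spg_sum \<Xi> \<Xi>) (dsum mzero (mone R \<Xi>))"
    unfolding dsum_def by (intro matrix_on_block matrix_on_simps)
  have psU: "psi d R (bm (?em h00) (?em h01) (?em h10) (\<lambda>n m. dg R (j ` pts \<Xi>) n m + ?em h11 n m))"
    by (intro psi_bm psi_add psi_dg ps)
  have psP: "psi d R (bm (\<lambda>_ _. 0) (\<lambda>_ _. 0) (\<lambda>_ _. 0) (dg R (j ` pts \<Xi>)))"
    by (intro psi_bm psi_zero psi_dg)
  have ioV: "io (jsum j j) (reg_pair \<Xi> U0) = V"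
  proof -
    have "?e + hl h11 = lift d R (\<lambda>n m. dg R (j ` pts \<Xi>) n m + ?em h11 n m) (dg R (j ` pts \<Xi>))"
      by (simp add: dgl_def hl_def lift_add psi_dg ps psi_zero)
    then show ?thesis
      by (simp add: V_def hl_def lift_blk ps psi_zero psi_add psi_dg io_def reg_pair_def emU emP)
  qed
  have "mmult R (bm (?em h00) (?em h01) (?em h10) (\<lambda>n m. dg R (j ` pts \<Xi>) n m + ?em h11 n m))
     (bm (?em h00) (?em h01) (?em h10) (\<lambda>n m. dg R (j ` pts \<Xi>) n m + ?em h11 n m)) =
     bm (?em h00) (?em h01) (?em h10) (\<lambda>n m. dg R (j ` pts \<Xi>) n m + ?em h11 n m)"
    unfolding emU[symmetric]
    by (simp add: em_mmult[OF is_emb_sum[OF j j] is_emb_sum[OF j j] is_emb_sum[OF j j] mU mU, symmetric] U(2))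
  then have "io (jsum j j) (reg_pair \<Xi> U0) * io (jsum j j) (reg_pair \<Xi> U0) = io (jsum j j) (reg_pair \<Xi> U0)"
    by (simp add: io_def reg_pair_def emU emP lift_mult psU psP mmult_idem_dg)
  moreover have "V \<in> Gpairs d R"
    unfolding V_def using hG(1) s dgl_props(1) G_C by (intro blk_G G_add) auto
  ultimately have iV: "idem V" unfolding ioV idem_def by simp
  have vp: "vp (jsum j j) (reg_pair \<Xi> U0)"
    unfolding vp_def ioV using iV
    by (simp add: reg_pair_def is_emb_sum[OF j j] mU mP emU emP psU psP)
  let ?c = "blk 0 0 0 (1 - ?e)"
  have UV: "U = V + ?c" by (simp add: U_def V_def blk_add add.commute)
  have c: "V * ?c = 0" "?c * V = 0" "?c * ?c = ?c"
    by (simp_all add: V_def blk_mult blk_zero algebra_simps he s dgl_props)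
  have "idem U"
    using iV c unfolding UV idem_def by (simp add: algebra_simps G_add blk_G G_intros G_C dgl_props)
  then have "regular ?e U"
    unfolding regular_def
  proof (intro conjI, assumption, intro bexI conjI)
    show "U = blk (hl h00) (hl h01) (hl h10) (1 + hl h11)" by (rule U_def)
  qed (simp_all add: hG s he hh m rel mult.assoc)
  moreover have "dsm ?e ?e * U = V"
    by (simp add: U_def V_def dsm_def blk_mult distrib_left he s)
  ultimately show thesis
    using that[OF vp] regular_cut(2)[of ?e U] dgl_props ioV by metis
qed

text \<open>The factor \<open>dgl E\<close> lives only in the component \<open>(d, R)\<close>, so
  \<open>h\<close> vanishes in all others and is determined by two matrices.\<close>

lemma lift_mat:
  assumes "dgl E * h = h" shows "h = lift d R (mat h d R True) (mat h d R False)"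
proof (rule mring_eqI)
  fix d' i and R' :: "('k, 'r) uext" assume R': "pm_ring R'"
  have "mat (dgl E * h) d' R' i = (\<lambda>_ _. 0)" if "\<not> (d' = d \<and> R' = R)"
    using that R' by (auto simp: mat_mult dgl_def mat_lft psi_dg pm_ring.mmult_zero)
  then show "mat h d' R' i = mat (lift d R (mat h d R True) (mat h d R False)) d' R' i"
    by (auto simp: mat_lft psi_mat pm_ring_axioms assms)
qed

text \<open>Turns an abstract regular idempotent back into matrices. Finite sets are the relevant
  case, since only finite bounds on the dimension have to be realised; on them every function is a
  growth function.\<close>

lemma regular_reg_pair:
  assumes E: "finite E" and U: "regular (dgl E) U"
  defines "\<Xi> \<equiv> \<lparr>pts = E, growth = UNIV\<rparr>"
  obtains U0 where "regular_idem d R \<Xi> U0" "vp (jsum (\<lambda>n. n) (\<lambda>n. n)) (reg_pair \<Xi> U0)"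
    "seq (io (jsum (\<lambda>n. n) (\<lambda>n. n)) (reg_pair \<Xi> U0)) U"
proof -
  let ?e = "dgl E" and ?em = "em (\<lambda>n. n) \<Xi> (\<lambda>n. n) \<Xi>"
  note pm = pm_ring_axioms
  from U obtain h00 h01 h10 h11 where h: "h00 \<in> Gpairs d R" "h01 \<in> Gpairs d R" "h10 \<in> Gpairs d R" "h11 \<in> Gpairs d R"
     "idem U" "U = blk h00 h01 h10 (1 + h11)"
     "cst False h00 = 0" "cst False h01 = 0" "cst False h10 = 0" "cst False h11 = 0"
     "?e * h00 * ?e = h00" "?e * h01 * ?e = h01" "?e * h10 * ?e = h10" "?e * h11 * ?e = h11"
     "h00 * h10 = 0" "h01 * h00 = 0" "h00 * h11 = 0" "h01 * h01 = 0"
     "h10 * h10 = 0" "h11 * h00 = 0" "h10 * h11 = 0" "h11 * h01 = 0"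
    unfolding regular_def by auto
  have eh: "?e * h00 = h00" "?e * h01 = h01" "?e * h10 = h10" "?e * h11 = h11"
      "h00 * ?e = h00" "h01 * ?e = h01" "h10 * ?e = h10" "h11 * ?e = h11"
    using h(11-14) dgl_props(2)[of E] by (metis mult.assoc)+
  define H where "H h = mat h d R True" for h
  have j: "is_emb (\<lambda>n. n) \<Xi>" by (rule is_emb_finite) (simp_all add: \<Xi>_def E)
  have HF: "mat h d R False = (\<lambda>_ _. 0)" if "cst False h = 0" for h
    using arg_cong[OF that, of "\<lambda>x. mat x d R False"] by (simp add: mat_cst mat_zero)
  have off: "H h u v = 0" if "?e * h = h" "h * ?e = h" "u \<notin> E \<or> v \<notin> E" for h u v
  proof -
    have "mmult R (dg R E) (H h) = H h" "mmult R (H h) (dg R E) = H h"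
      using arg_cong[OF that(1), of "\<lambda>x. mat x d R True"] arg_cong[OF that(2), of "\<lambda>x. mat x d R True"]
      by (simp_all add: mat_mult[OF pm] dgl_def psi_dg H_def)
    then show ?thesis using that(3) mmult_dg_left[of E "H h" u v] mmult_dg_right[of "H h" E u v] by metis
  qed
  have mH: "matrix_on \<Xi> \<Xi> (H h)" if "?e * h = h" "h * ?e = h" for h
    using off[OF that] by (auto simp: matrix_on_def \<Xi>_def)
  have emH: "?em (H h) = H h" if "?e * h = h" "h * ?e = h" for h
    by (rule em_eqI[OF j j]) (use off[OF that] in \<open>auto simp: \<Xi>_def\<close>)
  have KH: "H h \<in> Kmat d R \<Xi> \<Xi>" if "?e * h = h" "h * ?e = h" "h \<in> Gpairs d R" "cst False h = 0" for h
    using that(3) HF[OF that(4)] Kmat_em[OF j j mH[OF that(1,2)]] emH[OF that(1,2)]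
    by (simp add: Gpairs_def H_def)
  define U0 where "U0 = block (H h00) (H h01) (H h10) (madd (mone R \<Xi>) (H h11))"
  have emU: "em (jsum (\<lambda>n. n) (\<lambda>n. n)) (spg_sum \<Xi> \<Xi>) (jsum (\<lambda>n. n) (\<lambda>n. n)) (spg_sum \<Xi> \<Xi>) U0 =
      bm (H h00) (H h01) (H h10) (\<lambda>n m. dg R E n m + H h11 n m)"
    by (simp add: U0_def em_block[OF j j] em_add em_mone[OF j] emH eh) (simp add: \<Xi>_def)
  have mU: "matrix_on (spg_sum \<Xi> \<Xi>) (spg_sum \<Xi> \<Xi>) U0"
    unfolding U0_def by (intro matrix_on_block matrix_on_simps mH eh)
  define V where "V = dsm ?e ?e * U"
  have V: "V = blk h00 h01 h10 (?e + h11)"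
    by (simp add: V_def h(6) dsm_def blk_mult distrib_left eh)
  note cut = regular_cut[OF U dgl_props(2,1), folded V_def]
  have matV: "mat V d R True = bm (H h00) (H h01) (H h10) (\<lambda>n m. dg R E n m + H h11 n m)"
    by (simp add: V mat_blk[OF pm] mat_add dgl_def psi_dg H_def)
  have VV: "V * V = V" using cut(1) by (simp add: idem_def)
  have UU0: "mmult R U0 U0 = U0"
  proof (rule em_inject[OF is_emb_sum[OF j j] is_emb_sum[OF j j] matrix_on_mmult[OF mU mU] mU])
    show "em (jsum (\<lambda>n. n) (\<lambda>n. n)) (spg_sum \<Xi> \<Xi>) (jsum (\<lambda>n. n) (\<lambda>n. n)) (spg_sum \<Xi> \<Xi>) (mmult R U0 U0) =
        em (jsum (\<lambda>n. n) (\<lambda>n. n)) (spg_sum \<Xi> \<Xi>) (jsum (\<lambda>n. n) (\<lambda>n. n)) (spg_sum \<Xi> \<Xi>) U0"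
      unfolding em_mmult[OF is_emb_sum[OF j j] is_emb_sum[OF j j] is_emb_sum[OF j j] mU mU] emU matV[symmetric]
      using arg_cong[OF VV, of "\<lambda>x. mat x d R True"] by (simp add: mat_mult[OF pm])
  qed
  have rel: "mmult R (H h) (H k) = mzero" if "h * k = 0" for h k
    using arg_cong[OF that, of "\<lambda>x. mat x d R True"] by (simp add: mat_mult[OF pm] H_def mat_zero mzero_def)
  have reg: "regular_idem d R \<Xi> U0"
    unfolding regular_idem_def
  proof (rule bexI[of _ "H h00"], rule bexI[of _ "H h01"], rule bexI[of _ "H h10"], rule bexI[of _ "H h11"], intro conjI)
    show "U0 = block (H h00) (H h01) (H h10) (madd (mone R \<Xi>) (H h11))" by (rule U0_def)
    show "H h00 \<in> Kmat d R \<Xi> \<Xi>" "H h01 \<in> Kmat d R \<Xi> \<Xi>" "H h10 \<in> Kmat d R \<Xi> \<Xi>" "H h11 \<in> Kmat d R \<Xi> \<Xi>"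
      using h eh by (auto intro: KH)
  qed (rule UU0 rel h)+
  obtain W where W: "vp (jsum (\<lambda>n. n) (\<lambda>n. n)) (reg_pair \<Xi> U0)"
    using vp_regular[OF j reg] by metis
  have lm: "h = lift d R (H h) (\<lambda>_ _. 0)" if "?e * h = h" "cst False h = 0" for h
    using lift_mat[OF that(1)] HF[OF that(2)] by (simp add: H_def)
  have psH: "psi d R (H h)" for h by (simp add: H_def psi_mat pm)
  have emP: "em (jsum (\<lambda>n. n) (\<lambda>n. n)) (spg_sum \<Xi> \<Xi>) (jsum (\<lambda>n. n) (\<lambda>n. n)) (spg_sum \<Xi> \<Xi>) (dsum mzero (mone R \<Xi>)) =
      bm (\<lambda>_ _. 0) (\<lambda>_ _. 0) (\<lambda>_ _. 0) (dg R E)"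
    by (simp add: dsum_def em_block[OF j j] em_zero em_mone[OF j]) (simp add: \<Xi>_def)
  have "V = io (jsum (\<lambda>n. n) (\<lambda>n. n)) (reg_pair \<Xi> U0)"
  proof -
    have "?e + h11 = lift d R (\<lambda>n m. dg R E n m + H h11 n m) (dg R E)"
      by (subst lm[OF eh(4) h(10)]) (simp add: dgl_def lift_add psi_dg psH psi_zero)
    then have "V = blk (lift d R (H h00) (\<lambda>_ _. 0)) (lift d R (H h01) (\<lambda>_ _. 0)) (lift d R (H h10) (\<lambda>_ _. 0))
        (lift d R (\<lambda>n m. dg R E n m + H h11 n m) (dg R E))"
      unfolding V using lm[OF eh(1) h(7)] lm[OF eh(2) h(8)] lm[OF eh(3) h(9)] by simp
    then show ?thesis
      by (simp add: lift_blk psH psi_zero psi_add psi_dg io_def reg_pair_def emU emP)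
  qed
  then show thesis using that[OF reg W] cut(2) by simp
qed

section \<open>The dimension over one ring\<close>

lemma vdim_alt:
  "vdim d R p = Inf {spg_card \<Xi> | \<Xi> :: nat spg. is_spg \<Xi> \<and>
     (\<exists>U. regular_idem d R \<Xi> U \<and> alg_homotopic d R p (reg_pair \<Xi> U))}"
  by (simp add: vdim_def reg_pair_def)

text \<open>The infimum of a nonempty set of extended naturals is attained, and that of the empty
  set is infinite.\<close>

lemma enat_Inf_le: "Inf A \<le> enat n \<longleftrightarrow> (\<exists>x\<in>A. x \<le> enat n)"
proof
  assume le: "Inf A \<le> enat n"
  then have ne: "A \<noteq> {}" by (auto simp: Inf_enat_def)
  then have "Inf A \<in> A" unfolding Inf_enat_def using LeastI_ex[of "\<lambda>x. x \<in> A"] by auto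
  then show "\<exists>x\<in>A. x \<le> enat n" using le by blast
next
  assume "\<exists>x\<in>A. x \<le> enat n"
  then show "Inf A \<le> enat n" by (meson Inf_lower order_trans)
qed

lemma vdim_leD:
  assumes p: "vp j p" and le: "vdim d R p \<le> enat n"
  obtains E U where "finite E" "card E \<le> n" "regular (dgl E) U" "seq (io j p) U"
proof -
  obtain \<Xi> :: "nat spg" and U0 where X: "spg_card \<Xi> \<le> enat n" "is_spg \<Xi>" "regular_idem d R \<Xi> U0"
    "alg_homotopic d R p (reg_pair \<Xi> U0)"
    using le unfolding vdim_alt enat_Inf_le by blast
  obtain k where k: "is_emb k \<Xi>" using is_spg_emb[OF X(2)] .
  obtain U where U: "vp (jsum k k) (reg_pair \<Xi> U0)" "regular (dgl (k ` pts \<Xi>)) U"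
    "seq (io (jsum k k) (reg_pair \<Xi> U0)) U" using vp_regular[OF k X(3)] .
  have fin: "finite (pts \<Xi>)" "card (pts \<Xi>) \<le> n" using X(1) by (auto simp: spg_card_def split: if_splits)
  have "seq (io j p) U"
    using seq_trans[OF vp_idem[OF p] _ homotopic_seq[OF p U(1) X(4)] U(3)] U(2) by (simp add: regular_def)
  then show thesis
    using that[of "k ` pts \<Xi>" U] fin U(2) card_image_le[OF fin(1), of k] by simp
qed

lemma vdim_leI:
  assumes p: "vp j p" and E: "finite E" "card E \<le> n" and U: "regular (dgl E) U" "seq (io j p) U"
  shows "vdim d R p \<le> enat n"
proof -
  let ?X = "\<lparr>pts = E, growth = UNIV\<rparr>"
  obtain U0 where U0: "regular_idem d R ?X U0" "vp (jsum (\<lambda>n. n) (\<lambda>n. n)) (reg_pair ?X U0)"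
    "seq (io (jsum (\<lambda>n. n) (\<lambda>n. n)) (reg_pair ?X U0)) U"
    using regular_reg_pair[OF E(1) U(1)] .
  have "seq (io j p) (io (jsum (\<lambda>n. n) (\<lambda>n. n)) (reg_pair ?X U0))"
    by (rule seq_trans[OF vp_idem[OF p] vp_idem[OF U0(2)] U(2) seq_sym[OF U0(3)]])
  then have "alg_homotopic d R p (reg_pair ?X U0)" by (rule seq_homotopic[OF p U0(2)])
  moreover have "is_spg ?X" "spg_card ?X \<le> enat n" using E by (simp_all add: is_spg_def spg_card_def)
  ultimately show ?thesis unfolding vdim_alt enat_Inf_le using U0(1) by blast
qed

text \<open>The same index sets compete on both sides, infinite ones included.\<close>

lemma vdim_cong:
  assumes p: "vp j p" and q: "vp k q" and eq: "seq (io j p) (io k q)"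
  shows "vdim d R p = vdim d R q"
proof -
  have "alg_homotopic d R p (reg_pair \<Xi> U) \<longleftrightarrow> alg_homotopic d R q (reg_pair \<Xi> U)"
    if "is_spg \<Xi>" and reg: "regular_idem d R \<Xi> U" for \<Xi> :: "nat spg" and U
  proof -
    obtain l where l: "is_emb l \<Xi>" using is_spg_emb[OF \<open>is_spg \<Xi>\<close>] .
    obtain W where v: "vp (jsum l l) (reg_pair \<Xi> U)" using vp_regular[OF l reg] by metis
    show ?thesis
      unfolding homotopic_iff[OF p v] homotopic_iff[OF q v]
      using seq_trans[OF vp_idem[OF q] vp_idem[OF v] seq_sym[OF eq]]
        seq_trans[OF vp_idem[OF p] vp_idem[OF v] eq] by blast
  qed
  then have "{spg_card \<Xi> | \<Xi> :: nat spg. is_spg \<Xi> \<and>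
     (\<exists>U. regular_idem d R \<Xi> U \<and> alg_homotopic d R p (reg_pair \<Xi> U))} =
    {spg_card \<Xi> | \<Xi> :: nat spg. is_spg \<Xi> \<and>
     (\<exists>U. regular_idem d R \<Xi> U \<and> alg_homotopic d R q (reg_pair \<Xi> U))}"
    by blast
  then show ?thesis unfolding vdim_alt by simp
qed

text \<open>Over the empty index set the projection is \<open>0\<close>, and the only regular
  idempotent is the constant \<open>0 \<oplus> 1\<close>, which is stably trivial.\<close>

lemma vdim_zero_iff_seq:
  assumes p: "vp j p" shows "vdim d R p = 0 \<longleftrightarrow> seq (io j p) 0"
proof
  assume "vdim d R p = 0"
  then have "vdim d R p \<le> enat 0" by (simp add: zero_enat_def)
  then obtain E U where E: "finite E" "card E \<le> 0" "regular (dgl E) U" "seq (io j p) U"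
    using vdim_leD[OF p] by metis
  then have "U = blk 0 0 0 1" using regular_zero_unique[of U] by (simp add: dgl_empty)
  moreover have "seq (blk 0 0 0 1) 0"
    by (rule seq_C_zero) (simp_all add: idem_def blk_mult blk_G G_intros pi_blk pi_simps)
  ultimately show "seq (io j p) 0" using E(4) seq_trans[OF vp_idem[OF p] idem_zero] by blast
next
  assume s: "seq (io j p) 0"
  have i: "idem (blk 0 0 0 1)" by (simp add: idem_def blk_mult blk_G G_intros)
  have "seq (blk 0 0 0 1) 0"
    by (rule seq_C_zero[OF i]) (simp add: pi_blk pi_simps)
  then have "seq (io j p) (blk 0 0 0 1)" using seq_trans[OF vp_idem[OF p] i s seq_sym] by blast
  then have "vdim d R p \<le> enat 0"
    using vdim_leI[OF p, of "{}" 0] regular_zero by (simp add: dgl_empty)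
  then show "vdim d R p = 0" by (metis zero_enat_def le_zero_eq)
qed

lemma vp_pempty: "vp (\<lambda>n. n) pempty" "io (\<lambda>n. n) pempty = 0"
proof -
  have "is_emb (\<lambda>n. n) \<lparr>pts = {} :: nat set, growth = UNIV\<rparr>" by (rule is_emb_finite) simp_all
  moreover have "pempty = pzero \<lparr>pts = {} :: nat set, growth = UNIV\<rparr>"
    by (simp add: pempty_def pzero_def)
  ultimately show "vp (\<lambda>n. n) pempty" "io (\<lambda>n. n) pempty = 0"
    using vp_pzero(1) vp_pzero(2) by metis+
qed

lemma vdim_zero_iff: "vp j p \<Longrightarrow> vdim d R p = 0 \<longleftrightarrow> alg_homotopic d R p pempty"
  using vdim_zero_iff_seq[of j p] homotopic_iff[of j p, OF _ vp_pempty(1)] vp_pempty(2) by simp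

lemma vdim_psum_le:
  assumes p: "vp j p" and q: "vp k q"
  shows "vdim d R (psum p q) \<le> vdim d R p + vdim d R q"
proof (cases "vdim d R p"; cases "vdim d R q")
  fix m n assume mn: "vdim d R p = enat m" "vdim d R q = enat n"
  obtain E U where E: "finite E" "card E \<le> m" "regular (dgl E) U" "seq (io j p) U"
    using vdim_leD[OF p, of m] mn by auto
  obtain F V where F: "finite F" "card F \<le> n" "regular (dgl F) V" "seq (io k q) V"
    using vdim_leD[OF q, of n] mn by auto
  obtain X where X: "regular (dsm (dgl E) (dgl F)) X" "seq (dsm U V) X"
    using regular_dsm[OF E(3) F(3)] .
  have i: "idem U" "idem V" "idem X" using E F X by (auto simp: regular_def)
  note v = vp_psum[OF p q]
  have "seq (io (jsum j k) (psum p q)) (dsm U V)"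
    unfolding v(2) by (intro seq_dsm_cong vp_idem p q i E F)
  then have "seq (io (jsum j k) (psum p q)) X" by (rule seq_trans[OF vp_idem[OF v(1)] i(3) _ X(2)])
  moreover have "card (sh0 ` E \<union> sh1 ` F) \<le> m + n"
    using E F card_Un_le[of "sh0 ` E" "sh1 ` F"] card_image_le[of E sh0] card_image_le[of F sh1] by simp
  ultimately have "vdim d R (psum p q) \<le> enat (m + n)"
    using vdim_leI[OF v(1), of "sh0 ` E \<union> sh1 ` F"] E F X(1) by (simp add: dgl_dsm)
  then show ?thesis by (simp add: mn)
qed simp_all

lemma em_compl:
  assumes "is_emb j \<Omega>" shows "em j \<Omega> j \<Omega> (mcompl R \<Omega> a) = (\<lambda>n m. dg R (j ` pts \<Omega>) n m - em j \<Omega> j \<Omega> a n m)"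
  by (simp add: mcompl_def em_minus em_mone[OF assms])

lemma vp_pinv:
  assumes p: "vp j p"
  shows "vp j (pinv R p)" "io j (pinv R p) = dgl (j ` pts (idx p)) - io j p"
proof -
  have e: "is_emb j (idx p)" and m: "matrix_on (idx p) (idx p) (fstm p)" "matrix_on (idx p) (idx p) (sndm p)"
    and ps: "psi d R (em j (idx p) j (idx p) (fstm p))" "psi d R (em j (idx p) j (idx p) (sndm p))"
    using p by (auto simp: vp_def)
  show io: "io j (pinv R p) = dgl (j ` pts (idx p)) - io j p"
    by (simp add: io_def pinv_def em_compl[OF e] dgl_def lift_diff psi_dg ps)
  have "idem (io j (pinv R p))"
    unfolding io by (rule seq_compl_corner(1)[OF vp_idem[OF p] dgl_props(3,1) io_corner[OF p]])
  then show "vp j (pinv R p)"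
    unfolding vp_def using e m ps
    by (simp add: pinv_def em_compl psi_minus psi_dg) (simp add: mcompl_def matrix_on_simps)
qed

lemma vdim_pinv_le:
  assumes p: "vp j p" shows "vdim d R (pinv R p) \<le> vdim d R p"
proof (cases "vdim d R p")
  case (enat n)
  obtain E U where E: "finite E" "card E \<le> n" "regular (dgl E) U" "seq (io j p) U"
    using vdim_leD[OF p, of n] enat by auto
  obtain V where V: "regular (dgl E) V" "seq (1 - U) V" using regular_compl[OF E(3)] .
  have i: "idem U" "idem V" using E V by (auto simp: regular_def)
  note v = vp_pinv[OF p]
  have "seq (io j (pinv R p)) (1 - io j p)"
    unfolding v(2) by (rule seq_compl_corner(2)[OF vp_idem[OF p] dgl_props(3,1) io_corner[OF p]])
  moreover have "seq (1 - io j p) (1 - U)" by (rule seq_compl[OF vp_idem[OF p] i(1) E(4)])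
  ultimately have "seq (io j (pinv R p)) V"
    using V(2) i vp_idem[OF v(1)] idem_compl by (meson seq_trans)
  then show ?thesis using vdim_leI[OF v(1) E(1,2) V(1)] enat by simp
qed simp

text \<open>The inverse is an involution, so the inequality implies equality.\<close>

lemma vdim_pinv:
  assumes p: "vp j p" shows "vdim d R (pinv R p) = vdim d R p"
proof -
  have "pinv R (pinv R p) = p"
    by (simp add: pinv_def mcompl_def mminus_def)
  then show ?thesis using vdim_pinv_le[OF p] vdim_pinv_le[OF vp_pinv(1)[OF p]] by simp
qed

end

subsection \<open>Unitizations and tensor products of polymetric rings\<close>

text \<open>All three bases are closed subrings of the complex numbers; multiplicativity of
  \<open>av\<close> and completeness are inherited from there.\<close>

lemma base_ring_embedding:
  fixes av :: "'k::comm_ring_1 \<Rightarrow> real"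
  assumes "base_ring av"
  obtains \<theta> :: "'k \<Rightarrow> complex" where "\<And>x y. \<theta> (x + y) = \<theta> x + \<theta> y" "\<And>x y. \<theta> (x * y) = \<theta> x * \<theta> y"
    "\<theta> 1 = 1" "inj \<theta>" "\<And>x. av x = cmod (\<theta> x)" "closed (range \<theta>)"
proof -
  note result = that
  have *: thesis if \<phi>: "bij \<phi>" "\<And>x y. \<phi> (x + y) = \<phi> x + \<phi> y \<and> \<phi> (x * y) = \<phi> x * \<phi> y"
      and \<psi>: "\<And>x y. \<psi> (x + y) = \<psi> x + \<psi> y" "\<And>x y. \<psi> (x * y) = \<psi> x * \<psi> y" "\<psi> 1 = 1" "inj \<psi>" "closed (range \<psi>)"
      and av: "\<And>x. av x = cmod (\<psi> (\<phi> x))"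
    for \<phi> :: "'k \<Rightarrow> 'c::comm_ring_1" and \<psi> :: "'c \<Rightarrow> complex"
  proof (rule result[of "\<lambda>x. \<psi> (\<phi> x)"])
    \<comment> \<open>Preservation of the unit is not part of \<open>base_ring\<close>; it follows
      from surjectivity.\<close>
    obtain e where e: "\<phi> e = 1" using bij_is_surj[OF \<phi>(1)] by (metis surj_def)
    have "\<phi> 1 = 1" using \<phi>(2)[of 1 e] e by simp
    then show "\<psi> (\<phi> 1) = 1" by (simp add: \<psi>)
    show "inj (\<lambda>x. \<psi> (\<phi> x))" using inj_compose[OF \<psi>(4) bij_is_inj[OF \<phi>(1)]] by (simp add: comp_def)
    have "range (\<lambda>x. \<psi> (\<phi> x)) = range \<psi>" using bij_is_surj[OF \<phi>(1)] by (metis image_image)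
    then show "closed (range (\<lambda>x. \<psi> (\<phi> x)))" using \<psi>(5) by simp
  qed (simp_all add: \<phi>(2) \<psi> av)
  from assms show thesis
    unfolding base_ring_def
  proof (elim disjE exE conjE)
    fix \<phi> :: "'k \<Rightarrow> int"
    assume "bij \<phi>" "\<forall>x y. \<phi> (x + y) = \<phi> x + \<phi> y \<and> \<phi> (x * y) = \<phi> x * \<phi> y" "\<forall>x. av x = real_of_int \<bar>\<phi> x\<bar>"
    then show thesis
      by (intro *[of \<phi> of_int]) (auto simp: inj_def Ints_def[symmetric] closed_Ints)
  next
    fix \<phi> :: "'k \<Rightarrow> real"
    assume "bij \<phi>" "\<forall>x y. \<phi> (x + y) = \<phi> x + \<phi> y \<and> \<phi> (x * y) = \<phi> x * \<phi> y" "\<forall>x. av x = \<bar>\<phi> x\<bar>"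
    then show thesis
      by (intro *[of \<phi> of_real]) (auto simp: inj_def Reals_def[symmetric] closed_complex_Reals)
  next
    fix \<phi> :: "'k \<Rightarrow> complex"
    assume "bij \<phi>" "\<forall>x y. \<phi> (x + y) = \<phi> x + \<phi> y \<and> \<phi> (x * y) = \<phi> x * \<phi> y" "\<forall>x. av x = cmod (\<phi> x)"
    then show thesis
      by (intro *[of \<phi> "\<lambda>x. x"]) (auto simp: inj_def)
  qed
qed

lemma base_ring_props:
  fixes av :: "'k::comm_ring_1 \<Rightarrow> real"
  assumes "base_ring av"
  shows "av 0 = 0" "0 \<le> av x" "av (- x) = av x" "av (x + y) \<le> av x + av y" "av (x * y) = av x * av y"
    "av x = 0 \<Longrightarrow> x = 0"
    "(\<And>e. 0 < e \<Longrightarrow> \<exists>N. \<forall>m\<ge>N. \<forall>n\<ge>N. av (X m - X n) < e) \<Longrightarrow> \<exists>l. (\<lambda>n. av (X n - l)) \<longlonglongrightarrow> 0"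
proof -
  obtain \<theta> :: "'k \<Rightarrow> complex" where \<theta>: "\<And>x y. \<theta> (x + y) = \<theta> x + \<theta> y" "\<And>x y. \<theta> (x * y) = \<theta> x * \<theta> y"
    "inj \<theta>" "\<And>x. av x = cmod (\<theta> x)" "closed (range \<theta>)"
    using base_ring_embedding[OF assms] by metis
  have 0: "\<theta> 0 = 0" using \<theta>(1)[of 0 0] by simp
  have m: "\<theta> (- x) = - \<theta> x" for x using \<theta>(1)[of x "- x"] by (simp add: 0 minus_unique)
  have d: "\<theta> (x - y) = \<theta> x - \<theta> y" for x y using \<theta>(1)[of x "- y"] by (simp add: m)
  show "av 0 = 0" "0 \<le> av x" "av (- x) = av x" "av (x + y) \<le> av x + av y" "av (x * y) = av x * av y"
    by (simp_all add: \<theta>(1,2,4) 0 m norm_triangle_ineq norm_mult)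
  show "av x = 0 \<Longrightarrow> x = 0" using injD[OF \<theta>(3), of x 0] by (simp add: \<theta>(4) 0)
  assume c: "\<And>e. 0 < e \<Longrightarrow> \<exists>N. \<forall>m\<ge>N. \<forall>n\<ge>N. av (X m - X n) < e"
  have "Cauchy (\<lambda>n. \<theta> (X n))"
    using c by (intro CauchyI) (simp add: \<theta>(4) d)
  then obtain L where L: "(\<lambda>n. \<theta> (X n)) \<longlonglongrightarrow> L" by (auto simp: Cauchy_convergent_iff convergent_def)
  have "L \<in> range \<theta>"
    using \<theta>(5) L closed_sequentially[of "range \<theta>" "\<lambda>n. \<theta> (X n)" L] by blast
  then obtain l where "L = \<theta> l" by blast
  then have "(\<lambda>n. av (X n - l)) \<longlonglongrightarrow> 0"
    using L by (simp add: \<theta>(4) d LIM_zero_iff tendsto_norm_zero_iff)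
  then show "\<exists>l. (\<lambda>n. av (X n - l)) \<longlonglongrightarrow> 0" by blast
qed

lemma sn_span_props:
  assumes P: "\<And>p. p \<in> P \<Longrightarrow> p 0 = (0::real) \<and> (\<forall>x. 0 \<le> p x) \<and> (\<forall>x. p (- x) = p x) \<and> (\<forall>x y. p (x + y) \<le> p x + p y)"
    and s: "s \<in> sn_span P"
  shows "s 0 = 0" "0 \<le> s x" "s (- x) = s x" "s (x + y) \<le> s x + s y"
proof -
  obtain C F where C: "s = (\<lambda>x. C * (\<Sum>p\<in>F. p x))" "0 \<le> C" "finite F" "F \<subseteq> P"
    using s by (auto simp: sn_span_def)
  show "s 0 = 0" "0 \<le> s x" "s (- x) = s x"
    unfolding C(1) using P C by (auto intro!: sum.neutral sum.cong sum_nonneg mult_nonneg_nonneg simp: subset_eq)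
  have "(\<Sum>p\<in>F. p (x + y)) \<le> (\<Sum>p\<in>F. p x) + (\<Sum>p\<in>F. p y)"
    unfolding sum.distrib[symmetric] using P C(4) by (intro sum_mono) auto
  then show "s (x + y) \<le> s x + s y"
    unfolding C(1) distrib_left[symmetric] using C(2) by (rule mult_left_mono)
qed

lemma sn_span_mem: "p \<in> P \<Longrightarrow> p \<in> sn_span P"
  unfolding sn_span_def by (auto intro!: exI[of _ 1] exI[of _ "{p}"])

lemma sn_span_zero: "(\<lambda>_. 0) \<in> sn_span P"
  unfolding sn_span_def by (auto intro!: exI[of _ 0] exI[of _ "{}"])

lemma sn_span_dominated:
  assumes "\<And>p x. p \<in> P \<Longrightarrow> (0::real) \<le> p x" "s \<in> sn_span P" "s' \<in> sn_span P"
  obtains u where "u \<in> sn_span P" "\<And>x. s x + s' x \<le> u x"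
proof -
  obtain C F where C: "s = (\<lambda>x. C * (\<Sum>p\<in>F. p x))" "0 \<le> C" "finite F" "F \<subseteq> P"
    using assms(2) by (auto simp: sn_span_def)
  obtain D H where D: "s' = (\<lambda>x. D * (\<Sum>p\<in>H. p x))" "0 \<le> D" "finite H" "H \<subseteq> P"
    using assms(3) by (auto simp: sn_span_def)
  have "C * (\<Sum>p\<in>F. p x) + D * (\<Sum>p\<in>H. p x) \<le> (C + D) * (\<Sum>p\<in>F \<union> H. p x)" for x
    unfolding distrib_right using C D assms(1)
    by (intro add_mono mult_left_mono sum_mono2) auto
  moreover have "(\<lambda>x. (C + D) * (\<Sum>p\<in>F \<union> H. p x)) \<in> sn_span P"
    unfolding sn_span_def mem_Collect_eq
    by (intro exI[of _ "C + D"] exI[of _ "F \<union> H"]) (use C D in auto)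
  ultimately show thesis using that C(1) D(1) by blast
qed

context
  fixes av :: "'k::comm_ring_1 \<Rightarrow> real" and A :: "('k, 'a::ab_group_add) palg"
  assumes av: "base_ring av" and A: "polymetric av A"
begin

lemma palg_module: "module (scale A)" using A by (simp add: polymetric_def)

lemma palg_sn: "p \<in> sn A \<Longrightarrow> p 0 = 0 \<and> (\<forall>x. 0 \<le> p x) \<and> (\<forall>x. p (- x) = p x) \<and> (\<forall>x y. p (x + y) \<le> p x + p y)"
  using A by (simp add: polymetric_def)

lemma palg_scale: "p \<in> sn A \<Longrightarrow> p (scale A c x) \<le> av c * p x"
  using A by (simp add: polymetric_def)

lemma palg_mult: "p \<in> sn A \<Longrightarrow> \<exists>p'\<in>sn A. \<forall>x y. p (mult A x y) \<le> p' x * p' y"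
  using A by (simp add: polymetric_def)

lemma span_add_le:
  assumes "s \<in> sn_span (sn A)" "s' \<in> sn_span (sn A)"
  shows "\<exists>u\<in>sn_span (sn A). \<forall>x. s x + s' x \<le> u x"
proof -
  have nn: "\<And>p x. p \<in> sn A \<Longrightarrow> 0 \<le> p x" using palg_sn by blast
  show ?thesis by (rule sn_span_dominated[of "sn A" s s', OF _ assms]) (use nn in blast)+
qed

lemma span_scale:
  assumes "s \<in> sn_span (sn A)" shows "s (scale A c x) \<le> av c * s x"
proof -
  obtain C F where C: "s = (\<lambda>x. C * (\<Sum>p\<in>F. p x))" "0 \<le> C" "finite F" "F \<subseteq> sn A"
    using assms by (auto simp: sn_span_def)
  have "C * (\<Sum>p\<in>F. p (scale A c x)) \<le> C * (\<Sum>p\<in>F. av c * p x)"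
    using C palg_scale by (intro mult_left_mono sum_mono) auto
  then show ?thesis by (simp add: C(1) sum_distrib_left mult_ac)
qed

lemma span_mult:
  assumes "s \<in> sn_span (sn A)"
  obtains u where "u \<in> sn_span (sn A)" "\<And>x y. s (mult A x y) \<le> u x * u y"
proof -
  obtain C F where C: "s = (\<lambda>x. C * (\<Sum>p\<in>F. p x))" "0 \<le> C" "finite F" "F \<subseteq> sn A"
    using assms by (auto simp: sn_span_def)
  obtain p' where p': "\<And>p. p \<in> F \<Longrightarrow> p' p \<in> sn A" "\<And>p x y. p \<in> F \<Longrightarrow> p (mult A x y) \<le> p' p x * p' p y"
    using palg_mult C(4) by (metis subsetD)
  \<comment> \<open>\<open>D\<close> bounds both \<open>C * card F\<close> and \<open>1\<close>, so
    \<open>D * D\<close>, which is what the product of the two values of \<open>?u\<close> carries,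
    bounds \<open>C * card F\<close>.\<close>
  define D where "D = C * real (card F) + 1"
  let ?q = "\<lambda>x. \<Sum>p\<in>p' ` F. p x"
  let ?u = "\<lambda>x. D * ?q x"
  have nn: "0 \<le> p x" if "p \<in> sn A" for p x using palg_sn[OF that] by blast
  have le: "p' p x \<le> ?q x" if "p \<in> F" for p x
    using that C(3) nn p'(1) by (intro member_le_sum) auto
  have q0: "0 \<le> ?q x" for x using nn p'(1) by (intro sum_nonneg) auto
  have "s (mult A x y) \<le> ?u x * ?u y" for x y
  proof -
    have "s (mult A x y) \<le> C * (\<Sum>p\<in>F. ?q x * ?q y)"
      unfolding C(1)
    proof (intro mult_left_mono sum_mono C(2))
      fix p assume p: "p \<in> F"
      show "p (mult A x y) \<le> ?q x * ?q y"
        using p'(2)[OF p, of x y] mult_mono[OF le[OF p, of x] le[OF p, of y] q0 nn[OF p'(1)[OF p]]] by linarith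
    qed
    also have "\<dots> = (C * real (card F)) * (?q x * ?q y)" by simp
    also have "\<dots> \<le> (D * D) * (?q x * ?q y)"
    proof (rule mult_right_mono)
      have "0 \<le> C * real (card F)" using C(2) by simp
      then have "C * real (card F) \<le> D * 1" "1 \<le> D" by (simp_all add: D_def)
      then show "C * real (card F) \<le> D * D" using mult_left_mono[of 1 D D] by linarith
      show "0 \<le> ?q x * ?q y" using q0 by simp
    qed
    finally show ?thesis by (simp add: mult_ac)
  qed
  moreover have "?u \<in> sn_span (sn A)"
    unfolding sn_span_def using C p'(1) by (auto simp: D_def intro!: exI[of _ D] exI[of _ "p' ` F"])
  ultimately show thesis using that by blast
qed

lemma sn_unitization:
  "p \<in> sn (unitization av A) \<longleftrightarrow> (\<exists>C s. 0 \<le> C \<and> s \<in> sn_span (sn A) \<and> p = (\<lambda>z. C * av (fst z) + s (snd z)))"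
  unfolding unitization_def case_prod_beta' by auto

text \<open>The seminorms of a unitization already form a directed family, so passing to
  \<open>sn_span\<close> in the tensor product does not enlarge the bounds available.\<close>

lemma span_unitization:
  assumes "p \<in> sn_span (sn (unitization av A))"
  obtains q where "q \<in> sn (unitization av A)" "\<And>z. p z \<le> q z"
proof -
  obtain C F where C: "p = (\<lambda>x. C * (\<Sum>q\<in>F. q x))" "0 \<le> C" "finite F" "F \<subseteq> sn (unitization av A)"
    using assms by (auto simp: sn_span_def)
  from C(3,4) have "\<exists>D s. 0 \<le> D \<and> s \<in> sn_span (sn A) \<and> (\<forall>z. (\<Sum>q\<in>F. q z) \<le> D * av (fst z) + s (snd z))"
  proof (induction F)
    case empty
    then show ?case using sn_span_zero by (intro exI[of _ 0] exI[of _ "\<lambda>_. 0"]) auto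
  next
    case (insert q F)
    obtain D s where D: "0 \<le> D" "s \<in> sn_span (sn A)" "\<And>z. (\<Sum>q\<in>F. q z) \<le> D * av (fst z) + s (snd z)"
      using insert by auto
    obtain B s' where B: "0 \<le> B" "s' \<in> sn_span (sn A)" "q = (\<lambda>z. B * av (fst z) + s' (snd z))"
      using insert.prems by (auto simp: sn_unitization)
    obtain u where u: "u \<in> sn_span (sn A)" "\<And>x. s x + s' x \<le> u x"
      using span_add_le[OF D(2) B(2)] by blast
    have "(\<Sum>q\<in>insert q F. q z) \<le> (D + B) * av (fst z) + u (snd z)" for z
      using insert.hyps D(3)[of z] u(2)[of "snd z"] by (simp add: B(3) distrib_right)
    then show ?case using u(1) D(1) B(1) by (intro exI[of _ "D + B"] exI[of _ u]) auto
  qed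
  then obtain D s where D: "0 \<le> D" "s \<in> sn_span (sn A)" "\<And>z. (\<Sum>q\<in>F. q z) \<le> D * av (fst z) + s (snd z)"
    by blast
  obtain E H where E: "s = (\<lambda>x. E * (\<Sum>p\<in>H. p x))" "0 \<le> E" "finite H" "H \<subseteq> sn A"
    using D(2) by (auto simp: sn_span_def)
  have "(\<lambda>x. (C * E) * (\<Sum>p\<in>H. p x)) \<in> sn_span (sn A)"
    unfolding sn_span_def mem_Collect_eq using E C(2) by (intro exI[of _ "C * E"] exI[of _ H]) auto
  then have Cs: "(\<lambda>x. C * s x) \<in> sn_span (sn A)" by (simp add: E(1) mult.assoc)
  show thesis
  proof (rule that)
    show "(\<lambda>z. (C * D) * av (fst z) + C * s (snd z)) \<in> sn (unitization av A)"
      unfolding sn_unitization using Cs C(2) D(1)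
      by (intro exI[of _ "C * D"] exI[of _ "\<lambda>x. C * s x"]) auto
    show "p z \<le> (C * D) * av (fst z) + C * s (snd z)" for z
      using mult_left_mono[OF D(3)[of z] C(2)] by (simp add: C(1) algebra_simps)
  qed
qed

lemma unitization_simps:
  "mult (unitization av A) z z' = (fst z * fst z', scale A (fst z) (snd z') + scale A (fst z') (snd z) + mult A (snd z) (snd z'))"
  "unit (unitization av A) = (1, 0)" "ideal (unitization av A) = {z. fst z = 0}"
  by (auto simp: unitization_def case_prod_beta)

lemma palg_axioms:
  "\<forall>x y z. mult A (mult A x y) z = mult A x (mult A y z)"
  "\<forall>x y z. mult A (x + y) z = mult A x z + mult A y z"
  "\<forall>x y z. mult A x (y + z) = mult A x y + mult A x z"
  "\<forall>c x y. scale A c (mult A x y) = mult A (scale A c x) y \<and> scale A c (mult A x y) = mult A x (scale A c y)"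
  "\<forall>x. (\<forall>p\<in>sn A. p x = 0) \<longrightarrow> x = 0"
  "\<forall>X :: nat \<Rightarrow> 'a. (\<forall>p\<in>sn A. \<forall>e>0. \<exists>N. \<forall>m\<ge>N. \<forall>n\<ge>N. p (X m - X n) < e) \<longrightarrow>
     (\<exists>l. \<forall>p\<in>sn A. (\<lambda>n. p (X n - l)) \<longlonglongrightarrow> 0)"
  using A unfolding polymetric_def by - (elim conjE, assumption)+

lemma palg_add: "mult A (x + y) z = mult A x z + mult A y z" "mult A x (y + z) = mult A x y + mult A x z"
  and palg_assoc: "mult A (mult A x y) z = mult A x (mult A y z)"
  using palg_axioms(1-3) by simp_all

lemma palg_scale_mult:
  "mult A (scale A c x) y = scale A c (mult A x y)" "mult A x (scale A c y) = scale A c (mult A x y)"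
  using palg_axioms(4) by metis+

lemma palg_zero: "mult A 0 x = 0" "mult A x 0 = 0"
  using palg_add(1)[of 0 0 x] palg_add(2)[of x 0 0] by simp_all

lemma palg_scale_simps:
  "scale A c (x + y) = scale A c x + scale A c y" "scale A (c + c') x = scale A c x + scale A c' x"
  "scale A c (scale A c' x) = scale A (c * c') x" "scale A 1 x = x" "scale A c 0 = 0" "scale A 0 x = 0"
  using palg_module by (simp_all add: module.scale_right_distrib module.scale_left_distrib module.scale_scale
      module.scale_one module.scale_zero_right module.scale_zero_left)

lemma pm_ring_unitization: "pm_ring (unitization av A)"
proof
  note b = base_ring_props[OF av]
  note s = sn_span_props[OF palg_sn]
  fix x y z :: "'k \<times> 'a"
  let ?U = "unitization av A"
  show "mult ?U (mult ?U x y) z = mult ?U x (mult ?U y z)"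
    by (simp add: unitization_simps palg_add palg_assoc palg_scale_mult palg_scale_simps algebra_simps)
  show "mult ?U (x + y) z = mult ?U x z + mult ?U y z" "mult ?U x (y + z) = mult ?U x y + mult ?U x z"
    by (simp_all add: unitization_simps palg_add palg_scale_simps algebra_simps)
  show "mult ?U (unit ?U) x = x" "mult ?U x (unit ?U) = x"
    by (simp_all add: unitization_simps palg_zero palg_scale_simps)
  show "0 \<in> ideal ?U" by (simp add: unitization_simps)
  show "x \<in> ideal ?U \<Longrightarrow> y \<in> ideal ?U \<Longrightarrow> x + y \<in> ideal ?U" "x \<in> ideal ?U \<Longrightarrow> - x \<in> ideal ?U"
    "x \<in> ideal ?U \<Longrightarrow> mult ?U x y \<in> ideal ?U" "x \<in> ideal ?U \<Longrightarrow> mult ?U y x \<in> ideal ?U"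
    by (simp_all add: unitization_simps)
  fix p :: "'k \<times> 'a \<Rightarrow> real"
  show "p 0 = 0" "0 \<le> p x" "p (- x) = p x" "p (x + y) \<le> p x + p y" "\<exists>p'\<in>sn ?U. \<forall>x y. p (mult ?U x y) \<le> p' x * p' y"
    if p: "p \<in> sn ?U"
  proof -
    obtain C t where C: "0 \<le> C" "t \<in> sn_span (sn A)" "p = (\<lambda>z. C * av (fst z) + t (snd z))"
      using p sn_unitization by blast
    show "p 0 = 0" "0 \<le> p x" "p (- x) = p x"
      using C s(1-3)[OF _ C(2)] by (simp_all add: b)
    show "p (x + y) \<le> p x + p y"
      using mult_left_mono[OF b(4)[of "fst x" "fst y"] C(1)] s(4)[OF _ C(2), of "snd x" "snd y"]
      by (simp add: C(3) distrib_left)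
    obtain u where u: "u \<in> sn_span (sn A)" "\<And>x y. t (mult A x y) \<le> u x * u y"
      using span_mult[OF C(2)] by blast
    obtain v where v: "v \<in> sn_span (sn A)" "\<And>x. t x + u x \<le> v x"
      using span_add_le[OF C(2) u(1)] by blast
    \<comment> \<open>The cross terms \<open>av k * t c\<close> and \<open>av l * t a\<close>
      require a factor at least \<open>1\<close> before \<open>av\<close>, while \<open>v\<close>
      dominates both \<open>t\<close> and the seminorm \<open>u\<close> that controls
      products.\<close>
    let ?D = "C + 1"
    let ?q = "\<lambda>z. ?D * av (fst z) + v (snd z)"
    have "p (mult ?U x y) \<le> ?q x * ?q y" for x y
    proof -
      obtain k a l c where xy: "x = (k, a)" "y = (l, c)" by (cases x, cases y)
      have nn: "0 \<le> av k" "0 \<le> av l" "0 \<le> t a" "0 \<le> t c" "0 \<le> u a" "0 \<le> u c"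
        using b(2) s(2)[OF _ C(2)] s(2)[OF _ u(1)] by auto
      have vle: "t a \<le> v a" "t c \<le> v c" "u a \<le> v a" "u c \<le> v c"
        using v(2)[of a] v(2)[of c] nn by auto
      have "t (scale A k c + scale A l a + mult A a c) \<le> t (scale A k c) + t (scale A l a) + t (mult A a c)"
        using s(4)[OF _ C(2), of "scale A k c + scale A l a" "mult A a c"] s(4)[OF _ C(2), of "scale A k c" "scale A l a"]
        by simp
      also have "\<dots> \<le> av k * t c + av l * t a + u a * u c"
        by (intro add_mono span_scale C(2) u(2))
      also have "\<dots> \<le> av k * v c + av l * v a + v a * v c"
        using nn vle by (intro add_mono mult_mono) auto
      finally have 1: "p (mult ?U x y) \<le> C * (av k * av l) + (av k * v c + av l * v a + v a * v c)"
        by (simp add: C(3) xy unitization_simps b(5))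
      have "0 \<le> C * (av k * v c)" "0 \<le> C * (av l * v a)" "0 \<le> C * (C * (av k * av l))" "0 \<le> C * (av k * av l)"
         "0 \<le> av k * av l"
        using C(1) nn vle by auto
      then show ?thesis using 1 by (simp add: xy algebra_simps)
    qed
    moreover have "?q \<in> sn ?U" unfolding sn_unitization using C(1) v(1) by (intro exI[of _ ?D] exI[of _ v]) auto
    ultimately show "\<exists>p'\<in>sn ?U. \<forall>x y. p (mult ?U x y) \<le> p' x * p' y"
      by (intro bexI[of _ ?q]) auto
  qed
next
  note b = base_ring_props[OF av]
  let ?U = "unitization av A"
  have avU: "(\<lambda>z. 1 * av (fst z) + (\<lambda>_. 0) (snd z)) \<in> sn ?U"
    unfolding sn_unitization using sn_span_zero by (intro exI[of _ 1] exI[of _ "\<lambda>_. 0"]) auto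
  have pU: "(\<lambda>z. 0 * av (fst z) + p (snd z)) \<in> sn ?U" if "p \<in> sn A" for p
    unfolding sn_unitization using sn_span_mem[OF that] by (intro exI[of _ 0] exI[of _ p]) auto
  show "x = 0" if x: "\<And>p. p \<in> sn ?U \<Longrightarrow> p x = 0" for x
  proof -
    have "fst x = 0" using x[OF avU] b(6) by simp
    moreover have "snd x = 0"
    proof -
      have "\<forall>p\<in>sn A. p (snd x) = 0" using x[OF pU] by simp
      then show ?thesis using palg_axioms(5) by blast
    qed
    ultimately show ?thesis by (simp add: prod_eq_iff)
  qed
  show "x \<in> ideal ?U"
    if x: "\<And>F e. finite F \<Longrightarrow> F \<subseteq> sn ?U \<Longrightarrow> 0 < e \<Longrightarrow> \<exists>y\<in>ideal ?U. \<forall>p\<in>F. p (x - y) < e" for x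
  proof -
    have "av (fst x) < e" if "0 < e" for e
      using x[of "{\<lambda>z. 1 * av (fst z) + (\<lambda>_. 0) (snd z)}" e] avU that by (auto simp: unitization_simps)
    then have "av (fst x) = 0" using b(2)[of "fst x"] by (metis less_irrefl order_le_less)
    then show ?thesis using b(6) by (simp add: unitization_simps)
  qed
  show "\<exists>l. \<forall>p\<in>sn ?U. (\<lambda>n. p (X n - l)) \<longlonglongrightarrow> 0"
    if X: "\<And>p e. p \<in> sn ?U \<Longrightarrow> 0 < e \<Longrightarrow> \<exists>N. \<forall>m\<ge>N. \<forall>n\<ge>N. p (X m - X n) < e" for X
  proof -
    obtain l where l: "(\<lambda>n. av (fst (X n) - l)) \<longlonglongrightarrow> 0"
      using b(7)[of "\<lambda>n. fst (X n)"] X[OF avU] by auto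
    have "\<forall>p\<in>sn A. \<forall>e>0. \<exists>N. \<forall>m\<ge>N. \<forall>n\<ge>N. p (snd (X m) - snd (X n)) < e"
      using X[OF pU] by simp
    then obtain m where m: "\<And>p. p \<in> sn A \<Longrightarrow> (\<lambda>n. p (snd (X n) - m)) \<longlonglongrightarrow> 0"
      using palg_axioms(6)[rule_format, of "\<lambda>n. snd (X n)"] by blast
    have "(\<lambda>n. p (X n - (l, m))) \<longlonglongrightarrow> 0" if p: "p \<in> sn ?U" for p
    proof -
      obtain C s where C: "s \<in> sn_span (sn A)" "p = (\<lambda>z. C * av (fst z) + s (snd z))"
        using p sn_unitization by blast
      obtain D F where D: "s = (\<lambda>x. D * (\<Sum>p\<in>F. p x))" "F \<subseteq> sn A"
        using C(1) by (auto simp: sn_span_def)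
      have "(\<lambda>n. C * av (fst (X n) - l) + D * (\<Sum>p\<in>F. p (snd (X n) - m))) \<longlonglongrightarrow> C * 0 + D * (\<Sum>p\<in>F. 0)"
        using D(2) by (intro tendsto_intros l m) auto
      then show ?thesis by (simp add: C(2) D(1))
    qed
    then show ?thesis by blast
  qed
qed

end

lemma polymetric_base_alg:
  assumes "base_ring av" shows "polymetric av (base_alg av)"
proof -
  note b = base_ring_props[OF assms]
  have "\<exists>l. (\<lambda>n. av (X n - l)) \<longlonglongrightarrow> 0"
    if "\<forall>e>0. \<exists>N. \<forall>m\<ge>N. \<forall>n\<ge>N. av (X m - X n) < e" for X
    using that by (intro b(7)) auto
  moreover have "module ((*) :: 'a \<Rightarrow> 'a \<Rightarrow> 'a)" by unfold_locales (simp_all add: algebra_simps)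
  ultimately show ?thesis
    unfolding polymetric_def base_alg_def by (simp add: b algebra_simps)
qed

section \<open>Bilinear maps from commutative rings and completed tensor products\<close>

lemma bilin_flip:
  assumes "bilin R S T t" shows "bilin S R T (\<lambda>y x. t x y)"
proof -
  interpret bilin R S T t by (rule assms)
  show ?thesis
  proof
    fix x x' :: 'c and y y' :: 'b
    show "t y (x + x') = t y x + t y x'" by (rule t_add_right)
    show "t (y + y') x = t y x + t y' x" by (rule t_add_left)
    show "mult T (t y x) (t y' x') = t (mult R y y') (mult S x x')" by (rule t_mult)
    show "x \<in> ideal S \<Longrightarrow> y \<in> ideal R \<Longrightarrow> t y x \<in> ideal T" by (rule t_ideal)
  next
    fix r assume "r \<in> sn T"
    then obtain p q where "p \<in> sn R" "q \<in> sn S" "\<And>x y. r (t x y) \<le> p x * q y" using t_bound by meson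
    then show "\<exists>p\<in>sn S. \<exists>q\<in>sn R. \<forall>x y. r (t y x) \<le> p x * q y"
      by (intro bexI[of _ q] bexI[of _ p]) (auto simp: mult.commute)
  qed
qed

lemma bilin_commutative:
  assumes "base_ring av" "polymetric av A" "commutative A"
  shows "bilin (unitization av A) (unitization av A) (unitization av A) (mult (unitization av A))"
proof -
  let ?U = "unitization av A"
  interpret pm_ring ?U by (rule pm_ring_unitization[OF assms(1,2)])
  have comm: "mult ?U x y = mult ?U y x" for x y
    using assms(3) by (simp add: unitization_simps[OF assms(1,2)] commutative_def mult.commute add.commute)
  show ?thesis
  proof
    fix x y x' y'
    show "mult ?U (mult ?U x y) (mult ?U x' y') = mult ?U (mult ?U x x') (mult ?U y y')"
      by (metis comm mult_assoc)
    show "mult ?U (x + x') y = mult ?U x y + mult ?U x' y" by (rule mult_add_left)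
    show "mult ?U x (y + y') = mult ?U x y + mult ?U x y'" by (rule mult_add_right)
    show "x \<in> ideal ?U \<Longrightarrow> y \<in> ideal ?U \<Longrightarrow> mult ?U x y \<in> ideal ?U" by (rule ideal_mult_right)
    show "\<exists>p\<in>sn ?U. \<exists>q\<in>sn ?U. \<forall>x y. r (mult ?U x y) \<le> p x * q y" if "r \<in> sn ?U" for r
      using sn_mult[OF that] by blast
  qed
qed

text \<open>The multiplication is prescribed only on elementary tensors, so the unit laws and the
  ideal property are checked on finite sums, represented by lists, and extended by density and
  continuity.\<close>

lemma completed_tensor_bilin:
  fixes R :: "('k::comm_ring_1, 'r::ab_group_add) uext" and S :: "('k, 's::ab_group_add) uext"
    and T :: "('k, 't::ab_group_add) uext"
  assumes R: "pm_ring R" and S: "pm_ring S"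
    and spanR: "\<And>p. p \<in> sn_span (sn R) \<Longrightarrow> \<exists>q\<in>sn R. \<forall>z. p z \<le> q z"
    and spanS: "\<And>p. p \<in> sn_span (sn S) \<Longrightarrow> \<exists>q\<in>sn S. \<forall>z. p z \<le> q z"
    and T: "completed_tensor av R S T t"
  shows "bilin R S T t"
proof -
  interpret R: pm_ring R by (rule R)
  interpret S: pm_ring S by (rule S)
  have pT: "polymetric av T"
    and tl: "\<forall>x x' y. t (x + x') y = t x y + t x' y"
    and tr: "\<forall>x y y'. t x (y + y') = t x y + t x y'"
    and tm: "\<forall>x y x' y'. mult T (t x y) (t x' y') = t (mult R x x') (mult S y y')"
    and u: "unit T = t (unit R) (unit S)"
    and sn1: "\<forall>r\<in>sn T. \<exists>p\<in>sn_span (sn R). \<exists>q\<in>sn_span (sn S). \<forall>zs. r (tensor_eval t zs) = proj_sn R S p q zs"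
    and dense: "\<forall>w F e. finite F \<and> F \<subseteq> sn T \<and> 0 < e \<longrightarrow> (\<exists>zs. \<forall>r\<in>F. r (w - tensor_eval t zs) < e)"
    and ideal: "ideal T = {w. \<forall>F e. finite F \<and> F \<subseteq> sn T \<and> 0 < e \<longrightarrow>
        (\<exists>zs. set zs \<subseteq> ideal R \<times> ideal S \<and> (\<forall>r\<in>F. r (w - tensor_eval t zs) < e))}"
    using T unfolding completed_tensor_def by - (elim conjE, assumption)+
  have T1: "\<forall>x y z. mult T (mult T x y) z = mult T x (mult T y z)"
    and T2: "\<forall>x y z. mult T (x + y) z = mult T x z + mult T y z"
    and T3: "\<forall>x y z. mult T x (y + z) = mult T x y + mult T x z"
    and T4: "\<forall>p\<in>sn T. p 0 = 0 \<and> (\<forall>x. 0 \<le> p x) \<and> (\<forall>x. p (- x) = p x) \<and>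
               (\<forall>x y. p (x + y) \<le> p x + p y) \<and> (\<forall>c x. p (scale T c x) \<le> av c * p x)"
    and T5: "\<forall>p\<in>sn T. \<exists>p'\<in>sn T. \<forall>x y. p (mult T x y) \<le> p' x * p' y"
    and T6: "\<forall>x. (\<forall>p\<in>sn T. p x = 0) \<longrightarrow> x = 0"
    and T7: "\<forall>X :: nat \<Rightarrow> 't. (\<forall>p\<in>sn T. \<forall>e>0. \<exists>N. \<forall>m\<ge>N. \<forall>n\<ge>N. p (X m - X n) < e) \<longrightarrow>
        (\<exists>l. \<forall>p\<in>sn T. (\<lambda>n. p (X n - l)) \<longlonglongrightarrow> 0)"
    using pT unfolding polymetric_def by - (elim conjE, assumption)+
  note tl = tl[rule_format] and tr = tr[rule_format] and tm = tm[rule_format]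
  note T1 = T1[rule_format] and T2 = T2[rule_format] and T3 = T3[rule_format]
  have p0: "p 0 = 0" and pn: "0 \<le> p x" and pm: "p (- x) = p x" and pa: "p (x + y) \<le> p x + p y"
    if "p \<in> sn T" for p x y using T4 that by auto
  have pd: "p (x - y) \<le> p x + p y" if "p \<in> sn T" for p x y
    using pa[OF that, of x "- y"] pm[OF that, of y] by simp
  have z1: "mult T 0 x = 0" "mult T x 0 = 0" for x using T2[of 0 0 x] T3[of x 0 0] by simp_all
  have d1: "mult T (x - y) z = mult T x z - mult T y z" "mult T z (x - y) = mult T z x - mult T z y" for x y z
    using T2[of "x - y" y z] T3[of z "x - y" y] by simp_all
  have tz: "t 0 y = 0" "t x 0 = 0" for x y using tl[of 0 0 y] tr[of x 0 0] by simp_all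
  have tneg: "t (- x) y = - t x y" for x y using tl[of x "- x" y] by (simp add: tz minus_unique)
  have ev: "tensor_eval t [] = 0" "tensor_eval t (z # zs) = t (fst z) (snd z) + tensor_eval t zs"
    "tensor_eval t (zs @ zs') = tensor_eval t zs + tensor_eval t zs'" for z zs zs'
    by (simp_all add: tensor_eval_def case_prod_beta)
  let ?neg = "\<lambda>zs. map (\<lambda>(x, y). (- x, y)) zs"
  have ev_neg: "tensor_eval t (?neg zs) = - tensor_eval t zs" for zs
    by (induction zs) (auto simp: ev tneg)
  let ?prod = "\<lambda>zs zs'. concat (map (\<lambda>(x, y). map (\<lambda>(x', y'). (mult R x x', mult S y y')) zs') zs)"
  have ev_prod1: "tensor_eval t (map (\<lambda>(x', y'). (mult R x x', mult S y y')) zs') = mult T (t x y) (tensor_eval t zs')"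
    for x y zs' by (induction zs') (auto simp: ev z1 T3 tm)
  have ev_prod: "tensor_eval t (?prod zs zs') = mult T (tensor_eval t zs) (tensor_eval t zs')" for zs zs'
    by (induction zs) (auto simp: ev z1 T2 ev_prod1)
  have unit_ev: "mult T (unit T) (tensor_eval t zs) = tensor_eval t zs" "mult T (tensor_eval t zs) (unit T) = tensor_eval t zs" for zs
    by (induction zs) (auto simp: ev z1 T2 T3 u tm R.unit_left S.unit_left R.unit_right S.unit_right)
  have unit: "mult T (unit T) x = x" "mult T x (unit T) = x" for x
  proof -
    have le: "p (mult T (unit T) x - x) \<le> 0 + e \<and> p (mult T x (unit T) - x) \<le> 0 + e" if p: "p \<in> sn T" and e: "0 < e" for p e
    proof -
      obtain p' where p': "p' \<in> sn T" "\<And>x y. p (mult T x y) \<le> p' x * p' y" using T5 p by meson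
      \<comment> \<open>Chosen so that the two errors \<open>p' (unit T) * e'\<close> and
        \<open>e'\<close> add up to \<open>e\<close>.\<close>
      define e' where "e' = e / (p' (unit T) + 1)"
      have pos: "0 < p' (unit T) + 1" using pn[OF p'(1), of "unit T"] by simp
      then have "(p' (unit T) + 1) * e' = e" "0 < e'" using e by (simp_all add: e'_def)
      then have e': "0 < e'" "p' (unit T) * e' + e' = e" by (simp_all add: distrib_right)
      obtain zs where zs: "p (x - tensor_eval t zs) < e'" "p' (x - tensor_eval t zs) < e'"
        using dense[rule_format, of "{p, p'}" e' x] p p'(1) e'(1) by auto
      let ?z = "tensor_eval t zs"
      have "mult T (unit T) x - x = mult T (unit T) (x - ?z) - (x - ?z)"
        "mult T x (unit T) - x = mult T (x - ?z) (unit T) - (x - ?z)"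
        by (simp_all add: d1 unit_ev)
      then have "p (mult T (unit T) x - x) \<le> p (mult T (unit T) (x - ?z)) + p (x - ?z)"
        "p (mult T x (unit T) - x) \<le> p (mult T (x - ?z) (unit T)) + p (x - ?z)"
        using pd[OF p] by metis+
      moreover have "p (mult T (unit T) (x - ?z)) \<le> p' (unit T) * e'" "p (mult T (x - ?z) (unit T)) \<le> p' (unit T) * e'"
        using p'(2)[of "unit T" "x - ?z"] p'(2)[of "x - ?z" "unit T"] zs(2)
          mult_left_mono[of "p' (x - ?z)" e' "p' (unit T)"] pn[OF p'(1), of "unit T"]
        by (simp_all add: mult.commute)
      ultimately show ?thesis using zs(1) e'(2) by linarith
    qed
    have "p (mult T (unit T) x - x) \<le> 0" "p (mult T x (unit T) - x) \<le> 0" if "p \<in> sn T" for p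
      by (rule field_le_epsilon, rule le[OF that, THEN conjunct1], assumption)
        (rule field_le_epsilon, rule le[OF that, THEN conjunct2], assumption)
    then have "p (mult T (unit T) x - x) = 0" "p (mult T x (unit T) - x) = 0" if "p \<in> sn T" for p
      using that pn[OF that] by (simp_all add: antisym)
    then show "mult T (unit T) x = x" "mult T x (unit T) = x"
      using T6[rule_format, of "mult T (unit T) x - x"] T6[rule_format, of "mult T x (unit T) - x"] by simp_all
  qed
  have idealD: "\<exists>zs. set zs \<subseteq> ideal R \<times> ideal S \<and> (\<forall>r\<in>F. r (x - tensor_eval t zs) < e)"
    if "x \<in> ideal T" "finite F" "F \<subseteq> sn T" "0 < e" for x F and e :: real
    using that unfolding ideal by blast
  have idealI: "x \<in> ideal T" if "\<And>F e. finite F \<Longrightarrow> F \<subseteq> sn T \<Longrightarrow> 0 < (e::real) \<Longrightarrow>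
      \<exists>zs. set zs \<subseteq> ideal R \<times> ideal S \<and> (\<forall>r\<in>F. r (x - tensor_eval t zs) < e)" for x
    using that unfolding ideal by blast
  have ideal_prod: "mult T x y \<in> ideal T \<and> mult T y x \<in> ideal T" if x: "x \<in> ideal T" for x y
  proof -
    have approx: "\<exists>zs zs'. set zs \<subseteq> ideal R \<times> ideal S \<and>
        (\<forall>r\<in>F. r (mult T x y - mult T (tensor_eval t zs) (tensor_eval t zs')) < e \<and>
          r (mult T y x - mult T (tensor_eval t zs') (tensor_eval t zs)) < e)"
      if F: "finite F" "F \<subseteq> sn T" "0 < e" for F and e :: real
    proof -
      obtain p' where p': "\<And>p. p \<in> F \<Longrightarrow> p' p \<in> sn T" "\<And>p x y. p \<in> F \<Longrightarrow> p (mult T x y) \<le> p' p x * p' p y"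
        using T5 F(2) by (metis subsetD)
      have nn: "0 \<le> p' p z" if "p \<in> F" for p z using p'(1)[OF that] pn by blast
      \<comment> \<open>\<open>x\<close> is approximated first, to a precision depending on
        \<open>y\<close> through \<open>M\<close>; then \<open>y\<close> is approximated to a
        precision depending through \<open>N\<close> on the approximant of \<open>x\<close>. The
        summand \<open>1\<close> keeps both divisors positive.\<close>
      define M where "M = 1 + (\<Sum>p\<in>F. p' p y)"
      have M: "p' p y \<le> M" "0 < M" if "p \<in> F" for p
      proof -
        have "p' p y \<le> (\<Sum>p\<in>F. p' p y)" using that F nn by (intro member_le_sum) auto
        then show "p' p y \<le> M" "0 < M" using nn[OF that, of y] by (simp_all add: M_def)
      qed
      have M0: "0 < M" using nn by (simp add: M_def add_pos_nonneg sum_nonneg)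
      have "finite (p' ` F)" "p' ` F \<subseteq> sn T" "0 < e / (2 * M)" using F p'(1) M0 by auto
      from idealD[OF x this] obtain zs where zs: "set zs \<subseteq> ideal R \<times> ideal S"
        "\<And>p. p \<in> F \<Longrightarrow> p' p (x - tensor_eval t zs) < e / (2 * M)" by auto
      let ?z = "tensor_eval t zs"
      define N where "N = 1 + (\<Sum>p\<in>F. p' p ?z)"
      have N: "p' p ?z \<le> N" if "p \<in> F" for p
      proof -
        have "p' p ?z \<le> (\<Sum>p\<in>F. p' p ?z)" using that F nn by (intro member_le_sum) auto
        then show ?thesis by (simp add: N_def)
      qed
      have N0: "0 < N" using nn by (simp add: N_def add_pos_nonneg sum_nonneg)
      have "finite (p' ` F)" "p' ` F \<subseteq> sn T" "0 < e / (2 * N)" using F p'(1) N0 by auto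
      then obtain zs' where zs': "\<And>p. p \<in> F \<Longrightarrow> p' p (y - tensor_eval t zs') < e / (2 * N)"
        using dense[rule_format, of "p' ` F" "e / (2 * N)" y] by auto
      let ?z' = "tensor_eval t zs'"
      have "p (mult T x y - mult T ?z ?z') < e \<and> p (mult T y x - mult T ?z' ?z) < e" if p: "p \<in> F" for p
      proof -
        have pT: "p \<in> sn T" using p F by blast
        have "p' p (x - ?z) * p' p y \<le> p' p (x - ?z) * M" using M(1)[OF p] nn[OF p] by (intro mult_left_mono) auto
        also have "\<dots> < e / (2 * M) * M" using zs(2)[OF p] M0 by (rule mult_strict_right_mono)
        also have "\<dots> = e / 2" using M0 by simp
        finally have a: "p' p (x - ?z) * p' p y < e / 2" .
        have "p' p ?z * p' p (y - ?z') \<le> N * p' p (y - ?z')" using N[OF p] nn[OF p] by (intro mult_right_mono) auto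
        also have "\<dots> \<le> N * (e / (2 * N))" using zs'[OF p] N0 by (intro mult_left_mono) auto
        also have "\<dots> = e / 2" using N0 by simp
        finally have b: "p' p ?z * p' p (y - ?z') \<le> e / 2" .
        have dd: "mult T x y - mult T ?z ?z' = mult T (x - ?z) y + mult T ?z (y - ?z')"
          "mult T y x - mult T ?z' ?z = mult T y (x - ?z) + mult T (y - ?z') ?z"
          by (simp_all add: d1)
        have "p (mult T x y - mult T ?z ?z') \<le> p' p (x - ?z) * p' p y + p' p ?z * p' p (y - ?z')"
          "p (mult T y x - mult T ?z' ?z) \<le> p' p y * p' p (x - ?z) + p' p (y - ?z') * p' p ?z"
          unfolding dd
          using pa[OF pT, of "mult T (x - ?z) y" "mult T ?z (y - ?z')"] p'(2)[OF p, of "x - ?z" y] p'(2)[OF p, of ?z "y - ?z'"]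
            pa[OF pT, of "mult T y (x - ?z)" "mult T (y - ?z') ?z"] p'(2)[OF p, of y "x - ?z"] p'(2)[OF p, of "y - ?z'" ?z]
          by linarith+
        then show ?thesis using a b by (simp add: mult.commute)
      qed
      then show ?thesis using zs(1) by blast
    qed
    have sub: "set (?prod zs zs') \<subseteq> ideal R \<times> ideal S" "set (?prod zs' zs) \<subseteq> ideal R \<times> ideal S"
      if "set zs \<subseteq> ideal R \<times> ideal S" for zs zs'
      using that R.ideal_mult_right S.ideal_mult_right R.ideal_mult_left S.ideal_mult_left by auto
    show ?thesis
    proof (intro conjI idealI)
      fix F and e :: real assume "finite F" "F \<subseteq> sn T" "0 < e"
      then obtain zs zs' where z: "set zs \<subseteq> ideal R \<times> ideal S"
        "\<And>r. r \<in> F \<Longrightarrow> r (mult T x y - mult T (tensor_eval t zs) (tensor_eval t zs')) < e"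
        "\<And>r. r \<in> F \<Longrightarrow> r (mult T y x - mult T (tensor_eval t zs') (tensor_eval t zs)) < e"
        using approx[of F e] by blast
      show "\<exists>zs. set zs \<subseteq> ideal R \<times> ideal S \<and> (\<forall>r\<in>F. r (mult T x y - tensor_eval t zs) < e)"
        using z(2) sub(1)[OF z(1), of zs'] by (intro exI[of _ "?prod zs zs'"]) (simp add: ev_prod)
      show "\<exists>zs. set zs \<subseteq> ideal R \<times> ideal S \<and> (\<forall>r\<in>F. r (mult T y x - tensor_eval t zs) < e)"
        using z(3) sub(2)[OF z(1), of zs'] by (intro exI[of _ "?prod zs' zs"]) (simp add: ev_prod)
    qed
  qed
  have pmT: "pm_ring T"
  proof
    fix x y z
    show "mult T (mult T x y) z = mult T x (mult T y z)" by (rule T1)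
    show "mult T (x + y) z = mult T x z + mult T y z" by (rule T2)
    show "mult T x (y + z) = mult T x y + mult T x z" by (rule T3)
    show "mult T (unit T) x = x" "mult T x (unit T) = x" by (rule unit)+
    show "x = 0" if "\<And>p. p \<in> sn T \<Longrightarrow> p x = 0" using T6 that by blast
    show "0 \<in> ideal T" by (rule idealI) (auto intro!: exI[of _ "[]"] simp: ev p0)
    show "mult T x y \<in> ideal T" "mult T y x \<in> ideal T" if "x \<in> ideal T" using ideal_prod[OF that] by auto
    show "- x \<in> ideal T" if x: "x \<in> ideal T"
    proof (rule idealI)
      fix F and e :: real assume F: "finite F" "F \<subseteq> sn T" "0 < e"
      obtain zs where zs: "set zs \<subseteq> ideal R \<times> ideal S" "\<forall>r\<in>F. r (x - tensor_eval t zs) < e"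
        using idealD[OF x F] by blast
      have "r (- (x - tensor_eval t zs)) < e" if "r \<in> F" for r
        using pm[of r "x - tensor_eval t zs"] zs(2) F(2) that by (metis subsetD)
      then show "\<exists>zs. set zs \<subseteq> ideal R \<times> ideal S \<and> (\<forall>r\<in>F. r (- x - tensor_eval t zs) < e)"
        using zs by (intro exI[of _ "?neg zs"]) (auto simp: ev_neg intro: R.ideal_uminus)
    qed
    show "x + y \<in> ideal T" if x: "x \<in> ideal T" and y: "y \<in> ideal T"
    proof (rule idealI)
      fix F and e :: real assume F: "finite F" "F \<subseteq> sn T" "0 < e"
      then have e2: "0 < e / 2" by simp
      obtain zs where zs: "set zs \<subseteq> ideal R \<times> ideal S" "\<forall>r\<in>F. r (x - tensor_eval t zs) < e / 2"
        using idealD[OF x F(1,2) e2] by blast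
      obtain zs' where zs': "set zs' \<subseteq> ideal R \<times> ideal S" "\<forall>r\<in>F. r (y - tensor_eval t zs') < e / 2"
        using idealD[OF y F(1,2) e2] by blast
      have "r (x + y - (tensor_eval t zs + tensor_eval t zs')) < e" if "r \<in> F" for r
      proof -
        have "r \<in> sn T" using that F by blast
        from pa[OF this, of "x - tensor_eval t zs" "y - tensor_eval t zs'"]
        have "r (x + y - (tensor_eval t zs + tensor_eval t zs')) \<le> r (x - tensor_eval t zs) + r (y - tensor_eval t zs')"
          by (simp add: algebra_simps)
        then show ?thesis using zs(2) zs'(2) that by fastforce
      qed
      then show "\<exists>zs. set zs \<subseteq> ideal R \<times> ideal S \<and> (\<forall>r\<in>F. r (x + y - tensor_eval t zs) < e)"
        using zs(1) zs'(1) by (intro exI[of _ "zs @ zs'"]) (auto simp: ev)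
    qed
    show "x \<in> ideal T"
      if x: "\<And>F e. finite F \<Longrightarrow> F \<subseteq> sn T \<Longrightarrow> 0 < e \<Longrightarrow> \<exists>y\<in>ideal T. \<forall>p\<in>F. p (x - y) < e"
    proof (rule idealI)
      fix F and e :: real assume F: "finite F" "F \<subseteq> sn T" "0 < e"
      then have e2: "0 < e / 2" by simp
      obtain y where y: "y \<in> ideal T" "\<forall>r\<in>F. r (x - y) < e / 2" using x[OF F(1,2) e2] by blast
      obtain zs where zs: "set zs \<subseteq> ideal R \<times> ideal S" "\<forall>r\<in>F. r (y - tensor_eval t zs) < e / 2"
        using idealD[OF y(1) F(1,2) e2] by blast
      have "r (x - tensor_eval t zs) < e" if "r \<in> F" for r
      proof -
        have "r \<in> sn T" using that F by blast
        from pa[OF this, of "x - y" "y - tensor_eval t zs"]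
        have "r (x - tensor_eval t zs) \<le> r (x - y) + r (y - tensor_eval t zs)" by simp
        then show ?thesis using y(2) zs(2) that by fastforce
      qed
      then show "\<exists>zs. set zs \<subseteq> ideal R \<times> ideal S \<and> (\<forall>r\<in>F. r (x - tensor_eval t zs) < e)"
        using zs(1) by blast
    qed
  next
    fix p x y assume p: "p \<in> sn T"
    show "p 0 = 0" "0 \<le> p x" "p (- x) = p x" "p (x + y) \<le> p x + p y" using p p0 pn pm pa by blast+
    show "\<exists>p'\<in>sn T. \<forall>x y. p (mult T x y) \<le> p' x * p' y" using T5 p by blast
  next
    fix X :: "nat \<Rightarrow> 't"
    assume "\<And>p e. p \<in> sn T \<Longrightarrow> 0 < e \<Longrightarrow> \<exists>N. \<forall>m\<ge>N. \<forall>n\<ge>N. p (X m - X n) < e"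
    then show "\<exists>l. \<forall>p\<in>sn T. (\<lambda>n. p (X n - l)) \<longlonglongrightarrow> 0" using T7 by blast
  qed
  have nnR: "0 \<le> s x" if "s \<in> sn_span (sn R)" for s x
    by (rule sn_span_props(2)[OF _ that]) (simp add: R.sn_zero R.sn_nonneg R.sn_uminus R.sn_add)
  have nnS: "0 \<le> s x" if "s \<in> sn_span (sn S)" for s x
    by (rule sn_span_props(2)[OF _ that]) (simp add: S.sn_zero S.sn_nonneg S.sn_uminus S.sn_add)
  have bound: "\<exists>p\<in>sn R. \<exists>q\<in>sn S. \<forall>x y. r (t x y) \<le> p x * q y" if r: "r \<in> sn T" for r
  proof -
    obtain p q where pq: "p \<in> sn_span (sn R)" "q \<in> sn_span (sn S)" "\<And>zs. r (tensor_eval t zs) = proj_sn R S p q zs"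
      using sn1 r by meson
    obtain p' q' where p': "p' \<in> sn R" "\<And>z. p z \<le> p' z" and q': "q' \<in> sn S" "\<And>z. q z \<le> q' z"
      using spanR[OF pq(1)] spanS[OF pq(2)] by blast
    have "r (t x y) \<le> p' x * q' y" for x y
    proof -
      let ?A = "{\<Sum>(x, y)\<leftarrow>ws. p x * q y | ws. formal_sum ws - formal_sum [(x, y)] \<in> tensor_rel R S}"
      have "r (t x y) = Inf ?A" using pq(3)[of "[(x, y)]"] by (simp add: ev proj_sn_def)
      also have "\<dots> \<le> p x * q y"
      proof (rule cInf_lower)
        \<comment> \<open>The one-term list is itself an admissible representative, so the infimum
          is at most \<open>p x * q y\<close>.\<close>
        show "p x * q y \<in> ?A"
          by (rule CollectI, rule exI[of _ "[(x, y)]"]) (simp add: tensor_rel.intros(4))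
        have "0 \<le> (\<Sum>(x, y)\<leftarrow>ws. p x * q y)" for ws
          by (intro sum_list_nonneg) (auto simp: nnR[OF pq(1)] nnS[OF pq(2)])
        then show "bdd_below ?A" by (auto intro!: bdd_belowI[of _ 0])
      qed
      also have "\<dots> \<le> p' x * q' y"
        using p'(2) q'(2) nnR[OF pq(1)] nnS[OF pq(2)] R.sn_nonneg[OF p'(1)] by (intro mult_mono) auto
      finally show ?thesis .
    qed
    then show ?thesis using p'(1) q'(1) by blast
  qed
  have ti: "t x y \<in> ideal T" if "x \<in> ideal R" "y \<in> ideal S" for x y
    by (rule idealI, rule exI[of _ "[(x, y)]"]) (use that in \<open>auto simp: ev p0\<close>)
  show ?thesis
    by (intro bilin.intro bilin_axioms.intro R S pmT tl tr tm bound ti)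
qed

text \<open>Serves to replace \<open>kr (dgl E) (dgl F)\<close> by \<open>dgl\<close> of the product
  set: the former is carried by the latter, while the axioms of \<open>bilin\<close> do not make
  \<open>t (unit R) (unit S)\<close> the unit.\<close>

lemma (in stable) regular_mono:
  assumes "regular e U" "f * e = e" "e * f = e" shows "regular f U"
proof -
  have "f * h * f = h" if "e * h * e = h" for h
    using that assms(2,3) by (metis mult.assoc)
  then show ?thesis using assms(1) unfolding regular_def by blast
qed

subsection \<open>The dimension of tensor products\<close>

locale bilin_pairs = bilin R S T t
  for R :: "('k, 'r::ab_group_add) uext" and S :: "('k, 's::ab_group_add) uext"
    and T :: "('k, 't::ab_group_add) uext" and t +
  fixes d :: bool
begin

sublocale MR: mat_pairs R d by unfold_locales
sublocale MS: mat_pairs S d by unfold_locales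
sublocale MT: mat_pairs T d by unfold_locales

sublocale TT: tensor "Gpairs d R" "cst False" S0 S1 T0 T1 infl "Gpairs d S" "cst False" S0 S1 T0 T1 infl
    "Gpairs d T" "cst False" S0 S1 T0 T1 infl "cst True" "kr d"
  by (rule tensor_mring)

lemma kr_lift:
  assumes "psi d R a" "psi d R b" "psi d S a'" "psi d S b'"
  shows "kr d (lift d R b a) (lift d S b' a') = lift d T (krm t b b') (krm t a a')"
  by (simp add: kr_def assms)

lemma em_kron:
  assumes "is_emb j \<Omega>" "is_emb k \<Xi>"
  shows "em (jprod j k) (spg_prod \<Omega> \<Xi>) (jprod j k) (spg_prod \<Omega> \<Xi>) (kron t a b) =
    krm t (em j \<Omega> j \<Omega> a) (em k \<Xi> k \<Xi> b)"
proof (rule em_eqI[OF is_emb_prod[OF assms] is_emb_prod[OF assms]])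
  fix n m assume "n \<in> pts (spg_prod \<Omega> \<Xi>)" "m \<in> pts (spg_prod \<Omega> \<Xi>)"
  then show "krm t (em j \<Omega> j \<Omega> a) (em k \<Xi> k \<Xi> b) (jprod j k n) (jprod j k m) = kron t a b n m"
    by (auto simp: spg_prod_def krm_def jprod_def kron_def em_at[OF assms(1,1)] em_at[OF assms(2,2)])
next
  fix u v assume *: "u \<notin> jprod j k ` pts (spg_prod \<Omega> \<Xi>) \<or> v \<notin> jprod j k ` pts (spg_prod \<Omega> \<Xi>)"
  have im: "u \<in> jprod j k ` pts (spg_prod \<Omega> \<Xi>)" if h: "dfst u \<in> j ` pts \<Omega>" "dsnd u \<in> k ` pts \<Xi>" for u
  proof -
    obtain n m where "dfst u = j n" "n \<in> pts \<Omega>" "dsnd u = k m" "m \<in> pts \<Xi>" using h by blast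
    then have "u = jprod j k (n, m)"
      by (simp add: jprod_def) (metis prod.collapse prod_decode_inverse)
    then show ?thesis using \<open>n \<in> pts \<Omega>\<close> \<open>m \<in> pts \<Xi>\<close> by (simp add: spg_prod_def)
  qed
  show "krm t (em j \<Omega> j \<Omega> a) (em k \<Xi> k \<Xi> b) u v = 0"
  proof (rule ccontr)
    assume "krm t (em j \<Omega> j \<Omega> a) (em k \<Xi> k \<Xi> b) u v \<noteq> 0"
    then have "em j \<Omega> j \<Omega> a (dfst u) (dfst v) \<noteq> 0" "em k \<Xi> k \<Xi> b (dsnd u) (dsnd v) \<noteq> 0"
      using krm_nonzero by blast+
    then have "dfst u \<in> j ` pts \<Omega>" "dfst v \<in> j ` pts \<Omega>" "dsnd u \<in> k ` pts \<Xi>" "dsnd v \<in> k ` pts \<Xi>"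
      by (auto simp: em_def split: if_splits)
    then show False using * im by blast
  qed
qed

lemma matrix_on_kron:
  assumes "matrix_on \<Omega> \<Omega> a" "matrix_on \<Xi> \<Xi> b"
  shows "matrix_on (spg_prod \<Omega> \<Xi>) (spg_prod \<Omega> \<Xi>) (kron t a b)"
  unfolding matrix_on_def
proof (intro allI impI)
  fix x y assume "x \<notin> pts (spg_prod \<Omega> \<Xi>) \<or> y \<notin> pts (spg_prod \<Omega> \<Xi>)"
  then have "a (fst x) (fst y) = 0 \<or> b (snd x) (snd y) = 0"
    using assms by (auto simp: matrix_on_def spg_prod_def mem_Times_iff)
  then show "kron t a b x y = 0" by (auto simp: kron_def case_prod_beta t_zero_left t_zero_right)
qed

text \<open>The right tensor product forms complements with the unit \<open>?e\<close> of the second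
  index set, whereas \<open>Theta\<close> uses the full unit. The two differ by the orthogonal
  constant \<open>?c = a \<otimes> (1 - ?e)\<close>, with \<open>a\<close> the second component of
  the first pair.\<close>

lemma right_tensor_pair:
  fixes p :: "('i, 'r) mpair" and q :: "('j, 's) mpair"
  assumes p: "MR.vp j p" and q: "MS.vp k q"
  shows "MT.vp (jprod j k) (right_tensor S t p q)"
    "MT.seq (MT.io (jprod j k) (right_tensor S t p q)) (TT.Theta (MR.io j p) (MS.io k q))"
proof -
  let ?J = "jprod j k" and ?X = "right_tensor S t p q"
  let ?e = "MS.dgl (k ` pts (idx q))" and ?P = "MR.io j p" and ?Q = "MS.io k q"
  have e: "is_emb j (idx p)" "is_emb k (idx q)" using p q by (auto simp: MR.vp_def MS.vp_def)
  have mp: "matrix_on (idx p) (idx p) (fstm p)" "matrix_on (idx p) (idx p) (sndm p)"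
    and ps: "psi d R (em j (idx p) j (idx p) (fstm p))" "psi d R (em j (idx p) j (idx p) (sndm p))"
    using p by (auto simp: MR.vp_def)
  have mq: "matrix_on (idx q) (idx q) (fstm q)" "matrix_on (idx q) (idx q) (sndm q)"
    and qs: "psi d S (em k (idx q) k (idx q) (fstm q))" "psi d S (em k (idx q) k (idx q) (sndm q))"
    using q by (auto simp: MS.vp_def)
  have cs: "psi d S (\<lambda>n m. dg S (k ` pts (idx q)) n m - em k (idx q) k (idx q) a n m)"
    if "psi d S (em k (idx q) k (idx q) a)" for a
    by (intro MS.psi_minus S.psi_dg that)
  note ems = em_add em_kron[OF e] MS.em_compl[OF e(2)]
  have psX: "psi d T (em ?J (idx ?X) ?J (idx ?X) (fstm ?X))" "psi d T (em ?J (idx ?X) ?J (idx ?X) (sndm ?X))"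
    by (simp_all add: right_tensor_def ems T.psi_add psi_krm ps qs cs)
  have mX: "matrix_on (idx ?X) (idx ?X) (fstm ?X)" "matrix_on (idx ?X) (idx ?X) (sndm ?X)"
    by (simp_all add: right_tensor_def matrix_on_simps matrix_on_kron mp mq mcompl_def)
  have "MT.io ?J ?X = kr d (cst True ?P) ?Q + kr d (cst False ?P) (?e - ?Q)"
    by (simp add: MT.io_def right_tensor_def ems MR.io_def MS.io_def MS.dgl_def MS.lift_diff MR.cst_lift
        ps qs cs S.psi_dg kr_lift MT.lift_add psi_krm)
  also have "\<dots> = kr d 1 ?e * TT.Theta ?P ?Q"
    using MS.io_corner[OF q] by (simp add: TT.Theta_def algebra_simps TT.kr_simps)
  finally have io: "MT.io ?J ?X = kr d 1 ?e * TT.Theta ?P ?Q" .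
  have comm: "kr d 1 ?e * TT.Theta ?P ?Q = TT.Theta ?P ?Q * kr d 1 ?e"
    using MS.io_corner[OF q] by (simp add: TT.Theta_def algebra_simps TT.kr_simps)
  note iP = MR.vp_idem[OF p] and iQ = MS.vp_idem[OF q]
  have iT: "MT.idem (TT.Theta ?P ?Q)" by (rule TT.Theta_idem[OF iP iQ])
  have ie: "kr d 1 ?e * kr d 1 ?e = kr d 1 ?e" by (simp add: TT.kr_simps MS.dgl_props)
  have "kr d 1 ?e * TT.Theta ?P ?Q * (kr d 1 ?e * TT.Theta ?P ?Q) =
      kr d 1 ?e * (TT.Theta ?P ?Q * kr d 1 ?e) * TT.Theta ?P ?Q" by (simp only: mult.assoc)
  also have "\<dots> = (kr d 1 ?e * kr d 1 ?e) * (TT.Theta ?P ?Q * TT.Theta ?P ?Q)"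
    by (simp only: comm[symmetric] mult.assoc)
  also have "\<dots> = kr d 1 ?e * TT.Theta ?P ?Q" using iT ie by (simp add: MT.idem_def)
  finally have sq: "kr d 1 ?e * TT.Theta ?P ?Q * (kr d 1 ?e * TT.Theta ?P ?Q) = kr d 1 ?e * TT.Theta ?P ?Q" .
  have "cst False (kr d 1 ?e) = kr d 1 ?e"
    by (rule TT.kr_C) (simp_all add: MR.pi_one MS.dgl_props)
  then have "kr d 1 ?e \<in> Gpairs d T" by (rule MT.G_C)
  then have "kr d 1 ?e * TT.Theta ?P ?Q \<in> Gpairs d T"
    using iT by (simp add: MT.idem_def MT.G_mult)
  then have iX: "MT.idem (MT.io ?J ?X)"
    unfolding io MT.idem_def using sq by simp
  have "is_emb ?J (idx ?X)" using is_emb_prod[OF e] by (simp add: right_tensor_def)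
  then show "MT.vp ?J ?X" using iX psX mX by (simp add: MT.vp_def)
  let ?c = "kr d (cst False ?P) (1 - ?e)"
  have eQ: "(1 - ?e) * ?e = 0" "?e * (1 - ?e) = 0" "(1 - ?e) * (1 - ?e) = 1 - ?e" "(1 - ?e) * ?Q = 0" "?Q * (1 - ?e) = 0"
    using MS.dgl_props(2) MS.io_corner[OF q] by (simp_all add: algebra_simps)
  have aa: "cst False ?P * cst False ?P = cst False ?P"
    using MR.idem_pi[OF iP] by (simp add: MR.idem_def)
  have cC: "cst False ?c = ?c"
    by (rule TT.kr_C) (simp_all add: MR.pi_pi MS.pi_one_minus MS.dgl_props)
  have "?c * ?c = ?c" by (simp add: TT.kr_mult aa eQ)
  then have ic: "MT.idem ?c" using cC by (simp add: MT.idem_def MT.G_C)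
  have sum: "TT.Theta ?P ?Q = kr d 1 ?e * TT.Theta ?P ?Q + ?c"
    using MS.io_corner[OF q] by (simp add: TT.Theta_def algebra_simps TT.kr_simps)
  have "?c * (kr d 1 ?e * TT.Theta ?P ?Q) = 0"
    unfolding TT.Theta_def by (simp add: distrib_left TT.kr_mult TT.kr_mult' mult.assoc[symmetric] eQ TT.kr_zero_right)
  moreover have "kr d 1 ?e * TT.Theta ?P ?Q * ?c = 0"
    unfolding comm by (simp add: mult.assoc TT.kr_mult eQ TT.kr_zero_right)
  ultimately have "MT.seq (kr d 1 ?e * TT.Theta ?P ?Q + ?c) (kr d 1 ?e * TT.Theta ?P ?Q)"
    using iX[unfolded io] ic cC by (intro MT.seq_orth_trivial) auto
  then show "MT.seq (MT.io ?J ?X) (TT.Theta ?P ?Q)"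
    unfolding io sum[symmetric] by (rule MT.seq_sym)
qed

lemma vdim_right_tensor:
  fixes p :: "('i, 'r) mpair" and q :: "('j, 's) mpair"
  assumes p: "MR.vp j p" and q: "MS.vp k q"
  shows "vdim d T (right_tensor S t p q) \<le> vdim d R p * vdim d S q"
proof -
  let ?J = "jprod j k" and ?X = "right_tensor S t p q"
  note X = right_tensor_pair[OF p q]
  note iP = MR.vp_idem[OF p] and iQ = MS.vp_idem[OF q] and iX = MT.vp_idem[OF X(1)]
  \<comment> \<open>Zero times infinity is zero, so a factor of dimension zero needs its own
    argument: \<open>Theta\<close> is then stably trivial whatever the other factor is.\<close>
  consider (z) "vdim d R p = 0 \<or> vdim d S q = 0" | (i) "vdim d R p \<noteq> 0" "vdim d S q \<noteq> 0" "vdim d R p = \<infinity> \<or> vdim d S q = \<infinity>"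
    | (f) m n where "vdim d R p = enat m" "vdim d S q = enat n"
    by (cases "vdim d R p"; cases "vdim d S q") auto
  then show ?thesis
  proof cases
    case z
    then have "MR.seq (MR.io j p) 0 \<or> MS.seq (MS.io k q) 0"
      using MR.vdim_zero_iff_seq[OF p] MS.vdim_zero_iff_seq[OF q] by blast
    then have "MT.seq (TT.Theta (MR.io j p) (MS.io k q)) 0"
      using TT.Theta_zero_left[OF iQ iP] TT.Theta_zero_right[OF iP iQ] by blast
    then have "MT.seq (MT.io ?J ?X) 0"
      by (rule MT.seq_trans[OF iX MT.idem_zero X(2)])
    then have "vdim d T ?X = 0" using MT.vdim_zero_iff_seq[OF X(1)] by simp
    then show ?thesis by simp
  next
    case i
    then have "vdim d R p * vdim d S q = \<infinity>" by (auto simp: imult_is_infinity)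
    then show ?thesis by simp
  next
    case f
    obtain E U where E: "finite E" "card E \<le> m" "MR.regular (MR.dgl E) U" "MR.seq (MR.io j p) U"
      using MR.vdim_leD[OF p, of m] f by auto
    obtain F V where F: "finite F" "card F \<le> n" "MS.regular (MS.dgl F) V" "MS.seq (MS.io k q) V"
      using MS.vdim_leD[OF q, of n] f by auto
    obtain W where W: "MT.regular (kr d (MR.dgl E) (MS.dgl F)) W" "MT.seq (TT.Theta (MR.io j p) (MS.io k q)) W"
      using TT.Theta_regular[OF E(3) MR.dgl_props(1,2) F(3) MS.dgl_props(1,2) iP E(4) iQ F(4)] .
    let ?H = "prod_encode ` (E \<times> F)"
    have off: "krm t (dg R E) (dg S F) u v = 0" if "u \<notin> ?H \<or> v \<notin> ?H" for u v
    proof (rule ccontr)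
      assume "krm t (dg R E) (dg S F) u v \<noteq> 0"
      then have "dg R E (dfst u) (dfst v) \<noteq> 0" "dg S F (dsnd u) (dsnd v) \<noteq> 0" using krm_nonzero by blast+
      then have "dfst u \<in> E" "dfst v \<in> E" "dsnd u \<in> F" "dsnd v \<in> F" by (auto simp: dg_def split: if_splits)
      then have "u \<in> ?H" "v \<in> ?H" using mem_encode_image by blast+
      then show False using that by blast
    qed
    have "mmult T (dg T ?H) (krm t (dg R E) (dg S F)) = krm t (dg R E) (dg S F)"
      "mmult T (krm t (dg R E) (dg S F)) (dg T ?H) = krm t (dg R E) (dg S F)"
      using off by (auto simp: fun_eq_iff T.mmult_dg_left T.mmult_dg_right)
    then have "MT.dgl ?H * kr d (MR.dgl E) (MS.dgl F) = kr d (MR.dgl E) (MS.dgl F)"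
      "kr d (MR.dgl E) (MS.dgl F) * MT.dgl ?H = kr d (MR.dgl E) (MS.dgl F)"
      by (simp_all add: MR.dgl_def MS.dgl_def MT.dgl_def kr_lift R.psi_dg S.psi_dg T.psi_dg MT.lift_mult psi_krm)
    then have reg: "MT.regular (MT.dgl ?H) W" by (rule MT.regular_mono[OF W(1)])
    have iW: "MT.idem W" using W(1) by (simp add: MT.regular_def)
    have sq: "MT.seq (MT.io ?J ?X) W" by (rule MT.seq_trans[OF iX iW X(2) W(2)])
    have "card ?H = card E * card F" by (simp add: card_image inj_prod_encode card_cartesian_product)
    then have "card ?H \<le> m * n" using E F by (simp add: mult_mono)
    then have "vdim d T ?X \<le> enat (m * n)"
      using MT.vdim_leI[OF X(1) _ _ reg sq] E F by blast
    then show ?thesis by (simp add: f)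
  qed
qed

end

lemma em_swap:
  assumes "is_emb J (spg_prod \<Xi> \<Omega>)"
  shows "em (\<lambda>(n, m). J (m, n)) (spg_prod \<Omega> \<Xi>) (\<lambda>(n, m). J (m, n)) (spg_prod \<Omega> \<Xi>) a =
    em J (spg_prod \<Xi> \<Omega>) J (spg_prod \<Xi> \<Omega>) (\<lambda>(m, n) (m', n'). a (n, m) (n', m'))"
proof (rule em_eqI[OF is_emb_swap[OF assms] is_emb_swap[OF assms]])
  fix x y assume "x \<in> pts (spg_prod \<Omega> \<Xi>)" "y \<in> pts (spg_prod \<Omega> \<Xi>)"
  then show "em J (spg_prod \<Xi> \<Omega>) J (spg_prod \<Xi> \<Omega>) (\<lambda>(m, n) (m', n'). a (n, m) (n', m'))
      (case x of (n, m) \<Rightarrow> J (m, n)) (case y of (n, m) \<Rightarrow> J (m, n)) = a x y"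
    by (auto simp: spg_prod_def em_at[OF assms assms, unfolded spg_prod_def] split: prod.splits)
next
  fix u v
  have "(\<lambda>(n, m). J (m, n)) ` pts (spg_prod \<Omega> \<Xi>) = J ` pts (spg_prod \<Xi> \<Omega>)"
    by (auto simp: spg_prod_def image_iff)
  moreover assume "u \<notin> (\<lambda>(n, m). J (m, n)) ` pts (spg_prod \<Omega> \<Xi>) \<or> v \<notin> (\<lambda>(n, m). J (m, n)) ` pts (spg_prod \<Omega> \<Xi>)"
  ultimately show "em J (spg_prod \<Xi> \<Omega>) J (spg_prod \<Xi> \<Omega>) (\<lambda>(m, n) (m', n'). a (n, m) (n', m')) u v = 0"
    by (intro em_off) simp
qed

context bilin_pairs
begin

text \<open>Up to exchanging coordinates, the left tensor product of \<open>p\<close> and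
  \<open>q\<close> is the right tensor product of \<open>q\<close> and \<open>p\<close> for the
  flipped bilinear map. With swapped embeddings the two become the same element of the universal
  ring.\<close>

lemma vdim_left_tensor:
  fixes p :: "('i, 'r) mpair" and q :: "('j, 's) mpair"
  assumes p: "MR.vp j p" and q: "MS.vp k q"
  shows "vdim d T (left_tensor R t p q) \<le> vdim d R p * vdim d S q"
proof -
  have flip: "bilin_pairs S R T (\<lambda>y x. t x y)"
    by (rule bilin_pairs.intro[OF bilin_flip[OF bilin_axioms]])
  let ?J = "jprod k j" and ?X = "right_tensor R (\<lambda>y x. t x y) q p" and ?Y = "left_tensor R t p q"
  let ?K = "\<lambda>(n, m). ?J (m, n)"
  note X = bilin_pairs.right_tensor_pair(1)[OF flip q p]
  have idX: "idx ?X = spg_prod (idx q) (idx p)" "idx ?Y = spg_prod (idx p) (idx q)"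
    by (simp_all add: right_tensor_def left_tensor_def)
  have eJ: "is_emb ?J (spg_prod (idx q) (idx p))" using X by (simp add: MT.vp_def idX)
  have swap: "fstm ?X = (\<lambda>(m, n) (m', n'). fstm ?Y (n, m) (n', m'))"
    "sndm ?X = (\<lambda>(m, n) (m', n'). sndm ?Y (n, m) (n', m'))"
    by (simp_all add: right_tensor_def left_tensor_def madd_def kron_def fun_eq_iff)
  have em: "em ?K (idx ?Y) ?K (idx ?Y) (fstm ?Y) = em ?J (idx ?X) ?J (idx ?X) (fstm ?X)"
    "em ?K (idx ?Y) ?K (idx ?Y) (sndm ?Y) = em ?J (idx ?X) ?J (idx ?X) (sndm ?X)"
    unfolding idX swap by (rule em_swap[OF eJ])+
  have io: "MT.io ?K ?Y = MT.io ?J ?X" by (simp only: MT.io_def em)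
  have "matrix_on (idx ?Y) (idx ?Y) b"
    if "matrix_on (idx ?X) (idx ?X) (\<lambda>(m, n) (m', n'). b (n, m) (n', m'))" for b :: "'i \<times> 'j \<Rightarrow> 'i \<times> 'j \<Rightarrow> 't"
    using that unfolding matrix_on_def idX by (auto simp: spg_prod_def)
  then have m: "matrix_on (idx ?Y) (idx ?Y) (fstm ?Y)" "matrix_on (idx ?Y) (idx ?Y) (sndm ?Y)"
    using X unfolding MT.vp_def swap by blast+
  have Y: "MT.vp ?K ?Y"
    using X m is_emb_swap[OF eJ] unfolding MT.vp_def io em by (simp only: idX)
  have "vdim d T ?Y = vdim d T ?X"
    by (rule MT.vdim_cong[OF Y X]) (simp only: io MT.seq_refl[OF MT.vp_idem[OF X]])
  also have "\<dots> \<le> vdim d S q * vdim d R p" by (rule bilin_pairs.vdim_right_tensor[OF flip q p])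
  finally show ?thesis by (simp add: mult.commute)
qed

end

subsection \<open>The trace over a commutative ring\<close>

context pm_ring
begin

lemma asum_smooth_psi:
  assumes "smooth d R a" "psi d R b" shows "asum R (\<lambda>(n, m). mult R (a n m) (b m n))"
proof (cases d)
  case True
  then have "finite {(n, m). a n m \<noteq> 0}" using assms(1) by (simp add: smooth_def)
  then have "finite {i. (case i of (n, m) \<Rightarrow> mult R (a n m) (b m n)) \<noteq> 0}"
    by (rule rev_finite_subset) (auto simp: mult_zero_left)
  then show ?thesis by (rule asum_finite)
next
  case False
  show ?thesis
  proof (rule asum_bound2)
    fix p assume "p \<in> sn R"
    then obtain p' where p': "p' \<in> sn R" "\<And>x y. p (mult R x y) \<le> p' x * p' y"
      using sn_mult_obtain by blast
    obtain C l where C: "0 \<le> C" "\<And>n m. p' (b n m) \<le> C * w n ^ l"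
      using psi_bound_all[OF assms(2) False p'(1)] by metis
    obtain D where D: "\<And>n m. w n ^ (l + 2) * w m ^ (l + 2) * p' (a n m) \<le> D"
      using smooth_bound[OF assms(1) False p'(1)] by metis
    have nn: "0 \<le> p' x" for x by (rule sn_nonneg[OF p'(1)])
    have "w n ^ 2 * w m ^ 2 * p (mult R (a n m) (b m n)) \<le> C * D" for n m
    proof -
      have "w n ^ 2 * w m ^ 2 * p (mult R (a n m) (b m n)) \<le> w n ^ 2 * w m ^ 2 * (p' (a n m) * p' (b m n))"
        by (intro mult_left_mono p'(2)) simp
      also have "\<dots> \<le> w n ^ 2 * w m ^ 2 * (p' (a n m) * (C * w m ^ l))"
        using C nn by (intro mult_left_mono) auto
      also have "\<dots> = C * (w n ^ 2 * w m ^ (l + 2) * p' (a n m))"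
        by (simp add: power_add power2_eq_square)
      also have "\<dots> \<le> C * (w n ^ (l + 2) * w m ^ (l + 2) * p' (a n m))"
        using C nn by (intro mult_left_mono mult_right_mono w_mono) auto
      also have "\<dots> \<le> C * D" using C D by (intro mult_left_mono) auto
      finally show ?thesis .
    qed
    then show "\<exists>C. \<forall>n m. w n ^ 2 * w m ^ 2 * p (case (n, m) of (n, m) \<Rightarrow> mult R (a n m) (b m n)) \<le> C"
      by auto
  qed
qed

text \<open>Both traces sum the same double family in opposite orders; the rapidly decreasing factor
  makes that family absolutely summable.\<close>

lemma trace_commute:
  assumes c: "\<And>x y. mult R x y = mult R y x" and a: "smooth d R a" "psi d R b"
  shows "ring_sum R (\<lambda>n. mmult R a b n n) = ring_sum R (\<lambda>n. mmult R b a n n)"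
proof -
  let ?z = "\<lambda>i. mult R (a (fst i) (snd i)) (b (snd i) (fst i))"
  have z: "asum R ?z" using asum_smooth_psi[OF a] by (simp add: case_prod_unfold)
  have z': "asum R (\<lambda>i. ?z (prod.swap i))" by (rule asum_inj[OF z]) simp
  have "ring_sum R (\<lambda>n. mmult R a b n n) = ring_sum R ?z"
    using ring_sum_eq[OF rsums_Fubini[OF z]] by (simp add: mmult_def)
  also have "\<dots> = ring_sum R (\<lambda>i. ?z (prod.swap i))"
  proof (rule ring_sum_reindex[where j = prod.swap and P = UNIV])
    have "surj (prod.swap :: nat \<times> nat \<Rightarrow> _)" by simp
    then show "\<And>u. u \<notin> range prod.swap \<Longrightarrow> ?z (prod.swap u) = 0" by (metis UNIV_I)
  qed simp_all
  also have "\<dots> = ring_sum R (\<lambda>n. mmult R b a n n)"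
    using ring_sum_eq[OF rsums_Fubini[OF z']] by (simp add: mmult_def c)
  finally show ?thesis .
qed

lemma asum_smooth_diagonal:
  assumes "smooth d R a" shows "asum R (\<lambda>n. a n n)"
proof -
  have "asum R (\<lambda>i. case i of (n, m) \<Rightarrow> mult R (a n m) (dg R UNIV m n))"
    by (rule asum_smooth_psi[OF assms psi_dg])
  then have "asum R (\<lambda>i. (\<lambda>(n, m). mult R (a n m) (dg R UNIV m n)) (i, i))"
    by (rule asum_inj) (simp add: inj_def)
  then show ?thesis by (simp add: dg_def unit_right)
qed

end

context mat_pairs
begin

text \<open>The constant pair with both components \<open>b - a\<close>, so its trace may be read
  off either component.\<close>

definition diff_comp :: "('k, 'r) mring \<Rightarrow> ('k, 'r) mring" where
  "diff_comp x = cst True x - cst False x"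

definition trace :: "('k, 'r) mring \<Rightarrow> 'r" where
  "trace x = ring_sum R (\<lambda>n. mat x d R True n n)"

lemma smooth_diff_comp: "x \<in> Gpairs d R \<Longrightarrow> smooth d R (mat (diff_comp x) d R i)"
  by (simp add: diff_comp_def Gpairs_def mat_diff mat_cst)

lemma trace_mult_commute:
  assumes "\<And>x y. mult R x y = mult R y x" "smooth d R (mat x d R True)"
  shows "trace (x * y) = trace (y * x)"
  unfolding trace_def mat_mult[OF pm_ring_axioms]
  by (rule trace_commute[OF assms psi_mat[OF pm_ring_axioms]])

lemma trace_add:
  assumes "smooth d R (mat x d R True)" "smooth d R (mat y d R True)"
  shows "trace (x + y) = trace x + trace y"
  unfolding trace_def mat_add
  by (intro ring_sum_eq rsums_add asum_rsums asum_smooth_diagonal[OF assms(1)] asum_smooth_diagonal[OF assms(2)])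

text \<open>By the Leibniz rule the difference of \<open>x * y\<close> is a sum of two terms with
  one rapidly decreasing factor each. The trace is cyclic on these, and the stabilising
  \<open>1\<close> contributes nothing to the difference.\<close>

lemma trace_seq:
  assumes c: "\<And>x y. mult R x y = mult R y x" and pq: "p \<in> Gpairs d R" "q \<in> Gpairs d R" "seq p q"
  shows "trace (diff_comp p) = trace (diff_comp q)"
proof -
  note pm = pm_ring_axioms and ps = psi_mat[OF pm_ring_axioms]
  have stab: "trace (diff_comp (dsm z 1)) = trace (diff_comp z)" if z: "z \<in> Gpairs d R" for z
  proof -
    have "diff_comp (dsm z 1) = S0 * diff_comp z * T0"
      by (simp add: diff_comp_def dsm_def blk_def cst_simps algebra_simps)
    moreover have "trace (S0 * diff_comp z * T0) = trace (T0 * (S0 * diff_comp z))"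
      using smooth_mmult_left[OF ps smooth_diff_comp[OF z]] by (intro trace_mult_commute[OF c]) (simp add: mat_mult pm)
    ultimately show ?thesis by (simp add: mult.assoc[symmetric] t0s0)
  qed
  obtain x y where xy: "x \<in> Gpairs d R" "y \<in> Gpairs d R" "x * y = dsm p 1" "y * x = dsm q 1"
    using pq(3) unfolding seq_def mvn_def by blast
  have s: "smooth d R (mat (diff_comp u * v) d R True)" "smooth d R (mat (v * diff_comp u) d R True)"
    if "u \<in> Gpairs d R" for u v
    using smooth_mmult_left[OF ps smooth_diff_comp[OF that]] smooth_mmult_right[OF smooth_diff_comp[OF that] ps]
    by (simp_all add: mat_mult pm)
  have "diff_comp (x * y) = diff_comp x * cst True y + cst False x * diff_comp y"
    "diff_comp (y * x) = cst True y * diff_comp x + diff_comp y * cst False x"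
    by (simp_all add: diff_comp_def cst_simps algebra_simps)
  then have "trace (diff_comp (x * y)) = trace (diff_comp (y * x))"
    using trace_mult_commute[OF c smooth_diff_comp[OF xy(1)], of "cst True y"]
      trace_mult_commute[OF c smooth_diff_comp[OF xy(2)], of "cst False x"]
    by (simp add: trace_add s xy)
  then show ?thesis using stab pq by (simp add: xy)
qed

end

lemma vdim_punit:
  fixes av :: "'k::comm_ring_1 \<Rightarrow> real"
  assumes av: "base_ring av" shows "vdim d (unitization av (base_alg av)) punit = 1"
proof -
  let ?U = "unitization av (base_alg av)"
  note B = polymetric_base_alg[OF av]
  interpret mat_pairs ?U d by (rule mat_pairs.intro[OF pm_ring_unitization[OF av B]])
  have mult: "mult ?U x y = (fst x * fst y, fst x * snd y + fst y * snd x + snd x * snd y)" for x y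
    by (simp add: unitization_def base_alg_def case_prod_beta)
  have c: "mult ?U x y = mult ?U y x" for x y by (simp add: mult algebra_simps)
  let ?j = "\<lambda>_. 0 :: nat"
  let ?p = "punit :: (unit, 'k \<times> 'k) mpair"
  define a where "a = (\<lambda>n m. if n = (0::nat) \<and> m = (0::nat) then (0, 1) else (0 :: 'k \<times> 'k))"
  have e: "is_emb ?j (idx ?p)" by (rule is_emb_finite) (simp_all add: punit_def inj_on_def)
  have em: "em ?j (idx ?p) ?j (idx ?p) (fstm ?p) = a" "em ?j (idx ?p) ?j (idx ?p) (sndm ?p) = (\<lambda>_ _. 0)"
    by (rule em_eqI[OF e e]; auto simp: punit_def mzero_def a_def)+
  have "smooth d ?U a"
  proof -
    have "{(n, m). a n m \<noteq> 0} \<subseteq> {(0, 0)}" by (auto simp: a_def split: if_splits)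
    then have "finite {(n, m). a n m \<noteq> 0}" by (rule finite_subset) simp
    moreover have "\<exists>C. \<forall>n m. w n ^ k * w m ^ k * p (a n m) \<le> C" if "p \<in> sn ?U" for p k
      using sn_zero[OF that] sn_nonneg[OF that, of "(0, 1)"] by (intro exI[of _ "p (0, 1)"]) (simp add: a_def)
    then have "\<forall>p\<in>sn ?U. \<forall>k. \<exists>C. \<forall>n m. w n ^ k * w m ^ k * p (a n m) \<le> C" by (intro ballI allI)
    moreover have "\<forall>n m. a n m \<in> ideal ?U"
      by (auto simp: unitization_def zero_prod_def a_def)
    ultimately show ?thesis
      by (simp add: smooth_def)
  qed
  note ps = smooth_psi[OF this] and sm = this
  have io: "io ?j ?p = lift d ?U a (\<lambda>_ _. 0)" by (simp only: io_def em)
  have "mmult ?U a a n l = a n l" for n l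
    unfolding mmult_def by (subst ring_sum_single[of 0]) (auto simp: mult zero_prod_def a_def)
  then have "mmult ?U a a = a" by (intro ext)
  then have "io ?j ?p * io ?j ?p = io ?j ?p"
    by (simp add: io lift_mult ps psi_zero mmult_zero)
  moreover have G: "io ?j ?p \<in> Gpairs d ?U"
    using sm by (simp add: io Gpairs_def ps psi_zero)
  ultimately have "idem (io ?j ?p)" by (simp add: idem_def)
  then have p: "vp ?j ?p"
    using e ps unfolding vp_def em by (simp add: psi_zero punit_def matrix_on_def mzero_def)
  have "trace (diff_comp (io ?j ?p)) = ring_sum ?U (\<lambda>n. a n n)"
    by (simp add: trace_def diff_comp_def mat_diff mat_cst io ps psi_zero)
  also have "\<dots> = (0, 1)" by (subst ring_sum_single[of 0]) (auto simp: a_def)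
  finally have "trace (diff_comp (io ?j ?p)) = (0, 1)" .
  moreover have "trace (diff_comp 0) = 0"
    by (simp add: trace_def diff_comp_def mat_diff mat_cst mat_zero ring_sum_zero)
  ultimately have "\<not> seq (io ?j ?p) 0"
    using trace_seq[OF c G G_zero] by (auto simp: zero_prod_def)
  then have "vdim d ?U ?p \<noteq> 0" using vdim_zero_iff_seq[OF p] by blast
  \<comment> \<open>The \<open>model\<close> is regular over the index set of the pair itself, here
    a single point.\<close>
  moreover have "vdim d ?U ?p \<le> enat 1"
    by (rule vdim_leI[OF p _ _ regular_model[OF vp_idem[OF p] dgl_props(2,1) io_corner[OF p]]
          model_seq(2)[OF vp_idem[OF p]]]) (simp_all add: punit_def)
  ultimately show ?thesis
    by (cases "vdim d ?U ?p") (auto simp: one_enat_def zero_enat_def)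
qed

section \<open>Passage from embedded pairs to members of \<open>G2\<close>\<close>

lemma (in mat_pairs) vdim_G2:
  fixes p :: "('i, 'r) mpair" and q :: "('j, 'r) mpair"
  assumes p: "p \<in> G2 d R" and q: "q \<in> G2 d R"
  shows "alg_homotopic d R p q \<Longrightarrow> vdim d R p = vdim d R q"
    "vdim d R p = 0 \<longleftrightarrow> alg_homotopic d R p pempty"
    "vdim d R (psum p q) \<le> vdim d R p + vdim d R q"
    "vdim d R (pinv R p) = vdim d R p"
proof -
  obtain j where j: "vp j p" using G2_vp[OF p] .
  obtain k where k: "vp k q" using G2_vp[OF q] .
  show "alg_homotopic d R p q \<Longrightarrow> vdim d R p = vdim d R q"
    by (rule vdim_cong[OF j k homotopic_seq[OF j k]])
  show "vdim d R p = 0 \<longleftrightarrow> alg_homotopic d R p pempty" by (rule vdim_zero_iff[OF j])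
  show "vdim d R (psum p q) \<le> vdim d R p + vdim d R q" by (rule vdim_psum_le[OF j k])
  show "vdim d R (pinv R p) = vdim d R p" by (rule vdim_pinv[OF j])
qed

lemma vdim_tensor_G2:
  fixes p :: "('i, 'r::ab_group_add) mpair" and q :: "('j, 's::ab_group_add) mpair"
  assumes bil: "bilin R S T t" and p: "p \<in> G2 d R" and q: "q \<in> G2 d S"
  shows "vdim d T (left_tensor R t p q) \<le> vdim d R p * vdim d S q"
    "vdim d T (right_tensor S t p q) \<le> vdim d R p * vdim d S q"
proof -
  interpret bilin_pairs R S T t d by (rule bilin_pairs.intro[OF bil])
  obtain j where j: "MR.vp j p" using MR.G2_vp[OF p] .
  obtain k where k: "MS.vp k q" using MS.G2_vp[OF q] .
  show "vdim d T (left_tensor R t p q) \<le> vdim d R p * vdim d S q" by (rule vdim_left_tensor[OF j k])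
  show "vdim d T (right_tensor S t p q) \<le> vdim d R p * vdim d S q" by (rule vdim_right_tensor[OF j k])
qed

theorem theorem7p4:
  fixes av :: "'k::comm_ring_1 \<Rightarrow> real"
    and d :: bool
    and A :: "('k, 'a::ab_group_add) palg"
    and B :: "('k, 'b::ab_group_add) palg"
    and T :: "('k, 't::ab_group_add) uext"
    and t :: "'k \<times> 'a \<Rightarrow> 'k \<times> 'b \<Rightarrow> 't"
  assumes "base_ring av"
    and "polymetric av A" and "polymetric av B"
    and "d \<Longrightarrow> discrete_top (base_alg av) \<and> discrete_top A \<and> discrete_top B"
  shows "
    \<comment> \<open>(a)\<close>
    (\<forall>p1 :: ('i, 'k \<times> 'a) mpair. \<forall>p2 :: ('j, 'k \<times> 'a) mpair.
       p1 \<in> G2 d (unitization av A) \<longrightarrow> p2 \<in> G2 d (unitization av A) \<longrightarrow>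
       alg_homotopic d (unitization av A) p1 p2 \<longrightarrow>
       vdim d (unitization av A) p1 = vdim d (unitization av A) p2) \<and>
    \<comment> \<open>(b)\<close>
    (\<forall>p :: ('i, 'k \<times> 'a) mpair. p \<in> G2 d (unitization av A) \<longrightarrow>
       (vdim d (unitization av A) p = 0 \<longleftrightarrow> alg_homotopic d (unitization av A) p pempty)) \<and>
    \<comment> \<open>(c)\<close>
    (\<forall>p1 :: ('i, 'k \<times> 'a) mpair. \<forall>p2 :: ('j, 'k \<times> 'a) mpair.
       p1 \<in> G2 d (unitization av A) \<longrightarrow> p2 \<in> G2 d (unitization av A) \<longrightarrow>
       vdim d (unitization av A) (psum p1 p2)
         \<le> vdim d (unitization av A) p1 + vdim d (unitization av A) p2) \<and>
    \<comment> \<open>(d)\<close>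
    (\<forall>p :: ('i, 'k \<times> 'a) mpair. p \<in> G2 d (unitization av A) \<longrightarrow>
       vdim d (unitization av A) (pinv (unitization av A) p) = vdim d (unitization av A) p) \<and>
    \<comment> \<open>(e), projective tensor product\<close>
    (completed_tensor av (unitization av A) (unitization av B) T t \<longrightarrow>
      (\<forall>p1 :: ('i, 'k \<times> 'a) mpair. \<forall>p2 :: ('j, 'k \<times> 'b) mpair.
         p1 \<in> G2 d (unitization av A) \<longrightarrow> p2 \<in> G2 d (unitization av B) \<longrightarrow>
         vdim d T (left_tensor (unitization av A) t p1 p2)
           \<le> vdim d (unitization av A) p1 * vdim d (unitization av B) p2 \<and>
         vdim d T (right_tensor (unitization av B) t p1 p2)
           \<le> vdim d (unitization av A) p1 * vdim d (unitization av B) p2)) \<and>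
    \<comment> \<open>(e), commutative ring\<close>
    (commutative A \<longrightarrow>
      (\<forall>p1 :: ('i, 'k \<times> 'a) mpair. \<forall>p2 :: ('j, 'k \<times> 'a) mpair.
         p1 \<in> G2 d (unitization av A) \<longrightarrow> p2 \<in> G2 d (unitization av A) \<longrightarrow>
         vdim d (unitization av A)
             (left_tensor (unitization av A) (mult (unitization av A)) p1 p2)
           \<le> vdim d (unitization av A) p1 * vdim d (unitization av A) p2 \<and>
         vdim d (unitization av A)
             (right_tensor (unitization av A) (mult (unitization av A)) p1 p2)
           \<le> vdim d (unitization av A) p1 * vdim d (unitization av A) p2)) \<and>
    \<comment> \<open>(a)--(d) over a tensor product, with the unital extension used there\<close>
    (completed_tensor av (unitization av A) (unitization av B) T t \<longrightarrow>
      (\<forall>p1 :: ('i, 't) mpair. \<forall>p2 :: ('j, 't) mpair.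
         p1 \<in> G2 d T \<longrightarrow> p2 \<in> G2 d T \<longrightarrow>
         (alg_homotopic d T p1 p2 \<longrightarrow> vdim d T p1 = vdim d T p2) \<and>
         (vdim d T p1 = 0 \<longleftrightarrow> alg_homotopic d T p1 pempty) \<and>
         vdim d T (psum p1 p2) \<le> vdim d T p1 + vdim d T p2 \<and>
         vdim d T (pinv T p1) = vdim d T p1)) \<and>
    \<comment> \<open>(f)\<close>
    vdim d (unitization av (base_alg av)) punit = 1"
proof -
  note A = mat_pairs.vdim_G2[OF mat_pairs.intro[OF pm_ring_unitization[OF assms(1,2)]]]
  have ct: "bilin (unitization av A) (unitization av B) T t"
    if "completed_tensor av (unitization av A) (unitization av B) T t"
  proof (rule completed_tensor_bilin[OF pm_ring_unitization[OF assms(1,2)] pm_ring_unitization[OF assms(1,3)] _ _ that])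
    show "\<exists>q\<in>sn (unitization av A). \<forall>z. p z \<le> q z" if "p \<in> sn_span (sn (unitization av A))" for p
      using span_unitization[OF assms(1,2) that] by blast
    show "\<exists>q\<in>sn (unitization av B). \<forall>z. p z \<le> q z" if "p \<in> sn_span (sn (unitization av B))" for p
      using span_unitization[OF assms(1,3) that] by blast
  qed
  have T: "mat_pairs T" if "completed_tensor av (unitization av A) (unitization av B) T t"
    using ct[OF that] by (intro mat_pairs.intro) (simp add: bilin_def)
  note tensor = vdim_tensor_G2[OF ct]
  note commutative = vdim_tensor_G2[OF bilin_commutative[OF assms(1,2)]]
  show ?thesis
    using A(1) A(2) A(3) A(4) tensor commutative mat_pairs.vdim_G2[OF T] vdim_punit[OF assms(1)]
    by (intro conjI allI impI) (assumption | blast)+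
qed

end
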